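(* For every rational number $q$ with $0\le q<1$ there exist a set $S$ and an element $r\in F(S)'\setminus\{e\}$ such that $\|G_r\|\equiv q \mod 1$, i.e., $\|G_r\|-q\in\mathbb Z$.
   Context: For a set $S$, $F(S)$ is the free group on $S$, $F(S)'$ its commutator subgroup and $e$ the neutral element. For $r\in F(S)'\setminus\{e\}$ let $G_r:=\langle S\mid r\rangle$. Let $P_r$ be the presentation complex (one vertex, one $1$-cell for each element of $S$, one $2$-cell attached along $r$) and let $X_r$ be a classifying space of $G_r$ obtained from $P_r$ by attaching cells of dimension $\ge 3$, with inclusion $c_r\colon P_r\to X_r$. Since $r\in F(S)'$, the $2$-cell of $P_r$ defines a class $\widetilde\alpha_r\in H_2(P_r;\mathbb Z)$; the fundamental class is $\alpha_r:=H_2(c_r;\mathbb Z)(\widetilde\alpha_r)\in H_2(X_r;\mathbb Z)=H_2(G_r;\mathbb Z)$ (this group is infinite cyclic, generated by $\alpha_r$), and $\alpha_{r,\mathbb R}\in H_2(G_r;\mathbb R)$ is its image under change of coefficients. The simplicial volume of $G_r$ is $\|G_r\|:=\|\alpha_{r,\mathbb R}\|_1$, where $\|\alpha\|_1$ is the infimum of the $\ell^1$-norms (with respect to the basis of singular simplices) of all real singular cycles representing $\alpha$. *)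

theory Defs
  imports "HOL-Analysis.Complex_Transcendental" "HOL-Homology.Homology" "HOL-Algebra.Generated_Groups"
begin

section \<open>Free groups and one-relator groups\<close>

text \<open>Elements of the free group are reduced words; the letter \<open>(s, True)\<close> is the
  generator \<open>s\<close> and \<open>(s, False)\<close> its inverse.\<close>

type_synonym 'a word = "('a \<times> bool) list"

definition inv_letter :: "'a \<times> bool \<Rightarrow> 'a \<times> bool" where
  "inv_letter l = (fst l, \<not> snd l)"

definition reduced :: "'a word \<Rightarrow> bool" where
  "reduced w \<longleftrightarrow> successively (\<lambda>l m. m \<noteq> inv_letter l) w"

definition push :: "'a \<times> bool \<Rightarrow> 'a word \<Rightarrow> 'a word" where
  "push l w = (case w of [] \<Rightarrow> [l] | m # v \<Rightarrow> if m = inv_letter l then v else l # w)"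

definition free_group :: "'a set \<Rightarrow> 'a word monoid" where
  "free_group S =
    \<lparr>carrier = {w. reduced w \<and> set w \<subseteq> S \<times> UNIV}, monoid.mult = (\<lambda>u v. foldr push u v), one = []\<rparr>"

definition normal_closure :: "('g, 'b) monoid_scheme \<Rightarrow> 'g set \<Rightarrow> 'g set" where
  "normal_closure G R = generate G {g \<otimes>\<^bsub>G\<^esub> h \<otimes>\<^bsub>G\<^esub> inv\<^bsub>G\<^esub> g | g h. g \<in> carrier G \<and> h \<in> R}"

definition one_relator_group :: "'a set \<Rightarrow> 'a word \<Rightarrow> 'a word set monoid" where
  "one_relator_group S r = free_group S Mod normal_closure (free_group S) {r}"

lemma inv_letter_idem [simp]: "inv_letter (inv_letter l) = l"
  by (simp add: inv_letter_def)

lemma reduced_Nil [simp]: "reduced []"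
  by (simp add: reduced_def)

lemma reduced_Cons:
  "reduced (l # w) \<longleftrightarrow> reduced w \<and> (w = [] \<or> hd w \<noteq> inv_letter l)"
  by (auto simp: reduced_def successively_Cons)

lemma reduced_push: "reduced w \<Longrightarrow> reduced (push l w)"
  by (cases w) (auto simp: push_def reduced_Cons)

lemma push_inv: "reduced w \<Longrightarrow> push (inv_letter l) (push l w) = w"
  by (cases w) (auto simp: push_def reduced_Cons split: list.splits)

lemma reduced_foldr_push: "reduced w \<Longrightarrow> reduced (foldr push u w)"
  by (induction u) (auto simp: reduced_push)

lemma set_push: "set (push l w) \<subseteq> insert l (set w)"
  by (auto simp: push_def split: list.splits if_splits)

lemma set_foldr_push: "set (foldr push u w) \<subseteq> set u \<union> set w"
proof (induction u)
  case (Cons l u)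
  then show ?case using set_push[of l "foldr push u w"] by auto
qed simp

lemma foldr_push_push:
  assumes "reduced w"
  shows "foldr push (push l v) w = push l (foldr push v w)"
proof (cases v)
  case (Cons m v')
  have "push l (push (inv_letter l) (foldr push v' w)) = foldr push v' w"
    using push_inv[of "foldr push v' w" "inv_letter l"] assms by (simp add: reduced_foldr_push)
  then show ?thesis
    using Cons by (cases "m = inv_letter l") (auto simp: push_def[of l "x # v'" for x])
qed (simp add: push_def)

lemma foldr_push_assoc:
  "reduced w \<Longrightarrow> foldr push (foldr push u v) w = foldr push u (foldr push v w)"
  by (induction u) (simp_all add: foldr_push_push)

lemma foldr_push_Nil: "reduced w \<Longrightarrow> foldr push w [] = w"
proof (induction w)
  case (Cons l w)
  then show ?case by (cases w) (auto simp: reduced_Cons push_def)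
qed simp

lemma foldr_push_inverse:
  "reduced v \<Longrightarrow> foldr push (rev (map inv_letter w)) (foldr push w v) = v"
  by (induction w) (simp_all add: push_inv reduced_foldr_push)

lemma group_free_group: "group (free_group S)"
proof (rule groupI)
  fix x assume x: "x \<in> carrier (free_group S)"
  define y where "y = foldr push (rev (map inv_letter x)) []"
  have "set y \<subseteq> inv_letter ` set x"
    unfolding y_def using set_foldr_push[of "rev (map inv_letter x)" "[]"] by simp
  also have "\<dots> \<subseteq> S \<times> UNIV"
    using x by (auto simp: free_group_def inv_letter_def)
  finally have "y \<in> carrier (free_group S)"
    unfolding y_def by (simp add: free_group_def reduced_foldr_push)
  moreover have "y \<otimes>\<^bsub>free_group S\<^esub> x = \<one>\<^bsub>free_group S\<^esub>"
    using x foldr_push_inverse[of "[]" x]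
    by (simp add: y_def free_group_def foldr_push_assoc foldr_push_Nil)
  ultimately show "\<exists>y\<in>carrier (free_group S). y \<otimes>\<^bsub>free_group S\<^esub> x = \<one>\<^bsub>free_group S\<^esub>"
    by blast
next
  fix x y assume "x \<in> carrier (free_group S)" "y \<in> carrier (free_group S)"
  then show "x \<otimes>\<^bsub>free_group S\<^esub> y \<in> carrier (free_group S)"
    using set_foldr_push[of x y] by (auto simp: free_group_def reduced_foldr_push)
qed (auto simp: free_group_def foldr_push_assoc)


section \<open>Attaching cells\<close>

text \<open>As for \<open>nsphere\<close>, discs are sets of sequences vanishing from some index on;
  the boundary of \<open>ndisc n\<close> is \<open>nsphere (n - 1)\<close>.\<close>

definition ndisc :: "nat \<Rightarrow> (nat \<Rightarrow> real) topology" where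
  "ndisc n = subtopology (Euclidean_space n) {x. (\<Sum>i<n. x i ^ 2) \<le> 1}"

definition open_disc :: "nat \<Rightarrow> (nat \<Rightarrow> real) set" where
  "open_disc n = {x \<in> topspace (ndisc n). (\<Sum>i<n. x i ^ 2) < 1}"

text \<open>The final topology with respect to the inclusion of \<open>A\<close> and the maps \<open>\<phi> \<in> \<Phi>\<close>
  on discs of dimension \<open>n\<close>.\<close>

definition glue :: "'p topology \<Rightarrow> nat \<Rightarrow> ((nat \<Rightarrow> real) \<Rightarrow> 'p) set \<Rightarrow> 'p topology" where
  "glue A n \<Phi> = topology (\<lambda>U.
     U \<subseteq> topspace A \<union> (\<Union>\<phi>\<in>\<Phi>. \<phi> ` topspace (ndisc n)) \<and>
     openin A (U \<inter> topspace A) \<and>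
     (\<forall>\<phi>\<in>\<Phi>. openin (ndisc n) {x \<in> topspace (ndisc n). \<phi> x \<in> U}))"

lemma openin_glue:
  "openin (glue A n \<Phi>) U \<longleftrightarrow>
     U \<subseteq> topspace A \<union> (\<Union>\<phi>\<in>\<Phi>. \<phi> ` topspace (ndisc n)) \<and>
     openin A (U \<inter> topspace A) \<and>
     (\<forall>\<phi>\<in>\<Phi>. openin (ndisc n) {x \<in> topspace (ndisc n). \<phi> x \<in> U})"
proof -
  let ?D = "topspace (ndisc n)"
  have "istopology (\<lambda>U. U \<subseteq> topspace A \<union> (\<Union>\<phi>\<in>\<Phi>. \<phi> ` ?D) \<and> openin A (U \<inter> topspace A) \<and>
     (\<forall>\<phi>\<in>\<Phi>. openin (ndisc n) {x \<in> ?D. \<phi> x \<in> U}))"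
    unfolding istopology_def
  proof (intro conjI allI impI ballI)
    fix U V \<phi>
    assume U: "U \<subseteq> topspace A \<union> (\<Union>\<phi>\<in>\<Phi>. \<phi> ` ?D) \<and> openin A (U \<inter> topspace A) \<and>
        (\<forall>\<phi>\<in>\<Phi>. openin (ndisc n) {x \<in> ?D. \<phi> x \<in> U})"
      and V: "V \<subseteq> topspace A \<union> (\<Union>\<phi>\<in>\<Phi>. \<phi> ` ?D) \<and> openin A (V \<inter> topspace A) \<and>
        (\<forall>\<phi>\<in>\<Phi>. openin (ndisc n) {x \<in> ?D. \<phi> x \<in> V})"
    show "U \<inter> V \<subseteq> topspace A \<union> (\<Union>\<phi>\<in>\<Phi>. \<phi> ` ?D)" using U by blast
    have "U \<inter> V \<inter> topspace A = (U \<inter> topspace A) \<inter> (V \<inter> topspace A)" by blast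
    then show "openin A (U \<inter> V \<inter> topspace A)" using U V by (simp add: openin_Int)
    assume "\<phi> \<in> \<Phi>"
    moreover have "{x \<in> ?D. \<phi> x \<in> U \<inter> V} = {x \<in> ?D. \<phi> x \<in> U} \<inter> {x \<in> ?D. \<phi> x \<in> V}" by blast
    ultimately show "openin (ndisc n) {x \<in> ?D. \<phi> x \<in> U \<inter> V}" using U V by (simp add: openin_Int)
  next
    fix \<U> \<phi>
    assume *: "\<forall>U\<in>\<U>. U \<subseteq> topspace A \<union> (\<Union>\<phi>\<in>\<Phi>. \<phi> ` ?D) \<and> openin A (U \<inter> topspace A) \<and>
        (\<forall>\<phi>\<in>\<Phi>. openin (ndisc n) {x \<in> ?D. \<phi> x \<in> U})"
    show "\<Union>\<U> \<subseteq> topspace A \<union> (\<Union>\<phi>\<in>\<Phi>. \<phi> ` ?D)" using * by blast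
    have "\<Union>\<U> \<inter> topspace A = (\<Union>U\<in>\<U>. U \<inter> topspace A)" by blast
    moreover have "openin A (\<Union>U\<in>\<U>. U \<inter> topspace A)" using * by (intro openin_Union) blast
    ultimately show "openin A (\<Union>\<U> \<inter> topspace A)" by simp
    assume "\<phi> \<in> \<Phi>"
    moreover have "{x \<in> ?D. \<phi> x \<in> \<Union>\<U>} = (\<Union>U\<in>\<U>. {x \<in> ?D. \<phi> x \<in> U})" by blast
    moreover have "openin (ndisc n) (\<Union>U\<in>\<U>. {x \<in> ?D. \<phi> x \<in> U})"
      using * \<open>\<phi> \<in> \<Phi>\<close> by (intro openin_Union) blast
    ultimately show "openin (ndisc n) {x \<in> ?D. \<phi> x \<in> \<Union>\<U>}" by simp
  qed
  then show ?thesis by (simp add: glue_def)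
qed

text \<open>\<open>B\<close> is obtained from its closed subspace \<open>A\<close> by attaching \<open>n\<close>-cells with
  characteristic maps \<open>\<Phi>\<close>: the last two conditions say that, as a set, \<open>B\<close> is the disjoint
  union of \<open>A\<close> and one open disc for each member of \<open>\<Phi>\<close>.\<close>

definition attaches_cells :: "nat \<Rightarrow> 'p topology \<Rightarrow> 'p topology \<Rightarrow> bool" where
  "attaches_cells n A B \<longleftrightarrow> (\<exists>\<Phi>.
     B = glue A n \<Phi> \<and>
     (\<forall>\<phi>\<in>\<Phi>. continuous_map (nsphere (n - 1)) A \<phi>) \<and>
     inj_on (\<lambda>(\<phi>, x). \<phi> x) (\<Phi> \<times> open_disc n) \<and>
     (\<forall>\<phi>\<in>\<Phi>. \<forall>x\<in>open_disc n. \<phi> x \<notin> topspace A))"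

text \<open>\<open>X\<close> is obtained from \<open>P\<close> by attaching cells of dimension \<open>\<ge> 3\<close>; \<open>Y n\<close> is the union
  of \<open>P\<close> and the cells of dimension at most \<open>n\<close>, and \<open>X\<close> carries the colimit topology.\<close>

definition attaches_higher_cells :: "'p topology \<Rightarrow> 'p topology \<Rightarrow> bool" where
  "attaches_higher_cells P X \<longleftrightarrow> (\<exists>Y :: nat \<Rightarrow> 'p topology.
     Y 2 = P \<and>
     (\<forall>n\<ge>3. attaches_cells n (Y (n - 1)) (Y n)) \<and>
     (\<forall>U. openin X U \<longleftrightarrow>
        U \<subseteq> (\<Union>n\<in>{2..}. topspace (Y n)) \<and> (\<forall>n\<ge>2. openin (Y n) (U \<inter> topspace (Y n)))))"


section \<open>Presentation complexes\<close>

text \<open>Points of the presentation complex and of spaces containing it. The open \<open>1\<close>-cell of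
  \<open>s\<close> consists of the points \<open>Edge s x\<close> with \<open>\<bar>x\<bar> < 1\<close>, the open \<open>2\<close>-cell of the points
  \<open>Face v\<close> with \<open>v \<in> open_disc 2\<close>. The constructor \<open>Higher\<close> only provides room for further
  cells: attaching \<open>max \<bar>S\<bar> \<aleph>\<^sub>0\<close> cells in every dimension suffices to kill all higher
  homotopy groups, and \<open>Higher n i v\<close> leaves space for that many.\<close>

datatype 'a cw_point =
    Vertex
  | Edge 'a real
  | Face "nat \<Rightarrow> real"
  | Higher nat "'a + nat" "nat \<Rightarrow> real"

definition edge_point :: "'a \<Rightarrow> real \<Rightarrow> 'a cw_point" where
  "edge_point s x = (if \<bar>x\<bar> < 1 then Edge s x else Vertex)"

definition edge_map :: "'a \<Rightarrow> (nat \<Rightarrow> real) \<Rightarrow> 'a cw_point" where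
  "edge_map s v = edge_point s (v 0)"

definition letter_loop :: "'a \<times> bool \<Rightarrow> real \<Rightarrow> 'a cw_point" where
  "letter_loop l t = edge_point (fst l) (if snd l then 2 * t - 1 else 1 - 2 * t)"

text \<open>For \<open>0 \<le> t < 1\<close>: the loop that runs through the \<open>i\<close>-th letter of \<open>r\<close> on the interval
  from \<open>i / length r\<close> to \<open>(i + 1) / length r\<close>.\<close>

definition word_loop :: "'a word \<Rightarrow> real \<Rightarrow> 'a cw_point" where
  "word_loop r t =
     letter_loop (r ! nat \<lfloor>real (length r) * t\<rfloor>) (frac (real (length r) * t))"

definition face_map :: "'a word \<Rightarrow> (nat \<Rightarrow> real) \<Rightarrow> 'a cw_point" where
  "face_map r v =
     (if v \<in> open_disc 2 then Face v
      else word_loop r (Arg2pi (Complex (v 0) (v 1)) / (2 * pi)))"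

definition one_skeleton :: "'a set \<Rightarrow> 'a cw_point topology" where
  "one_skeleton S = glue (discrete_topology {Vertex}) 1 (edge_map ` S)"

definition presentation_complex :: "'a set \<Rightarrow> 'a word \<Rightarrow> 'a cw_point topology" where
  "presentation_complex S r = glue (one_skeleton S) 2 {face_map r}"


section \<open>Classifying spaces\<close>

definition loops :: "'p topology \<Rightarrow> 'p \<Rightarrow> (real \<Rightarrow> 'p) set" where
  "loops X x = {f. pathin X f \<and> f 0 = x \<and> f 1 = x}"

definition loop_homotopy :: "'p topology \<Rightarrow> 'p \<Rightarrow> ((real \<Rightarrow> 'p) \<times> (real \<Rightarrow> 'p)) set" where
  "loop_homotopy X x = {(f, g). f \<in> loops X x \<and> g \<in> loops X x \<and>
     homotopic_with (\<lambda>h. h 0 = x \<and> h 1 = x) (top_of_set {0..1}) X f g}"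

definition path_join :: "(real \<Rightarrow> 'p) \<Rightarrow> (real \<Rightarrow> 'p) \<Rightarrow> real \<Rightarrow> 'p" where
  "path_join f g t = (if t \<le> 1/2 then f (2 * t) else g (2 * t - 1))"

definition fundamental_group :: "'p topology \<Rightarrow> 'p \<Rightarrow> (real \<Rightarrow> 'p) set monoid" where
  "fundamental_group X x =
     \<lparr>carrier = loops X x // loop_homotopy X x,
      monoid.mult = (\<lambda>a b. loop_homotopy X x `` {path_join f g | f g. f \<in> a \<and> g \<in> b}),
      one = loop_homotopy X x `` {\<lambda>_. x}\<rparr>"

text \<open>Since \<open>X\<close> is path connected, the last condition (no base points) is equivalent to the
  vanishing of all homotopy groups of degree \<open>k \<ge> 2\<close>.\<close>

definition classifying_space :: "('g, 'b) monoid_scheme \<Rightarrow> 'p topology \<Rightarrow> bool" where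
  "classifying_space G X \<longleftrightarrow>
     topspace X \<noteq> {} \<and> path_connected_space X \<and>
     (\<forall>x\<in>topspace X. fundamental_group X x \<cong> G) \<and>
     (\<forall>k\<ge>2. \<forall>f. continuous_map (nsphere k) X f \<longrightarrow>
        (\<exists>c. homotopic_with (\<lambda>_. True) (nsphere k) X f (\<lambda>_. c)))"

definition classifying_extension :: "'a set \<Rightarrow> 'a word \<Rightarrow> 'a cw_point topology \<Rightarrow> bool" where
  "classifying_extension S r X \<longleftrightarrow>
     attaches_higher_cells (presentation_complex S r) X \<and>
     classifying_space (one_relator_group S r) X"

text \<open>Any two choices are homotopy equivalent relative to the presentation complex.\<close>

definition classifying_complex :: "'a set \<Rightarrow> 'a word \<Rightarrow> 'a cw_point topology" where
  "classifying_complex S r = (SOME X. classifying_extension S r X)"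


section \<open>The l1-semi-norm on real singular homology\<close>

type_synonym 'p real_chain = "((nat \<Rightarrow> real) \<Rightarrow> 'p) \<Rightarrow>\<^sub>0 real"

definition singular_real_chain :: "nat \<Rightarrow> 'p topology \<Rightarrow> 'p real_chain \<Rightarrow> bool" where
  "singular_real_chain p X c \<longleftrightarrow> Poly_Mapping.keys c \<subseteq> singular_simplex_set p X"

definition real_boundary :: "nat \<Rightarrow> 'p real_chain \<Rightarrow> 'p real_chain" where
  "real_boundary p c =
     (if p = 0 then 0
      else \<Sum>\<sigma>\<in>Poly_Mapping.keys c. \<Sum>k\<le>p.
             Poly_Mapping.single (singular_face p k \<sigma>) ((-1) ^ k * Poly_Mapping.lookup c \<sigma>))"

definition l1_norm :: "'p real_chain \<Rightarrow> real" where
  "l1_norm c = (\<Sum>\<sigma>\<in>Poly_Mapping.keys c. \<bar>Poly_Mapping.lookup c \<sigma>\<bar>)"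

text \<open>Like the elements of \<open>homology_group\<close>, real homology classes are sets of homologous
  cycles.\<close>

definition real_homology_class :: "nat \<Rightarrow> 'p topology \<Rightarrow> 'p real_chain \<Rightarrow> 'p real_chain set" where
  "real_homology_class p X z =
     {c. singular_real_chain p X c \<and>
         (\<exists>b. singular_real_chain (Suc p) X b \<and> c - z = real_boundary (Suc p) b)}"

definition change_of_coefficients :: "nat \<Rightarrow> 'p topology \<Rightarrow> 'p chain set \<Rightarrow> 'p real_chain set" where
  "change_of_coefficients p X a =
     (\<Union>z\<in>a. real_homology_class p X (Poly_Mapping.map real_of_int z))"

definition l1_seminorm :: "'p real_chain set \<Rightarrow> real" where
  "l1_seminorm a = Inf (l1_norm ` a)"


section \<open>Fundamental classes and simplicial volume\<close>

text \<open>A generator of the infinite cyclic second homology group of the disc relative to its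
  boundary, i.e. an orientation. The other choice changes the fundamental class by a sign and
  hence does not affect its semi-norm.\<close>

definition disc_class :: "(nat \<Rightarrow> real) chain set" where
  "disc_class = (SOME \<gamma>.
     \<gamma> \<in> carrier (relative_homology_group 2 (ndisc 2) (topspace (nsphere 1))) \<and>
     generate (relative_homology_group 2 (ndisc 2) (topspace (nsphere 1))) {\<gamma>} =
       carrier (relative_homology_group 2 (ndisc 2) (topspace (nsphere 1))))"

text \<open>The \<open>2\<close>-cell is a cellular chain, i.e. an element of the homology of the complex
  relative to its \<open>1\<close>-skeleton. If the relator is in the commutator subgroup, the cellular
  boundary is trivial, and so the cell has a preimage in the absolute homology. That preimage
  is unique, because the second homology of the \<open>1\<close>-skeleton is trivial.\<close>

definition cell_class :: "'a set \<Rightarrow> 'a word \<Rightarrow> 'a cw_point chain set" where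
  "cell_class S r = (THE a.
     a \<in> carrier (homology_group 2 (presentation_complex S r)) \<and>
     hom_induced 2 (presentation_complex S r) {}
         (presentation_complex S r) (topspace (one_skeleton S)) id a =
     hom_induced 2 (ndisc 2) (topspace (nsphere 1))
         (presentation_complex S r) (topspace (one_skeleton S)) (face_map r) disc_class)"

definition fundamental_class :: "'a set \<Rightarrow> 'a word \<Rightarrow> 'a cw_point chain set" where
  "fundamental_class S r =
     hom_induced 2 (presentation_complex S r) {} (classifying_complex S r) {} id (cell_class S r)"

definition simplicial_volume :: "'a set \<Rightarrow> 'a word \<Rightarrow> real" where
  "simplicial_volume S r =
     l1_seminorm (change_of_coefficients 2 (classifying_complex S r) (fundamental_class S r))"

end

theory Submission
  imports Defs "HOL-Analysis.Urysohn"
begin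

text \<open>Let \<open>w = [a, \<tau>]\<^sup>k\<close>, \<open>v = [a\<^sup>m, \<tau>]\<close> and \<open>r = w t v\<^sup>-\<^sup>1 t\<^sup>-\<^sup>1\<close> with \<open>1 \<le> k \<le> m\<close>. The group \<open>G\<^sub>r\<close> is an HNN
 extension of the free group on \<open>a\<close> and \<open>\<tau>\<close>. Its normal forms collapse every finite part of the
 Cayley complex into a contractible one, so the presentation complex is aspherical and the seminorm
 can be estimated with bar chains; it is \<open>2k + 2 - 4k/m\<close>.

 Upper bound: \<open>m\<close> copies of the annulus \<open>[w\<^sup>n|t] - [t|v\<^sup>n]\<close> are filled by \<open>n m (2k + 2 - 4k/m) + O(1)\<close>
 triangles. Indeed \<open>v\<close> is a product of \<open>m\<close> conjugates of \<open>[a, \<tau>]\<close> and also the product of \<open>a\<^sup>m\<close> and a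
 conjugate of its inverse, and a pair of pants with boundary \<open>p\<^sup>n, q\<^sup>n, (pq)\<^sup>n\<close> takes \<open>2n + O(1)\<close> triangles.

 Lower bound: at each coset of \<open>\<langle>a\<rangle>\<close>, the vertices of a triangle are seen in certain directions
 \<open>a\<^sup>i \<tau>\<^sup>\<plusminus>\<^sup>1\<close>, and at most one coset sees three distinct ones. Adding \<open>h (j - i)\<close> over the pairs of
 directions of the same sign, with the odd function \<open>h x = 2\<lceil>x/m\<rceil> - 1 - 2x/m\<close> for \<open>x > 0\<close>, gives
 a cocycle of norm at most \<open>1\<close> whose value on \<open>r\<close> is \<open>2k h 1 - 2 h m = 2k + 2 - 4k/m\<close>.

 For \<open>q = p/n\<close> take \<open>m = 4n\<close> and \<open>k \<equiv> -p\<close> modulo \<open>n\<close>.\<close>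

text \<open>The space in the statement is an arbitrary choice among classifying extensions. Since
  the presentation complex \<open>P2\<close> is aspherical, it is itself such an extension and every
  other one retracts onto it, so all seminorms can be computed in \<open>P2\<close>. There the
  fundamental class is accessible only as a generator of the second homology. The integral cocycle
  \<open>lam\<close>, which counts powers of \<open>u True\<close> carried across t, tells up to
  sign which multiple of the class a cycle represents. Both bounds use cycles with
  \<open>lam\<close> value proportional to n; bounded errors vanish after division by n. The
  function h is a step function minus an additive one. In h i + h j + h l with i + j + l = 0 the
  additive part drops out, and the step part leaves at most 1, because rounding up a sum loses 0 or
  1. Triangles with directions of both signs, or with a vertex without direction, see a single value
  of h; the slope 2/m keeps that value between -1 and 1. Asphericity rests on pairing every face
  with one t-edge outside a spanning tree, so that contractible subcomplexes grow one cell at a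
  time.\<close>

abbreviation "I01 \<equiv> top_of_set {0..1::real}"
abbreviation "tsp \<equiv> topspace"
abbreviation "cmap \<equiv> continuous_map"
abbreviation "subt \<equiv> subtopology"
abbreviation "prodt \<equiv> prod_topology"
abbreviation "eur \<equiv> euclideanreal"
abbreviation "hrel \<equiv> homologous_rel_set"
abbreviation "rhg \<equiv> relative_homology_group"
abbreviation "rchain \<equiv> singular_real_chain"
abbreviation "rbd \<equiv> real_boundary"
abbreviation "rhc \<equiv> real_homology_class"
abbreviation "stds \<equiv> standard_simplex"
abbreviation "ssimp \<equiv> singular_simplex"
abbreviation "sface \<equiv> singular_face"
abbreviation "nS \<equiv> nsphere"
abbreviation "fcm \<equiv> frag_cmul"
abbreviation "odisc \<equiv> open_disc"
abbreviation "smap \<equiv> simplex_map"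
abbreviation "dtop \<equiv> discrete_topology"
lemmas cm_fun = continuous_map_funspace
lemmas cmo = continuous_map_compose
lemmas cm_into = continuous_map_in_subtopology
lemmas cm_from = continuous_map_from_subtopology
lemmas open_pre = openin_continuous_map_preimage
lemmas closed_pre = closedin_continuous_map_preimage
lemmas cm_full = continuous_map_into_fulltopology
lemmas auc = add_uminus_conv_diff
lemmas cm_comp = continuous_map_componentwise_UNIV
lemmas cpt_sub = compact_space_subtopology
lemmas dcu = diff_conv_add_uminus

section \<open>Powers in additive groups and free groups\<close>

text \<open>Base groups live in the class \<open>group_add\<close>, written additively although not
  commutative, so that identities in them need no carrier assumptions.\<close>

definition gpow :: "'g::group_add => int => 'g" where
 "gpow u n=(if n >= 0 then ((+) u ^^ nat n) 0 else - (((+) u ^^ nat (- n)) 0))"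

lemma gpow_0 [simp]: "gpow u 0=0"
 by (simp add: gpow_def)

lemma funpow_plus_right: "((+) u ^^ n) 0 + u=u + ((+) u ^^ n) (0 :: 'g::group_add)"
 by (induction n) (simp_all add: add.assoc)

lemma gpow_Suc: "gpow u (n + 1)=gpow u n + u"
proof -
 consider "n >= 0" | "n = -1" | "n < -1" by linarith
 thus ?thesis
 proof cases
  case 1
  hence "nat (n + 1)=Suc (nat n)" by simp
  thus ?thesis using 1 by (simp add: gpow_def funpow_plus_right)
 next
  case 3
  hence "nat (- n)=Suc (nat (- n - 1))" by simp
  thus ?thesis using 3 by (simp add: gpow_def minus_add)
 qed (simp add: gpow_def)
qed

lemma gpow_pred: "gpow u (n - 1)=gpow u n - u"
 using gpow_Suc[of u "n - 1"] by simp

lemma gpow_add: "gpow u (i + j)=gpow u i + gpow u j"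
proof (induction j rule: int_induct[where k = 0])
 case (step1 j)
 thus ?case using gpow_Suc[of u "i + j"] gpow_Suc[of u j] by (simp add: add.assoc)
next
 case (step2 j)
 have "i + (j - 1)=i + j - 1" by simp
 thus ?case using step2 gpow_pred[of u "i + j"] gpow_pred[of u j] by (simp add: add_diff_eq)
qed simp

lemma gpow_1 [simp]: "gpow u 1=u"
 using gpow_Suc[of u 0] by simp

lemma gpow_minus: "gpow u (- i) = - gpow u i"
 by (metis add.right_inverse gpow_0 gpow_add minus_unique)

lemma gpow_diff: "gpow u (i - j)=gpow u i - gpow u j"
 using gpow_add[of u i "- j"] by (simp add: gpow_minus)

lemma gpow_mult: "gpow (gpow u i) j=gpow u (i * j)"
proof (induction j rule: int_induct[where k = 0])
 case (step1 j) thus ?case by (simp add: gpow_add distrib_left)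
next
 case (step2 j) thus ?case by (simp add: gpow_diff right_diff_distrib)
qed simp

lemma gpow_conj: "gpow (g + u - g) n=g + gpow u n - g"
proof (induction n rule: int_induct[where k = 0])
 case (step1 j) thus ?case by (simp add: gpow_add add.assoc dcu del: auc)
next
 case (step2 j) thus ?case
  unfolding gpow_pred by (simp add: minus_add add.assoc dcu del: auc)
qed simp

section \<open>The free group as a type of reduced words\<close>

typedef 'a fg = "{w :: 'a word. reduced w}"
 morphisms letters Abs_fg by (rule exI[of _ "[]"]) simp

lemma reduced_letters [simp]: "reduced (letters u)"
 using letters by blast

lemma reduced_snoc: "reduced (w @ [l]) \<longleftrightarrow> reduced w & (w=[] | last w ~= inv_letter l)"
 by (cases w rule: rev_cases) (auto simp: reduced_def successively_append_iff)

lemma reduced_append: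
 "reduced (v @ w) \<longleftrightarrow> reduced v & reduced w & (v=[] | w=[] | hd w ~= inv_letter (last v))"
 by (auto simp: reduced_def successively_append_iff)

lemma inv_letter_neq [simp]: "inv_letter l ~= l" "l ~= inv_letter l"
 by (auto simp: inv_letter_def prod_eq_iff)

lemma inv_letter_eq_iff: "inv_letter l=m \<longleftrightarrow> l=inv_letter m"
 by auto

definition inv_word :: "'a word => 'a word" where
 "inv_word w=rev (map inv_letter w)"

lemma reduced_inv_word: "reduced w ==> reduced (inv_word w)"
proof (induction w)
 case (Cons l w)
 thus ?case
  by (cases w) (auto simp: inv_word_def reduced_append reduced_Cons reduced_snoc inv_letter_eq_iff)
qed (simp add: inv_word_def)

instantiation fg :: (type) group_add
begin

definition zero_fg :: "'a fg" where "0=Abs_fg []"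
definition plus_fg :: "'a fg => 'a fg => 'a fg" where
 "u + v=Abs_fg (foldr push (letters u) (letters v))"
definition uminus_fg :: "'a fg => 'a fg" where "- u=Abs_fg (inv_word (letters u))"
definition minus_fg :: "'a fg => 'a fg => 'a fg" where "u - v=u + - (v :: 'a fg)"

lemma letters_zero [simp]: "letters 0=[]"
 by (simp add: zero_fg_def Abs_fg_inverse)

lemma letters_plus: "letters (u + v)=foldr push (letters u) (letters v)"
 by (simp add: plus_fg_def Abs_fg_inverse reduced_foldr_push)

lemma letters_uminus: "letters (- u)=inv_word (letters u)"
 by (simp add: uminus_fg_def Abs_fg_inverse reduced_inv_word)

instance
proof
 fix a b c :: "'a fg"
 show "a + b + c=a + (b + c)"
  by (simp add: letters_plus foldr_push_assoc flip: letters_inject)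
 show "0 + a=a" by (simp add: letters_plus flip: letters_inject)
 show "a + 0=a" by (simp add: letters_plus foldr_push_Nil flip: letters_inject)
 show "- a + a=0"
  using foldr_push_inverse[of "[]" "letters a"]
  by (simp add: letters_plus letters_uminus inv_word_def foldr_push_Nil flip: letters_inject)
 show "a + - b=a - b" by (simp add: minus_fg_def)
qed

end

definition gen :: "'a \<times> bool => 'a fg" where "gen l=Abs_fg [l]"

lemma letters_gen [simp]: "letters (gen l)=[l]"
 by (simp add: gen_def Abs_fg_inverse reduced_def)

lemma letters_gen_plus: "letters (gen l + u)=push l (letters u)"
 by (simp add: letters_plus)

lemma gen_inv: "gen (inv_letter l) = - gen l"
 by (simp add: letters_uminus inv_word_def flip: letters_inject)

lemma letters_plus_reduced:
 "reduced (letters u @ letters v) ==> letters (u + v)=letters u @ letters v"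
 using foldr_push_Nil[of "letters u @ letters v"] foldr_push_Nil[of "letters v"]
 by (simp add: letters_plus)

definition word_val :: "'a word => 'a fg" where
 "word_val w=foldr (%l u. gen l + u) w 0"

lemma word_val_simps [simp]:
 "word_val []=0" "word_val (l # w)=gen l + word_val w"
 by (simp_all add: word_val_def)

lemma word_val_append [simp]: "word_val (v @ w)=word_val v + word_val w"
 by (induction v) (simp_all add: add.assoc)

lemma letters_word_val: "letters (word_val w)=foldr push w []"
 by (induction w) (simp_all add: letters_gen_plus)

lemma word_val_letters [simp]: "word_val (letters u)=u"
 by (simp add: letters_word_val foldr_push_Nil flip: letters_inject)

lemma letters_word_val_reduced: "reduced w ==> letters (word_val w)=w"
 by (simp add: letters_word_val foldr_push_Nil)

lemma word_val_inv: "word_val (inv_word w) = - word_val w"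
 by (induction w) (simp_all add: inv_word_def gen_inv minus_add del: auc)

text \<open>The hypothesis says that \<open>u\<close> is cyclically reduced, so nothing cancels
  between consecutive copies.\<close>

lemma letters_gpow:
 assumes "reduced (letters u @ letters u)"
 shows "letters (gpow u (int n))=concat (replicate n (letters u))"
proof (induction n)
 case (Suc n)
 have red: "reduced (concat (replicate i (letters u)))" for i
 proof (cases "letters u=[]")
  case False
  show ?thesis
  proof (induction i)
   case (Suc i)
   have "hd (concat (replicate i (letters u)))=hd (letters u)" if "i > 0"
    using that False by (cases i) auto
   thus ?case using Suc assms False by (cases "i=0") (auto simp: reduced_append)
  qed simp
 qed simp
 have "gpow u (int (Suc n))=u + gpow u (int n)"
  using gpow_add[of u 1 "int n"] by simp
 thus ?case
  using letters_plus_reduced[of u "gpow u (int n)"] Suc red[of "Suc n"] by simp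
qed simp

text \<open>Positive powers of a nontrivial cyclically reduced word are nonempty reduced words. This
  supplies the assumption \<open>gpow_u\<close> of the HNN construction.\<close>

lemma gpow_inj_of_reduced:
 assumes "reduced (letters u @ letters u)" "u ~= 0" "gpow u n=0"
 shows "n=0"
proof -
 have ne: "letters u ~= []" using assms(2) by (metis letters_inject letters_zero)
 have *: "i=0" if "gpow u (int i)=0" for i
  using letters_gpow[OF assms(1), of i] that ne by (cases i) auto
 show ?thesis
 proof (cases "n >= 0")
  case True
  then obtain i where "n=int i" using nonneg_int_cases by blast
  thus ?thesis using * assms by simp
 next
  case False
  then obtain i where "n = - int i" by (intro that[of "nat (- n)"]) simp
  thus ?thesis using * assms by (simp add: gpow_minus)
 qed
qed

section \<open>Normal forms in HNN extensions with cyclic associated subgroups\<close>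

text \<open>A pair \<open>(L, g)\<close> with \<open>L = [(c\<^sub>n, \<epsilon>\<^sub>n), \<dots>, (c\<^sub>1, \<epsilon>\<^sub>1)]\<close> stands for the element
  \<open>c\<^sub>1 t\<^bsup>\<epsilon>\<^sub>1\<^esup> \<dots> c\<^sub>n t\<^bsup>\<epsilon>\<^sub>n\<^esup> g\<close> of the extension with \<open>u True \<cdot> t = t \<cdot> u False\<close>, so that the
  head of the list is the last syllable.\<close>

type_synonym 'g state = "('g \<times> bool) list \<times> 'g"

abbreviation sg :: "bool => int" where "sg e == (if e then 1 else -1)"

definition addg :: "'g::group_add => 'g state => 'g state" where
 "addg h x=(fst x, snd x + h)"

lemma addg_Pair [simp]: "addg h (L, g)=(L, g + h)"
 by (simp add: addg_def)

lemma addg_addg [simp]: "addg h (addg h' x)=addg (h' + h) x"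
 by (simp add: addg_def add.assoc)

lemma addg_0 [simp]: "addg 0 x=x"
 by (simp add: addg_def)

lemma fst_addg [simp]: "fst (addg h x)=fst x"
 by (simp add: addg_def)

locale hnn =
 fixes u :: "bool => 'g::group_add"
 assumes gpow_u: "gpow (u e) n=0 ==> n=0"
begin

lemma gpow_u_inj: "gpow (u e) i=gpow (u e) j ==> i=j"
 using gpow_u[of e "i - j"] by (simp add: gpow_diff)

text \<open>A transversal for the left cosets of the subgroup generated by \<open>u e\<close>. The
  choice is made from a predicate that depends only on the coset, so elements of one coset get the
  same representative. The subgroup itself must get 0, since 0 signals a possible
  cancellation.\<close>

definition rep :: "bool => 'g => 'g" where
 "rep e g=(if EX n. g=gpow (u e) n then 0 else SOME h. EX n. h=g + gpow (u e) n)"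

definition ex :: "bool => 'g => int" where
 "ex e g=(THE n. g=rep e g + gpow (u e) n)"

lemma rep_ex: "g=rep e g + gpow (u e) (ex e g)"
proof -
 have "EX n. g=rep e g + gpow (u e) n"
 proof (cases "EX n. g=gpow (u e) n")
  case False
  have "EX n. rep e g=g + gpow (u e) n"
   unfolding rep_def if_not_P[OF False]
   by (rule someI[of "%h. EX n. h=g + gpow (u e) n" "g + gpow (u e) 0"]) blast
  then obtain n where "rep e g=g + gpow (u e) n" by blast
  thus ?thesis by (intro exI[of _ "- n"]) (simp add: add.assoc gpow_minus)
 qed (simp add: rep_def)
 hence "\<exists>!n. g=rep e g + gpow (u e) n"
  using gpow_u_inj by (metis add_left_cancel)
 thus ?thesis unfolding ex_def by (rule theI')
qed

lemma rep_shift [simp]: "rep e (g + gpow (u e) n)=rep e g"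
proof -
 have 1: "(EX i. g + gpow (u e) n=gpow (u e) i) \<longleftrightarrow> (EX i. g=gpow (u e) i)"
 proof
  assume "EX i. g + gpow (u e) n=gpow (u e) i"
  then obtain i where "g + gpow (u e) n=gpow (u e) i" by blast
  hence "g=gpow (u e) (i - n)" by (simp add: gpow_diff eq_diff_eq)
  thus "EX i. g=gpow (u e) i" by blast
 qed (metis gpow_add)
 have "(EX i. h=g + gpow (u e) n + gpow (u e) i) \<longleftrightarrow> (EX i. h=g + gpow (u e) i)" for h
 proof
  assume "EX i. h=g + gpow (u e) i"
  then obtain i where "h=g + gpow (u e) i" by blast
  hence "h=g + gpow (u e) n + gpow (u e) (i - n)"
   using gpow_add[of "u e" n "i - n"] by (simp add: add.assoc)
  thus "EX i. h=g + gpow (u e) n + gpow (u e) i" by blast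
 qed (metis add.assoc gpow_add)
 thus ?thesis unfolding rep_def 1 by simp
qed

lemma exI_unique: "g=rep e g + gpow (u e) n ==> ex e g=n"
 using rep_ex[of g e] gpow_u_inj by (metis add_left_cancel)

lemma ex_shift [simp]: "ex e (g + gpow (u e) n)=ex e g + n"
proof (rule exI_unique)
 show "g + gpow (u e) n=rep e (g + gpow (u e) n) + gpow (u e) (ex e g + n)"
  using rep_ex[of g e] by (simp add: gpow_add flip: add.assoc)
qed

lemma rep_0 [simp]: "rep e 0=0" and ex_0 [simp]: "ex e 0=0"
proof -
 show "rep e 0=0" by (metis rep_def gpow_0)
 thus "ex e 0=0" by (intro exI_unique) simp
qed

lemma rep_gpow [simp]: "rep e (gpow (u e) n)=0" and ex_gpow [simp]: "ex e (gpow (u e) n)=n"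
 using rep_shift[of e 0 n] ex_shift[of e 0 n] by simp_all

lemma rep_rep [simp]: "rep e (rep e g)=rep e g"
 using rep_shift[of e "rep e g" "ex e g"] rep_ex[of g e] by simp

lemma ex_rep [simp]: "rep e c=c ==> ex e c=0"
 by (intro exI_unique) simp

text \<open>Britton's reducedness for normal forms: the entries are chosen representatives, and t is
  never followed directly by its inverse.\<close>

fun vl :: "('g \<times> bool) list => bool" where
 "vl []=True"
| "vl ((c, e) # L) \<longleftrightarrow> rep e c=c & vl L & (c=0 --> L=[] | snd (hd L)=e)"

definition V :: "'g state set" where "V={x. vl (fst x)}"

text \<open>Right multiplication by t or its inverse. The final entry is split into representative
  and power of \<open>u e\<close>; the power crosses the letter and becomes a power of
  \<open>u (~e)\<close>; the letter cancels if only a trivial representative separates it from its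
  inverse.\<close>

definition tact :: "bool => 'g state => 'g state" where
 "tact e x=(let (L, g)=x; c=rep e g; h=gpow (u (~e)) (ex e g) in
   if c=0 & L ~= [] & snd (hd L)=(~e) then (tl L, fst (hd L) + h) else ((c, e) # L, h))"

text \<open>The exponent that \<open>tact\<close> carries across the letter, signed so that t and
  its inverse contribute opposite amounts (\<open>inc_inverse\<close>).\<close>

definition inc :: "bool => 'g state => int" where
 "inc e x=sg e * ex e (snd x)"

lemma tact_shift: "tact e (addg (gpow (u e) n) x)=addg (gpow (u (~e)) n) (tact e x)"
 by (cases x) (auto simp: tact_def Let_def gpow_add add.assoc)

lemma inc_shift: "inc e (addg (gpow (u e) n) x)=inc e x + sg e * n"
 by (auto simp: inc_def addg_def)

lemma V_addg [simp]: "addg h x:V \<longleftrightarrow> x:V"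
 by (simp add: V_def)

lemma tact_V: "x:V ==> tact e x:V"
 by (cases x; cases "fst x") (auto simp: V_def tact_def Let_def)

text \<open>The letters act on \<open>V\<close> by permutations. This is van der Waerden's method:
  normal forms are unique because they are the points of a set on which the group acts, and no
  confluence argument is required.\<close>

lemma tact_inverse:
 assumes "x:V" shows "tact (~e) (tact e x)=x"
proof -
 obtain L g where x: "x=(L, g)" by fastforce
 have g: "g=rep e g + gpow (u e) (ex e g)" by (rule rep_ex)
 show ?thesis
 proof (cases "rep e g=0 & L ~= [] & snd (hd L)=(~e)")
  case False
  hence "tact e x=((rep e g, e) # L, gpow (u (~e)) (ex e g))" by (auto simp: x tact_def Let_def)
  thus ?thesis using g by (simp add: tact_def x)
 next
  case True
  then obtain c L' where L: "L=(c, ~e) # L'" by (cases L) auto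
  hence c: "rep (~e) c=c" "c=0 ==> L'=[] | snd (hd L')=(~e)"
   using assms by (auto simp: V_def x)
  have "tact e x=(L', c + gpow (u (~e)) (ex e g))" using True by (simp add: x tact_def L)
  hence "tact (~e) (tact e x)=(L, gpow (u e) (ex e g))"
   using c by (auto simp: tact_def Let_def L)
  thus ?thesis using True g by (simp add: x)
 qed
qed

lemma inc_inverse:
 assumes "x:V" shows "inc (~e) (tact e x) = - inc e x"
proof -
 obtain L g where x: "x=(L, g)" by fastforce
 show ?thesis
 proof (cases "rep e g=0 & L ~= [] & snd (hd L)=(~e)")
  case True
  then obtain c L' where L: "L=(c, ~e) # L'" by (cases L) auto
  hence c: "rep (~e) c=c" using assms by (auto simp: V_def x)
  thus ?thesis using True by (simp add: x tact_def L inc_def)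
 qed (auto simp: x tact_def Let_def inc_def)
qed

lemma tact_inverse': "x:V ==> tact e (tact (~e) x)=x"
 using tact_inverse[of x "~e"] by simp

section \<open>The group structure on normal forms\<close>

definition one_V :: "'g state" where "one_V=([], 0)"

definition mulL :: "'g state => ('g \<times> bool) list => 'g state" where
 "mulL y L=foldr (%(c, e) z. tact e (addg c z)) L y"

text \<open>The word spelled by \<open>x\<close> acts on \<open>y\<close> from the right, so the
  product needs no reduction procedure of its own.\<close>

definition mul :: "'g state => 'g state => 'g state" where
 "mul y x=addg (snd x) (mulL y (fst x))"

lemma mulL_simps [simp]: "mulL y []=y" "mulL y ((c, e) # L)=tact e (addg c (mulL y L))"
 by (simp_all add: mulL_def)

lemma mulL_V: "y:V ==> mulL y L:V"
 by (induction L) (auto simp: tact_V)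

lemma mul_V: "y:V ==> mul y x:V"
 by (simp add: mul_def mulL_V)

lemma one_in_V [simp]: "one_V:V"
 by (simp add: one_V_def V_def)

lemma mul_one_right [simp]: "mul x one_V=x"
 by (simp add: mul_def one_V_def)

lemma mul_addg: "mul y (addg h x)=addg h (mul y x)"
 by (simp add: mul_def addg_def add.assoc)

text \<open>Left multiplication commutes with the right action of t. With the analogue
  \<open>mul_addg\<close>, associativity and the unit law follow by induction along
  \<open>state_induct\<close>.\<close>

lemma mul_tact:
 assumes "y:V" "x:V"
 shows "mul y (tact e x)=tact e (mul y x)"
proof -
 obtain L g where x: "x=(L, g)" by fastforce
 let ?n = "ex e g"
 have g: "g=rep e g + gpow (u e) ?n" by (rule rep_ex)
 have "tact e (mul y x)=tact e (addg (gpow (u e) ?n) (addg (rep e g) (mulL y L)))"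
  using g by (simp add: x mul_def)
 hence 1: "tact e (mul y x)=addg (gpow (u (~e)) ?n) (tact e (addg (rep e g) (mulL y L)))"
  by (simp only: tact_shift)
 show ?thesis
 proof (cases "rep e g=0 & L ~= [] & snd (hd L)=(~e)")
  case False
  hence "tact e x=((rep e g, e) # L, gpow (u (~e)) ?n)" by (auto simp: x tact_def Let_def)
  thus ?thesis using 1 by (simp add: mul_def)
 next
  case True
  then obtain c L' where L: "L=(c, ~e) # L'" by (cases L) auto
  \<comment> \<open>In the cancelling case the last step in the computation of
    \<open>mulL y L\<close> was the inverse letter, and \<open>tact e\<close> undoes it.\<close>
  have "tact e (mulL y L)=addg c (mulL y L')"
   using tact_inverse'[of "addg c (mulL y L')" e] assms by (simp add: L mulL_V)
  moreover have "tact e x=(L', c + gpow (u (~e)) ?n)" using True by (simp add: x tact_def L)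
  ultimately show ?thesis using 1 True by (simp add: mul_def)
 qed
qed

lemma state_induct [consumes 1, case_names one addg tact]:
 assumes "x:V" and "P one_V"
  and "!!x h. x:V ==> P x ==> P (addg h x)"
  and "!!x e. x:V ==> P x ==> P (tact e x)"
 shows "P x"
proof -
 have "vl L ==> P (L, g)" for L g
 proof (induction L arbitrary: g)
  case Nil
  thus ?case using assms(3)[of one_V g] assms(2) by (simp add: one_V_def V_def)
 next
  case (Cons ce L)
  obtain c e where ce: "ce=(c, e)" by fastforce
  have "tact e (L, c)=(ce # L, 0)"
   using Cons.prems by (cases L) (auto simp: tact_def ce)
  moreover have "P (L, c)" "(L, c):V" using Cons by (auto simp: ce V_def)
  ultimately have "P (ce # L, 0)" "(ce # L, 0):V"
   using assms(4)[of "(L, c)" e] tact_V[of "(L, c)" e] by auto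
  thus ?case using assms(3)[of "(ce # L, 0)" g] by simp
 qed
 thus ?thesis using assms(1) by (cases x) (auto simp: V_def)
qed

lemma mul_one_left: "x:V ==> mul one_V x=x"
 by (induction rule: state_induct) (simp_all add: mul_addg mul_tact)

lemma mul_assoc:
 assumes "y:V" "x:V" "z:V" shows "mul (mul y x) z=mul y (mul x z)"
 using assms(3) by (induction rule: state_induct) (simp_all add: mul_addg mul_tact mul_V assms)

lemma right_inverse: "x:V ==> EX y:V. mul x y = one_V"
proof (induction rule: state_induct)
 case one
 show ?case by (intro bexI[of _ one_V]) simp_all
next
 case (addg x h)
 then obtain y where y: "y:V" "mul x y = one_V" by blast
 let ?z = "mul (addg (- h) one_V) y"
 have "mul (addg h x) ?z=mul (mul (addg h x) (addg (- h) one_V)) y"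
  using addg y by (simp add: mul_assoc)
 also have "mul (addg h x) (addg (- h) one_V)=x" by (simp add: mul_addg)
 finally show ?case using y by (intro bexI[of _ ?z]) (auto intro: mul_V)
next
 case (tact x e)
 then obtain y where y: "y:V" "mul x y = one_V" by blast
 let ?z = "mul (tact (~e) one_V) y"
 have "mul (tact e x) ?z=mul (mul (tact e x) (tact (~e) one_V)) y"
  using tact y by (simp add: mul_assoc tact_V)
 also have "mul (tact e x) (tact (~e) one_V)=x" using tact by (simp add: mul_tact tact_V tact_inverse)
 finally show ?case using y by (intro bexI[of _ ?z]) (simp_all add: mul_V tact_V)
qed

definition hgrp :: "'g state monoid" where
 "hgrp=\<lparr>carrier=V, monoid.mult=mul, one = one_V\<rparr>"

lemma hgrp_simps [simp]: "carrier hgrp=V" "x \<otimes>\<^bsub>hgrp\<^esub> y=mul x y" "\<one>\<^bsub>hgrp\<^esub> = one_V"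
 by (simp_all add: hgrp_def)

lemma group_hgrp: "group hgrp"
proof (rule groupI)
 fix x assume "x:carrier hgrp"
 hence x: "x:V" by simp
 obtain y where y: "y:V" "mul x y = one_V" using right_inverse x by blast
 obtain z where z: "z:V" "mul y z = one_V" using right_inverse y by blast
 have "mul (mul x y) z=x" using x y z by (metis mul_assoc mul_one_right)
 hence "x=z" using y z by (simp add: mul_one_left)
 thus "EX y:carrier hgrp. y \<otimes>\<^bsub>hgrp\<^esub> x=\<one>\<^bsub>hgrp\<^esub>" using y z by auto
qed (auto simp: mul_V mul_assoc mul_one_left)

definition invV :: "'g state => 'g state" where "invV x=inv\<^bsub>hgrp\<^esub> x"

lemma invV [simp]:
 assumes "x:V"
 shows "invV x:V" "mul x (invV x) = one_V" "mul (invV x) x = one_V"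
 using assms group.inv_closed[OF group_hgrp, of x] group.r_inv[OF group_hgrp, of x]
  group.l_inv[OF group_hgrp, of x] by (simp_all add: invV_def)

lemma mul_left_cancel: "y:V ==> x:V ==> z:V ==> mul y x=mul y z \<longleftrightarrow> x=z"
 by (metis invV(1,3) mul_assoc mul_one_left)

text \<open>The cocycle of the central extension in which \<open>u True \<cdot> t = z \<cdot> t \<cdot> u False\<close>.\<close>

fun lamL :: "'g state => ('g \<times> bool) list => int" where
 "lamL y []=0"
| "lamL y ((c, e) # L)=lamL y L + inc e (addg c (mulL y L))"

definition lam :: "'g state => 'g state => int" where "lam y x=lamL y (fst x)"

lemma lam_addg [simp]: "lam y (addg h x)=lam y x"
 by (simp add: lam_def)

lemma lam_one [simp]: "lam y one_V=0"
 by (simp add: lam_def one_V_def)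

text \<open>Describes \<open>lam\<close> by its increments along the generators, so that the cocycle
  identity can be proved by the same induction as associativity.\<close>

lemma lam_tact:
 assumes "y:V" "x:V"
 shows "lam y (tact e x)=lam y x + inc e (mul y x) - inc e x"
proof -
 obtain L g where x: "x=(L, g)" by fastforce
 let ?n = "ex e g"
 have g: "g=rep e g + gpow (u e) ?n" by (rule rep_ex)
 have "inc e (mul y x)=inc e (addg (gpow (u e) ?n) (addg (rep e g) (mulL y L)))"
  using g by (simp add: x mul_def)
 hence 1: "inc e (mul y x)=inc e (addg (rep e g) (mulL y L)) + inc e x"
  unfolding inc_shift by (simp add: inc_def x)
 show ?thesis
 proof (cases "rep e g=0 & L ~= [] & snd (hd L)=(~e)")
  case False
  hence "tact e x=((rep e g, e) # L, gpow (u (~e)) ?n)" by (auto simp: x tact_def Let_def)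
  thus ?thesis using 1 by (simp add: lam_def x)
 next
  case True
  then obtain c L' where L: "L=(c, ~e) # L'" by (cases L) auto
  have "inc e (mulL y L) = - inc (~e) (addg c (mulL y L'))"
   using inc_inverse[of "addg c (mulL y L')" "~e"] assms by (simp add: L mulL_V)
  moreover have "tact e x=(L', c + gpow (u (~e)) ?n)" using True by (simp add: x tact_def L)
  ultimately show ?thesis using 1 True by (simp add: lam_def x L)
 qed
qed

lemma lam_cocycle:
 assumes "y:V" "x:V" "z:V"
 shows "lam y x + lam (mul y x) z=lam x z + lam y (mul x z)"
 using assms(3)
 by (induction rule: state_induct) (simp_all add: mul_addg mul_tact mul_V lam_tact mul_assoc assms)

end

section \<open>Words over a group and one-relator presentations of HNN extensions\<close>

locale word_map = group Q for Q (structure) +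
 fixes q :: "'s \<times> bool => 'a"
 assumes q_closed [simp]: "q l:carrier Q" and q_inv: "q (inv_letter l)=inv (q l)"
begin

definition wm :: "'s word => 'a" where "wm w=foldr (%l z. q l \<otimes> z) w \<one>"

lemma wm_simps [simp]: "wm []=\<one>" "wm (l # w)=q l \<otimes> wm w"
 by (simp_all add: wm_def)

lemma wm_closed [simp]: "wm w:carrier Q"
 by (induction w) simp_all

lemma wm_append: "wm (v @ w)=wm v \<otimes> wm w"
 by (induction v) (simp_all add: m_assoc)

lemma wm_push: "wm (push l w)=q l \<otimes> wm w"
proof (cases w)
 case (Cons m v)
 have "q l \<otimes> (inv (q l) \<otimes> wm v)=wm v" by (simp flip: m_assoc)
 thus ?thesis using Cons by (simp add: push_def q_inv)
qed (simp add: push_def)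

lemma wm_foldr_push: "wm (foldr push v w)=wm v \<otimes> wm w"
 by (induction v) (simp_all add: wm_push m_assoc)

lemma wm_inv_word: "wm (inv_word w)=inv (wm w)"
 by (induction w) (simp_all add: inv_word_def wm_append q_inv inv_mult_group)

end

text \<open>The base group is free on \<open>False\<close> (the letter a) and \<open>True\<close>
  (the letter \<tau>). In the one-relator group these become 0 and 1, and 2 is the stable letter
  t.\<close>

definition emb :: "bool word => nat word" where
 "emb=map (%l. (if fst l then 1 else 0, snd l))"

lemma emb_simps [simp]: "emb []=[]" "emb (l # w)=(if fst l then 1 else 0, snd l) # emb w"
  "emb (v @ w)=emb v @ emb w" "length (emb w)=length w"
 by (simp_all add: emb_def)

lemma emb_eq_Nil [simp]: "emb w=[] \<longleftrightarrow> w=[]"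
 by (cases w) auto

lemma emb_push: "emb (push l w)=push (if fst l then 1 else 0, snd l) (emb w)"
 by (cases w) (auto simp: push_def inv_letter_def prod_eq_iff split: if_splits)

lemma emb_foldr_push: "emb (foldr push v w)=foldr push (emb v) (emb w)"
 by (induction v) (auto simp: emb_push)

definition three :: "nat set" where "three={0, 1, 2}"

lemma set_emb: "set (emb w) <= {0, 1} \<times> UNIV"
 by (induction w) auto

lemma set_emb_three: "set (emb w) <= three \<times> UNIV"
 using set_emb[of w] by (auto simp: three_def)

lemma emb_inv_word: "emb (inv_word w)=inv_word (emb w)"
 by (simp add: emb_def inv_word_def rev_map inv_letter_def)

lemma reduced_emb: "reduced w ==> reduced (emb w)"
proof (induction w)
 case (Cons l w)
 thus ?case
  by (cases w) (auto simp: reduced_Cons inv_letter_def prod_eq_iff split: if_splits)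
qed simp

section \<open>The one-relator presentation of the extension\<close>

locale hnn_words = hnn u for u :: "bool => bool fg" +
 assumes u_nz: "u e ~= 0"
begin

definition lact :: "nat \<times> bool => bool fg state => bool fg state" where
 "lact l x=(if fst l=2 then tact (snd l) x else addg (gen (fst l=1, snd l)) x)"

definition wact :: "nat word => bool fg state => bool fg state" where
 "wact w x=fold lact w x"

lemma wact_simps [simp]: "wact [] x=x" "wact (l # w) x=wact w (lact l x)"
  "wact (v @ w) x=wact w (wact v x)"
 by (simp_all add: wact_def)

lemma lact_V [simp]: "x:V ==> lact l x:V"
 by (simp add: lact_def tact_V)

lemma wact_V [simp]: "x:V ==> wact w x:V"
 by (induction w arbitrary: x) simp_all

lemma lact_inv [simp]: "x:V ==> lact (inv_letter l) (lact l x)=x"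
 using gen_inv[of "(fst l=1, snd l)"]
 by (cases l) (auto simp: lact_def tact_inverse inv_letter_def)

lemma lact_inv' [simp]: "x:V ==> lact l (lact (inv_letter l) x)=x"
 using lact_inv[of x "inv_letter l"] by simp

lemma mul_lact: "y:V ==> x:V ==> mul y (lact l x)=lact l (mul y x)"
 by (simp add: lact_def mul_addg mul_tact)

lemma mul_wact: "y:V ==> x:V ==> mul y (wact w x)=wact w (mul y x)"
 by (induction w arbitrary: x) (simp_all add: mul_lact)

lemma wact_push: "x:V ==> wact (push l w) x=wact w (lact l x)"
 by (cases w) (auto simp: push_def)

lemma wact_foldr_push: "x:V ==> wact (foldr push v w) x=wact w (wact v x)"
 by (induction v arbitrary: x) (simp_all add: wact_push)

lemma wact_emb [simp]: "wact (emb w) x=addg (word_val w) x"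
 by (induction w arbitrary: x) (auto simp: lact_def)

text \<open>The word read off from a normal form; syllables are appended on the right because the
  head of the list is the last one.\<close>

definition nfw :: "bool fg state => nat word" where
 "nfw x=foldr (%(c, e) w. w @ emb (letters c) @ [(2, e)]) (fst x) [] @ emb (letters (snd x))"

lemma nfw_one [simp]: "nfw one_V=[]"
 by (simp add: nfw_def one_V_def)

lemma nfw_Cons: "nfw ((c, e) # L, g)=nfw (L, c) @ [(2, e)] @ emb (letters g)"
 by (simp add: nfw_def)

lemma wact_nfw: "y:V ==> wact (nfw x) y=mul y x"
proof -
 have "wact (nfw (L, g)) y=mul y (L, g)" for L g
 proof (induction L arbitrary: g)
  case (Cons ce L)
  thus ?case by (cases ce) (simp add: nfw_Cons lact_def mul_def)
 qed (simp add: nfw_def mul_def)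
 thus ?thesis by (cases x) simp
qed

lemma wact_nfw_one: "x:V ==> wact (nfw x) one_V=x"
 by (simp add: wact_nfw mul_one_left)

definition relator :: "nat word" where
 "relator=emb (letters (u True)) @ [(2, True)] @ emb (letters (- u False)) @ [(2, False)]"

lemma wact_relator [simp]:
 assumes "x:V" shows "wact relator x=x"
proof -
 have "tact True (addg (gpow (u True) 1) x)=addg (gpow (u False) 1) (tact True x)"
  using tact_shift[of True 1 x] by simp
 thus ?thesis
  using assms tact_inverse[of x True] by (simp add: relator_def lact_def)
qed

lemma letters_nz: "g ~= 0 ==> letters g ~= []"
 by (metis letters_inject letters_zero)

lemma relator_reduced: "reduced relator"
proof -
 have ne: "emb (letters (u True)) ~= []" "emb (letters (- u False)) ~= []"
  using u_nz by (auto intro!: letters_nz)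
 have h: "fst (hd (emb w)) ~= 2" "fst (last (emb w)) ~= 2" if "emb w ~= []" for w
  using hd_in_set[OF that] last_in_set[OF that] set_emb[of w] by force+
 have "reduced (emb (letters (- u False)) @ [(2, False)])"
  using h(2)[OF ne(2)] by (auto simp: reduced_snoc reduced_emb inv_letter_def prod_eq_iff)
 hence "reduced ((2, True) # emb (letters (- u False)) @ [(2, False)])"
  using h(1)[OF ne(2)] ne(2) by (auto simp: reduced_Cons inv_letter_def prod_eq_iff)
 thus ?thesis
  using h(2)[OF ne(1)] by (auto simp: relator_def reduced_append reduced_emb inv_letter_def prod_eq_iff)
qed

lemma relator_carrier: "relator:carrier (free_group three)"
 using relator_reduced set_emb_three[of "letters (u True)"] set_emb_three[of "letters (- u False)"]
 by (auto simp: free_group_def relator_def three_def)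

definition ev :: "nat word => bool fg state" where "ev w=wact w one_V"

lemma ev_hom: "ev:hom (free_group three) hgrp"
proof (rule homI)
 fix v w :: "nat word"
 have "ev (foldr push v w)=wact w (mul (ev v) one_V)"
  by (simp add: ev_def wact_foldr_push)
 also have "... = mul (ev v) (ev w)"
  using mul_wact[of "wact v one_V" one_V w] by (simp add: ev_def)
 finally show "ev (v \<otimes>\<^bsub>free_group three\<^esub> w)=ev v \<otimes>\<^bsub>hgrp\<^esub> ev w"
  by (simp add: free_group_def)
qed (simp add: ev_def)

lemma group_hom_ev: "group_hom (free_group three) hgrp ev"
 by (simp add: group_hom_def group_hom_axioms_def group_free_group group_hgrp ev_hom)

lemma set_nfw: "set (nfw x) <= three \<times> UNIV"
proof -
 have "set (nfw (L, g)) <= three \<times> UNIV" for L g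
 proof (induction L arbitrary: g)
  case Nil show ?case using set_emb_three[of "letters g"] by (auto simp: nfw_def)
 next
  case (Cons ce L)
  thus ?case using set_emb_three[of "letters g"] by (cases ce) (auto simp: nfw_Cons three_def)
 qed
 thus ?thesis by (cases x) simp
qed

lemma ev_surj: "ev ` carrier (free_group three)=V"
proof
 show "V <= ev ` carrier (free_group three)"
 proof
  fix x assume x: "x:V"
  let ?w = "foldr push (nfw x) []"
  have "ev ?w=x" using x by (simp add: ev_def wact_foldr_push wact_nfw_one)
  moreover have "?w:carrier (free_group three)"
   using set_foldr_push[of "nfw x" "[]"] set_nfw[of x]
   by (auto simp: free_group_def reduced_foldr_push)
  ultimately show "x:ev ` carrier (free_group three)" by force
 qed
qed (auto simp: ev_def)

text \<open>In every group that satisfies the relation, evaluation of normal forms is compatible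
  with right multiplication by letters. Hence a word that acts trivially on states is trivial in
  every such group, in particular in the one-relator group. This is the substantial inclusion in
  \<open>kernel_ev\<close>.\<close>

lemma wm_nfw_lact:
 fixes Q (structure)
 assumes "word_map Q q" and rel: "word_map.wm Q q relator=\<one>" and x: "x:V" and l: "fst l:three"
 shows "word_map.wm Q q (nfw (lact l x))=word_map.wm Q q (nfw x) \<otimes> q l"
proof -
 interpret word_map Q q by fact
 define p where "p g=wm (emb (letters g))" for g
 have pc [simp]: "p g:carrier Q" for g by (simp add: p_def)
 have p_add: "p (g + h)=p g \<otimes> p h" for g h
  by (simp add: p_def letters_plus emb_foldr_push wm_foldr_push)
 have p_0 [simp]: "p 0=\<one>" by (simp add: p_def)
 have p_minus: "p (- g)=inv (p g)" for g
  by (simp add: p_def letters_uminus emb_inv_word wm_inv_word)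
 let ?t = "%e. q (2, e)"
 have t_inv: "?t (~e)=inv (?t e)" for e using q_inv[of "(2, e)"] by (simp add: inv_letter_def)
 have comm: "p (u e) \<otimes> ?t e=?t e \<otimes> p (u (~e))" for e
 proof -
  have "p (u True) \<otimes> (?t True \<otimes> (inv (p (u False)) \<otimes> inv (?t True)))=\<one>"
   using rel t_inv[of True] by (simp add: relator_def wm_append p_minus flip: p_def)
  hence "(p (u True) \<otimes> ?t True) \<otimes> inv (?t True \<otimes> p (u False))=\<one>"
   by (simp add: m_assoc inv_mult_group)
  hence 1: "p (u True) \<otimes> ?t True=?t True \<otimes> p (u False)"
   by (metis inv_closed inv_equality inv_inv m_closed pc q_closed)
  show ?thesis
  proof (cases e)
   case False
   have "inv (?t True) \<otimes> (p (u True) \<otimes> ?t True) \<otimes> inv (?t True)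
     = inv (?t True) \<otimes> (?t True \<otimes> p (u False)) \<otimes> inv (?t True)" by (simp only: 1)
   hence "inv (?t True) \<otimes> p (u True)=p (u False) \<otimes> inv (?t True)"
    by (simp add: m_assoc) (simp flip: m_assoc)
   thus ?thesis using False t_inv[of True] by simp
  qed (use 1 in simp)
 qed
 have shift: "p (gpow (u e) n) \<otimes> ?t e=?t e \<otimes> p (gpow (u (~e)) n)" for e n
 proof (induction n rule: int_induct[where k = 0])
  case (step1 i)
  have "p (gpow (u e) (i + 1)) \<otimes> ?t e=p (gpow (u e) i) \<otimes> (?t e \<otimes> p (u (~e)))"
   by (simp add: gpow_Suc p_add m_assoc comm)
  also have "... = ?t e \<otimes> p (gpow (u (~e)) (i + 1))"
   using step1 by (simp add: gpow_Suc p_add flip: m_assoc)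
  finally show ?case .
 next
  case (step2 i)
  have c': "inv (p (u e)) \<otimes> ?t e=?t e \<otimes> inv (p (u (~e)))"
  proof -
   have "inv (p (u e)) \<otimes> ?t e \<otimes> p (u (~e))=inv (p (u e)) \<otimes> (p (u e) \<otimes> ?t e)"
    by (simp add: m_assoc comm)
   also have "... = ?t e" by (simp flip: m_assoc)
   finally show ?thesis by (metis inv_closed inv_solve_right m_closed pc q_closed)
  qed
  have "p (gpow (u e) (i - 1)) \<otimes> ?t e=p (gpow (u e) i) \<otimes> (?t e \<otimes> inv (p (u (~e))))"
   using p_add[of _ "- u e"] by (simp add: gpow_pred p_minus m_assoc c')
  also have "... = ?t e \<otimes> p (gpow (u (~e)) (i - 1))"
   using step2 p_add[of _ "- u (~e)"] by (simp add: gpow_pred p_minus flip: m_assoc)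
  finally show ?case .
 qed simp
 have nf: "wm (nfw (L, g))=wm (nfw (L, 0)) \<otimes> p g" for L g
  by (simp add: nfw_def wm_append p_def)
 have nfC: "wm (nfw ((c, e) # L, g))=wm (nfw (L, 0)) \<otimes> p c \<otimes> ?t e \<otimes> p g" for c e L g
  using nf[of L c] by (simp add: nfw_Cons wm_append p_def m_assoc)
 obtain L g where xe: "x=(L, g)" by fastforce
 show ?thesis
 proof (cases "fst l=2")
  case False
  hence "fst l=0 | fst l=1" using l by (auto simp: three_def)
  hence "p (gen (fst l=1, snd l))=q l" by (cases l) (auto simp: p_def)
  thus ?thesis using False nf[of L "g + gen (fst l=1, snd l)"] nf[of L g]
   by (simp add: lact_def xe p_add m_assoc)
 next
  case True
  then obtain e where le: "l=(2, e)" by (cases l) auto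
  let ?n = "ex e g" and ?h = "gpow (u (~e)) (ex e g)"
  have g: "g=rep e g + gpow (u e) ?n" by (rule rep_ex)
  have "wm (nfw x) \<otimes> ?t e=wm (nfw (L, 0)) \<otimes> p (rep e g) \<otimes> (p (gpow (u e) ?n) \<otimes> ?t e)"
   using nf[of L g] p_add[of "rep e g" "gpow (u e) ?n"] g by (simp add: xe m_assoc)
  also have "... = wm (nfw (L, 0)) \<otimes> p (rep e g) \<otimes> ?t e \<otimes> p ?h"
   by (simp add: shift m_assoc)
  finally have 1: "wm (nfw x) \<otimes> ?t e=wm (nfw (L, 0)) \<otimes> p (rep e g) \<otimes> ?t e \<otimes> p ?h" .
  show ?thesis
  proof (cases "rep e g=0 & L ~= [] & snd (hd L)=(~e)")
   case False
   hence "tact e x=((rep e g, e) # L, ?h)" by (auto simp: xe tact_def Let_def)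
   thus ?thesis using 1 by (simp add: le lact_def nfC)
  next
   case True
   then obtain c L' where L: "L=(c, ~e) # L'" by (cases L) auto
   have "tact e x=(L', c + ?h)" using True by (simp add: xe tact_def L)
   moreover have "wm (nfw (L, 0)) \<otimes> ?t e=wm (nfw (L', 0)) \<otimes> p c"
    unfolding L nfC using t_inv[of e] by (simp add: m_assoc)
   ultimately show ?thesis using 1 True nf[of L' "c + ?h"]
    by (simp add: le lact_def p_add m_assoc)
  qed
 qed
qed

lemma kernel_ev: "kernel (free_group three) hgrp ev=normal_closure (free_group three) {relator}"
 (is "?K=?N")
proof
 let ?F = "free_group three"
 interpret F: group ?F by (rule group_free_group)
 interpret e: group_hom ?F hgrp ev by (rule group_hom_ev)
 let ?R = "{g \<otimes>\<^bsub>?F\<^esub> h \<otimes>\<^bsub>?F\<^esub> inv\<^bsub>?F\<^esub> g | g h. g:carrier ?F & h:{relator}}"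
 have R: "?R <= carrier ?F" using relator_carrier F.m_closed F.inv_closed by blast
 have "ev relator = one_V" by (simp add: ev_def)
 hence "?R <= ?K"
  using relator_carrier e.H.r_inv[OF e.hom_closed] by (auto simp: kernel_def mul_V)
 thus "?N <= ?K"
  unfolding normal_closure_def by (intro F.generate_subgroup_incl e.subgroup_kernel)
 have sub: "subgroup ?N ?F" unfolding normal_closure_def by (rule F.generate_is_subgroup[OF R])
 have nrm: "?N \<lhd> ?F"
  unfolding normal_closure_def
 proof (rule F.normal_generateI[OF R])
  fix h g assume "h:?R" and g: "g:carrier ?F"
  then obtain x where x: "x:carrier ?F" "h=x \<otimes>\<^bsub>?F\<^esub> relator \<otimes>\<^bsub>?F\<^esub> inv\<^bsub>?F\<^esub> x" by blast
  have "g \<otimes>\<^bsub>?F\<^esub> h \<otimes>\<^bsub>?F\<^esub> inv\<^bsub>?F\<^esub> g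
    = (g \<otimes>\<^bsub>?F\<^esub> x) \<otimes>\<^bsub>?F\<^esub> relator \<otimes>\<^bsub>?F\<^esub> inv\<^bsub>?F\<^esub> (g \<otimes>\<^bsub>?F\<^esub> x)"
   using x g relator_carrier by (simp add: F.m_assoc F.inv_mult_group)
  thus "g \<otimes>\<^bsub>?F\<^esub> h \<otimes>\<^bsub>?F\<^esub> inv\<^bsub>?F\<^esub> g:?R" using g x by blast
 qed
 interpret N: normal ?N ?F by (rule nrm)
 let ?Q = "?F Mod ?N"
 interpret Q: group ?Q by (rule N.factorgroup_is_group)
 define vt where "vt w=?N #>\<^bsub>?F\<^esub> w" for w
 have vt_hom: "vt:hom ?F ?Q" unfolding vt_def using N.r_coset_hom_Mod by simp
 interpret vt: group_hom ?F ?Q vt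
  by (simp add: group_hom_def group_hom_axioms_def vt_hom F.is_group Q.is_group)
 have letter: "[l]:carrier ?F" if "fst l:three" for l
  using that by (cases l) (auto simp: free_group_def reduced_def)
 define q where "q l=(if fst l:three then vt [l] else \<one>\<^bsub>?Q\<^esub>)" for l
 have linv: "[inv_letter l]=inv\<^bsub>?F\<^esub> [l]" if "fst l:three" for l
 proof (rule F.inv_equality[symmetric])
  show "[inv_letter l] \<otimes>\<^bsub>?F\<^esub> [l]=\<one>\<^bsub>?F\<^esub>" by (simp add: free_group_def push_def)
  show "[l]:carrier ?F" "[inv_letter l]:carrier ?F"
   using letter[OF that] letter[of "inv_letter l"] that by (auto simp: inv_letter_def)
 qed
 have wmap: "word_map ?Q q"
 proof (intro word_map.intro word_map_axioms.intro Q.is_group)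
  fix l :: "nat \<times> bool"
  show "q l:carrier ?Q"
   using letter[of l] vt.hom_closed[of "[l]"] Q.one_closed unfolding q_def by presburger
  have f: "fst (inv_letter l)=fst l" by (simp add: inv_letter_def)
  show "q (inv_letter l)=inv\<^bsub>?Q\<^esub> q l"
   unfolding q_def f using linv[of l] letter[of l] vt.hom_inv[of "[l]"] Q.inv_one by presburger
 qed
 interpret W: word_map ?Q q by (rule wmap)
 have wm_red: "W.wm w=vt w" if "w:carrier ?F" for w
  using that
 proof (induction w)
  case Nil
  have "[]=\<one>\<^bsub>?F\<^esub>" by (simp add: free_group_def)
  thus ?case using vt.hom_one by (metis W.wm_simps(1))
 next
  case (Cons l w)
  hence w: "w:carrier ?F" "fst l:three" by (auto simp: free_group_def reduced_Cons)
  have "[l] \<otimes>\<^bsub>?F\<^esub> w=l # w"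
   using Cons.prems foldr_push_Nil[of "l # w"] foldr_push_Nil[of w] by (simp add: free_group_def reduced_Cons)
  hence "vt (l # w)=vt [l] \<otimes>\<^bsub>?Q\<^esub> vt w" using vt.hom_mult[of "[l]" w] letter w by simp
  moreover have "q l=vt [l]" using w by (simp add: q_def)
  ultimately show ?case using Cons.IH[OF w(1)] W.wm_simps(2)[of l w] by presburger
 qed
 have "vt relator=\<one>\<^bsub>?Q\<^esub>"
 proof -
  have "\<one>\<^bsub>?F\<^esub> \<otimes>\<^bsub>?F\<^esub> relator \<otimes>\<^bsub>?F\<^esub> inv\<^bsub>?F\<^esub> \<one>\<^bsub>?F\<^esub> : ?N"
   unfolding normal_closure_def by (rule generate.incl) blast
  thus ?thesis
   using relator_carrier F.coset_join2[OF _ sub] by (simp add: vt_def FactGroup_def)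
 qed
 hence relW: "W.wm relator=\<one>\<^bsub>?Q\<^esub>" using wm_red[OF relator_carrier] by simp
 show "?K <= ?N"
 proof
  fix w assume "w:?K"
  hence w: "w:carrier ?F" "wact w one_V = one_V" by (auto simp: kernel_def ev_def)
  have ws: "set w <= three \<times> UNIV" using w by (simp add: free_group_def)
  \<comment> \<open>Reading \<open>v\<close> letter by letter moves the normal form and its value in
    the quotient together; a normal form that returns to \<open>one_V\<close> brings the value back
    to the identity.\<close>
  have "W.wm (nfw (wact v x))=W.wm (nfw x) \<otimes>\<^bsub>?Q\<^esub> W.wm v"
   if "x:V" "set v <= three \<times> UNIV" for v x
   using that
  proof (induction v arbitrary: x)
   case (Cons l v)
   have "fst l:three" using Cons.prems by auto
   hence "W.wm (nfw (wact (l # v) x))=(W.wm (nfw x) \<otimes>\<^bsub>?Q\<^esub> q l) \<otimes>\<^bsub>?Q\<^esub> W.wm v"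
    using Cons.IH[of "lact l x"] Cons.prems wm_nfw_lact[OF wmap relW Cons.prems(1)] by simp
   thus ?case
    using Q.m_assoc[OF W.wm_closed W.q_closed W.wm_closed] W.wm_simps(2) by presburger
  next
   case Nil
   show ?case using Q.r_one[OF W.wm_closed] by (metis W.wm_simps(1) wact_simps(1))
  qed
  from this[of one_V w, OF one_in_V ws] have "\<one>\<^bsub>?Q\<^esub>=\<one>\<^bsub>?Q\<^esub> \<otimes>\<^bsub>?Q\<^esub> W.wm w"
   unfolding w(2) nfw_one W.wm_simps(1) .
  hence "W.wm w=\<one>\<^bsub>?Q\<^esub>" using Q.l_one[OF W.wm_closed] by metis
  hence "?N #>\<^bsub>?F\<^esub> w=?N" using wm_red w by (simp add: vt_def FactGroup_def)
  thus "w:?N" using F.coset_join1[OF _ w(1) sub] by simp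
 qed
qed

lemma one_relator_group_iso: "one_relator_group three relator \<cong> hgrp"
 using group_hom.FactGroup_iso[OF group_hom_ev] ev_surj
 by (simp add: one_relator_group_def kernel_ev)

end

section \<open>Extending maps over higher cells\<close>

lemma tsp_nS:
 "tsp (nS n)={x. (SUM i<=n. x i ^ 2)=1 & (ALL i>n. x i=0)}"
 by (simp add: nsphere)

lemma tsp_ndisc:
 "tsp (ndisc n)={x. (SUM i<n. x i ^ 2) <= 1 & (ALL i>=n. x i=0)}"
 by (auto simp: ndisc_def topspace_Euclidean_space)

lemma ndisc_alt:
 "ndisc n=subt (powertop_real UNIV) {x. (SUM i<n. x i ^ 2) <= 1 & (ALL i>=n. x i=0)}"
 by (simp add: ndisc_def Euclidean_space_def subtopology_subtopology Collect_conj_eq Int_commute)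

lemma compact_space_nsphere: "compact_space (nS n)"
proof -
 let ?X = "powertop_real (UNIV :: nat set)"
 let ?S = "{x :: nat => real. (SUM i<=n. x i ^ 2)=1 & (ALL i>n. x i=0)}"
 have proj: "cmap ?X eur (%x. x i)" for i
  by (rule continuous_map_product_projection) auto
 have "compactin ?X (PiE UNIV (%_. {-1..1}))"
  by (simp add: compactin_PiE)
 moreover have "?S <= PiE UNIV (%_. {-1..1})"
 proof clarify
  fix x :: "nat => real" assume x: "(SUM i<=n. x i ^ 2)=1" "ALL i>n. x i=0"
  have "\<bar>x i\<bar> <= 1" for i
  proof (cases "i <= n")
   case True
   hence "x i ^ 2 <= (SUM i<=n. x i ^ 2)" by (intro member_le_sum) auto
   thus ?thesis using x by (simp add: abs_square_le_1)
  qed (use x in auto)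
  thus "x:PiE UNIV (%_. {-1..1})" by (auto simp: abs_le_iff)
 qed
 moreover have "closedin ?X ?S"
 proof -
  have "cmap ?X eur (%x. SUM i<=n. x i ^ 2)"
   by (intro continuous_map_sum continuous_map_real_pow proj) auto
  hence "closedin ?X {x:tsp ?X. (SUM i<=n. x i ^ 2):{1}}"
   by (rule closed_pre) auto
  moreover have "closedin ?X {x:tsp ?X. x i:{0}}" for i
   by (rule closed_pre[OF proj]) auto
  hence "closedin ?X (tsp (Euclidean_space (Suc n)))"
   using closedin_Euclidean_space by blast
  ultimately have "closedin ?X ({x:tsp ?X. (SUM i<=n. x i ^ 2):{1}} Int
    tsp (Euclidean_space (Suc n)))" by blast
  moreover have "{x:tsp ?X. (SUM i<=n. x i ^ 2):{1}} Int tsp (Euclidean_space (Suc n))=?S"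
   by (auto simp: topspace_Euclidean_space Suc_le_eq)
  ultimately show ?thesis by simp
 qed
 ultimately have "compactin ?X ?S" by (rule closed_compactin)
 thus ?thesis by (simp add: nsphere cpt_sub)
qed

lemma Hausdorff_space_ndisc: "Hausdorff_space (ndisc n)"
 by (simp add: ndisc_alt Hausdorff_space_subtopology Hausdorff_space_product_topology)

text \<open>A null-homotopy is a map on the cylinder over \<open>B\<close> that is constant on the
  end t = 1. By compactness \<open>q\<close> is a quotient map, and as it identifies points at most
  on that end, the homotopy descends to \<open>D\<close>. Used for discs and for triangles.\<close>

lemma cone_extension:
 assumes q: "cmap (prodt I01 B) D q"
  and surj: "q ` ({0..1} \<times> tsp B)=tsp D"
  and "compact_space B" "Hausdorff_space D"
  and inj: "!!t x s y. [|t:{0..1}; s:{0..1}; x:tsp B; y:tsp B; q (t, x)=q (s, y)|]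
   ==> t=s & (x=y | t=1)"
  and hom: "homotopic_with (%_. True) B Z f (%_. c)"
 obtains g where "cmap D Z g" and "!!x. x:tsp B ==> g (q (0, x))=f x"
proof -
 let ?C = "prodt I01 B"
 obtain h where h: "cmap ?C Z h" "!!x. h (0, x)=f x" "!!x. h (1, x)=c"
  using hom unfolding homotopic_with_def by blast
 have "compact_space ?C"
  using assms(3) by (simp add: compact_space_prod_topology cpt_sub)
 hence "quotient_map ?C D q"
  using continuous_closed_imp_quotient_map[OF q] continuous_imp_closed_map[OF q _ assms(4)] surj
  by simp
 moreover have "h p=h p'" if p: "p:tsp ?C" "p':tsp ?C" and eq: "q p=q p'" for p p'
  using inj[of "fst p" "fst p'" "snd p" "snd p'"] that h(3) by (cases p; cases p') auto
 ultimately obtain g where "cmap D Z g" "!!p. p:tsp ?C ==> g (q p)=h p"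
  using quotient_map_lift_exists[of ?C D q Z h] h(1) by metis
 thus ?thesis using that h(2) by auto
qed

text \<open>Polar coordinates with radius 1 - t present the disc as a cone over the sphere.\<close>

lemma nullhomotopic_extends_to_disc:
 assumes "homotopic_with (%_. True) (nS n) Z f (%_. c)"
 obtains g where "cmap (ndisc (Suc n)) Z g"
  and "!!x. x:tsp (nS n) ==> g x=f x"
proof -
 let ?I = "I01"
 let ?C = "prodt ?I (nS n)"
 define q :: "real \<times> (nat => real) => nat => real" where "q=(%(t, x) i. (1 - t) * x i)"
 have sq: "(SUM i<=n. q (t, x) i ^ 2)=(1 - t) ^ 2" if "x:tsp (nS n)" for t x
  using that by (simp add: q_def power_mult_distrib tsp_nS flip: sum_distrib_left)
 have im: "q p:tsp (ndisc (Suc n))" if "p:tsp ?C" for p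
 proof -
  obtain t x where p: "p=(t, x)" by fastforce
  hence tx: "0 <= t" "t <= 1" "x:tsp (nS n)" using that by auto
  hence "(1 - t)\<^sup>2 <= 1" by (simp add: power_le_one)
  thus ?thesis
   using p tx sq[OF tx(3), of t] by (auto simp: tsp_ndisc lessThan_Suc_atMost q_def tsp_nS)
 qed
 have cont: "cmap ?C (ndisc (Suc n)) q"
 proof -
  have "cmap ?C eur (%p. q p i)" for i
  proof -
   have "cmap ?C eur (%p. (1 - fst p) * snd p i)"
   proof (intro continuous_map_real_mult continuous_map_diff)
    show "cmap ?C eur (%p. snd p i)"
     using cmo[OF continuous_map_snd continuous_map_nsphere_projection, of ?I n i]
     by (simp add: o_def)
    show "cmap ?C eur fst"
     using cm_full[OF continuous_map_fst] by fastforce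
   qed auto
   thus ?thesis by (simp add: q_def case_prod_beta')
  qed
  hence "cmap ?C (powertop_real UNIV) q"
   by (simp add: cm_comp)
  thus ?thesis
   using im unfolding ndisc_alt
   by (auto simp: cm_into tsp_ndisc simp flip: ndisc_alt)
 qed
 have surj: "q ` tsp ?C=tsp (ndisc (Suc n))"
 proof (intro equalityI subsetI)
  fix y assume y: "y:tsp (ndisc (Suc n))"
  define r where "r=sqrt (SUM i<=n. y i ^ 2)"
  have r: "0 <= r" "r <= 1" "r\<^sup>2=(SUM i<=n. y i ^ 2)"
   using y by (auto simp: r_def tsp_ndisc lessThan_Suc_atMost sum_nonneg)
  show "y:q ` tsp ?C"
  proof (cases "r=0")
   case True
   hence "y i=0" for i
    using y r by (cases "i <= n") (auto simp: tsp_ndisc sum_nonneg_eq_0_iff)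
   hence "y=q (1, %n. if n=0 then 1 else 0)" by (auto simp: q_def)
   thus ?thesis using in_topspace_nsphere[of n] by (intro image_eqI) auto
  next
   case False
   have "(%i. y i / r):tsp (nS n)"
    using False r y by (auto simp: tsp_nS tsp_ndisc power_divide simp flip: sum_divide_distrib)
   moreover have "y=q (1 - r, %i. y i / r)" using False by (auto simp: q_def)
   ultimately show ?thesis using r by (intro image_eqI) auto
  qed
 qed (use im in auto)
 have inj: "t=s & (x=y | t=1)"
  if "t:{0..1}" "s:{0..1}" "x:tsp (nS n)" "y:tsp (nS n)" "q (t, x)=q (s, y)"
  for t s x y
 proof -
  have "(1 - t)\<^sup>2=(1 - s)\<^sup>2" using sq[of x t] sq[of y s] that by simp
  hence t: "t=s" using that by (auto simp: power2_eq_iff)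
  show ?thesis
  proof (cases "t=1")
   case False
   hence "x i=y i" for i using fun_cong[OF that(5), of i] t by (auto simp: q_def)
   thus ?thesis using t by auto
  qed (use t in simp)
 qed
 have surj': "q ` ({0..1} \<times> tsp (nS n))=tsp (ndisc (Suc n))" using surj by simp
 show ?thesis
 proof (rule cone_extension[OF cont surj' compact_space_nsphere Hausdorff_space_ndisc inj assms])
  fix g assume "cmap (ndisc (Suc n)) Z g"
   and g: "!!x. x:tsp (nS n) ==> g (q (0, x))=f x"
  moreover have "g x=f x" if "x:tsp (nS n)" for x using g[OF that] by (simp add: q_def)
  ultimately show ?thesis using that by blast
 qed
qed

lemma topspace_glue:
 assumes "!!ph. ph:Ph ==> cmap (nS (n - 1)) A ph" and "n > 0"
  and "!!ph x. ph:Ph ==> x:odisc n ==> ph x ~: tsp A"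
 shows "tsp (glue A n Ph)=tsp A Un (UN ph:Ph. ph ` tsp (ndisc n))"
proof -
 have "openin (glue A n Ph) (tsp A Un (UN ph:Ph. ph ` tsp (ndisc n)))"
  unfolding openin_glue
 proof (intro conjI ballI)
  fix ph assume "ph:Ph"
  hence "{x:tsp (ndisc n). ph x:tsp A Un (UN ph:Ph. ph ` tsp (ndisc n))}=tsp (ndisc n)"
   by auto
  thus "openin (ndisc n) {x:tsp (ndisc n). ph x:tsp A Un (UN ph:Ph. ph ` tsp (ndisc n))}"
   by simp
 next
  show "openin A ((tsp A Un (UN ph:Ph. ph ` tsp (ndisc n))) Int tsp A)"
   by (simp add: Int_absorb1 Un_Int_distrib2 inf_sup_absorb Int_commute)
 qed auto
 hence "tsp A Un (UN ph:Ph. ph ` tsp (ndisc n)) <= tsp (glue A n Ph)"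
  by (rule openin_subset)
 moreover have "tsp (glue A n Ph) <= tsp A Un (UN ph:Ph. ph ` tsp (ndisc n))"
  using openin_topspace[of "glue A n Ph"] unfolding openin_glue by blast
 ultimately show ?thesis by blast
qed

lemma disc_boundary:
 "n > 0 ==> x:tsp (ndisc n) ==> x ~: odisc n ==> x:tsp (nS (n - 1))"
 by (cases n) (auto simp: tsp_ndisc open_disc_def tsp_nS lessThan_Suc_atMost)

lemma attaches_cells_subset:
 assumes "attaches_cells n A B" and "n > 0"
 shows "tsp A <= tsp B"
proof -
 obtain Ph where B: "B=glue A n Ph" and Ph: "ALL ph:Ph. cmap (nS (n - 1)) A ph"
  and new: "ALL ph:Ph. ALL x:odisc n. ph x ~: tsp A"
  using assms(1) unfolding attaches_cells_def by metis
 have "tsp B=tsp A Un (UN ph:Ph. ph ` tsp (ndisc n))"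
  unfolding B by (rule topspace_glue) (use Ph new \<open>n > 0\<close> in auto)
 thus ?thesis by simp
qed

text \<open>In \<open>Z\<close> every attaching map becomes null-homotopic, so the composite extends
  over each disc separately.\<close>

lemma extend_over_cells:
 assumes "attaches_cells n A B" and "n > 0" and f: "cmap A Z f"
  and null: "!!u. cmap (nS (n - 1)) Z u ==>
   EX c. homotopic_with (%_. True) (nS (n - 1)) Z u (%_. c)"
 obtains g where "cmap B Z g" and "!!x. x:tsp A ==> g x=f x"
proof -
 let ?D = "tsp (ndisc n)"
 obtain Ph where B: "B=glue A n Ph"
  and Ph: "!!ph. ph:Ph ==> cmap (nS (n - 1)) A ph"
  and inj: "inj_on (%(ph, x). ph x) (Ph \<times> odisc n)"
  and new: "!!ph x. ph:Ph ==> x:odisc n ==> ph x ~: tsp A"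
  using assms(1) unfolding attaches_cells_def by blast
 have top: "tsp B=tsp A Un (UN ph:Ph. ph ` ?D)"
  unfolding B by (rule topspace_glue) (use Ph new \<open>n > 0\<close> in auto)
 have "EX e. cmap (ndisc n) Z e & (ALL x:tsp (nS (n - 1)). e x=f (ph x))"
  if ph: "ph:Ph" for ph
 proof -
  obtain c where "homotopic_with (%_. True) (nS (n - 1)) Z (f o ph) (%_. c)"
   using null[OF cmo[OF Ph[OF ph] f]] by blast
  from nullhomotopic_extends_to_disc[OF this] obtain e where
    "cmap (ndisc (Suc (n - 1))) Z e" "!!x. x:tsp (nS (n - 1)) ==> e x=(f o ph) x"
   by blast
  thus ?thesis using \<open>n > 0\<close> by (intro exI[of _ e]) auto
 qed
 then obtain e where e: "!!ph. ph:Ph ==> cmap (ndisc n) Z (e ph)"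
  "!!ph x. ph:Ph ==> x:tsp (nS (n - 1)) ==> e ph x=f (ph x)"
  by metis
 \<comment> \<open>A point outside \<open>A\<close> lies in exactly one open cell, with unique
   coordinates there, so the choice of the pair is forced.\<close>
 define g where "g y=(if y:tsp A then f y
  else case (SOME p. p:Ph \<times> odisc n & y=fst p (snd p)) of (ph, x) => e ph x)" for y
 have gA: "g y=f y" if "y:tsp A" for y using that by (simp add: g_def)
 have gD: "g (ph x)=e ph x" if "ph:Ph" "x:?D" for ph x
 proof (cases "x:odisc n")
  case True
  have "(SOME p. p:Ph \<times> odisc n & ph x=fst p (snd p))=(ph, x)"
   using inj that True by (intro some_equality) (auto simp: inj_on_def)
  thus ?thesis using new[OF that(1) True] by (simp add: g_def)
 next
  case False
  hence "x:tsp (nS (n - 1))" using disc_boundary that \<open>n > 0\<close> by blast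
  thus ?thesis using e(2) Ph[OF that(1)] that gA by (auto simp: continuous_map_def)
 qed
 have "cmap B Z g"
  unfolding continuous_map_def
 proof (intro conjI allI impI)
  show "g:tsp B \<rightarrow> tsp Z"
  proof
   fix y assume "y:tsp B"
   then consider "y:tsp A" | ph x where "ph:Ph" "x:?D" "y=ph x" unfolding top by blast
   thus "g y:tsp Z"
   proof cases
    case 1 thus ?thesis using gA f by (auto simp: continuous_map_def)
   next
    case 2 thus ?thesis using gD e(1)[of ph] by (auto simp: continuous_map_def)
   qed
  qed
 next
  fix U assume U: "openin Z U"
  let ?V = "{y:tsp B. g y:U}"
  have "?V Int tsp A={y:tsp A. f y:U}" using gA top by auto
  moreover have "{x:?D. ph x:?V}={x:?D. e ph x:U}" if "ph:Ph" for ph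
  proof -
   have "ph x:tsp B" if "x:?D" for x using that \<open>ph : Ph\<close> unfolding top by blast
   thus ?thesis using gD[OF \<open>ph : Ph\<close>] by auto
  qed
  ultimately show "openin B ?V"
   unfolding B openin_glue
   using open_pre[OF f U] open_pre[OF e(1) U] top B by auto
 qed
 thus ?thesis using gA that by blast
qed

text \<open>As \<open>P\<close> has no higher homotopy, its identity extends over the cells of
  dimension 3 and more, one skeleton after another. The resulting retraction makes seminorms
  independent of the choice of the classifying space.\<close>

lemma higher_cells_retraction:
 assumes "attaches_higher_cells P X"
  and null: "!!k u. k >= 2 ==> cmap (nS k) P u ==>
   EX c. homotopic_with (%_. True) (nS k) P u (%_. c)"
 obtains rh where "cmap X P rh" "!!x. x:tsp P ==> rh x=x" "cmap P X id"
proof -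
 obtain Y where Y: "Y 2=P" "!!n. n >= 3 ==> attaches_cells n (Y (n - 1)) (Y n)"
  and X: "!!U. openin X U \<longleftrightarrow>
    U <= (UN n:{2..}. tsp (Y n)) & (ALL n>=2. openin (Y n) (U Int tsp (Y n)))"
  using assms(1) unfolding attaches_higher_cells_def by blast
 define Z where "Z i=Y (i + 2)" for i
 have Zc: "attaches_cells (i + 3) (Z i) (Z (Suc i))" for i
  using Y(2)[of "i + 3"] by (simp add: Z_def eval_nat_numeral)
 have Z0: "Z 0=P" using Y(1) by (simp add: Z_def numeral_2_eq_2)
 have mono: "tsp (Z i) <= tsp (Z j)" if "i <= j" for i j
  using that by (induction j rule: dec_induct) (use attaches_cells_subset[OF Zc] in auto)
 have XZ: "openin X U \<longleftrightarrow> U <= (\<Union>i. tsp (Z i)) & (ALL i. openin (Z i) (U Int tsp (Z i)))" for U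
 proof -
  have "(UN n:{2..}. tsp (Y n))=(\<Union>i. tsp (Z i))"
  proof -
   have "{2..}=range (%i :: nat. i + 2)" by (auto simp: image_iff) presburger
   thus ?thesis by (simp add: Z_def image_image)
  qed
  moreover have "(ALL n>=2. openin (Y n) (U Int tsp (Y n))) \<longleftrightarrow> (ALL i. openin (Z i) (U Int tsp (Z i)))"
   unfolding Z_def by (metis le_add2 le_add_diff_inverse2)
  ultimately show ?thesis unfolding X by simp
 qed
 have topX: "tsp X=(\<Union>i. tsp (Z i))"
 proof
  have "(\<Union>i. tsp (Z i)) Int tsp (Z j)=tsp (Z j)" for j by auto
  hence "openin X (\<Union>i. tsp (Z i))" unfolding XZ by simp
  thus "(\<Union>i. tsp (Z i)) <= tsp X" by (rule openin_subset)
 qed (use openin_topspace[of X] XZ in blast)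
 \<comment> \<open>Dependent choice, as each extension starts from the previous one; the index i
   stands for dimension i + 2.\<close>
 have "EX f. f 0=id & (ALL i. cmap (Z i) P (f i) & (ALL x:tsp (Z i). f (Suc i) x=f i x))"
 proof -
  have "EX f. ALL i. (cmap (Z i) P (f i) & (i=0 --> f i=id)) & (ALL x:tsp (Z i). f (Suc i) x=f i x)"
  proof (rule dependent_nat_choice)
   show "EX f. cmap (Z 0) P f & (0=(0 :: nat) --> f=id)" by (auto simp: Z0)
   fix f i assume "cmap (Z i) P f & (i=0 --> f=id)"
   then obtain g where "cmap (Z (Suc i)) P g" "!!x. x:tsp (Z i) ==> g x=f x"
    using extend_over_cells[OF Zc[of i], of P f] null[of "i + 2"] by (auto simp: eval_nat_numeral)
   thus "EX g. (cmap (Z (Suc i)) P g & (Suc i=0 --> g=id)) & (ALL x:tsp (Z i). g x=f x)"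
    by auto
  qed
  thus ?thesis by blast
 qed
 then obtain f where f0: "f 0=id" and f: "!!i. cmap (Z i) P (f i)"
  and fS: "!!i x. x:tsp (Z i) ==> f (Suc i) x=f i x" by blast
 have fj: "f j x=f i x" if "i <= j" "x:tsp (Z i)" for i j x
  using that(1)
 proof (induction j rule: dec_induct)
  case (step n)
  thus ?case using that(2) mono[OF step(1)] fS[of x n] by auto
 qed simp
 define rh where "rh x=f (LEAST i. x:tsp (Z i)) x" for x
 have rh: "rh x=f i x" if "x:tsp (Z i)" for x i
  unfolding rh_def using fj[of _ i x] that by (metis LeastI Least_le)
 have "cmap X P rh"
  unfolding continuous_map_def
 proof (intro conjI allI impI)
  show "rh:tsp X \<rightarrow> tsp P"
   using rh cm_fun[OF f] by (fastforce simp: topX)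
  fix U assume U: "openin P U"
  have "{x:tsp X. rh x:U} Int tsp (Z i)={x:tsp (Z i). f i x:U}" for i
   using rh by (auto simp: topX)
  thus "openin X {x:tsp X. rh x:U}"
   unfolding XZ using open_pre[OF f U] topX by auto
 qed
 moreover have "rh x=x" if "x:tsp P" for x using rh[of x 0] that f0 Z0 by simp
 moreover have "cmap P X id"
  unfolding continuous_map_def
 proof (intro conjI allI impI)
  show "id:tsp P \<rightarrow> tsp X" using topX Z0 by auto
  fix U assume "openin X U"
  hence "openin P (U Int tsp P)" using XZ Z0 by metis
  thus "openin P {x:tsp P. id x:U}" by (simp add: Int_def conj_commute)
 qed
 ultimately show ?thesis using that by blast
qed

text \<open>Every stage may have an empty set of cells. Hence an aspherical presentation complex is
  a classifying extension of itself, and the choice in \<open>classifying_complex\<close> is made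
  from a nonempty collection.\<close>

lemma attaches_no_higher_cells: "attaches_higher_cells P P"
proof -
 have gl: "glue P n {}=P" for n
 proof -
  have "openin (glue P n {}) U = openin P U" for U
   using openin_subset[of P U] by (auto simp: openin_glue Int_absorb2)
  thus ?thesis by (simp add: topology_eq)
 qed
 have "attaches_cells n P P" for n
  unfolding attaches_cells_def by (intro exI[of _ "{}"]) (simp add: gl)
 moreover have "openin P U \<longleftrightarrow> U <= (UN n:{2::nat..}. tsp P) & (ALL n>=2::nat. openin P (U Int tsp P))" for U
  using openin_subset[of P U] by (auto simp: Int_absorb2)
 ultimately show ?thesis
  unfolding attaches_higher_cells_def by (intro exI[of _ "%_. P"]) blast
qed

section \<open>Real chains\<close>

abbreviation lookup where "lookup == Poly_Mapping.lookup"
abbreviation keys where "keys == Poly_Mapping.keys"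
abbreviation single where "single == Poly_Mapping.single"

text \<open>Common form of boundary, push-forward and evaluation. Additivity in the coefficient is
  the separate condition \<open>additive_family\<close>, because the norm has this form too without
  being additive.\<close>

definition lsum :: "('a => 'r::ab_group_add => 'b::ab_group_add) => ('a \<Rightarrow>\<^sub>0 'r) => 'b" where
 "lsum h c=(SUM si:keys c. h si (lookup c si))"

definition additive_family :: "('a => 'r::ab_group_add => 'b::ab_group_add) => bool" where
 "additive_family h \<longleftrightarrow> (ALL si a b. h si (a + b)=h si a + h si b)"

lemma additive_family_0: "additive_family h ==> h si 0=0"
 unfolding additive_family_def by (metis add_cancel_right_right)

lemma lsum_superset:
 "finite A ==> keys c <= A ==> (!!si. h si 0=0) ==> lsum h c=(SUM si:A. h si (lookup c si))"
 unfolding lsum_def by (rule sum.mono_neutral_left) (auto simp: in_keys_iff)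

lemma lsum_add:
 assumes "additive_family h" shows "lsum h (c + d)=lsum h c + lsum h d"
proof -
 let ?A = "keys c Un keys d"
 have 0: "!!si. h si 0=0" using additive_family_0[OF assms] .
 have "lsum h (c + d)=(SUM si:?A. h si (lookup (c + d) si))"
  by (rule lsum_superset) (use Poly_Mapping.keys_add[of c d] 0 in auto)
 moreover have "lsum h c=(SUM si:?A. h si (lookup c si))" "lsum h d=(SUM si:?A. h si (lookup d si))"
  by (rule lsum_superset; use 0 in auto)+
 ultimately show ?thesis
  using assms by (simp add: lookup_add additive_family_def sum.distrib)
qed

lemma lsum_0 [simp]: "lsum h 0=0"
 by (simp add: lsum_def)

lemma lsum_single: "additive_family h ==> lsum h (single si a)=h si a"
 by (auto simp: lsum_def additive_family_0)

lemma lsum_minus: "additive_family h ==> lsum h (- c) = - lsum h c"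
 using lsum_add[of h c "- c"] by (simp add: eq_neg_iff_add_eq_0 add.commute)

lemma lsum_diff: "additive_family h ==> lsum h (c - d)=lsum h c - lsum h d"
 using lsum_add[of h c "- d"] by (simp add: lsum_minus)

lemma lsum_sum: "additive_family h ==> lsum h (SUM i:I. c i)=(SUM i:I. lsum h (c i))"
 by (induction I rule: infinite_finite_induct) (simp_all add: lsum_add)

lemma poly_mapping_sum_single: "(c :: 'a \<Rightarrow>\<^sub>0 'r::ab_group_add)=lsum single c"
 by (rule poly_mapping_eqI) (auto simp: lsum_def lookup_sum lookup_single when_def in_keys_iff)

lemma additive_induct [case_names single add]:
 fixes c :: "'a \<Rightarrow>\<^sub>0 'r::ab_group_add"
 assumes "!!si a. si:keys c ==> P (single si a)" "!!x y. P x ==> P y ==> P (x + y)" "P 0"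
 shows "P c"
proof -
 have "P (SUM si:A. single si (lookup c si))" if "finite A" "A <= keys c" for A
  using that by (induction A rule: finite_induct) (auto intro: assms)
 from this[of "keys c"] show ?thesis using poly_mapping_sum_single[of c] by (simp add: lsum_def)
qed

lemma additive_family_single [simp]: "additive_family (%si. single (f si))"
 by (simp add: additive_family_def single_add)

lemma additive_family_mult [simp]: "additive_family (%si a. a * (ph si :: 'r::ring))"
 by (simp add: additive_family_def distrib_right)

definition bdf :: "nat => ((nat => real) => 'p) => real => 'p real_chain" where
 "bdf p si a=(SUM k<=p. single (sface p k si) ((-1) ^ k * a))"

lemma additive_family_bdf [simp]: "additive_family (bdf p)"
 by (simp add: additive_family_def bdf_def distrib_left single_add sum.distrib)

lemma real_boundary_lsum: "p > 0 ==> rbd p c=lsum (bdf p) c"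
 by (simp add: real_boundary_def lsum_def bdf_def)

lemma real_boundary_add: "rbd p (c + d)=rbd p c + rbd p d"
 by (cases "p=0") (simp add: real_boundary_def, simp add: real_boundary_lsum lsum_add)

lemma real_boundary_diff: "rbd p (c - d)=rbd p c - rbd p d"
 by (cases "p=0") (simp add: real_boundary_def, simp add: real_boundary_lsum lsum_diff)

lemma real_boundary_0 [simp]: "rbd p 0=0"
 by (simp add: real_boundary_def)

lemma l1_norm_nonneg [simp]: "0 <= l1_norm c"
 by (simp add: l1_norm_def sum_nonneg)

lemma l1_norm_lsum: "l1_norm c=lsum (%_ a. \<bar>a\<bar>) c"
 by (simp add: l1_norm_def lsum_def)

lemma l1_norm_single [simp]: "l1_norm (single si a)=\<bar>a\<bar>"
 by (simp add: l1_norm_def)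

lemma l1_norm_0 [simp]: "l1_norm 0=0"
 by (simp add: l1_norm_def)

lemma l1_norm_add: "l1_norm (c + d) <= l1_norm c + l1_norm d"
proof -
 let ?A = "keys c Un keys d"
 have "l1_norm (c + d)=(SUM si:?A. \<bar>lookup (c + d) si\<bar>)"
  unfolding l1_norm_lsum by (rule lsum_superset) (use Poly_Mapping.keys_add[of c d] in auto)
 also have "... <= (SUM si:?A. \<bar>lookup c si\<bar> + \<bar>lookup d si\<bar>)"
  by (rule sum_mono) (simp add: lookup_add abs_triangle_ineq)
 also have "... = l1_norm c + l1_norm d"
  unfolding l1_norm_lsum sum.distrib by (intro arg_cong2[where f = "(+)"] lsum_superset[symmetric]) auto
 finally show ?thesis .
qed

lemma l1_norm_sum: "l1_norm (SUM i:I. c i) <= (SUM i:I. l1_norm (c i))"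
 by (induction I rule: infinite_finite_induct) (auto intro: order_trans[OF l1_norm_add])

lemma l1_norm_lsum_single_le: "l1_norm (lsum (%si. single (f si)) c) <= l1_norm c"
 unfolding lsum_def by (rule order_trans[OF l1_norm_sum]) (simp only: l1_norm_single, simp add: l1_norm_def)

lemma singular_real_chain_add:
 "rchain p X c ==> rchain p X d ==> rchain p X (c + d)"
 unfolding singular_real_chain_def using Poly_Mapping.keys_add[of c d] by blast

lemma singular_real_chain_minus: "rchain p X c ==> rchain p X (- c)"
 by (simp add: singular_real_chain_def)

lemma singular_real_chain_diff:
 "rchain p X c ==> rchain p X d ==> rchain p X (c - d)"
 using singular_real_chain_add[of p X c "- d"] by (simp add: singular_real_chain_minus)

lemma singular_real_chain_0 [simp]: "rchain p X 0"
 by (simp add: singular_real_chain_def)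

section \<open>Push-forward, change of coefficients and seminorms\<close>

definition push_chain :: "nat => ('p => 'q) => 'p real_chain => 'q real_chain" where
 "push_chain p g=lsum (%si. single (smap p g si))"

lemma push_chain_add: "push_chain p g (c + d)=push_chain p g c + push_chain p g d"
 and push_chain_diff: "push_chain p g (c - d)=push_chain p g c - push_chain p g d"
 and push_chain_single: "push_chain p g (single si a)=single (smap p g si) a"
 by (simp_all add: push_chain_def lsum_add lsum_diff lsum_single)

lemma push_chain_norm: "l1_norm (push_chain p g c) <= l1_norm c"
 unfolding push_chain_def by (rule l1_norm_lsum_single_le)

lemma singular_real_chain_push:
 assumes "rchain p X c" "cmap X Y g"
 shows "rchain p Y (push_chain p g c)"
proof -
 have "keys (push_chain p g c) <= smap p g ` keys c"
  unfolding push_chain_def lsum_def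
  by (rule order_trans[OF keys_sum]) auto
 thus ?thesis
  using assms singular_simplex_simplex_map unfolding singular_real_chain_def by blast
qed

lemma singular_face_simplex_map':
 "k <= Suc p ==> sface (Suc p) k (smap (Suc p) g si)=smap p g (sface (Suc p) k si)"
 using simplical_face_in_standard_simplex[of "Suc p" k]
 by (auto simp: simplex_map_def singular_face_def restrict_def fun_eq_iff)

lemma push_chain_boundary:
 "rbd (Suc p) (push_chain (Suc p) g c)=push_chain p g (rbd (Suc p) c)"
proof (induction c rule: additive_induct)
 case (single si a)
 have "rbd (Suc p) (push_chain (Suc p) g (single si a)) =
   (SUM k<=Suc p. single (smap p g (sface (Suc p) k si)) ((-1) ^ k * a))"
  by (simp add: push_chain_single real_boundary_lsum lsum_single bdf_def singular_face_simplex_map' del: sum.atMost_Suc)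
 also have "... = push_chain p g (rbd (Suc p) (single si a))"
  by (simp add: real_boundary_lsum lsum_single bdf_def push_chain_def lsum_sum del: sum.atMost_Suc)
 finally show ?case .
qed (simp_all add: push_chain_add real_boundary_add, simp add: push_chain_def)

definition realc :: "'p chain => 'p real_chain" where
 "realc z=Poly_Mapping.map real_of_int z"

lemma lookup_realc [simp]: "lookup (realc z) si=real_of_int (lookup z si)"
 by (simp add: realc_def map.rep_eq when_def)

lemma keys_realc [simp]: "keys (realc z)=keys z"
 by (auto simp: in_keys_iff)

lemma realc_add: "realc (x + y)=realc x + realc y"
 and realc_diff: "realc (x - y)=realc x - realc y"
 and realc_0 [simp]: "realc 0=0"
 by (rule poly_mapping_eqI; simp add: lookup_add lookup_minus)+

lemma realc_single: "realc (single si n)=single si (real_of_int n)"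
 by (rule poly_mapping_eqI) (simp add: lookup_single when_def)

lemma realc_sum: "realc (SUM i:I. c i)=(SUM i:I. realc (c i))"
 by (induction I rule: infinite_finite_induct) (simp_all add: realc_add)

lemma singular_real_chain_realc [simp]: "rchain p X (realc z) \<longleftrightarrow> singular_chain p X z"
 by (simp add: singular_real_chain_def singular_chain_def)

lemma frag_cmul_single: "fcm n (frag_of si)=single si n"
 by (rule poly_mapping_eqI) (simp add: lookup_single when_def)

lemma frag_cmul_single': "fcm n (single si m)=single si (n * m)"
 by (rule poly_mapping_eqI) (simp add: lookup_single when_def)

lemma realc_chain_boundary: "realc (chain_boundary p z)=rbd p (realc z)"
proof (cases "p=0")
 case False
 show ?thesis
 proof (induction z rule: additive_induct)
  case (single si n)
  have "chain_boundary p (single si n)=fcm n (chain_boundary p (frag_of si))"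
   using chain_boundary_cmul[of p n "frag_of si"] frag_cmul_single[of n si] by metis
  also have "... = (SUM k<=p. fcm n (fcm ((-1) ^ k) (frag_of (sface p k si))))"
   using False by (simp add: chain_boundary_of frag_cmul_sum)
  also have "... = (SUM k<=p. single (sface p k si) ((-1) ^ k * n))"
   by (simp add: frag_cmul_single' mult.commute)
  finally show ?case
   using False by (simp add: realc_sum realc_single real_boundary_lsum lsum_single bdf_def)
 qed (simp_all add: chain_boundary_add realc_add real_boundary_add)
qed (simp add: real_boundary_def chain_boundary_def)

lemma realc_chain_map: "realc (chain_map p g z)=push_chain p g (realc z)"
proof (induction z rule: additive_induct)
 case (single si n)
 have "chain_map p g (single si n)=single (smap p g si) n"
  using chain_map_cmul[of p g n "frag_of si"] by (simp add: frag_cmul_single)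
 thus ?case by (simp add: realc_single push_chain_single)
qed (simp_all add: chain_map_add realc_add push_chain_add, simp add: push_chain_def)

lemma real_homology_class_eqI:
 assumes "c:rhc p X z"
 shows "rhc p X c=rhc p X z"
proof -
 obtain b where b: "rchain (Suc p) X b" "c - z=rbd (Suc p) b"
  using assms unfolding real_homology_class_def by blast
 have "(EX b. rchain (Suc p) X b & d - c=rbd (Suc p) b) \<longleftrightarrow>
   (EX b. rchain (Suc p) X b & d - z=rbd (Suc p) b)" for d
 proof
  assume "EX b. rchain (Suc p) X b & d - c=rbd (Suc p) b"
  then obtain b' where b': "rchain (Suc p) X b'" "d - c=rbd (Suc p) b'" by blast
  have "d - z=(d - c) + (c - z)" by simp
  also have "... = rbd (Suc p) (b' + b)" by (simp only: real_boundary_add b b')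
  finally show "EX b. rchain (Suc p) X b & d - z=rbd (Suc p) b"
   using b b' singular_real_chain_add by blast
 next
  assume "EX b. rchain (Suc p) X b & d - z=rbd (Suc p) b"
  then obtain b' where b': "rchain (Suc p) X b'" "d - z=rbd (Suc p) b'" by blast
  have "d - c=(d - z) - (c - z)" by simp
  also have "... = rbd (Suc p) (b' - b)" by (simp only: real_boundary_diff b b')
  finally show "EX b. rchain (Suc p) X b & d - c=rbd (Suc p) b"
   using b b' singular_real_chain_diff by blast
 qed
 thus ?thesis unfolding real_homology_class_def by blast
qed

lemma homologous_rel_empty:
 assumes "homologous_rel p X {} x y"
 shows "EX b. singular_chain (Suc p) X b & chain_boundary (Suc p) b=x - y"
 using assms by (simp add: homologous_rel_def singular_boundary)

text \<open>Integrally homologous chains stay homologous over the reals, so all sets in the union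
  defining \<open>change_of_coefficients\<close> are the same real class.\<close>

lemma change_of_coefficients_class:
 assumes "singular_chain p X z"
 shows "change_of_coefficients p X (hrel p X {} z)=rhc p X (realc z)"
proof -
 have cl: "rhc p X (realc y)=rhc p X (realc z)"
  if y: "homologous_rel p X {} z y" for y
 proof -
  obtain b where b: "singular_chain (Suc p) X b" "chain_boundary (Suc p) b=y - z"
   using homologous_rel_empty[of p X y z] y homologous_rel_sym by metis
  hence "y=z + chain_boundary (Suc p) b" by simp
  hence "singular_chain p X y"
   using b(1) assms singular_chain_boundary[of "Suc p" X b] by (simp add: singular_chain_add)
  moreover have "realc y - realc z=rbd (Suc p) (realc b)"
   using b(2) realc_chain_boundary[of "Suc p" b] by (simp add: realc_diff)
  ultimately have "realc y:rhc p X (realc z)"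
   using b(1) unfolding real_homology_class_def
   by (metis (mono_tags, lifting) mem_Collect_eq singular_real_chain_realc)
  thus ?thesis by (rule real_homology_class_eqI)
 qed
 have "(UN y:hrel p X {} z. rhc p X (realc y)) =
   (UN y:hrel p X {} z. rhc p X (realc z))"
 proof (rule SUP_cong[OF refl])
  fix y assume "y:hrel p X {} z"
  thus "rhc p X (realc y)=rhc p X (realc z)"
   using cl by blast
 qed
 moreover have "z:hrel p X {} z" by (simp add: homologous_rel_refl)
 hence "hrel p X {} z ~= {}" by blast
 ultimately show ?thesis
  unfolding change_of_coefficients_def realc_def[symmetric] by (simp only: UN_constant if_False)
qed

text \<open>Push-forward does not increase the norm of a chain and respects homologies.\<close>

lemma l1_seminorm_push_le:
 assumes "cmap X Y g" "z'=push_chain p g z" "rchain p X z"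
 shows "l1_seminorm (rhc p Y z') <= l1_seminorm (rhc p X z)"
 unfolding l1_seminorm_def
proof (rule cInf_mono)
 show "l1_norm ` rhc p X z ~= {}"
 proof -
  have "z - z=rbd (Suc p) 0" by simp
  hence "z:rhc p X z"
   using assms(3) singular_real_chain_0[of "Suc p" X] unfolding real_homology_class_def by blast
  thus ?thesis by blast
 qed
 show "bdd_below (l1_norm ` rhc p Y z')" by (rule bdd_belowI[of _ 0]) auto
 fix n assume "n:l1_norm ` rhc p X z"
 then obtain c b where c: "n=l1_norm c" "rchain p X c"
   "rchain (Suc p) X b" "c - z=rbd (Suc p) b"
  unfolding real_homology_class_def by blast
 have "push_chain p g c - z'=rbd (Suc p) (push_chain (Suc p) g b)"
  using c by (simp add: assms(2) push_chain_boundary flip: push_chain_diff)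
 hence "push_chain p g c:rhc p Y z'"
  using c assms(1) singular_real_chain_push unfolding real_homology_class_def by blast
 thus "EX a:l1_norm ` rhc p Y z'. a <= n"
  using push_chain_norm c(1) by blast
qed

lemma push_chain_id:
 assumes "rchain p X c" "!!x. x:tsp X ==> g x=x"
 shows "push_chain p g c=c"
proof -
 have "push_chain p g c=lsum single c"
  unfolding push_chain_def lsum_def
 proof (rule sum.cong)
  fix si assume "si:keys c"
  hence "ssimp p X si" using assms(1) by (auto simp: singular_real_chain_def)
  thus "single (smap p g si) (lookup c si)=single si (lookup c si)"
   using simplex_map_id_gen assms(2) by metis
 qed simp
 thus ?thesis using poly_mapping_sum_single by metis
qed

lemma push_chain_compose: "push_chain p h (push_chain p g c)=push_chain p (h o g) c"
proof (induction c rule: additive_induct)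
 case (single si a)
 have "smap p (h o g) si=smap p h (smap p g si)"
  by (simp only: simplex_map_compose o_apply)
 thus ?case unfolding push_chain_single by (rule arg_cong[OF sym])
qed (simp_all add: push_chain_add, simp add: push_chain_def)

text \<open>Neither inclusion nor retraction increases seminorms, and together they fix the chain
  \<open>z\<close> itself.\<close>

lemma l1_seminorm_retract:
 assumes "cmap X P rh" "!!x. x:tsp P ==> rh x=x" "cmap P X id"
  and z: "rchain p P z"
 shows "l1_seminorm (rhc p X (push_chain p id z))=l1_seminorm (rhc p P z)"
proof (rule antisym)
 show "l1_seminorm (rhc p X (push_chain p id z)) <= l1_seminorm (rhc p P z)"
  using l1_seminorm_push_le[OF assms(3) refl z] .
 have "push_chain p rh (push_chain p id z)=z"
  using push_chain_id[OF z, of "rh o id"] assms(2) by (simp add: push_chain_compose)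
 thus "l1_seminorm (rhc p P z) <= l1_seminorm (rhc p X (push_chain p id z))"
  using l1_seminorm_push_le[OF assms(1) _ singular_real_chain_push[OF z assms(3)], of z] by simp
qed

lemma l1_seminorm_fundamental:
 assumes "cmap X P rh" "!!x. x:tsp P ==> rh x=x" "cmap P X id"
  and z: "singular_relcycle p P {} z"
 shows "l1_seminorm (change_of_coefficients p X
   (hom_induced p P {} X {} id (hrel p P {} z)))=l1_seminorm (rhc p P (realc z))"
proof -
 have zc: "singular_chain p P z" using z by (simp add: singular_relcycle_def)
 have "hom_induced p P {} X {} id (hrel p P {} z)=hrel p X {} (chain_map p id z)"
  using hom_induced_chain_map[OF assms(3), of "{}" "{}" p z] z by simp
 moreover have "singular_chain p X (chain_map p id z)" using singular_chain_chain_map[OF zc assms(3)] .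
 ultimately show ?thesis
  using l1_seminorm_retract[OF assms(1-3), of p "realc z"] zc
  by (simp add: change_of_coefficients_class realc_chain_map)
qed

section \<open>Covering maps between abstract topological spaces\<close>

lemma continuous_map_union_closed:
 assumes "closedin X A" "closedin X B" "tsp X <= A Un B"
  and f: "cmap (subt X A) Y h" and g: "cmap (subt X B) Y h"
 shows "cmap X Y h"
 unfolding continuous_map_closedin
proof (intro conjI allI impI funcsetI)
 fix x assume "x:tsp X"
 hence "x:tsp (subt X A) | x:tsp (subt X B)"
  using assms(3) by auto
 thus "h x:tsp Y" using f g by (auto simp: continuous_map_def)
next
 fix C assume C: "closedin Y C"
 have "closedin X {x:tsp (subt X A). h x:C}"
    "closedin X {x:tsp (subt X B). h x:C}"
  using closed_pre[OF f C] closed_pre[OF g C]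
   closedin_trans_full assms(1,2) by blast+
 hence "closedin X ({x:tsp (subt X A). h x:C} Un {x:tsp (subt X B). h x:C})"
  by (rule closedin_Un)
 moreover have "... = {x:tsp X. h x:C}" using assms(3) by auto
 ultimately show "closedin X {x:tsp X. h x:C}" by simp
qed

text \<open>Evenly covered sets are described by their local sections: these have open images, reach
  every point above \<open>U\<close>, and coincide as soon as they agree at one point. In this form
  local lifts are compositions with a section.\<close>

definition sheets :: "'e topology => 'p topology => ('e => 'p) => 'p set => ('p => 'e) set => bool" where
 "sheets E P p U Sx \<longleftrightarrow> openin P U &
  (ALL s:Sx. cmap (subt P U) E s & (ALL u:U. p (s u)=u) & openin E (s ` U)) &
  (ALL e:tsp E. p e:U --> (EX s:Sx. s (p e)=e)) &
  (ALL s:Sx. ALL s':Sx. ALL u:U. s u=s' u --> s=s')"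

definition covers :: "'e topology => 'p topology => ('e => 'p) => bool" where
 "covers E P p \<longleftrightarrow> cmap E P p & (ALL y:tsp P. EX U Sx. y:U & sheets E P p U Sx)"

text \<open>Near a point both lifts stay on one sheet each, so the set of agreement and its
  complement are both open.\<close>

lemma lift_unique:
 assumes cov: "covers E P p" and X: "connected_space X"
  and g: "cmap X E g" and h: "cmap X E h"
  and pgh: "!!x. x:tsp X ==> p (g x)=p (h x)"
  and a: "a:tsp X" "g a=h a" and x: "x:tsp X"
 shows "g x=h x"
proof -
 let ?A = "{x:tsp X. g x=h x}" and ?B = "{x:tsp X. g x ~= h x}"
 have *: "EX W. openin X W & x:W & (if g x=h x then W <= ?A else W <= ?B)" if x: "x:tsp X" for x
 proof -
  have e: "g x:tsp E" "h x:tsp E" using x g h by (auto simp: continuous_map_def)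
  hence "p (g x):tsp P" using cov by (auto simp: covers_def continuous_map_def)
  then obtain U Sx where U: "p (g x):U" "sheets E P p U Sx" using cov unfolding covers_def by blast
  obtain s where s: "s:Sx" "s (p (g x))=g x" using U e unfolding sheets_def by blast
  obtain s' where s': "s':Sx" "s' (p (g x))=h x" using U e pgh[OF x] unfolding sheets_def by metis
  have op: "openin E (s ` U)" "openin E (s' ` U)" using U s s' unfolding sheets_def by blast+
  let ?W = "{x:tsp X. g x:s ` U} Int {x:tsp X. h x:s' ` U}"
  have W: "openin X ?W"
   using open_pre[OF g op(1)] open_pre[OF h op(2)] by blast
  have xW: "x:?W" using x s s' U by (metis (mono_tags, lifting) IntI image_eqI mem_Collect_eq)
  have ps: "p (s u)=u" "p (s' u)=u" if "u:U" for u using that U s s' unfolding sheets_def by blast+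
  have loc: "EX u:U. g y=s u & h y=s' u" if "y:?W" for y
  proof -
   from that obtain u v where uv: "u:U" "g y=s u" "v:U" "h y=s' v" "y:tsp X" by auto
   hence "u=v" using pgh[OF uv(5)] ps by simp
   thus ?thesis using uv by blast
  qed
  have uni: "s=s'" if "u:U" "s u=s' u" for u using that U s s' unfolding sheets_def by blast
  show ?thesis
  proof (cases "g x=h x")
   case True
   hence "s=s'" using uni[of "p (g x)"] s s' U by simp
   hence "?W <= ?A" using loc by fastforce
   thus ?thesis using W xW True by auto
  next
   case False
   hence "s ~= s'" using s s' by metis
   have "?W <= ?B"
   proof
    fix y assume y: "y:?W"
    then obtain u where "u:U" "g y=s u" "h y=s' u" using loc by blast
    hence "g y ~= h y" using uni[of u] \<open>s ~= s'\<close> by auto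
    thus "y:?B" using y by auto
   qed
   thus ?thesis using W xW False by auto
  qed
 qed
 have "EX W. openin X W & x:W & W <= ?A" if "x:?A" for x
  using *[of x] that by (metis (mono_tags, lifting) mem_Collect_eq)
 hence "openin X ?A" using openin_subopen[of X ?A] by blast
 moreover have "EX W. openin X W & x:W & W <= ?B" if "x:?B" for x
  using *[of x] that by (metis (mono_tags, lifting) mem_Collect_eq)
 hence "openin X ?B" using openin_subopen[of X ?B] by blast
 moreover have "?A Un ?B=tsp X" "?A Int ?B={}" "?A ~= {}" using a by auto
 ultimately have "?B={}" using X unfolding connected_space_eq by blast
 thus ?thesis using x by auto
qed

lemma homotopy_lifting:
 fixes H :: "real \<times> 'z => 'p"
 assumes cov: "covers E P p"
  and H: "cmap (prodt I01 Z) P H"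
  and h0: "cmap Z E h0" and ph0: "!!z. z:tsp Z ==> p (h0 z)=H (0, z)"
 obtains K where "cmap (prodt I01 Z) E K"
  "!!t z. t:{0..1} ==> z:tsp Z ==> p (K (t, z))=H (t, z)"
  "!!z. z:tsp Z ==> K (0, z)=h0 z"
proof -
 let ?\<Pi> = "prodt eur Z"
 have Hs: "cmap (subt ?\<Pi> ({0..1} \<times> tsp Z)) P H"
  using H by (simp add: subtopology_Times)
 have Hsub: "cmap (subt ?\<Pi> (A \<times> N)) P H" if "A <= {0..1}" "N <= tsp Z" for A N
  by (rule continuous_map_from_subtopology_mono[OF Hs]) (use that in auto)
 \<comment> \<open>\<open>Q z a b\<close>: every lift prescribed at time a near z extends over the
   times from a to b on a smaller neighbourhood of z. Quantifying over all prescribed lifts lets the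
   property pass from two adjacent intervals to their union, as bisection requires.\<close>
 define Q where "Q z a b \<longleftrightarrow> (0 <= a --> a <= b --> b <= 1 --> (ALL N g. openin Z N --> z:N -->
   cmap (subt Z N) E g --> (ALL z':N. p (g z')=H (a, z')) -->
   (EX N' K. openin Z N' & z:N' & N' <= N & cmap (subt ?\<Pi> ({a..b} \<times> N')) E K &
    (ALL t:{a..b}. ALL z':N'. p (K (t, z'))=H (t, z')) & (ALL z':N'. K (a, z')=g z'))))" for z a b
 have QD: "EX N' K. openin Z N' & z:N' & N' <= N & cmap (subt ?\<Pi> ({a..b} \<times> N')) E K &
    (ALL t:{a..b}. ALL z':N'. p (K (t, z'))=H (t, z')) & (ALL z':N'. K (a, z')=g z')"
  if "Q z a b" "0 <= a" "a <= b" "b <= 1" "openin Z N" "z:N" "cmap (subt Z N) E g"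
   "ALL z':N. p (g z')=H (a, z')" for z a b N g
  using that(1)[unfolded Q_def, rule_format, OF that(2-6) that(7)] that(8) by (simp add: Ball_def)
 have main: "Q z 0 1" if z: "z:tsp Z" for z
  using zero_le_one
 proof (induction rule: Bolzano[of 0 1 "Q z", consumes 1, case_names trans local])
  case (trans a b c)
  show ?case
   unfolding Q_def
  proof (intro impI allI)
   fix N g
   assume ac: "0 <= a" "a <= c" "c <= 1" and N: "openin Z N" "z:N"
    and g: "cmap (subt Z N) E g" "ALL z':N. p (g z')=H (a, z')"
   obtain N1 K1 where 1: "openin Z N1" "z:N1" "N1 <= N" "cmap (subt ?\<Pi> ({a..b} \<times> N1)) E K1"
     "ALL t:{a..b}. ALL z':N1. p (K1 (t, z'))=H (t, z')" "ALL z':N1. K1 (a, z')=g z'"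
    using QD[OF trans(1) ac(1) trans(3) _ N g] trans(4) ac(3) by auto
   have "cmap (subt Z N1) (subt ?\<Pi> ({a..b} \<times> N1)) (%z'. (b, z'))"
    unfolding cm_into
    using trans by (auto simp: continuous_map_paired cm_from)
   from cmo[OF this 1(4)]
   have g1: "cmap (subt Z N1) E (%z'. K1 (b, z'))" by (simp add: o_def)
   have "0 <= b" using ac trans by auto
   moreover have "ALL z':N1. p (K1 (b, z'))=H (b, z')" using 1(5) trans by auto
   ultimately obtain N2 K2 where 2: "openin Z N2" "z:N2" "N2 <= N1" "cmap (subt ?\<Pi> ({b..c} \<times> N2)) E K2"
     "ALL t:{b..c}. ALL z':N2. p (K2 (t, z'))=H (t, z')" "ALL z':N2. K2 (b, z')=K1 (b, z')"
    using QD[OF trans(2) _ trans(4) ac(3) 1(1,2) g1] by auto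
   define K where "K=(%(t, z'). if t <= b then K1 (t, z') else K2 (t, z'))"
   let ?X = "subt ?\<Pi> ({a..c} \<times> N2)"
   have N2: "N2 <= tsp Z" using 2(1) openin_subset by blast
   have fstc: "cmap ?X eur fst"
    by (rule cm_from) (rule continuous_map_fst)
   have c1: "closedin ?X {x:tsp ?X. fst x:{..b}}" and c2: "closedin ?X {x:tsp ?X. fst x:{b..}}"
    by (rule closed_pre[OF fstc]; simp)+
   have "{x:tsp ?X. fst x:{..b}}={a..b} \<times> N2" "{x:tsp ?X. fst x:{b..}}={b..c} \<times> N2"
    using trans N2 by auto
   hence cl: "closedin ?X ({a..b} \<times> N2)" "closedin ?X ({b..c} \<times> N2)" using c1 c2 by simp_all
   have sub: "subt ?X ({a..b} \<times> N2)=subt ?\<Pi> ({a..b} \<times> N2)"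
     "subt ?X ({b..c} \<times> N2)=subt ?\<Pi> ({b..c} \<times> N2)"
    unfolding subtopology_subtopology using trans by (auto intro!: arg_cong[where f = "subt ?\<Pi>"])
   have "cmap ?X E K"
   proof (rule continuous_map_union_closed[OF cl])
    show "tsp ?X <= {a..b} \<times> N2 Un {b..c} \<times> N2" by auto
    have "cmap (subt ?\<Pi> ({a..b} \<times> N2)) E K1"
     by (rule continuous_map_from_subtopology_mono[OF 1(4)]) (use 2 in auto)
    thus "cmap (subt ?X ({a..b} \<times> N2)) E K"
     unfolding sub by (rule continuous_map_eq) (auto simp: K_def)
    show "cmap (subt ?X ({b..c} \<times> N2)) E K"
     unfolding sub by (rule continuous_map_eq[OF 2(4)]) (use 2(6) in \<open>auto simp: K_def\<close>)
   qed
   moreover have "ALL t:{a..c}. ALL z':N2. p (K (t, z'))=H (t, z')"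
    using 1(5) 2(3,5) by (auto simp: K_def subset_iff)
   moreover have "ALL z':N2. K (a, z')=g z'" using 1(6) 2(3) trans by (auto simp: K_def)
   ultimately show "EX N' K. openin Z N' & z:N' & N' <= N & cmap (subt ?\<Pi> ({a..c} \<times> N')) E K &
    (ALL t:{a..c}. ALL z':N'. p (K (t, z'))=H (t, z')) & (ALL z':N'. K (a, z')=g z')"
    using 2(1-3) 1(3) by (intro exI[of _ N2] exI[of _ K]) auto
  qed
 next
  case (local t)
  have tz: "(t, z):tsp (prodt I01 Z)" using local z by simp
  hence "H (t, z):tsp P" using H by (auto simp: continuous_map_def)
  then obtain U Sx where U: "H (t, z):U" "sheets E P p U Sx" using cov unfolding covers_def by blast
  let ?O = "{x:tsp (prodt I01 Z). H x:U}"
  have "openin (prodt I01 Z) ?O"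
   using open_pre[OF H] U unfolding sheets_def by blast
  moreover have "(t, z):?O" using U tz by blast
  ultimately obtain T M where TM: "openin I01 T" "openin Z M" "t:T" "z:M" "T \<times> M <= ?O"
   unfolding openin_prod_topology_alt by meson
  obtain d where d: "d > 0" "ball t d Int {0..1} <= T"
   using TM(1,3) unfolding openin_contains_ball by blast
  have "Q z a b" if ab: "a <= t" "t <= b" "b - a < d" for a b
   unfolding Q_def
  proof (intro impI allI)
   fix N g
   assume a: "0 <= a" "a <= b" "b <= 1" and N: "openin Z N" "z:N"
    and g: "cmap (subt Z N) E g" "ALL z':N. p (g z')=H (a, z')"
   have "{a..b} <= ball t d Int {0..1}" using ab a by (auto simp: dist_real_def)
   hence abT: "{a..b} <= T" using d by blast
   have HU: "H (r, z'):U" if "r:{a..b}" "z':M" for r z' using TM(5) abT that by blast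
   have gz: "g z:tsp E" using g(1) N openin_subset by (fastforce simp: continuous_map_def)
   have "p (g z):U" using g(2) N HU[of a z] a TM by simp
   then obtain s where s: "s:Sx" "s (p (g z))=g z" using U gz unfolding sheets_def by blast
   have sc: "cmap (subt P U) E s" "openin E (s ` U)" "!!u. u:U ==> p (s u)=u"
    using s U unfolding sheets_def by blast+
   define N' where "N'={z':tsp (subt Z N). g z':s ` U} Int M"
   have "openin (subt Z N) {z':tsp (subt Z N). g z':s ` U}"
    by (rule open_pre[OF g(1) sc(2)])
   hence N': "openin Z N'" using openin_trans_full[OF _ N(1)] TM(2) unfolding N'_def by blast
   have zN': "z:N'"
    using N TM s \<open>p (g z) : U\<close> openin_subset[OF N(1)] unfolding N'_def by (auto intro: image_eqI[OF sym])
   have sub: "N' <= N" "N' <= M" "N' <= tsp Z" by (auto simp: N'_def)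
   have "cmap (subt ?\<Pi> ({a..b} \<times> N')) (subt P U) H"
    unfolding cm_into using Hsub[of "{a..b}" N'] HU sub a by auto
   hence "cmap (subt ?\<Pi> ({a..b} \<times> N')) E (s o H)"
    using cmo sc(1) by blast
   moreover have "ALL r:{a..b}. ALL z':N'. p ((s o H) (r, z'))=H (r, z')" using HU sub sc by auto
   moreover have ag: "(s o H) (a, z')=g z'" if z'N: "z':N'" for z'
   proof -
    obtain v where "v:U" "g z'=s v" using z'N unfolding N'_def by auto
    moreover have "H (a, z')=p (g z')" using g(2) z'N sub by auto
    ultimately show ?thesis using sc(3)[of v] by simp
   qed
   ultimately show "EX N' K. openin Z N' & z:N' & N' <= N & cmap (subt ?\<Pi> ({a..b} \<times> N')) E K &
    (ALL t:{a..b}. ALL z':N'. p (K (t, z'))=H (t, z')) & (ALL z':N'. K (a, z')=g z')"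
    using N' zN' sub by blast
  qed
  thus ?case using d(1) by blast
 qed
 have loc: "EX N K. openin Z N & z:N & cmap (subt ?\<Pi> ({0..1} \<times> N)) E K &
    (ALL t:{0..1}. ALL z':N. p (K (t, z'))=H (t, z')) & (ALL z':N. K (0, z')=h0 z')" if z: "z:tsp Z" for z
 proof -
  have "cmap (subt Z (tsp Z)) E h0" using h0 by simp
  from QD[OF main[OF z] order_refl zero_le_one order_refl openin_topspace z this] ph0 show ?thesis by blast
 qed
 define G where "G z N K \<longleftrightarrow> openin Z N & z:N & cmap (subt ?\<Pi> ({0..1} \<times> N)) E K &
    (ALL t:{0..1}. ALL z':N. p (K (t, z'))=H (t, z')) & (ALL z':N. K (0, z')=h0 z')" for z N K
 have "ALL z:tsp Z. EX N K. G z N K" using loc unfolding G_def by blast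
 then obtain N K where "ALL z:tsp Z. G z (N z) (K z)" by metis
 hence NK: "!!z. z:tsp Z ==> openin Z (N z)" "!!z. z:tsp Z ==> z:N z"
   "!!z. z:tsp Z ==> cmap (subt ?\<Pi> ({0..1} \<times> N z)) E (K z)"
   "!!z t z'. [|z:tsp Z; t:{0..1}; z':N z|] ==> p (K z (t, z'))=H (t, z')"
   "!!z z'. [|z:tsp Z; z':N z|] ==> K z (0, z')=h0 z'"
  unfolding G_def by blast+
 have sec: "cmap I01 E (%t. K z (t, z'))" if "z:tsp Z" "z':N z" for z z'
 proof -
  have "z':tsp Z" using that NK(1) openin_subset by blast
  hence "cmap I01 (subt ?\<Pi> ({0..1} \<times> N z)) (%t. (t, z'))"
   unfolding cm_into using that
   by (auto simp: continuous_map_paired cm_from)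
  from cmo[OF this NK(3)[OF that(1)]] show ?thesis by (simp add: o_def)
 qed
 \<comment> \<open>Over a fixed point both sides lift the same path from the same start, so the
   local lifts glue.\<close>
 have agree: "K z (t, z')=K y (t, z')"
  if "z:tsp Z" "y:tsp Z" "z':N z" "z':N y" "t:{0..1}" for z y z' t
 proof (rule lift_unique[OF cov _ sec[OF that(1,3)] sec[OF that(2,4)]])
  show "connected_space I01"
   by (simp add: is_interval_1)
  show "K z (0, z')=K y (0, z')" using NK(5) that by simp
 qed (use that NK(4) in auto)
 let ?X = "subt ?\<Pi> ({0..1} \<times> tsp Z)"
 define L where "L=(%(t, z). K z (t, z))"
 have "cmap ?X E L"
 proof (rule pasting_lemma[where I = "tsp Z" and T = "%z. {0..1} \<times> N z" and f = K])
  fix z assume z: "z:tsp Z"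
  have "openin ?X (({0..1} \<times> tsp Z) Int (UNIV \<times> N z))"
   using openin_subtopology_Int2[of ?\<Pi> "UNIV \<times> N z"] NK(1)[OF z]
   by (simp add: openin_prod_Times_iff)
  moreover have "({0..1::real} \<times> tsp Z) Int (UNIV \<times> N z)={0..1} \<times> N z"
   using NK(1)[OF z] openin_subset by blast
  ultimately show "openin ?X ({0..1} \<times> N z)" by simp
  have "({0..1::real} \<times> tsp Z) Int ({0..1} \<times> N z)={0..1} \<times> N z"
   using NK(1)[OF z] openin_subset by blast
  thus "cmap (subt ?X ({0..1} \<times> N z)) E (K z)"
   using NK(3)[OF z] by (simp add: subtopology_subtopology)
 next
  fix z y x assume zy: "z:tsp Z" "y:tsp Z"
   and x: "x:tsp ?X Int ({0..1} \<times> N z) Int ({0..1} \<times> N y)"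
  obtain t z' where "x=(t, z')" by fastforce
  thus "K z x=K y x" using agree[OF zy, of z' t] x by simp
 next
  fix x assume "x:tsp ?X"
  thus "EX j. j:tsp Z & x:{0..1} \<times> N j & L x=K j x"
   using NK(2) by (cases x) (auto simp: L_def)
 qed
 hence "cmap (prodt I01 Z) E L" by (simp add: subtopology_Times)
 moreover have "p (L (t, z))=H (t, z)" if "t:{0..1}" "z:tsp Z" for t z
  using NK(4)[OF that(2,1)] NK(2) that by (simp add: L_def)
 moreover have "L (0, z)=h0 z" if "z:tsp Z" for z using NK(5)[OF that] NK(2) that by (simp add: L_def)
 ultimately show ?thesis using that by blast
qed

section \<open>Lifting maps from contractible domains and spheres\<close>

lemma star_lift:
 assumes cov: "covers E P p" and f: "cmap X P f"
  and c: "cmap (prodt I01 X) X c"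
  and c0: "!!x. x:tsp X ==> c (0, x)=x0" and c1: "!!x. x:tsp X ==> c (1, x)=x"
  and cx0: "!!t. t:{0..1} ==> c (t, x0)=x0"
  and x0: "x0:tsp X" and e: "e:tsp E" "p e=f x0"
 obtains g where "cmap X E g" "!!x. x:tsp X ==> p (g x)=f x" "g x0=e"
proof -
 have "cmap (prodt I01 X) P (f o c)"
  by (rule cmo[OF c f])
 moreover have "cmap X E (%_. e)" using e by simp
 moreover have "!!z. z:tsp X ==> p e=(f o c) (0, z)" using e c0 by simp
 ultimately obtain K where K: "cmap (prodt I01 X) E K"
   "!!t z. t:{0..1} ==> z:tsp X ==> p (K (t, z))=(f o c) (t, z)"
   "!!z. z:tsp X ==> K (0, z)=e"
  using homotopy_lifting[OF cov, of X "f o c" "%_. e"] by blast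
 have "cmap X (prodt I01 X) (%x. (1, x))"
  by (auto simp: continuous_map_paired)
 from cmo[OF this K(1)] have g: "cmap X E (%x. K (1, x))" by (simp add: o_def)
 have pg: "p (K (1, x))=f x" if "x:tsp X" for x using K(2)[of 1 x] c1 that by simp
 have "K (1, x0)=e"
 proof -
  have "cmap I01 (prodt I01 X) (%t. (t, x0))"
   using x0 by (auto simp: continuous_map_paired)
  from cmo[OF this K(1)]
  have k: "cmap I01 E (%t. K (t, x0))" by (simp add: o_def)
  show ?thesis
  proof (rule lift_unique[OF cov _ k, where h = "%_. e" and a = 0])
   show "connected_space I01" by (simp add: is_interval_1)
   show "p (K (t, x0))=p e" if "t:tsp I01" for t
    using K(2)[of t x0] that x0 cx0 e by simp
  qed (use e x0 K(3) in auto)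
 qed
 thus ?thesis using that g pg by blast
qed

lemma path_lift:
 assumes cov: "covers E P p" and f: "pathin P f" and e: "e:tsp E" "p e=f 0"
 obtains g where "pathin E g" "!!t. t:{0..1} ==> p (g t)=f t" "g 0=e"
proof -
 have c: "cmap (prodt I01 I01) I01 (%(t, x). t * x)"
 proof -
  have "continuous_on ({0..1} \<times> {0..1::real}) (%p. fst p * snd p)" by (intro continuous_intros)
  thus ?thesis
   by (auto simp: case_prod_beta' cm_into mult_le_one simp flip: subtopology_Times)
 qed
 obtain g where "cmap I01 E g" "!!x. x:{0..1} ==> p (g x)=f x" "g 0=e"
  by (rule star_lift[OF cov f[unfolded pathin_def] c, of 0 e]) (use e in auto)
 thus ?thesis using that by (simp add: pathin_def)
qed

lemma path_lift_unique:
 assumes "covers E P p" "pathin E g" "pathin E h" "!!t. t:{0..1} ==> p (g t)=p (h t)" "g 0=h 0" "t:{0..1}"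
 shows "g t=h t"
 by (rule lift_unique[OF assms(1) _ assms(2,3)[unfolded pathin_def], of 0]) (use assms(4-) in \<open>auto simp: is_interval_1\<close>)

text \<open>Suspension coordinates: from the pole at s = 0 to the pole at s = 1 through rescaled
  copies of the lower sphere, with the height in coordinate n + 1.\<close>

definition susp :: "nat => real \<times> (nat => real) => nat => real" where
 "susp n=(%(s, x) i. if i <= n then sin (pi * s) * x i else if i=Suc n then cos (pi * s) else 0)"

lemma susp_in:
 assumes "x:tsp (nS n)" shows "susp n (s, x):tsp (nS (Suc n))"
proof -
 have "(SUM i<=n. (susp n (s, x) i)\<^sup>2)=(sin (pi * s))\<^sup>2"
  using assms by (simp add: susp_def tsp_nS power_mult_distrib flip: sum_distrib_left)
 thus ?thesis by (simp add: tsp_nS) (simp add: susp_def)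
qed

lemma continuous_map_susp:
 "cmap (prodt I01 (nS n)) (nS (Suc n)) (susp n)"
proof -
 let ?C = "prodt I01 (nS n)"
 have fst: "cmap ?C eur fst"
  using cm_full[OF continuous_map_fst] by fastforce
 have "cmap ?C eur (%p. susp n p i)" for i
 proof -
  have s: "cmap ?C eur (%p. sin (pi * fst p))"
  proof -
   have "cmap eur eur (%s. sin (pi * s))"
    by simp (intro continuous_intros)
   from cmo[OF fst this] show ?thesis by (simp add: o_def)
  qed
  have c: "cmap ?C eur (%p. cos (pi * fst p))"
  proof -
   have "cmap eur eur (%s. cos (pi * s))"
    by simp (intro continuous_intros)
   from cmo[OF fst this] show ?thesis by (simp add: o_def)
  qed
  have x: "cmap ?C eur (%p. snd p i)"
   using cmo[OF continuous_map_snd continuous_map_nsphere_projection, of "I01" n i]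
   by (simp add: o_def)
  have "(%p. susp n p i)=(if i <= n then (%p. sin (pi * fst p) * snd p i)
    else if i=Suc n then (%p. cos (pi * fst p)) else (%_. 0))"
   by (auto simp: susp_def)
  thus ?thesis using continuous_map_real_mult[OF s x] c by simp
 qed
 hence "cmap ?C (powertop_real UNIV) (susp n)"
  by (simp add: cm_comp)
 moreover have "susp n p:tsp (nS (Suc n))" if "p:tsp ?C" for p
  using that susp_in by (cases p) auto
 ultimately show ?thesis
  unfolding nsphere[of "Suc n"] cm_into
  by (auto simp flip: nsphere)
qed

lemma susp_surj:
 assumes "y:tsp (nS (Suc n))"
 obtains s x where "s:{0..1}" "x:tsp (nS n)" "y=susp n (s, x)"
proof -
 have y: "(SUM i<=n. (y i)\<^sup>2) + (y (Suc n))\<^sup>2=1" "!!i. i > Suc n ==> y i=0"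
  using assms by (auto simp: tsp_nS)
 have le: "(y (Suc n))\<^sup>2 <= 1" using y(1) sum_nonneg[of "{..n}" "%i. (y i)\<^sup>2"] by simp
 hence b: "-1 <= y (Suc n)" "y (Suc n) <= 1" by (simp_all add: abs_square_le_1 abs_le_iff)
 define s where "s=arccos (y (Suc n)) / pi"
 have s: "s:{0..1}" using arccos_lbound[OF b] arccos_ubound[OF b] by (simp add: s_def)
 have cs: "cos (pi * s)=y (Suc n)" using cos_arccos[OF b] by (simp add: s_def)
 have ss: "(sin (pi * s))\<^sup>2=(SUM i<=n. (y i)\<^sup>2)" using y(1) sin_cos_squared_add[of "pi * s"] cs by simp
 show ?thesis
 proof (cases "sin (pi * s)=0")
  case True
  hence "y i=0" if "i <= n" for i using ss that by (simp add: sum_nonneg_eq_0_iff)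
  hence "y=susp n (s, %n. if n=0 then 1 else 0)"
   using True cs y(2) by (auto simp: susp_def fun_eq_iff not_le less_Suc_eq_le)
  thus ?thesis using that s in_topspace_nsphere by blast
 next
  case False
  let ?x = "%i. if i <= n then y i / sin (pi * s) else 0"
  have "(SUM i<=n. (y i / sin (pi * s))\<^sup>2)=1"
   using False by (simp add: power_divide flip: sum_divide_distrib ss)
  hence "?x:tsp (nS n)" by (simp add: tsp_nS)
  moreover have "y=susp n (s, ?x)"
   using False cs y(2) by (auto simp: susp_def fun_eq_iff not_le)
  ultimately show ?thesis using that s by blast
 qed
qed

lemma susp_inj:
 assumes "susp n (s, x)=susp n (t, y)" "s:{0..1}" "t:{0..1}"
  "x:tsp (nS n)" "y:tsp (nS n)"
 shows "s=t" "s=0 | s=1 | x=y"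
proof -
 have "cos (pi * s)=cos (pi * t)" using fun_cong[OF assms(1), of "Suc n"] by (simp add: susp_def)
 moreover have "0 <= pi * s" "pi * s <= pi" "0 <= pi * t" "pi * t <= pi" using assms(2,3) by auto
 ultimately have "pi * s=pi * t" using cos_inj_pi by blast
 thus st: "s=t" by simp
 show "s=0 | s=1 | x=y"
 proof (cases "s=0 | s=1")
  case False
  hence "sin (pi * s) > 0" using assms(2) by (intro sin_gt_zero) auto
  hence "x i=y i" for i
   using fun_cong[OF assms(1), of i] st assms(4,5)
   by (cases "i <= n") (auto simp: susp_def tsp_nS)
  thus ?thesis by auto
 qed auto
qed

lemma path_connected_nsphere: "path_connected_space (nS (Suc n))"
proof -
 define N where "N=susp n (0, %n. if n=0 then 1 else 0)"
 have N: "susp n (0, x)=N" for x by (auto simp: N_def susp_def)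
 have "EX g. pathin (nS (Suc n)) g & g 0=N & g 1=y" if y: "y:tsp (nS (Suc n))" for y
 proof -
  obtain s x where sx: "s:{0..1}" "x:tsp (nS n)" "y=susp n (s, x)" using susp_surj[OF y] by blast
  have "cmap I01 (prodt I01 (nS n)) (%t. (t * s, x))"
   using sx by (auto simp: continuous_map_paired cm_into mult_le_one intro!: continuous_intros)
  from cmo[OF this continuous_map_susp]
  have "pathin (nS (Suc n)) (%t. susp n (t * s, x))" by (simp add: pathin_def o_def)
  thus ?thesis using sx N by (intro exI[of _ "%t. susp n (t * s, x)"]) simp
 qed
 hence *: "path_component_of (nS (Suc n)) N y" if "y:tsp (nS (Suc n))" for y
  using that unfolding path_component_of_def by blast
 show ?thesis
  unfolding path_connected_space_iff_path_component
  using * path_component_of_sym path_component_of_trans by metis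
qed

lemma connected_nsphere: "connected_space (nS (Suc n))"
 by (rule path_connected_imp_connected_space[OF path_connected_nsphere])

lemma Hausdorff_space_nsphere: "Hausdorff_space (nS n)"
 by (simp add: nsphere Hausdorff_space_subtopology Hausdorff_space_product_topology)

text \<open>In suspension coordinates the map is a homotopy that starts with a constant map. At the
  other pole its lift covers a constant map on a sphere of dimension at least 1; that sphere is
  connected, so the lift is constant there and descends from the cylinder to the sphere.\<close>

lemma sphere_lift:
 assumes cov: "covers E P p" and surj: "p ` tsp E=tsp P"
  and f: "cmap (nS (Suc (Suc n))) P f"
 obtains g where "cmap (nS (Suc (Suc n))) E g"
  "!!x. x:tsp (nS (Suc (Suc n))) ==> p (g x)=f x"
proof -
 let ?S = "nS (Suc n)" and ?q = "susp (Suc n)"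
 let ?C = "prodt I01 ?S"
 define a :: "nat => real" where "a=(%n. if n=0 then 1 else 0)"
 have a: "a:tsp ?S" unfolding a_def by (rule in_topspace_nsphere)
 have q0: "?q (0, x)=?q (0, a)" "?q (1, x)=?q (1, a)" for x by (auto simp: susp_def)
 have "f (?q (0, a)):tsp P"
  using f susp_in[OF a] by (auto simp: continuous_map_def)
 then obtain e where e: "e:tsp E" "p e=f (?q (0, a))" using surj by (metis imageE)
 have H: "cmap ?C P (f o ?q)" by (rule cmo[OF continuous_map_susp f])
 have "cmap ?S E (%_. e)" using e by simp
 moreover have "!!z. z:tsp ?S ==> p e=(f o ?q) (0, z)" using e q0 by (metis o_apply)
 ultimately obtain K where K: "cmap ?C E K"
   "!!t z. t:{0..1} ==> z:tsp ?S ==> p (K (t, z))=(f o ?q) (t, z)"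
   "!!z. z:tsp ?S ==> K (0, z)=e"
  using homotopy_lifting[OF cov H, of "%_. e"] by blast
 have "cmap ?S ?C (%x. (1, x))" by (auto simp: continuous_map_paired)
 from cmo[OF this K(1)] have k1: "cmap ?S E (%x. K (1, x))" by (simp add: o_def)
 have Ka: "K (1, a):tsp E" using cm_fun[OF k1] a by auto
 have K1: "K (1, x)=K (1, a)" if "x:tsp ?S" for x
 proof (rule lift_unique[OF cov connected_nsphere k1, where h = "%_. K (1, a)" and a = a])
  show "p (K (1, y))=p (K (1, a))" if "y:tsp ?S" for y
   using K(2)[of 1 y] K(2)[of 1 a] that a q0 by (metis atLeastAtMost_iff o_apply order_refl zero_le_one)
 qed (use that a Ka in auto)
 have "compact_space ?C"
  using compact_space_nsphere by (simp add: compact_space_prod_topology cpt_sub)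
 hence quo: "quotient_map ?C (nS (Suc (Suc n))) ?q"
 proof (intro continuous_closed_imp_quotient_map continuous_imp_closed_map continuous_map_susp Hausdorff_space_nsphere)
  show "?q ` tsp ?C=tsp (nS (Suc (Suc n)))"
  proof
   show "?q ` tsp ?C <= tsp (nS (Suc (Suc n)))" using susp_in by force
   show "tsp (nS (Suc (Suc n))) <= ?q ` tsp ?C"
   proof
    fix y assume "y:tsp (nS (Suc (Suc n)))"
    then obtain s x where "s:{0..1}" "x:tsp ?S" "y=?q (s, x)" using susp_surj by blast
    thus "y:?q ` tsp ?C" by (intro image_eqI[of _ _ "(s, x)"]) auto
   qed
  qed
 qed
 have fib: "K u=K v" if u: "u:tsp ?C" and v: "v:tsp ?C" and eq: "?q u=?q v" for u v
 proof -
  obtain s x where ux: "u=(s, x)" by fastforce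
  obtain t y where vy: "v=(t, y)" by fastforce
  have xy: "x:tsp ?S" "y:tsp ?S" using u v ux vy by auto
  have "s=t" "s=0 | s=1 | x=y" using susp_inj[of "Suc n" s x t y] u v eq ux vy by auto
  thus ?thesis using K(3) K1 xy ux vy by metis
 qed
 obtain g where g: "cmap (nS (Suc (Suc n))) E g" "!!u. u:tsp ?C ==> g (?q u)=K u"
  using quotient_map_lift_exists[of ?C "nS (Suc (Suc n))" ?q E K] quo K(1) fib by metis
 have "p (g y)=f y" if y: "y:tsp (nS (Suc (Suc n)))" for y
 proof -
  obtain s x where sx: "s:{0..1}" "x:tsp ?S" "y=?q (s, x)" using susp_surj[OF y] by blast
  thus ?thesis using g(2)[of "(s, x)"] K(2)[of s x] by simp
 qed
 thus ?thesis using that g(1) by blast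
qed

text \<open>Weaker than contractibility, but enough for maps from compact spaces. For an infinite
  complex exhausted by contractible pieces it avoids choosing compatible contractions of the
  pieces.\<close>

definition ccontractible :: "'e topology => bool" where
 "ccontractible E \<longleftrightarrow> (ALL C. compactin E C --> (EX K. C <= K & contractible_space (subt E K)))"

lemma ccontractible_null:
 assumes "ccontractible E" "compact_space X" "cmap X E f"
 shows "EX c. homotopic_with (%_. True) X E f (%_. c)"
proof -
 have "compactin E (f ` tsp X)"
  using image_compactin[of X "tsp X" E f] assms(2,3) by (simp add: compact_space_def)
 then obtain K where K: "f ` tsp X <= K" "contractible_space (subt E K)"
  using assms(1) unfolding ccontractible_def by blast
 have "cmap X (subt E K) f" using assms(3) K(1) by (auto simp: cm_into)
 then obtain c where "homotopic_with (%_. True) X (subt E K) f (%_. c)"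
  using nullhomotopic_into_contractible_space[OF _ K(2)] by metis
 moreover have "cmap (subt E K) E id" by simp
 ultimately show ?thesis
  using homotopic_with_compose_continuous_map_left[of "%_. True" X "subt E K" f "%_. c" E id "%_. True"]
  by (auto simp: o_def)
qed

lemma sphere_null:
 assumes cov: "covers E P p" and surj: "p ` tsp E=tsp P" and E: "ccontractible E"
  and k: "k >= 2" and f: "cmap (nS k) P f"
 shows "EX c. homotopic_with (%_. True) (nS k) P f (%_. c)"
proof -
 obtain n where n: "k=Suc (Suc n)" using k by (metis add_2_eq_Suc le_Suc_ex)
 obtain g where g: "cmap (nS k) E g" "!!x. x:tsp (nS k) ==> p (g x)=f x"
  using sphere_lift[OF cov surj f[unfolded n]] unfolding n by blast
 obtain c where "homotopic_with (%_. True) (nS k) E g (%_. c)"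
  using ccontractible_null[OF E compact_space_nsphere g(1)] by blast
 moreover have "cmap E P p" using cov by (simp add: covers_def)
 ultimately have "homotopic_with (%_. True) (nS k) P (p o g) (p o (%_. c))"
  using homotopic_with_compose_continuous_map_left[of "%_. True" "nS k" E g "%_. c" P p "%_. True"] by simp
 hence "homotopic_with (%_. True) (nS k) P f (%_. p c)"
  by (rule homotopic_with_eq) (use g(2) in auto)
 thus ?thesis by blast
qed

section \<open>Fundamental groups of quotients of contractible spaces\<close>

lemma ccontractible_path:
 assumes "ccontractible E" "x:tsp E" "y:tsp E"
 obtains g where "pathin E g" "g 0=x" "g 1=y"
proof -
 have "compactin E {x, y}" using assms by (simp add: finite_imp_compactin)
 then obtain K where K: "{x, y} <= K" "contractible_space (subt E K)"
  using assms(1) unfolding ccontractible_def by blast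
 hence "path_connected_space (subt E K)" by (simp add: contractible_imp_path_connected_space)
 moreover have "x:tsp (subt E K)" "y:tsp (subt E K)" using K assms by auto
 ultimately obtain g where "pathin (subt E K) g" "g 0=x" "g 1=y"
  unfolding path_connected_space_def by blast
 moreover from this have "pathin E g" by (simp add: pathin_subtopology)
 ultimately show ?thesis using that by blast
qed

lemma continuous_map_ndisc:
 assumes "!!i. cmap X eur (%x. f x i)"
  and "!!x. x:tsp X ==> f x:tsp (ndisc n)"
 shows "cmap X (ndisc n) f"
proof -
 have "cmap X (powertop_real UNIV) f" using assms(1) by (simp add: cm_comp)
 thus ?thesis
  using assms(2) unfolding ndisc_alt cm_into by auto
qed

lemma pathin_path_join:
 assumes f: "pathin X f" and g: "pathin X g" and fg: "f 1=g 0"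
 shows "pathin X (path_join f g)"
 unfolding pathin_def
proof (rule continuous_map_union_closed)
 let ?I = "I01"
 show "closedin ?I {0..1/2}" "closedin ?I {1/2..1}" by (auto intro: closed_subset)
 show "tsp ?I <= {0..1/2} Un {1/2..1}" by auto
 have s: "subt ?I {0..1/2}=top_of_set {0..1/2}" "subt ?I {1/2..1}=top_of_set {1/2..1}"
  by (auto simp: subtopology_subtopology intro!: arg_cong[where f = top_of_set])
 have "cmap (top_of_set {0..1/2}) ?I (%t. 2 * t)" "cmap (top_of_set {1/2..1}) ?I (%t. 2 * t - 1)"
  by (auto simp: cm_into intro!: continuous_intros)
 hence c: "cmap (top_of_set {0..1/2}) X (f o (%t. 2 * t))"
  "cmap (top_of_set {1/2..1}) X (g o (%t. 2 * t - 1))"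
  using cmo f g unfolding pathin_def by blast+
 show "cmap (subt ?I {0..1/2}) X (path_join f g)"
  unfolding s by (rule continuous_map_eq[OF c(1)]) (auto simp: path_join_def)
 have "path_join f g t=g (2 * t - 1)" if "t >= 1/2" for t
 proof (cases "t=1/2")
  case True
  show ?thesis unfolding True path_join_def using fg by simp
 qed (use that in \<open>auto simp: path_join_def\<close>)
 thus "cmap (subt ?I {1/2..1}) X (path_join f g)"
  unfolding s by (intro continuous_map_eq[OF c(2)]) auto
qed

text \<open>A covering whose fibres carry a free and transitive group action and whose total space
  is contractible on compact sets; the base is then a classifying space of that group.\<close>

locale deck =
 fixes E :: "'e topology" and P :: "'p topology" and p :: "'e => 'p"
  and G :: "'v monoid" (structure) and act :: "'v => 'e => 'e"
 assumes cov: "covers E P p" and surj: "p ` tsp E=tsp P" and grp: "group G"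
  and act_cont: "g:carrier G ==> cmap E E (act g)"
  and act_mult: "[|g:carrier G; h:carrier G; e:tsp E|] ==> act (g \<otimes> h) e=act g (act h e)"
  and p_act: "[|g:carrier G; e:tsp E|] ==> p (act g e)=p e"
  and trans: "[|e:tsp E; e':tsp E; p e=p e'|] ==> EX g:carrier G. act g e=e'"
  and free: "[|g:carrier G; h:carrier G; e:tsp E; act g e=act h e|] ==> g=h"
  and cc: "ccontractible E"
begin

lemma p_cont: "cmap E P p"
 using cov by (simp add: covers_def)

lemma act_in: "g:carrier G ==> e:tsp E ==> act g e:tsp E"
 using act_cont[of g] by (auto simp: continuous_map_def)

lemma path_connected_E: "path_connected_space E"
 unfolding path_connected_space_def using ccontractible_path[OF cc] by metis

lemma path_connected_P: "path_connected_space P"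
 using path_connectedin_continuous_map_image[OF p_cont, of "tsp E"] path_connected_E surj
 by (simp add: path_connectedin_topspace)

lemma pathin_p: "pathin E g ==> pathin P (p o g)"
 unfolding pathin_def by (rule cmo[OF _ p_cont])

text \<open>The two paths are the upper and the lower half of a loop, which bounds a disc in
  \<open>E\<close>; sweeping the disc vertically and projecting gives a homotopy that keeps the ends
  fixed.\<close>

lemma homotopy_rel_ends:
 assumes a: "pathin E a" and b: "pathin E b" and ends: "a 0=b 0" "a 1=b 1"
 shows "homotopic_with (%h. h 0=p (a 0) & h 1=p (a 1)) I01 P (p o a) (p o b)"
proof -
 let ?S = "nS 1" and ?I = "I01"
 define ta where "ta v=arccos (- v (0 :: nat)) / pi" for v :: "nat => real"
 have bnd: "- v 0:{-1..1}" if "v:tsp ?S" for v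
 proof -
  have "(v 0)\<^sup>2 <= 1" using that by (auto simp: tsp_nS) (metis add.commute le_add_same_cancel2 zero_le_power2)
  thus ?thesis by (auto simp: abs_square_le_1 abs_le_iff)
 qed
 have "cmap ?S (top_of_set {-1..1}) (%v. - v 0)"
  unfolding cm_into
  using bnd continuous_map_nsphere_projection by (auto intro: continuous_map_minus)
 moreover have "cmap (top_of_set {-1..1}) ?I (%y. arccos y / pi)"
  using arccos_lbound arccos_ubound
  by (auto simp: cm_into divide_le_eq intro!: continuous_intros continuous_on_arccos')
 ultimately have ta: "cmap ?S ?I ta"
  unfolding ta_def using cmo[of ?S "top_of_set {-1..1}" "%v. - v 0" ?I "%y. arccos y / pi"]
  by (simp add: o_def)
 define u where "u v=(if v (1 :: nat) >= (0 :: real) then a (ta v) else b (ta v))" for v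
 have at: "cmap ?S E (a o ta)" "cmap ?S E (b o ta)"
  using cmo[OF ta] a b unfolding pathin_def by blast+
 have pr: "cmap ?S eur (%v. v 1)" by (rule continuous_map_nsphere_projection)
 have cl: "closedin ?S {v:tsp ?S. v 1:{0..}}" "closedin ?S {v:tsp ?S. v 1:{..0}}"
  by (rule closed_pre[OF pr]; simp)+
 have u: "cmap ?S E u"
 proof (rule continuous_map_union_closed[OF cl])
  show "tsp ?S <= {v:tsp ?S. v 1:{0..}} Un {v:tsp ?S. v 1:{..0}}" by auto
  show "cmap (subt ?S {v:tsp ?S. v 1:{0..}}) E u"
   by (rule continuous_map_eq[OF cm_from[OF at(1)]]) (auto simp: u_def)
  have "(b o ta) v=u v" if v: "v:tsp ?S" "v 1 <= 0" for v
  proof (cases "v 1=0")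
   case True
   hence "(v 0)\<^sup>2=1" using v by (auto simp: tsp_nS)
   hence "v 0=1 | v 0 = -1" by (simp add: power2_eq_1_iff)
   hence "ta v=1 | ta v=0" by (auto simp: ta_def)
   thus ?thesis using True ends by (auto simp: u_def)
  qed (use v in \<open>auto simp: u_def\<close>)
  thus "cmap (subt ?S {v:tsp ?S. v 1:{..0}}) E u"
   by (intro continuous_map_eq[OF cm_from[OF at(2)]]) auto
 qed
 obtain c where "homotopic_with (%_. True) ?S E u (%_. c)"
  using ccontractible_null[OF cc compact_space_nsphere u] by blast
 then obtain g where g: "cmap (ndisc (Suc 1)) E g" "!!v. v:tsp ?S ==> g v=u v"
  using nullhomotopic_extends_to_disc by metis
 \<comment> \<open>Coordinates on the disc in which t determines the first coordinate, while s moves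
   from the upper to the lower half circle; \<open>ta\<close> recovers t.\<close>
 define w :: "real \<times> real => nat => real" where
  "w=(%(s, t) i. if i=0 then - cos (pi * t) else if i=1 then (1 - 2 * s) * sin (pi * t) else 0)"
 let ?II = "prodt ?I ?I"
 have win: "w (s, t):tsp (ndisc (Suc 1))" if "s:{0..1}" for s t
 proof -
  have "\<bar>1 - 2 * s\<bar> <= 1" using that by auto
  hence "(1 - 2 * s)\<^sup>2 <= 1" by (simp add: abs_square_le_1)
  hence "((1 - 2 * s) * sin (pi * t))\<^sup>2 <= (sin (pi * t))\<^sup>2"
   by (simp add: power_mult_distrib mult_left_le_one_le)
  hence "(cos (pi * t))\<^sup>2 + ((1 - 2 * s) * sin (pi * t))\<^sup>2 <= 1"
   using sin_cos_squared_add[of "pi * t"] by linarith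
  thus ?thesis by (simp add: tsp_ndisc w_def)
 qed
 have wc: "cmap ?II (ndisc (Suc 1)) w"
 proof (rule continuous_map_ndisc)
  fix i
  have "continuous_on ({0..1} \<times> {0..1}) (%p. w p i)"
   by (cases "i=0"; cases "i=1") (auto simp: w_def case_prod_beta' intro!: continuous_intros)
  thus "cmap ?II eur (%p. w p i)"
   by (simp flip: subtopology_Times)
 qed (use win in auto)
 define h where "h=p o g o w"
 have hc: "cmap ?II P h"
  unfolding h_def by (intro cmo[OF wc] cmo[OF g(1)] p_cont)
 have tau: "ta (w (s, t))=t" if "t:{0..1}" for s t
 proof -
  have "arccos (cos (pi * t))=pi * t" using that by (intro arccos_cos) auto
  thus ?thesis by (simp add: ta_def w_def)
 qed
 have sph: "w (s, t):tsp ?S" if "s=0 | s=1" for s t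
  using that sin_cos_squared_add[of "pi * t"] by (auto simp: tsp_nS w_def)
 have h0: "h (0, t)=(p o a) t" if "t:{0..1}" for t
 proof -
  have "w (0, t) 1 >= 0" using that sin_ge_zero[of "pi * t"] by (simp add: w_def)
  thus ?thesis using g(2)[OF sph[of 0 t]] tau[OF that] by (simp add: h_def u_def)
 qed
 have h1: "h (1, t)=(p o b) t" if "t:{0..1}" for t
 proof (cases "t=0 | t=1")
  case True
  thus ?thesis using g(2)[OF sph[of 1 t]] tau[OF that] ends by (auto simp: h_def u_def)
 next
  case False
  hence "sin (pi * t) > 0" using that by (intro sin_gt_zero) auto
  hence "w (1, t) 1 < 0" by (simp add: w_def)
  thus ?thesis using g(2)[OF sph[of 1 t]] tau[OF that] by (simp add: h_def u_def)
 qed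
 have he: "h (s, 0)=p (a 0)" "h (s, 1)=p (a 1)" if "s:{0..1}" for s
 proof -
  have "w (s, 0)=w (0, 0)" "w (s, 1)=w (0, 1)" by (auto simp: w_def)
  thus "h (s, 0)=p (a 0)" "h (s, 1)=p (a 1)" using h0[of 0] h0[of 1] by (auto simp: h_def)
 qed
 show ?thesis
  by (subst homotopic_with) (use hc h0 h1 he in \<open>auto intro!: exI[of _ h]\<close>)
qed

context
 fixes x e0 assumes x: "x:tsp P" and e0: "e0:tsp E" "p e0=x"
begin

definition lft :: "(real => 'p) => real => 'e" where
 "lft f=(SOME g. pathin E g & (ALL t:{0..1}. p (g t)=f t) & g 0=e0)"

text \<open>The deck transformation that takes \<open>e0\<close> to the end of the lifted loop,
  unique because the action is free.\<close>

definition dk :: "(real => 'p) => 'v" where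
 "dk f=(THE g. g:carrier G & act g e0=lft f 1)"

lemma lft:
 assumes "f:loops P x"
 shows "pathin E (lft f)" "!!t. t:{0..1} ==> p (lft f t)=f t" "lft f 0=e0"
proof -
 have "EX g. pathin E g & (ALL t:{0..1}. p (g t)=f t) & g 0=e0"
 proof -
  have "pathin P f" "p e0=f 0" using assms e0 by (auto simp: loops_def)
  from path_lift[OF cov this(1) e0(1) this(2)] show ?thesis by metis
 qed
 hence "pathin E (lft f) & (ALL t:{0..1}. p (lft f t)=f t) & lft f 0=e0"
  unfolding lft_def by (rule someI_ex)
 thus "pathin E (lft f)" "!!t. t:{0..1} ==> p (lft f t)=f t" "lft f 0=e0" by blast+
qed

lemma pathin_end: "pathin E g ==> t:{0..1} ==> g t:tsp E"
 unfolding pathin_def using cm_fun by fastforce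

lemma dk:
 assumes f: "f:loops P x" shows "dk f:carrier G" "act (dk f) e0=lft f 1"
proof -
 have "lft f 1:tsp E" using pathin_end[OF lft(1)[OF f]] by simp
 moreover have "p e0=p (lft f 1)" using lft(2)[OF f, of 1] e0 f by (simp add: loops_def)
 ultimately obtain g where g: "g:carrier G" "act g e0=lft f 1" using trans e0 by blast
 hence "dk f=g" unfolding dk_def using free e0 by (intro the_equality) auto
 thus "dk f:carrier G" "act (dk f) e0=lft f 1" using g by auto
qed

lemma dk_eqI:
 assumes f: "f:loops P x" and g: "pathin E g" "!!t. t:{0..1} ==> p (g t)=f t" "g 0=e0" "g 1=act d e0"
  and d: "d:carrier G"
 shows "dk f=d"
proof -
 have "g 1=lft f 1"
  by (rule path_lift_unique[OF cov g(1) lft(1)[OF f]]) (use g lft[OF f] in auto)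
 thus ?thesis using dk[OF f] g d free e0 by metis
qed

lemma dk_homotopic:
 assumes f: "f:loops P x" and f': "f':loops P x"
  and hom: "homotopic_with (%h. h 0=x & h 1=x) I01 P f f'"
 shows "dk f=dk f'"
proof -
 let ?I = "I01"
 obtain H where H: "cmap (prodt ?I ?I) P H" "!!t. H (0, t)=f t" "!!t. H (1, t)=f' t"
   "!!s. s:{0..1} ==> H (s, 0)=x & H (s, 1)=x"
  using hom unfolding homotopic_with_def by blast
 have "cmap ?I E (lft f)" using lft(1)[OF f] by (simp add: pathin_def)
 moreover have "!!t. t:tsp ?I ==> p (lft f t)=H (0, t)" using lft(2)[OF f] H(2) by simp
 ultimately obtain K where K: "cmap (prodt ?I ?I) E K"
   "!!s t. s:{0..1} ==> t:tsp ?I ==> p (K (s, t))=H (s, t)" "!!t. t:tsp ?I ==> K (0, t)=lft f t"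
  using homotopy_lifting[OF cov H(1)] by blast
 have side: "cmap ?I E (%s. K (s, t))" "cmap ?I E (%s. K (t, s))" if "t:{0..1}" for t
 proof -
  have "cmap ?I (prodt ?I ?I) (%s. (s, t))" "cmap ?I (prodt ?I ?I) (%s. (t, s))"
   by (rule continuous_map_pairedI; use that in simp)+
  from cmo[OF this(1) K(1)] cmo[OF this(2) K(1)]
  show "cmap ?I E (%s. K (s, t))" "cmap ?I E (%s. K (t, s))" by (simp_all add: o_def)
 qed
 have const: "K (1, t)=lft f t" if t: "t=0 | t=1" for t
 proof -
  have t01: "t:{0..1}" using t by auto
  have "lft f t:tsp E" using pathin_end[OF lft(1)[OF f] t01] .
  hence c: "cmap ?I E (%_. lft f t)" by simp
  show ?thesis
  proof (rule lift_unique[OF cov _ side(1)[OF t01] c, of 0])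
   show "p (K (s, t))=p (lft f t)" if "s:tsp ?I" for s
    using K(2)[of s t] lft(2)[OF f t01] H(4)[of s] t01 t that f by (auto simp: loops_def)
  qed (use K(3) t01 in \<open>auto simp: is_interval_1\<close>)
 qed
 have "dk f'=dk f"
 proof (rule dk_eqI[OF f'])
  show "pathin E (%t. K (1, t))" using side(2)[of 1] by (simp add: pathin_def)
  show "p (K (1, t))=f' t" if "t:{0..1}" for t using K(2)[of 1 t] H(3) that by simp
  show "K (1, 0)=e0" using const[of 0] lft(3)[OF f] by simp
  show "K (1, 1)=act (dk f) e0" using const[of 1] dk[OF f] by simp
  show "dk f:carrier G" using dk[OF f] by simp
 qed
 thus ?thesis by simp
qed

lemma loop_homotopy_iff:
 "(f, f'):loop_homotopy P x \<longleftrightarrow> f:loops P x & f':loops P x & dk f=dk f'"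
proof
 assume *: "f:loops P x & f':loops P x & dk f=dk f'"
 hence f: "f:loops P x" and f': "f':loops P x" by auto
 have e: "lft f 1=lft f' 1" "lft f 0=lft f' 0" using dk f f' * lft(3) by metis+
 have "homotopic_with (%h. h 0=p (lft f 0) & h 1=p (lft f 1)) I01 P (p o lft f) (p o lft f')"
  by (rule homotopy_rel_ends) (use lft(1) f f' e in auto)
 moreover have "p (lft f 0)=x" "p (lft f 1)=x" using lft(2)[OF f, of 0] lft(2)[OF f, of 1] f by (auto simp: loops_def)
 ultimately have "homotopic_with (%h. h 0=x & h 1=x) I01 P (p o lft f) (p o lft f')" by simp
 hence "homotopic_with (%h. h 0=x & h 1=x) I01 P f f'"
  by (rule homotopic_with_eq) (use lft(2) f f' in auto)
 thus "(f, f'):loop_homotopy P x" using f f' by (simp add: loop_homotopy_def)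
qed (auto simp: loop_homotopy_def dk_homotopic)

lemma path_join_loops: "f:loops P x ==> f':loops P x ==> path_join f f':loops P x"
 using pathin_path_join[of P f f'] by (auto simp: loops_def path_join_def)

text \<open>The lift of the second loop has to start where the first lift ends, so it is the
  standard lift translated by \<open>dk f\<close>. This is why the order of the factors is
  kept.\<close>

lemma dk_join:
 assumes f: "f:loops P x" and f': "f':loops P x"
 shows "dk (path_join f f')=dk f \<otimes> dk f'"
proof (rule dk_eqI[OF path_join_loops[OF f f']])
 let ?g = "path_join (lft f) (act (dk f) o lft f')"
 have "pathin E (act (dk f) o lft f')"
  using cmo[OF _ act_cont] dk[OF f] lft(1)[OF f'] unfolding pathin_def by blast
 thus "pathin E ?g"
  by (intro pathin_path_join lft(1)[OF f]) (use dk[OF f] lft(3)[OF f'] in auto)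
 have in': "lft f' t:tsp E" if "t:{0..1}" for t using pathin_end[OF lft(1)[OF f'] that] .
 show "p (?g t)=path_join f f' t" if "t:{0..1}" for t
  using that lft(2)[OF f, of "2 * t"] lft(2)[OF f', of "2 * t - 1"] p_act[OF dk(1)[OF f] in', of "2 * t - 1"]
  by (auto simp: path_join_def)
 show "?g 0=e0" using lft(3)[OF f] by (simp add: path_join_def)
 show "?g 1=act (dk f \<otimes> dk f') e0"
  using dk[OF f] dk[OF f'] e0 act_mult by (simp add: path_join_def)
 show "dk f \<otimes> dk f':carrier G" using dk(1)[OF f] dk(1)[OF f'] grp by (simp add: group.is_monoid monoid.m_closed)
qed

lemma dk_surj:
 assumes "g:carrier G" obtains f where "f:loops P x" "dk f=g"
proof -
 obtain a where a: "pathin E a" "a 0=e0" "a 1=act g e0"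
  using ccontractible_path[OF cc e0(1) act_in[OF assms e0(1)]] by blast
 have l: "p o a:loops P x"
  using pathin_p[OF a(1)] a e0 p_act[OF assms e0(1)] by (simp add: loops_def)
 show ?thesis by (rule that[OF l dk_eqI[OF l a(1)]]) (use a assms in auto)
qed

lemma fundamental_group_iso_at: "fundamental_group P x \<cong> G"
proof -
 let ?R = "loop_homotopy P x"
 define Py where "Py g={f:loops P x. dk f=g}" for g
 have im: "?R `` {f}=Py (dk f)" if "f:loops P x" for f
  using that by (auto simp: loop_homotopy_iff Py_def)
 have car: "loops P x // ?R=Py ` carrier G"
 proof
  show "loops P x // ?R <= Py ` carrier G" unfolding quotient_def using im dk(1) by auto
  show "Py ` carrier G <= loops P x // ?R"
  proof
   fix A assume "A:Py ` carrier G"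
   then obtain g where g: "g:carrier G" "A=Py g" by blast
   obtain f where "f:loops P x" "dk f=g" using dk_surj[OF g(1)] by blast
   thus "A:loops P x // ?R" using im g(2) unfolding quotient_def by blast
  qed
 qed
 have "Py:iso G (fundamental_group P x)"
 proof (rule isoI)
  show "Py:hom G (fundamental_group P x)"
  proof (rule homI)
   fix g h assume g: "g:carrier G" and h: "h:carrier G"
   obtain f where f: "f:loops P x" "dk f=g" using dk_surj[OF g] by blast
   obtain f' where f': "f':loops P x" "dk f'=h" using dk_surj[OF h] by blast
   have "?R `` {path_join a b | a b. a:Py g & b:Py h}=Py (g \<otimes> h)"
   proof
    show "?R `` {path_join a b | a b. a:Py g & b:Py h} <= Py (g \<otimes> h)"
     using dk_join by (auto simp: loop_homotopy_iff Py_def)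
    have "path_join f f':{path_join a b | a b. a:Py g & b:Py h}"
     using f f' by (auto simp: Py_def)
    moreover have "?R `` {path_join f f'}=Py (g \<otimes> h)"
     using im[OF path_join_loops[OF f(1) f'(1)]] dk_join[OF f(1) f'(1)] f f' by simp
    ultimately show "Py (g \<otimes> h) <= ?R `` {path_join a b | a b. a:Py g & b:Py h}" by blast
   qed
   thus "Py (g \<otimes> h)=Py g \<otimes>\<^bsub>fundamental_group P x\<^esub> Py h"
    by (simp add: fundamental_group_def)
  qed (simp add: fundamental_group_def car)
  show "bij_betw Py (carrier G) (carrier (fundamental_group P x))"
   unfolding bij_betw_def
  proof
   show "inj_on Py (carrier G)"
   proof (rule inj_onI)
    fix g h assume "g:carrier G" "h:carrier G" "Py g=Py h"
    obtain f where "f:loops P x" "dk f=g" using dk_surj[OF \<open>g : carrier G\<close>] by blast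
    hence "f:Py h" using \<open>Py g = Py h\<close> by (auto simp: Py_def)
    thus "g=h" using \<open>dk f = g\<close> by (simp add: Py_def)
   qed
  qed (simp add: fundamental_group_def car)
 qed
 hence "G \<cong> fundamental_group P x" by (auto simp: is_iso_def)
 thus ?thesis by (rule group.iso_sym[OF grp])
qed

end

lemma classifying_space_P:
 assumes "G \<cong> H" "tsp P ~= {}"
 shows "classifying_space H P"
 unfolding classifying_space_def
proof (intro conjI ballI allI impI)
 show "tsp P ~= {}" by fact
 show "path_connected_space P" by (rule path_connected_P)
next
 fix x assume x: "x:tsp P"
 then obtain e where "e:tsp E" "p e=x" using surj by (metis imageE)
 hence "fundamental_group P x \<cong> G" using fundamental_group_iso_at x by blast
 thus "fundamental_group P x \<cong> H" using iso_trans assms(1) by blast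
next
 fix k f assume "(2::nat) <= k" "cmap (nS k) P f"
 thus "EX c. homotopic_with (%_. True) (nS k) P f (%_. c)"
  using sphere_null[OF cov surj cc] by blast
qed

end

section \<open>Attaching cells: separation, compactness and collars\<close>

definition nrm :: "nat => (nat => real) => real" where
 "nrm n x=sqrt (SUM i<n. (x i)\<^sup>2)"

definition unitv :: "nat => (nat => real) => nat => real" where
 "unitv n x=(%i. x i / nrm n x)"

lemma tsp_ndisc_nrm: "tsp (ndisc n)={x. nrm n x <= 1 & (ALL i>=n. x i=0)}"
 by (simp add: tsp_ndisc nrm_def)

lemma open_disc_nrm: "odisc n={x. nrm n x < 1 & (ALL i>=n. x i=0)}"
 by (auto simp: open_disc_def tsp_ndisc_nrm) (auto simp: nrm_def)

lemma open_disc_subset: "odisc n <= tsp (ndisc n)"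
 by (simp add: open_disc_def)

lemma topspace_nsphere_nrm: "n > 0 ==> tsp (nS (n - 1))={x. nrm n x=1 & (ALL i>=n. x i=0)}"
 by (cases n) (auto simp: tsp_nS nrm_def lessThan_Suc_atMost Suc_le_eq)

lemmas sphere_nrm = topspace_nsphere_nrm topspace_nsphere_nrm[unfolded One_nat_def]

lemma unitv_sphere:
 assumes "n > 0" "x:tsp (ndisc n)" "nrm n x > 0" shows "unitv n x:tsp (nS (n - 1))"
proof -
 have "(SUM i<n. (x i / nrm n x)\<^sup>2)=(SUM i<n. (x i)\<^sup>2) / (nrm n x)\<^sup>2"
  by (simp add: power_divide sum_divide_distrib)
 also have "... = 1" using assms(3) by (simp add: nrm_def sum_nonneg)
 finally have "(SUM i<n. (unitv n x i)\<^sup>2)=1" by (simp add: unitv_def)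
 hence "nrm n (unitv n x)=1" using nrm_def[of n "unitv n x"] by simp
 thus ?thesis using assms by (auto simp: sphere_nrm tsp_ndisc_nrm unitv_def)
qed

lemma unitv_id: "n > 0 ==> x:tsp (nS (n - 1)) ==> unitv n x=x"
 by (auto simp: sphere_nrm unitv_def)

lemma sphere_subset_disc: "n > 0 ==> tsp (nS (n - 1)) <= tsp (ndisc n)"
 by (auto simp: sphere_nrm tsp_ndisc_nrm)

lemma sphere_subtopology: "n > 0 ==> nS (n - 1)=subt (ndisc n) (tsp (nS (n - 1)))"
 using sphere_subset_disc[of n]
 by (cases n) (auto simp: nsphere ndisc_alt subtopology_subtopology lessThan_Suc_atMost Suc_le_eq intro!: arg_cong[where f = "subt (powertop_real UNIV)"])

lemma continuous_map_ndisc_proj: "cmap (ndisc n) eur (%x. x i)"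
 unfolding ndisc_alt by (intro cm_from continuous_map_product_projection) simp

lemma continuous_map_nrm: "cmap (ndisc n) eur (nrm n)"
 unfolding nrm_def
 by (intro continuous_map_sqrt continuous_map_sum continuous_map_real_pow continuous_map_ndisc_proj) simp

lemma continuous_map_unitv:
 assumes "n > 0"
 shows "cmap (subt (ndisc n) {x. nrm n x > 0}) (nS (n - 1)) (unitv n)"
proof -
 let ?X = "subt (ndisc n) {x. nrm n x > 0}"
 have "cmap ?X eur (%x. x i / nrm n x)" for i
  by (intro continuous_map_real_divide cm_from continuous_map_ndisc_proj continuous_map_nrm) auto
 hence c: "cmap ?X (powertop_real UNIV) (unitv n)"
  by (simp add: cm_comp unitv_def)
 have "unitv n x:tsp (nS (n - 1))" if "x:tsp ?X" for x
  using that unitv_sphere[OF assms] by auto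
 thus ?thesis using c unfolding nsphere cm_into by auto
qed

lemma openin_nrm:
 "openin (ndisc n) {x:tsp (ndisc n). nrm n x < r}" "openin (ndisc n) {x:tsp (ndisc n). nrm n x > r}"
proof -
 have "openin (ndisc n) {x:tsp (ndisc n). nrm n x:{..<r}}" "openin (ndisc n) {x:tsp (ndisc n). nrm n x:{r<..}}"
  by (rule open_pre[OF continuous_map_nrm]; simp)+
 thus "openin (ndisc n) {x:tsp (ndisc n). nrm n x < r}" "openin (ndisc n) {x:tsp (ndisc n). nrm n x > r}" by simp_all
qed

locale glued =
 fixes A :: "'p topology" and n :: nat and Ph :: "((nat => real) => 'p) set"
 assumes n: "n > 0"
  and cont: "ph:Ph ==> cmap (nS (n - 1)) A ph"
  and inj: "[|ph:Ph; py:Ph; x:odisc n; y:odisc n; ph x=py y|] ==> ph=py & x=y"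
  and new: "[|ph:Ph; x:odisc n|] ==> ph x ~: tsp A"
begin

abbreviation "B == glue A n Ph"
abbreviation "D == tsp (ndisc n)"

lemma top_B: "tsp B=tsp A Un (UN ph:Ph. ph ` D)"
 by (rule topspace_glue) (use cont n new in auto)

lemma openin_B:
 "openin B U \<longleftrightarrow> U <= tsp B & openin A (U Int tsp A) & (ALL ph:Ph. openin (ndisc n) {x:D. ph x:U})"
 unfolding openin_glue top_B ..

lemma phi_sphere: "ph:Ph ==> x:tsp (nS (n - 1)) ==> ph x:tsp A"
 using cm_fun[OF cont] by auto

lemma phi_in_A: "ph:Ph ==> x:D ==> ph x:tsp A \<longleftrightarrow> x ~: odisc n"
 using new phi_sphere disc_boundary[OF n] by blast

lemma top_B_cases:
 assumes "y:tsp B"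
 obtains "y:tsp A" | ph x where "ph:Ph" "x:odisc n" "y=ph x" "y ~: tsp A"
 using assms phi_in_A unfolding top_B by blast

lemma continuous_phi: "ph:Ph ==> cmap (ndisc n) B ph"
 unfolding continuous_map_def using openin_B top_B by auto

lemma continuous_A: "cmap A B id"
 unfolding continuous_map_def
proof (intro conjI allI impI)
 show "id:tsp A \<rightarrow> tsp B" by (simp add: top_B)
 fix U assume "openin B U"
 hence "openin A (U Int tsp A)" by (simp add: openin_B)
 thus "openin A {x:tsp A. id x:U}" by (simp add: Int_def conj_commute)
qed

lemma continuous_map_B:
 assumes "cmap A Z f" and "!!ph. ph:Ph ==> cmap (ndisc n) Z (f o ph)"
 shows "cmap B Z f"
 unfolding continuous_map_def
proof (intro conjI allI impI)
 show "f:tsp B \<rightarrow> tsp Z"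
  using cm_fun[OF assms(1)] cm_fun[OF assms(2)] unfolding top_B by fastforce
 fix U assume U: "openin Z U"
 have "{x:tsp B. f x:U} Int tsp A={x:tsp A. f x:U}" unfolding top_B by auto
 moreover have "{x:D. ph x:{x:tsp B. f x:U}}={x:D. (f o ph) x:U}" if "ph:Ph" for ph
  unfolding top_B using that by auto
 ultimately show "openin B {x:tsp B. f x:U}"
  unfolding openin_B
  using open_pre[OF assms(1) U] open_pre[OF assms(2) U] by auto
qed

lemma closedin_B:
 assumes "C <= tsp B" "closedin A (C Int tsp A)" "!!ph. ph:Ph ==> closedin (ndisc n) {x:D. ph x:C}"
 shows "closedin B C"
 unfolding closedin_def
proof
 have "(tsp B - C) Int tsp A=tsp A - C Int tsp A" unfolding top_B by auto
 hence 1: "openin A ((tsp B - C) Int tsp A)" using assms(2) by (simp add: closedin_def)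
 have "{x:D. ph x:tsp B - C}=D - {x:D. ph x:C}" if "ph:Ph" for ph
  using that unfolding top_B by auto
 hence "ALL ph:Ph. openin (ndisc n) {x:D. ph x:tsp B - C}" using assms(3) by (simp add: closedin_def)
 thus "openin B (tsp B - C)" unfolding openin_B using 1 by blast
qed fact

lemma closedin_A_B:
 assumes C: "closedin A C" shows "closedin B C"
proof (rule closedin_B)
 have sub: "C <= tsp A" using C closedin_subset by blast
 thus "C <= tsp B" unfolding top_B by blast
 show "closedin A (C Int tsp A)" using C sub by (simp add: Int_absorb2)
 fix ph assume ph: "ph:Ph"
 have "{x:D. ph x:C}={x:tsp (nS (n - 1)). ph x:C}"
  using phi_in_A[OF ph] sub disc_boundary[OF n] sphere_subset_disc[OF n] by blast
 moreover have "closedin (nS (n - 1)) {x:tsp (nS (n - 1)). ph x:C}"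
  by (rule closed_pre[OF cont[OF ph] C])
 moreover have "closedin (ndisc n) (tsp (nS (n - 1)))"
 proof -
  have "D - tsp (nS (n - 1))={x:D. nrm n x < 1}"
   by (auto simp: sphere_nrm[OF n] tsp_ndisc_nrm)
  thus ?thesis using openin_nrm(1) sphere_subset_disc[OF n] by (simp add: closedin_def)
 qed
 ultimately show "closedin (ndisc n) {x:D. ph x:C}"
  using closedin_trans_full sphere_subtopology[OF n] by metis
qed

lemma subtopology_A: "subt B (tsp A)=A"
proof (rule topology_eq[THEN iffD2], intro allI)
 fix U
 show "openin (subt B (tsp A)) U \<longleftrightarrow> openin A U"
 proof
  assume "openin (subt B (tsp A)) U"
  then obtain W where "openin B W" "U=W Int tsp A" unfolding openin_subtopology by blast
  thus "openin A U" by (simp add: openin_B)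
 next
  assume U: "openin A U"
  have "closedin B (tsp A - U)" using U by (intro closedin_A_B) auto
  hence "openin B (tsp B - (tsp A - U))" by blast
  moreover have "U=(tsp B - (tsp A - U)) Int tsp A"
   using openin_subset[OF U] unfolding top_B by blast
  ultimately show "openin (subt B (tsp A)) U" unfolding openin_subtopology by blast
 qed
qed

text \<open>The radial collar: a point of a disc other than the centre belongs to it if its radial
  projection to the boundary sphere is mapped into \<open>W\<close>. Open sets of the skeleton are
  thickened in a way that preserves disjointness and, in the Cayley complex, injectivity of the
  projection.\<close>

definition ext :: "'p set => 'p set" where
 "ext W=W Un (UN ph:Ph. ph ` {x:D. nrm n x > 0 & ph (unitv n x):W})"

lemma phi_ext:
 assumes "W <= tsp A" "ph:Ph" "x:D"
 shows "ph x:ext W \<longleftrightarrow> nrm n x > 0 & ph (unitv n x):W"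
proof (cases "x:odisc n")
 case True
 show ?thesis
 proof
  assume "ph x:ext W"
  moreover have "ph x ~: W" using new[OF assms(2) True] assms(1) by blast
  ultimately obtain py y where y: "py:Ph" "y:D" "nrm n y > 0" "py (unitv n y):W" "ph x=py y"
   unfolding ext_def by blast
  have "y:odisc n" using phi_in_A[OF y(1,2)] new[OF assms(2) True] y(5) by simp
  thus "nrm n x > 0 & ph (unitv n x):W" using inj[OF assms(2) y(1) True _ y(5)] y by auto
 qed (use assms in \<open>auto simp: ext_def\<close>)
next
 case False
 hence s: "x:tsp (nS (n - 1))" using disc_boundary[OF n assms(3)] by blast
 hence u: "unitv n x=x" "nrm n x=1" using unitv_id[OF n] sphere_nrm[OF n] by auto
 show ?thesis
 proof
  assume "ph x:ext W"
  moreover have "ph x:tsp A" using phi_sphere[OF assms(2) s] .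
  ultimately consider "ph x:W" | py y where "py:Ph" "y:D" "py (unitv n y):W" "ph x=py y" "y ~: odisc n"
   unfolding ext_def using new by fastforce
  thus "nrm n x > 0 & ph (unitv n x):W"
  proof cases
   case 2
   hence "y:tsp (nS (n - 1))" using disc_boundary[OF n] by blast
   thus ?thesis using 2 u unitv_id[OF n] by simp
  qed (use u in simp)
 qed (use u in \<open>auto simp: ext_def\<close>)
qed

lemma ext_A: "W <= tsp A ==> y:tsp A ==> y:ext W \<longleftrightarrow> y:W"
proof
 assume W: "W <= tsp A" and y: "y:tsp A" "y:ext W"
 then consider "y:W" | ph x where "ph:Ph" "x:D" "y=ph x" unfolding ext_def by blast
 thus "y:W"
 proof cases
  case 2
  hence "x ~: odisc n" using phi_in_A y by blast
  hence "unitv n x=x" using disc_boundary[OF n] 2 unitv_id[OF n] by blast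
  thus ?thesis using phi_ext[OF W 2(1,2)] y 2 by simp
 qed
qed (simp add: ext_def)

lemma ext_subset: "W <= tsp A ==> ext W <= tsp B"
 unfolding ext_def top_B by blast

lemma openin_ext:
 assumes W: "openin A W" shows "openin B (ext W)"
 unfolding openin_B
proof (intro conjI ballI)
 have sub: "W <= tsp A" using W openin_subset by blast
 show "ext W <= tsp B" using ext_subset[OF sub] .
 have "ext W Int tsp A=W" using ext_A[OF sub] sub by blast
 thus "openin A (ext W Int tsp A)" using W by simp
 fix ph assume ph: "ph:Ph"
 let ?X = "subt (ndisc n) {x. nrm n x > 0}"
 have "cmap ?X A (ph o unitv n)" using cmo[OF continuous_map_unitv[OF n] cont[OF ph]] .
 hence "openin ?X {x:tsp ?X. (ph o unitv n) x:W}" using open_pre W by blast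
 moreover have "openin (ndisc n) (D Int {x. nrm n x > 0})" using openin_nrm(2)[of n 0] by (simp add: Collect_conj_eq)
 hence "?X=subt (ndisc n) (D Int {x. nrm n x > 0})" by (metis subtopology_restrict)
 moreover have "{x:tsp ?X. (ph o unitv n) x:W}={x:D. ph x:ext W}"
  using phi_ext[OF sub ph] by auto
 ultimately show "openin (ndisc n) {x:D. ph x:ext W}"
  using openin_trans_full \<open>openin (ndisc n) (D Int {x. nrm n x > 0})\<close> by metis
qed

lemma openin_cell:
 assumes ph: "ph:Ph" and W: "openin (ndisc n) W" "W <= odisc n"
 shows "openin B (ph ` W)"
 unfolding openin_B
proof (intro conjI ballI)
 show "ph ` W <= tsp B" using ph W(2) open_disc_subset unfolding top_B by blast
 have "ph ` W Int tsp A={}" using new ph W(2) by blast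
 thus "openin A (ph ` W Int tsp A)" by simp
 fix py assume py: "py:Ph"
 have *: "ph=py & x:W" if xD: "x:D" and xW: "py x:ph ` W" for x
 proof -
  obtain y where y: "y:W" "py x=ph y" using xW by blast
  hence "x:odisc n" using phi_in_A[OF py xD] new[OF ph] W(2) by auto
  thus ?thesis using inj[OF py ph _ _ y(2)] y W(2) by blast
 qed
 show "openin (ndisc n) {x:D. py x:ph ` W}"
 proof (cases "ph=py")
  case True
  hence "{x:D. py x:ph ` W}=W" using * W(2) open_disc_subset by blast
  thus ?thesis using W by simp
 next
  case False
  hence "{x:D. py x:ph ` W}={}" using * by blast
  thus ?thesis by (simp only: openin_empty)
 qed
qed

lemma openin_open_disc: "openin (ndisc n) (odisc n)"
proof -
 have "odisc n={x:D. nrm n x < 1}" by (auto simp: open_disc_nrm tsp_ndisc_nrm)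
 thus ?thesis using openin_nrm(1) by simp
qed

text \<open>Points of the skeleton are separated by collars, points of one cell within that cell,
  and a cell point is separated from the skeleton by a smaller concentric disc.\<close>

lemma Hausdorff_B:
 assumes A: "Hausdorff_space A" shows "Hausdorff_space B"
 unfolding Hausdorff_space_def
proof (intro allI impI)
 fix x y assume *: "x:tsp B & y:tsp B & x ~= y"
 have cellA: "EX U V. openin B U & openin B V & ph v:U & y:V & disjnt U V"
  if ph: "ph:Ph" and v: "v:odisc n" and y: "y:tsp A" for ph v y
 proof -
  define r where "r=(nrm n v + 1) / 2"
  have r: "nrm n v < r" "r < 1" using v by (auto simp: r_def open_disc_nrm)
  let ?U = "ph ` {x:D. nrm n x < r}" and ?C = "ph ` {x:D. nrm n x <= r}"
  have sub: "{x:D. nrm n x <= r} <= odisc n" using r by (auto simp: open_disc_nrm tsp_ndisc_nrm)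
  have "openin B ?U" using openin_cell[OF ph openin_nrm(1)] sub by force
  moreover have "closedin B ?C"
  proof (rule closedin_B)
   show "?C <= tsp B" using ph unfolding top_B by blast
   have "?C Int tsp A={}" using new[OF ph] sub by blast
   thus "closedin A (?C Int tsp A)" by simp
   fix py assume py: "py:Ph"
   have *: "ph=py & nrm n x <= r" if xD: "x:D" and xC: "py x:?C" for x
   proof -
    obtain z where z: "z:D" "nrm n z <= r" "py x=ph z" using xC by blast
    hence zo: "z:odisc n" using sub by blast
    hence "x:odisc n" using phi_in_A[OF py xD] new[OF ph zo] z(3) by simp
    thus ?thesis using inj[OF py ph _ zo z(3)] z by blast
   qed
   show "closedin (ndisc n) {x:D. py x:?C}"
   proof (cases "ph=py")
    case True
    hence "{x:D. py x:?C}={x:D. nrm n x <= r}" using * by blast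
    moreover have "D - {x:D. nrm n x <= r}={x:D. nrm n x > r}" by auto
    ultimately show ?thesis using openin_nrm(2)[of n r] by (simp add: closedin_def)
   next
    case False
    hence "{x:D. py x:?C}={}" using * by blast
    thus ?thesis by (simp only: closedin_empty)
   qed
  qed
  moreover have "ph v:?U" using v r open_disc_subset by blast
  moreover have "y:tsp B - ?C" using y new[OF ph] sub unfolding top_B by blast
  moreover have "disjnt ?U (tsp B - ?C)" unfolding disjnt_def by force
  ultimately show ?thesis by blast
 qed
 have "x:tsp B" "y:tsp B" "x ~= y" using * by auto
 thus "EX U V. openin B U & openin B V & x:U & y:V & disjnt U V"
 proof (cases x rule: top_B_cases)
  case 1
  from \<open>y : tsp B\<close> show ?thesis
  proof (cases y rule: top_B_cases)
   case 1
   obtain U V where UV: "openin A U" "openin A V" "x:U" "y:V" "disjnt U V"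
    using A \<open>x : tsp A\<close> \<open>y : tsp A\<close> \<open>x ~= y\<close> unfolding Hausdorff_space_def by blast
   have sub: "U <= tsp A" "V <= tsp A" using UV openin_subset by blast+
   have "disjnt (ext U) (ext V)"
    unfolding disjnt_iff
   proof (intro allI notI)
    fix z assume z: "z:ext U & z:ext V"
    hence "z:tsp B" using ext_subset[OF sub(1)] by blast
    thus False
    proof (cases z rule: top_B_cases)
     case 1 thus ?thesis using z ext_A[OF sub(1)] ext_A[OF sub(2)] UV(5) by (auto simp: disjnt_iff)
    next
     case (2 ph v)
     hence "v:D" using open_disc_subset by blast
     thus ?thesis using z 2 phi_ext[OF sub(1)] phi_ext[OF sub(2)] UV(5) by (auto simp: disjnt_iff)
    qed
   qed
   moreover have "x:ext U" "y:ext V" using UV by (auto simp: ext_def)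
   ultimately show ?thesis using openin_ext UV(1,2) by blast
  next
   case (2 ph v)
   thus ?thesis using cellA[OF 2(1,2) \<open>x : tsp A\<close>] by (metis disjnt_sym)
  qed
 next
  case (2 ph v)
  note x = this
  from \<open>y : tsp B\<close> show ?thesis
  proof (cases y rule: top_B_cases)
   case 1 thus ?thesis using cellA[OF x(1,2) 1] x(3) by blast
  next
   case (2 py u)
   show ?thesis
   proof (cases "ph=py")
    case True
    hence "v ~= u" using x 2 \<open>x ~= y\<close> by blast
    moreover have "v:D" "u:D" using x(2) 2(2) open_disc_subset by blast+
    ultimately obtain U V where UV: "openin (ndisc n) U" "openin (ndisc n) V" "v:U" "u:V" "disjnt U V"
     using Hausdorff_space_ndisc[of n] unfolding Hausdorff_space_def by blast
    have op: "openin (ndisc n) (U Int odisc n)" "openin (ndisc n) (V Int odisc n)"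
     using UV openin_open_disc by blast+
    have "disjnt (ph ` (U Int odisc n)) (ph ` (V Int odisc n))"
     unfolding disjnt_iff
    proof (intro allI notI)
     fix z assume "z:ph ` (U Int odisc n) & z:ph ` (V Int odisc n)"
     then obtain a b where ab: "a:U" "a:odisc n" "b:V" "b:odisc n" "ph a=ph b" by auto
     hence "a=b" using inj[OF x(1) x(1) ab(2) ab(4)] by blast
     thus False using ab UV(5) by (auto simp: disjnt_iff)
    qed
    thus ?thesis
     using openin_cell[OF x(1) op(1)] openin_cell[OF x(1) op(2)] x 2 UV True by blast
   next
    case False
    have "disjnt (ph ` odisc n) (py ` odisc n)"
     unfolding disjnt_iff using inj[OF x(1) 2(1)] False by blast
    thus ?thesis
     using openin_cell[OF x(1) openin_open_disc] openin_cell[OF 2(1) openin_open_disc] x 2 by blast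
   qed
  qed
 qed
qed

text \<open>One point is chosen in each open cell that meets \<open>C\<close>. Each disc meets this
  set in at most one point, so all its subsets are closed; it is compact and discrete, hence
  finite.\<close>

lemma compactin_finitely_many_cells:
 assumes C: "compactin B C"
 shows "finite {ph:Ph. ph ` odisc n Int C ~= {}}"
proof -
 define F where "F={ph:Ph. ph ` odisc n Int C ~= {}}"
 have F: "ph:Ph" if "ph:F" for ph using that by (simp add: F_def)
 have "ALL ph:F. EX v. v:odisc n & ph v:C" unfolding F_def by blast
 then obtain v where v0: "ALL ph:F. v ph:odisc n & ph (v ph):C" by metis
 have v: "v ph:odisc n" "ph (v ph):C" if "ph:F" for ph using v0 that by blast+
 let ?g = "%ph. ph (v ph)"
 have injg: "inj_on ?g F"
 proof (rule inj_onI)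
  fix ph py assume *: "ph:F" "py:F" "?g ph=?g py"
  show "ph=py"
   using inj[of ph py "v ph" "v py"] v(1)[OF *(1)] v(1)[OF *(2)] F[OF *(1)] F[OF *(2)] *(3) by blast
 qed
 have cl: "closedin B T" if T: "T <= ?g ` F" for T
 proof (rule closedin_B)
  have "?g ` F <= tsp B"
  proof
   fix y assume "y:?g ` F"
   then obtain ph where "ph:F" "y=ph (v ph)" by blast
   thus "y:tsp B" using v(1) F open_disc_subset unfolding top_B by blast
  qed
  thus "T <= tsp B" using T by blast
  have "ph (v ph) ~: tsp A" if "ph:F" for ph using new[OF F[OF that] v(1)[OF that]] .
  hence "T Int tsp A={}" using T by blast
  thus "closedin A (T Int tsp A)" by simp
  fix py assume py: "py:Ph"
  have "{x:D. py x:T} <= {v py}"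
  proof
   fix x assume "x:{x:D. py x:T}"
   then obtain ph where ph: "x:D" "ph:F" "py x=ph (v ph)" using T by blast
   hence "x:odisc n" using phi_in_A[OF py ph(1)] new[OF F[OF ph(2)] v(1)[OF ph(2)]] ph(3) by simp
   thus "x:{v py}" using inj[OF py F[OF ph(2)] _ v(1)[OF ph(2)] ph(3)] by blast
  qed
  hence "finite {x:D. py x:T}" using finite_subset by blast
  moreover have "t1_space (ndisc n)" using Hausdorff_space_ndisc Hausdorff_imp_t1_space by blast
  ultimately show "closedin (ndisc n) {x:D. py x:T}"
   using t1_space_closedin_finite by blast
 qed
 have "compactin B (?g ` F)" by (rule closed_compactin[OF C]) (use v(2) cl in auto)
 hence comp: "compact_space (subt B (?g ` F))" by (rule cpt_sub)
 have "subt B (?g ` F)=dtop (?g ` F)"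
 proof (rule topology_eq[THEN iffD2], intro allI)
  fix U
  show "openin (subt B (?g ` F)) U \<longleftrightarrow> openin (dtop (?g ` F)) U"
  proof
   assume "openin (dtop (?g ` F)) U"
   hence U: "U <= ?g ` F" by simp
   have "openin B (tsp B - (?g ` F - U))" using cl[of "?g ` F - U"] by blast
   moreover have "U=(tsp B - (?g ` F - U)) Int ?g ` F"
    using U cl[OF order_refl] closedin_subset by blast
   ultimately show "openin (subt B (?g ` F)) U" unfolding openin_subtopology by blast
  qed (auto simp: openin_subtopology)
 qed
 hence "finite (?g ` F)" using comp compact_space_discrete_topology by metis
 thus ?thesis using injg finite_imageD unfolding F_def by blast
qed

end

declare One_nat_def [simp del]

section \<open>Loops on the circle and piecewise paths\<close>

definition circ :: "real => nat => real" where
 "circ s=(%i. if i=0 then cos (2 * pi * s) else if i=1 then sin (2 * pi * s) else 0)"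

definition ang :: "(nat => real) => real" where
 "ang v=Arg2pi (Complex (v 0) (v 1)) / (2 * pi)"

lemma topspace_circle: "tsp (nS 1)={v. (v 0)\<^sup>2 + (v 1)\<^sup>2=1 & (ALL i>=2. v i=0)}"
proof -
 have "(ALL i>1. v i=0) \<longleftrightarrow> (ALL i>=2. v i=0)" for v :: "nat => real"
  by (metis Suc_1 Suc_le_eq)
 moreover have "(SUM i<=1. v i ^ 2)=(v 0)\<^sup>2 + (v 1)\<^sup>2" for v :: "nat => real"
  by (simp add: One_nat_def)
 ultimately show ?thesis by (simp add: tsp_nS)
qed

lemma circ_sphere [simp]: "circ s:tsp (nS 1)"
 by (simp add: topspace_circle circ_def del: One_nat_def)

lemma ang_range: "0 <= ang v" "ang v < 1"
 using Arg2pi_ge_0[of "Complex (v 0) (v 1)"] Arg2pi_lt_2pi[of "Complex (v 0) (v 1)"]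
 by (auto simp: ang_def divide_less_eq)

lemma ang_circ: "0 <= s ==> s < 1 ==> ang (circ s)=s"
proof -
 assume s: "0 <= s" "s < 1"
 have "Arg2pi (Complex (circ s 0) (circ s 1))=2 * pi * s"
  by (rule Arg2pi_unique[of 1]) (use s in \<open>auto simp: circ_def complex_eq_iff Re_exp Im_exp\<close>)
 thus ?thesis by (simp add: ang_def)
qed

lemma circ_1: "circ 1=circ 0"
 by (auto simp: circ_def)

lemma circ_ang: "v:tsp (nS 1) ==> circ (ang v)=v"
proof -
 assume v: "v:tsp (nS 1)"
 let ?z = "Complex (v 0) (v 1)"
 have "cmod ?z=1" using v by (simp add: topspace_circle cmod_def)
 hence "cos (Arg2pi ?z)=v 0" "sin (Arg2pi ?z)=v 1"
  using cos_Arg2pi[of ?z] sin_Arg2pi[of ?z] by simp_all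
 thus ?thesis using v by (auto simp: circ_def ang_def topspace_circle fun_eq_iff)
qed

lemma continuous_map_circ: "cmap I01 (nS 1) circ"
proof -
 have "cmap I01 eur (%s. circ s i)" for i
  by (cases "i=0"; cases "i=1") (auto simp: circ_def intro!: continuous_intros)
 hence "cmap I01 (powertop_real UNIV) circ"
  by (simp add: cm_comp)
 thus ?thesis
  using circ_sphere unfolding nsphere[of 1] cm_into by auto
qed

lemma quotient_map_circ: "quotient_map I01 (nS 1) circ"
proof (intro continuous_closed_imp_quotient_map continuous_imp_closed_map continuous_map_circ Hausdorff_space_nsphere)
 show "compact_space I01" by (simp add: cpt_sub)
 show "circ ` tsp I01=tsp (nS 1)"
 proof
  show "tsp (nS 1) <= circ ` tsp I01"
  proof
   fix v assume "v:tsp (nS 1)"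
   hence "v=circ (ang v)" using circ_ang by simp
   thus "v:circ ` tsp I01"
    using ang_range[of v] by (intro image_eqI[of _ _ "ang v"]) auto
  qed
 qed (use circ_sphere in auto)
qed

lemma continuous_map_circle:
 assumes W: "cmap I01 X W" "W 0=W 1"
 shows "cmap (nS 1) X (%v. W (ang v))"
proof (rule continuous_compose_quotient_map[OF quotient_map_circ])
 have "((%v. W (ang v)) o circ) s=W s" if "s:{0..1}" for s
  using that ang_circ[of s] ang_circ[of 0] W(2) circ_1 by (cases "s=1") auto
 thus "cmap I01 X ((%v. W (ang v)) o circ)"
  by (intro continuous_map_eq[OF W(1)]) auto
qed

text \<open>At s = 1 the floor is already n, one past the last piece, so that value is taken from
  the end of piece n - 1.\<close>

lemma continuous_map_pieces:
 fixes f :: "nat => real => 'p"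
 assumes n: "n > 0" and f: "!!i. i < n ==> cmap I01 X (f i)"
  and ff: "!!i. Suc i < n ==> f i 1=f (Suc i) 0"
 shows "cmap I01 X
  (%s. if s=1 then f (n - 1) 1 else f (nat \<lfloor>real n * s\<rfloor>) (frac (real n * s)))" (is "cmap _ X ?g")
proof (rule pasting_lemma_closed[where I = "{..<n}" and T = "%i. {real i / n..(real i + 1) / n}"
   and f = "%i s. f i (real n * s - real i)"])
 show "finite {..<n}" by simp
next
 fix i assume "i:{..<n}"
 hence i: "i < n" by simp
 have sub: "{real i / n..(real i + 1) / n} <= {0..1}" using i n by (auto simp: field_simps)
 thus "closedin I01 {real i / n..(real i + 1) / n}"
  by (rule closed_subset) simp
 have "cmap (top_of_set {real i / n..(real i + 1) / n}) I01 (%s. real n * s - real i)"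
  using n by (auto simp: cm_into field_simps intro!: continuous_intros)
 from cmo[OF this f[OF i]]
 have "cmap (top_of_set {real i / n..(real i + 1) / n}) X (%s. f i (real n * s - real i))"
  by (simp add: o_def)
 moreover have "subt I01 {real i / n..(real i + 1) / n}=top_of_set {real i / n..(real i + 1) / n}"
  unfolding subtopology_subtopology Int_absorb1[OF sub] ..
 ultimately show "cmap (subt I01 {real i / n..(real i + 1) / n}) X (%s. f i (real n * s - real i))"
  by simp
next
 have *: "f i (real n * x - real i)=f j (real n * x - real j)"
  if ij: "i < j" "j < n" and x: "x:{real i / n..(real i + 1) / n}" "x:{real j / n..(real j + 1) / n}" for i j x
 proof -
  have "real j <= real n * x" "real n * x <= real i + 1" using x n by (auto simp: field_simps)
  hence "j=Suc i" "real n * x=real j" using ij by linarith+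
  thus ?thesis using ff[of i] ij by simp
 qed
 fix i j x assume "i:{..<n}" "j:{..<n}"
  "x:tsp I01 Int {real i / n..(real i + 1) / n} Int {real j / n..(real j + 1) / n}"
 hence "i < n" "j < n" "x:{real i / n..(real i + 1) / n}" "x:{real j / n..(real j + 1) / n}" by simp_all
 thus "f i (real n * x - real i)=f j (real n * x - real j)"
 proof (cases i j rule: linorder_cases)
  case less
  thus ?thesis by (rule *) fact+
 next
  case greater
  thus ?thesis by (rule *[symmetric]) fact+
 qed (rule arg_cong2[where f = f], simp_all)
next
 fix x :: real assume "x:tsp I01"
 hence x: "0 <= x" "x <= 1" by auto
 show "EX j. j:{..<n} & x:{real j / n..(real j + 1) / n} & ?g x=f j (real n * x - real j)"
 proof (cases "x=1")
  case True
  have r: "real (n - 1)=real n - 1" using n by simp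
  have "n - 1:{..<n}" "x:{real (n - 1) / n..(real (n - 1) + 1) / n}" "?g x=f (n - 1) (real n * x - real (n - 1))"
   unfolding r using n True by (simp_all add: divide_simps)
  thus ?thesis by blast
 next
  case False
  let ?j = "nat \<lfloor>real n * x\<rfloor>"
  have nx: "0 <= real n * x" "real n * x < real n" using x False n by auto
  hence j: "real ?j = of_int \<lfloor>real n * x\<rfloor>" by simp
  have "?j < n" using nx by linarith
  moreover have "x:{real ?j / n..(real ?j + 1) / n}"
   using j n of_int_floor_le[of "real n * x"] floor_correct[of "real n * x"] by (auto simp: field_simps)
  moreover have "?g x=f ?j (real n * x - real ?j)" using False j by (simp add: frac_def)
  ultimately show ?thesis by blast
 qed
qed

section \<open>The Cayley complex\<close>

lemma diff_2_1: "(2::nat) - 1=1" "2 - Suc 0=1"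
 by simp_all

lemma sum_lessThan_1: "(SUM i<(1::nat). f i)=f 0"
 by (simp add: One_nat_def)

lemma ndisc1: "tsp (ndisc 1)={v. \<bar>v 0\<bar> <= 1 & (ALL i>=1. v i=0)}"
 by (auto simp: tsp_ndisc sum_lessThan_1 abs_square_le_1)

lemma open_disc1: "odisc 1={v. \<bar>v 0\<bar> < 1 & (ALL i>=1. v i=0)}"
 by (auto simp: open_disc_def tsp_ndisc sum_lessThan_1 abs_square_less_1 abs_square_le_1)

lemma nsphere0: "tsp (nS 0)={v. \<bar>v 0\<bar>=1 & (ALL i>=1. v i=0)}"
 by (auto simp: tsp_nS power2_eq_1_iff Suc_le_eq abs_if)

type_synonym pt = "bool fg state \<times> nat cw_point"

context hnn_words begin

text \<open>Points of the Cayley complex are pairs of a group element and a point of the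
  presentation complex. The edge labelled s at x runs from the vertex x, at parameter -1, to the
  vertex of x times s, at parameter 1.\<close>

definition eedge :: "bool fg state => nat => real => pt" where
 "eedge x s y=(if \<bar>y\<bar> < 1 then (x, Edge s y) else if y <= 0 then (x, Vertex) else (lact (s, True) x, Vertex))"

definition emap :: "bool fg state => nat => (nat => real) => pt" where
 "emap x s v=eedge x s (v 0)"

text \<open>An inverse letter runs backwards through the edge that starts at the endpoint of the
  letter.\<close>

definition eletter :: "bool fg state => nat \<times> bool => real => pt" where
 "eletter x l t=(if snd l then eedge x (fst l) (2 * t - 1) else eedge (lact l x) (fst l) (1 - 2 * t))"

definition eword :: "bool fg state => nat word => real => pt" where
 "eword x r t=(let i=nat \<lfloor>real (length r) * t\<rfloor> in
   eletter (wact (take i r) x) (r ! i) (frac (real (length r) * t)))"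

definition fmap :: "bool fg state => (nat => real) => pt" where
 "fmap x v=(if v:odisc 2 then (x, Face v) else eword x relator (ang v))"

definition E0 :: "pt topology" where "E0=dtop (V \<times> {Vertex})"
definition E1 :: "pt topology" where "E1=glue E0 1 {emap x s | x s. x:V & s:three}"
definition E2 :: "pt topology" where "E2=glue E1 2 {fmap x | x. x:V}"

abbreviation "P1 == one_skeleton three"
abbreviation "P2 == presentation_complex three relator"

lemma snd_eedge: "snd (eedge x s y)=edge_point s y"
 by (simp add: eedge_def edge_point_def)

lemma snd_emap: "snd (emap x s v)=edge_map s v"
 by (simp add: emap_def edge_map_def snd_eedge)

lemma snd_eletter: "snd (eletter x l t)=letter_loop l t"
 by (simp add: eletter_def letter_loop_def snd_eedge)

lemma snd_fmap: "snd (fmap x v)=face_map relator v"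
 by (simp add: fmap_def face_map_def eword_def word_loop_def Let_def snd_eletter ang_def)

text \<open>Left translation, which is compatible with the characteristic maps because these are
  built from right multiplications.\<close>

definition act :: "bool fg state => pt => pt" where "act g e=(mul g (fst e), snd e)"

lemma act_eedge: "g:V ==> x:V ==> act g (eedge x s y)=eedge (mul g x) s y"
 by (simp add: act_def eedge_def mul_lact)

lemma act_emap: "g:V ==> x:V ==> act g (emap x s v)=emap (mul g x) s v"
 by (simp add: emap_def act_eedge)

lemma act_eletter: "g:V ==> x:V ==> act g (eletter x l t)=eletter (mul g x) l t"
 by (simp add: eletter_def act_eedge mul_lact)

lemma act_fmap: "g:V ==> x:V ==> act g (fmap x v)=fmap (mul g x) v"
 by (simp add: fmap_def eword_def Let_def act_eletter mul_wact act_def[of g "(x, Face v)"])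

lemma eedge_fst: "x:V ==> fst (eedge x s y):V"
 by (simp add: eedge_def)

lemma fmap_fst: "x:V ==> fst (fmap x v):V"
 by (simp add: fmap_def eword_def Let_def eletter_def eedge_fst)

lemma glued_E1: "glued E0 1 {emap x s | x s. x:V & s:three}"
proof
 fix ph assume "ph:{emap x s | x s. x:V & s:three}"
 then obtain x s where ph: "ph=emap x s" "x:V" by blast
 have d: "nS 0=dtop (tsp (nS 0))"
 proof -
  have "finite (tsp (nS 0))"
  proof (rule finite_subset)
   show "tsp (nS 0) <= {%i. if i=0 then 1 else 0, %i. if i=0 then -1 else 0}"
    by (auto simp: nsphere0 fun_eq_iff abs_if split: if_splits)
  qed simp
  thus ?thesis
   using Hausdorff_space_nsphere[of 0] by (metis finite_topspace_imp_discrete_topology)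
 qed
 have "ph v:V \<times> {Vertex}" if "v:tsp (nS 0)" for v
  using that ph by (auto simp: nsphere0 emap_def eedge_def)
 hence "cmap (dtop (tsp (nS 0))) E0 ph"
  by (auto simp: E0_def)
 thus "cmap (nS (1 - 1)) E0 ph" using d by simp
next
 fix ph py v w
 assume "ph:{emap x s | x s. x:V & s:three}" "py:{emap x s | x s. x:V & s:three}"
  and v: "v:odisc 1" and w: "w:odisc 1" and eq: "ph v=py w"
 then obtain x s y s' where *: "ph=emap x s" "py=emap y s'" by blast
 have "x=y" "s=s'" "v 0=w 0" using eq v w unfolding * by (auto simp: emap_def eedge_def open_disc1)
 moreover from this(3) have "v i=w i" for i using v w by (cases i) (auto simp: open_disc1)
 hence "v=w" by (rule ext)
 ultimately show "ph=py & v=w" using * by simp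
next
 fix ph v assume "ph:{emap x s | x s. x:V & s:three}" "v:odisc 1"
 thus "ph v ~: tsp E0" by (auto simp: E0_def emap_def eedge_def open_disc1)
qed simp

sublocale G1: glued E0 1 "{emap x s | x s. x:V & s:three}"
 rewrites "glue E0 1 {emap x s | x s. x:V & s:three}=E1"
 by (rule glued_E1) (simp add: E1_def)

lemma relator_ne: "relator ~= []"
 by (simp add: relator_def)

lemma relator_letters:
 assumes "i < length relator" shows "fst (relator ! i):three"
proof -
 have "set relator <= three \<times> UNIV" using relator_carrier by (simp add: free_group_def)
 hence "relator ! i:three \<times> UNIV" using nth_mem[OF assms] by (rule subsetD)
 thus ?thesis by (simp add: mem_Times_iff)
qed

lemma continuous_eedge: "x:V ==> s:three ==> cmap (top_of_set {-1..1}) E1 (eedge x s)"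
proof -
 assume x: "x:V" and s: "s:three"
 have "cmap (top_of_set {-1..1}) (ndisc 1) (%y i. if i=0 then y else 0)"
  by (rule continuous_map_ndisc) (auto simp: ndisc1)
 moreover have "cmap (ndisc 1) E1 (emap x s)" using G1.continuous_phi x s by blast
 ultimately have "cmap (top_of_set {-1..1}) E1 (emap x s o (%y i. if i=0 then y else 0))"
  by (rule cmo)
 thus ?thesis by (simp add: o_def emap_def)
qed

lemma continuous_eletter:
 assumes x: "x:V" and l: "fst l:three" shows "cmap I01 E1 (eletter x l)"
proof -
 have "cmap I01 (top_of_set {-1..1}) (%t::real. if snd l then 2 * t - 1 else 1 - 2 * t)"
  by (cases "snd l") (auto simp: cm_into intro!: continuous_intros)
 moreover have "cmap (top_of_set {-1..1}) E1 (eedge (if snd l then x else lact l x) (fst l))"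
  by (rule continuous_eedge) (use x l in auto)
 ultimately have "cmap I01 E1
   (eedge (if snd l then x else lact l x) (fst l) o (%t. if snd l then 2 * t - 1 else 1 - 2 * t))"
  by (rule cmo)
 thus ?thesis by (rule continuous_map_eq) (auto simp: eletter_def)
qed

lemma eletter_ends:
 assumes "x:V" shows "eletter x l 0=(x, Vertex)" "eletter x l 1=(lact l x, Vertex)"
proof -
 have "lact (fst l, True) (lact l x)=x" if "~snd l"
  using lact_inv[OF assms, of l] that by (simp add: inv_letter_def)
 moreover have "(fst l, True)=l" if "snd l" using that by (cases l) auto
 ultimately show "eletter x l 0=(x, Vertex)" "eletter x l 1=(lact l x, Vertex)"
  by (auto simp: eletter_def eedge_def)
qed

lemma continuous_fmap_sphere:
 assumes x: "x:V" shows "cmap (nS 1) E1 (fmap x)"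
proof -
 let ?n = "length relator"
 let ?f = "%i. eletter (wact (take i relator) x) (relator ! i)"
 let ?W = "%s. if s=1 then ?f (?n - 1) 1 else ?f (nat \<lfloor>real ?n * s\<rfloor>) (frac (real ?n * s))"
 have n: "?n > 0" using relator_ne by simp
 have c: "cmap I01 E1 ?W"
 proof (rule continuous_map_pieces[OF n])
  show "cmap I01 E1 (?f i)" if "i < ?n" for i
   by (rule continuous_eletter) (use x relator_letters that in auto)
  show "?f i 1=?f (Suc i) 0" if "Suc i < ?n" for i
   using x that by (simp add: eletter_ends take_Suc_conv_app_nth)
 qed
 have "relator=take (?n - 1) relator @ [relator ! (?n - 1)]"
  using n take_Suc_conv_app_nth[of "?n - 1" relator] by simp
 hence "wact relator x=lact (relator ! (?n - 1)) (wact (take (?n - 1) relator) x)"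
  by (metis wact_simps)
 \<comment> \<open>Here the relation enters: the relator acts trivially on states, so the boundary
   path closes up.\<close>
 hence "?W 1=(x, Vertex)" using x by (simp add: eletter_ends)
 moreover have "?W 0=(x, Vertex)" using x by (simp add: eletter_ends frac_def)
 ultimately have "cmap (nS 1) E1 (%v. ?W (ang v))"
  by (intro continuous_map_circle[OF c]) simp
 moreover have "?W (ang v)=fmap x v" if "v:tsp (nS 1)" for v
 proof -
  have "v ~: odisc 2" using that topspace_circle by (auto simp: open_disc_def numeral_2_eq_2 lessThan_Suc One_nat_def)
  thus ?thesis using ang_range[of v] by (simp add: fmap_def eword_def Let_def)
 qed
 ultimately show ?thesis by (rule continuous_map_eq)
qed

lemma top_E1: "tsp E1={(x, c). x:V & (c=Vertex | (EX s y. c=Edge s y & s:three & \<bar>y\<bar> < 1))}"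
proof
 show "tsp E1 <= {(x, c). x:V & (c=Vertex | (EX s y. c=Edge s y & s:three & \<bar>y\<bar> < 1))}"
  unfolding G1.top_B by (auto simp: E0_def emap_def eedge_def split: if_splits)
 show "{(x, c). x:V & (c=Vertex | (EX s y. c=Edge s y & s:three & \<bar>y\<bar> < 1))} <= tsp E1"
 proof clarify
  fix x c assume x: "x:V" and c: "c=Vertex | (EX s y. c=Edge s y & s:three & \<bar>y\<bar> < 1)"
  from c show "(x, c):tsp E1"
  proof
   assume "c=Vertex" thus ?thesis using x unfolding G1.top_B by (simp add: E0_def)
  next
   assume "EX s y. c=Edge s y & s:three & \<bar>y\<bar> < 1"
   then obtain s y where sy: "c=Edge s y" "s:three" "\<bar>y\<bar> < 1" by blast
   let ?v = "%i::nat. if i=0 then y else 0"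
   have "?v:tsp (ndisc 1)" "emap x s ?v=(x, c)" using sy by (auto simp: ndisc1 emap_def eedge_def)
   hence "(x, c):emap x s ` tsp (ndisc 1)" by force
   moreover have "emap x s:{emap x s | x s. x:V & s:three}" using x sy(2) by blast
   ultimately show ?thesis unfolding G1.top_B by blast
  qed
 qed
qed

lemma glued_E2: "glued E1 2 {fmap x | x. x:V}"
proof
 fix ph assume "ph:{fmap x | x. x:V}"
 thus "cmap (nS (2 - 1)) E1 ph" using continuous_fmap_sphere unfolding diff_2_1 by blast
next
 fix ph py v w
 assume "ph:{fmap x | x. x:V}" "py:{fmap x | x. x:V}" "v:odisc 2" "w:odisc 2" "ph v=py w"
 thus "ph=py & v=w" by (auto simp: fmap_def)
next
 fix ph v assume "ph:{fmap x | x. x:V}" "v:odisc 2"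
 thus "ph v ~: tsp E1" by (auto simp: fmap_def top_E1)
qed simp

sublocale G2: glued E1 2 "{fmap x | x. x:V}"
 rewrites "glue E1 2 {fmap x | x. x:V}=E2"
 by (rule glued_E2) (simp add: E2_def)

definition cells :: "nat cw_point set" where
 "cells={c. c=Vertex | (EX s y. c=Edge s y & s:three & \<bar>y\<bar> < 1) | (EX v:odisc 2. c=Face v)}"

lemma top_E2: "tsp E2=V \<times> cells"
proof
 show "tsp E2 <= V \<times> cells"
 proof
  fix e assume "e:tsp E2"
  thus "e:V \<times> cells"
   by (cases e rule: G2.top_B_cases) (auto simp: top_E1 cells_def fmap_def)
 qed
 show "V \<times> cells <= tsp E2"
 proof clarify
  fix x c assume x: "x:V" and c: "c:cells"
  show "(x, c):tsp E2"
  proof (cases "EX v:odisc 2. c=Face v")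
   case True
   then obtain v where v: "v:odisc 2" "c=Face v" by blast
   hence "(x, c)=fmap x v" "v:tsp (ndisc 2)" using open_disc_subset by (auto simp: fmap_def)
   thus ?thesis using x unfolding G2.top_B by blast
  next
   case False
   hence "(x, c):tsp E1" using x c by (auto simp: top_E1 cells_def)
   thus ?thesis unfolding G2.top_B by blast
  qed
 qed
qed

lemma Hausdorff_E2: "Hausdorff_space E2"
 by (intro G2.Hausdorff_B G1.Hausdorff_B) (simp add: E0_def)

subsection \<open>The presentation complex\<close>

lemma glued_P1: "glued (dtop {Vertex}) 1 (edge_map ` three)"
proof
 fix ph assume "ph:edge_map ` three"
 then obtain s where ph: "ph=edge_map s" by blast
 have "cmap (nS 0) (dtop {Vertex}) (%_. Vertex)" by simp
 hence "cmap (nS 0) (dtop {Vertex}) ph"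
  by (rule continuous_map_eq) (auto simp: nsphere0 ph edge_map_def edge_point_def)
 thus "cmap (nS (1 - 1)) (dtop {Vertex}) ph" by simp
next
 fix ph py v w
 assume "ph:edge_map ` three" "py:edge_map ` three"
  and v: "v:odisc 1" and w: "w:odisc 1" and eq: "ph v=py w"
 then obtain s s' where *: "ph=edge_map s" "py=edge_map s'" by blast
 have "s=s'" "v 0=w 0" using eq v w unfolding * by (auto simp: edge_map_def edge_point_def open_disc1)
 moreover from this(2) have "v i=w i" for i using v w by (cases i) (auto simp: open_disc1)
 hence "v=w" by (rule ext)
 ultimately show "ph=py & v=w" using * by simp
next
 fix ph v assume "ph:edge_map ` three" "v:odisc 1"
 thus "ph v ~: tsp (dtop {Vertex})" by (auto simp: edge_map_def edge_point_def open_disc1)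
qed simp

sublocale H1: glued "dtop {Vertex}" 1 "edge_map ` three"
 rewrites "glue (dtop {Vertex}) 1 (edge_map ` three)=P1"
 by (rule glued_P1) (simp add: one_skeleton_def)

lemma continuous_snd_E1: "cmap E1 P1 snd"
proof (rule G1.continuous_map_B)
 have "cmap E0 (dtop {Vertex}) snd" by (auto simp: E0_def)
 from cmo[OF this H1.continuous_A] show "cmap E0 P1 snd" by simp
 fix ph assume "ph:{emap x s | x s. x:V & s:three}"
 then obtain x s where "ph=emap x s" "s:three" by blast
 moreover have "snd o emap x s=edge_map s" for x s by (rule ext) (simp add: snd_emap)
 ultimately show "cmap (ndisc 1) P1 (snd o ph)" using H1.continuous_phi by simp
qed

lemma top_P1: "tsp P1={c. c=Vertex | (EX s y. c=Edge s y & s:three & \<bar>y\<bar> < 1)}"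
proof
 show "tsp P1 <= {c. c=Vertex | (EX s y. c=Edge s y & s:three & \<bar>y\<bar> < 1)}"
  unfolding H1.top_B by (auto simp: edge_map_def edge_point_def)
 show "{c. c=Vertex | (EX s y. c=Edge s y & s:three & \<bar>y\<bar> < 1)} <= tsp P1"
 proof
  fix c assume "c:{c. c=Vertex | (EX s y. c=Edge s y & s:three & \<bar>y\<bar> < 1)}"
  hence "(one_V, c):tsp E1" by (simp add: top_E1)
  from Pi_mem[OF cm_fun[OF continuous_snd_E1] this] show "c:tsp P1" by simp
 qed
qed

lemma glued_P2: "glued P1 2 {face_map relator}"
proof
 fix ph assume "ph:{face_map relator}"
 moreover have "cmap (nS 1) P1 (snd o fmap one_V)"
  by (rule cmo[OF continuous_fmap_sphere continuous_snd_E1]) simp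
 moreover have "snd o fmap one_V=face_map relator" by (rule ext) (simp add: snd_fmap)
 ultimately show "cmap (nS (2 - 1)) P1 ph" unfolding diff_2_1 by simp
next
 fix ph py v w
 assume "ph:{face_map relator}" "py:{face_map relator}" and v: "v:odisc 2" and w: "w:odisc 2"
  and eq: "ph v=py w"
 hence ph: "ph=face_map relator" "py=face_map relator" by simp_all
 have "face_map relator v=Face v" "face_map relator w=Face w" using v w by (simp_all add: face_map_def)
 thus "ph=py & v=w" using ph eq by simp
next
 fix ph v assume "ph:{face_map relator}" and v: "v:odisc 2"
 hence "ph v=Face v" by (simp add: face_map_def)
 thus "ph v ~: tsp P1" by (simp add: top_P1)
qed simp

sublocale H2: glued P1 2 "{face_map relator}"
 rewrites "glue P1 2 {face_map relator}=P2"
 by (rule glued_P2) (simp add: presentation_complex_def)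

lemma continuous_snd_E2: "cmap E2 P2 snd"
proof (rule G2.continuous_map_B)
 from cmo[OF continuous_snd_E1 H2.continuous_A] show "cmap E1 P2 snd" by simp
 fix ph assume "ph:{fmap x | x. x:V}"
 then obtain x where "ph=fmap x" by blast
 moreover have "snd o fmap x=face_map relator" for x by (rule ext) (simp add: snd_fmap)
 ultimately show "cmap (ndisc 2) P2 (snd o ph)" using H2.continuous_phi by simp
qed

lemma top_P2: "tsp P2=cells"
proof
 show "tsp P2 <= cells"
 proof
  fix c assume "c:tsp P2"
  thus "c:cells"
  proof (cases c rule: H2.top_B_cases)
   case (2 ph v)
   from 2(1) have "ph=face_map relator" by (rule singletonD)
   hence "c=Face v" using 2(2,3) by (simp add: face_map_def)
   thus ?thesis using 2(2) unfolding cells_def by blast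
  qed (auto simp: top_P1 cells_def)
 qed
 show "cells <= tsp P2"
 proof
  fix c assume "c:cells"
  hence "(one_V, c):tsp E2" by (simp add: top_E2)
  from Pi_mem[OF cm_fun[OF continuous_snd_E2] this] show "c:tsp P2" by simp
 qed
qed

end

section \<open>The covering of the presentation complex\<close>

text \<open>The sections are the inverses of \<open>p\<close> on disjoint open sets that
  \<open>p\<close> maps bijectively onto \<open>U\<close>; openness of \<open>p\<close> makes them
  continuous.\<close>

lemma sheetsI:
 assumes cont: "cmap E P p" and opn: "!!W. openin E W ==> openin P (p ` W)"
  and N: "!!N. N:\<O> ==> openin E N & inj_on p N & p ` N=U" and U: "openin P U"
  and disj: "!!N N' e. N:\<O> ==> N':\<O> ==> e:N ==> e:N' ==> N=N'"
  and cov: "!!e. e:tsp E ==> p e:U ==> EX N:\<O>. e:N"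
 shows "sheets E P p U ((%N. inv_into N p) ` \<O>)"
 unfolding sheets_def
proof (intro conjI ballI impI U)
 have inv: "inv_into N p u:N" "p (inv_into N p u)=u" if "N:\<O>" "u:U" for N u
  using N[OF that(1)] that(2) inv_into_into[of u p N] f_inv_into_f[of u p N] by auto
 fix s assume "s:(%N. inv_into N p) ` \<O>"
 then obtain N where s: "s=inv_into N p" "N:\<O>" by blast
 have UP: "U <= tsp P" using U by (rule openin_subset)
 have OE: "N <= tsp E" using N[OF s(2)] openin_subset by blast
 show "cmap (subt P U) E s"
  unfolding continuous_map_def
 proof (intro conjI allI impI)
  show "s:tsp (subt P U) \<rightarrow> tsp E" using inv(1)[OF s(2)] OE s(1) by auto
  fix W assume W: "openin E W"
  have "{x:tsp (subt P U). s x:W}=p ` (N Int W)"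
  proof (intro equalityI subsetI)
   fix x assume "x:{x:tsp (subt P U). s x:W}"
   hence "x:U" "s x:W" by auto
   thus "x:p ` (N Int W)" using inv[OF s(2)] s(1) by (intro image_eqI[of _ _ "s x"]) auto
  next
   fix x assume "x:p ` (N Int W)"
   then obtain e where e: "e:N" "e:W" "x=p e" by blast
   have "s x=e" using e N[OF s(2)] inv_into_f_f[of p N e] s(1) by simp
   moreover have "x:U" using e N[OF s(2)] by blast
   ultimately show "x:{x:tsp (subt P U). s x:W}" using e UP by auto
  qed
  moreover have "openin P (p ` (N Int W))" using opn N[OF s(2)] W by (simp add: openin_Int)
  moreover have "p ` (N Int W) <= U" using N[OF s(2)] by blast
  ultimately show "openin (subt P U) {x:tsp (subt P U). s x:W}"
   using openin_subset_topspace_eq openin_open_subtopology[OF U] by simp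
 qed
 show "p (s u)=u" if "u:U" for u using inv(2)[OF s(2) that] s(1) by simp
 have "s ` U=N"
 proof
  show "s ` U <= N" using inv(1)[OF s(2)] s(1) by blast
  show "N <= s ` U"
  proof
   fix e assume e: "e:N"
   hence "s (p e)=e" "p e:U" using N[OF s(2)] inv_into_f_f[of p N e] s(1) by auto
   thus "e:s ` U" by (metis image_eqI)
  qed
 qed
 thus "openin E (s ` U)" using N[OF s(2)] by simp
 fix s' u assume "s':(%N. inv_into N p) ` \<O>" and u: "u:U" and eq: "s u=s' u"
 then obtain N' where s': "s'=inv_into N' p" "N':\<O>" by blast
 have "N=N'" using disj[OF s(2) s'(2), of "s u"] inv(1)[OF s(2) u] inv(1)[OF s'(2) u] eq s s' by simp
 thus "s=s'" using s s' by simp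
next
 fix e assume e: "e:tsp E" "p e:U"
 then obtain N where N': "N:\<O>" "e:N" using cov by blast
 hence "inv_into N p (p e)=e" using N inv_into_f_f[of p N e] by simp
 thus "EX s:(%N. inv_into N p) ` \<O>. s (p e)=e" using N' by blast
qed

lemma inj_on_snd: "(!!e. e:W ==> fst e=z) ==> inj_on snd W"
 by (rule inj_onI) (simp add: prod_eq_iff)

context hnn_words begin

lemma snd_act [simp]: "snd (act g e)=snd e" and fst_act: "fst (act g e)=mul g (fst e)"
 by (simp_all add: act_def)

lemma act_act: "g:V ==> h:V ==> fst e:V ==> act g (act h e)=act (mul g h) e"
 by (simp add: act_def mul_assoc)

lemma act_inv: "g:V ==> fst e:V ==> act (invV g) (act g e)=e" "g:V ==> fst e:V ==> act g (act (invV g) e)=e"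
 by (simp_all add: act_act) (simp_all add: act_def mul_one_left)

lemma act_trans:
 assumes "fst e:V" "fst e':V" "snd e=snd e'" shows "EX g:V. act g e=e'"
proof (intro bexI)
 show "act (mul (fst e') (invV (fst e))) e=e'"
  using assms by (simp add: act_def mul_assoc prod_eq_iff)
qed (use assms mul_V in simp)

lemma act_free:
 assumes "g:V" "h:V" "fst e:V" "act g e=act h e" shows "g=h"
proof -
 have "mul g (fst e)=mul h (fst e)" using assms(4) by (simp add: act_def)
 hence "mul (mul g (fst e)) (invV (fst e))=mul (mul h (fst e)) (invV (fst e))" by simp
 thus ?thesis using assms by (simp add: mul_assoc)
qed

lemma equivariant_inj:
 assumes "!!g x. g:V ==> x:V ==> act g (F x v)=F (mul g x) v" "fst (F one_V v):V"
  and "x:V" "y:V" "F x v=F y v"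
 shows "x=y"
 using assms(1)[of x one_V] assms(1)[of y one_V] assms(2-) act_free[of x y "F one_V v"] by simp

lemma equivariant_reach:
 assumes F: "!!g x. g:V ==> x:V ==> act g (F x v)=F (mul g x) v" "fst (F one_V v):V"
  and e: "fst e:V" "snd e=snd (F one_V v)"
 shows "EX x:V. F x v=e"
proof -
 obtain g where "g:V" "act g (F one_V v)=e" using act_trans[of "F one_V v" e] F e by auto
 thus ?thesis using F(1)[of g one_V] by auto
qed

lemma top_E1_fst: "e:tsp E1 ==> fst e:V" and top_E2_fst: "e:tsp E2 ==> fst e:V"
 by (auto simp: top_E1 top_E2)

lemma emap_fst: "x:V ==> fst (emap x s v):V"
 by (simp add: emap_def eedge_fst)

lemma open_snd_E1:
 assumes W: "openin E1 W" shows "openin P1 (snd ` W)"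
 unfolding H1.openin_B
proof (intro conjI ballI)
 have WE: "W <= tsp E1" using W openin_subset by blast
 thus "snd ` W <= tsp P1" using cm_fun[OF continuous_snd_E1] by blast
 show "openin (dtop {Vertex}) (snd ` W Int tsp (dtop {Vertex}))" by simp
 fix ph assume "ph:edge_map ` three"
 then obtain s where s: "ph=edge_map s" "s:three" by blast
 have "{v:tsp (ndisc 1). ph v:snd ` W}=(UN x:V. {v:tsp (ndisc 1). emap x s v:W})"
 proof (intro equalityI subsetI)
  fix v assume "v:{v:tsp (ndisc 1). ph v:snd ` W}"
  then obtain e where v: "v:tsp (ndisc 1)" "e:W" "edge_map s v=snd e" using s by auto
  have "EX x:V. emap x s v=e"
   by (rule equivariant_reach[of "%x v. emap x s v"], erule (1) act_emap)
    (use v(3) top_E1_fst[OF subsetD[OF WE v(2)]] in \<open>simp_all add: emap_fst snd_emap\<close>)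
  thus "v:(UN x:V. {v:tsp (ndisc 1). emap x s v:W})" using v by blast
 next
  fix v assume "v:(UN x:V. {v:tsp (ndisc 1). emap x s v:W})"
  then obtain x where "v:tsp (ndisc 1)" "emap x s v:W" by blast
  thus "v:{v:tsp (ndisc 1). ph v:snd ` W}" using snd_emap[of x s v] s image_eqI[of "edge_map s v" snd "emap x s v" W] by simp
 qed
 moreover have "openin (ndisc 1) {v:tsp (ndisc 1). emap x s v:W}" if "x:V" for x
  using W that s(2) unfolding G1.openin_B by blast
 ultimately show "openin (ndisc 1) {v:tsp (ndisc 1). ph v:snd ` W}" by (auto intro!: openin_Union)
qed

lemma open_snd_E2:
 assumes W: "openin E2 W" shows "openin P2 (snd ` W)"
 unfolding H2.openin_B
proof (intro conjI ballI)
 have WE: "W <= tsp E2" using W openin_subset by blast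
 thus "snd ` W <= tsp P2" using cm_fun[OF continuous_snd_E2] by blast
 have "snd ` W Int tsp P1=snd ` (W Int tsp E1)"
 proof (intro equalityI subsetI)
  fix c assume c: "c:snd ` W Int tsp P1"
  then obtain e where "e:W" "c=snd e" by blast
  moreover from this c WE have "e:tsp E1" by (cases e) (auto simp: top_E1 top_P1 top_E2)
  ultimately show "c:snd ` (W Int tsp E1)" by blast
 qed (use cm_fun[OF continuous_snd_E1] in blast)
 moreover have "openin E1 (W Int tsp E1)" using W by (simp add: G2.openin_B)
 ultimately show "openin P1 (snd ` W Int tsp P1)" using open_snd_E1 by simp
 fix ph assume "ph:{face_map relator}"
 hence s: "ph=face_map relator" by blast
 have "{v:tsp (ndisc 2). ph v:snd ` W}=(UN x:V. {v:tsp (ndisc 2). fmap x v:W})"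
 proof (intro equalityI subsetI)
  fix v assume "v:{v:tsp (ndisc 2). ph v:snd ` W}"
  then obtain e where v: "v:tsp (ndisc 2)" "e:W" "face_map relator v=snd e" using s by auto
  have "EX x:V. fmap x v=e"
   by (rule equivariant_reach[of fmap], erule (1) act_fmap)
    (use v(3) top_E2_fst[OF subsetD[OF WE v(2)]] in \<open>simp_all add: fmap_fst snd_fmap\<close>)
  thus "v:(UN x:V. {v:tsp (ndisc 2). fmap x v:W})" using v by blast
 next
  fix v assume "v:(UN x:V. {v:tsp (ndisc 2). fmap x v:W})"
  then obtain x where "v:tsp (ndisc 2)" "fmap x v:W" by blast
  thus "v:{v:tsp (ndisc 2). ph v:snd ` W}" using snd_fmap[of x v] s image_eqI[of "face_map relator v" snd "fmap x v" W] by simp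
 qed
 moreover have "openin (ndisc 2) {v:tsp (ndisc 2). fmap x v:W}" if "x:V" for x
  using W that unfolding G2.openin_B by blast
 ultimately show "openin (ndisc 2) {v:tsp (ndisc 2). ph v:snd ` W}" by (auto intro!: openin_Union)
qed

lemma continuous_act:
 assumes g: "g:V" shows "cmap E2 E2 (act g)"
proof (rule G2.continuous_map_B)
 have "cmap E1 E1 (act g)"
 proof (rule G1.continuous_map_B)
  have "mul g x:V" for x using mul_V g by simp
  hence "act g e:V \<times> {Vertex}" if "e:V \<times> {Vertex}" for e
   using that unfolding act_def by (simp add: mem_Times_iff)
  hence "cmap E0 E0 (act g)" by (simp add: E0_def Pi_iff)
  from cmo[OF this G1.continuous_A] show "cmap E0 E1 (act g)" by simp
  fix ph assume "ph:{emap x s | x s. x:V & s:three}"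
  then obtain x s where x: "ph=emap x s" "x:V" "s:three" by blast
  hence "act g o ph=emap (mul g x) s" using g by (intro ext) (simp add: act_emap)
  moreover have "cmap (ndisc 1) E1 (emap (mul g x) s)"
   by (rule G1.continuous_phi) (use mul_V g x in blast)
  ultimately show "cmap (ndisc 1) E1 (act g o ph)" by simp
 qed
 from cmo[OF this G2.continuous_A] show "cmap E1 E2 (act g)" by simp
 fix ph assume "ph:{fmap x | x. x:V}"
 then obtain x where x: "ph=fmap x" "x:V" by blast
 hence "act g o ph=fmap (mul g x)" using g by (intro ext) (simp add: act_fmap)
 moreover have "cmap (ndisc 2) E2 (fmap (mul g x))"
  by (rule G2.continuous_phi) (use mul_V g x in blast)
 ultimately show "cmap (ndisc 2) E2 (act g o ph)" by simp
qed

lemma act_E2: "g:V ==> e:tsp E2 ==> act g e:tsp E2"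
 using cm_fun[OF continuous_act] by blast

lemma open_act:
 assumes g: "g:V" and W: "openin E2 W" shows "openin E2 (act g ` W)"
proof -
 have WE: "W <= tsp E2" using W openin_subset by blast
 have "act g ` W={e:tsp E2. act (invV g) e:W}"
 proof (intro equalityI subsetI)
  fix e assume "e:act g ` W"
  then obtain e' where e': "e':W" "e=act g e'" by blast
  hence "e':tsp E2" using WE by blast
  thus "e:{e:tsp E2. act (invV g) e:W}"
   using e' act_E2[OF g] act_inv(1)[OF g top_E2_fst] by simp
 next
  fix e assume "e:{e:tsp E2. act (invV g) e:W}"
  hence "act (invV g) e:W" "e=act g (act (invV g) e)" using act_inv(2)[OF g top_E2_fst] by simp_all
  thus "e:act g ` W" by blast
 qed
 thus ?thesis using open_pre[OF continuous_act W, of "invV g"] g by simp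
qed

text \<open>The translates of \<open>W\<close> are disjoint since the action is free and
  \<open>snd\<close> is injective on \<open>W\<close>; they exhaust the preimage since the action is
  transitive on fibres.\<close>

lemma sheets_of_injective:
 assumes W: "openin E2 W" and inj: "inj_on snd W"
 shows "sheets E2 P2 snd (snd ` W) ((%N. inv_into N snd) ` ((%g. act g ` W) ` V))"
proof (rule sheetsI[OF continuous_snd_E2 open_snd_E2])
 have WV: "fst e:V" if "e:W" for e using that openin_subset[OF W] top_E2_fst by blast
 show "openin P2 (snd ` W)" by (rule open_snd_E2[OF W])
 show "openin E2 N & inj_on snd N & snd ` N=snd ` W" if N: "N:(%g. act g ` W) ` V" for N
 proof -
  obtain g where g: "g:V" "N=act g ` W" using N by blast
  have "inj_on snd N"
  proof (rule inj_onI)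
   fix e e' assume "e:N" "e':N" "snd e=snd e'"
   then obtain d d' where "e=act g d" "e'=act g d'" "d:W" "d':W" "snd d=snd d'" using g by auto
   thus "e=e'" using inj by (auto dest: inj_onD)
  qed
  moreover have "snd ` N=snd ` W" unfolding g(2) image_image by simp
  ultimately show ?thesis using open_act[OF g(1) W] g(2) by simp
 qed
 show "N=N'" if N: "N:(%g. act g ` W) ` V" "N':(%g. act g ` W) ` V" "e:N" "e:N'" for N N' e
 proof -
  obtain g h where g: "g:V" "N=act g ` W" "h:V" "N'=act h ` W" using N by blast
  obtain d d' where d: "e=act g d" "e=act h d'" "d:W" "d':W" using N g by blast
  have "snd d=snd d'" using d by (metis snd_act)
  hence "d=d'" using inj d inj_onD by metis
  hence "g=h" using act_free[OF g(1) g(3) WV[OF d(3)]] d by simp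
  thus ?thesis using g by simp
 qed
 show "EX N:(%g. act g ` W) ` V. e:N" if e: "e:tsp E2" "snd e:snd ` W" for e
 proof -
  obtain d where "d:W" "snd d=snd e" using e by auto
  then obtain g where "g:V" "act g d=e" using act_trans[of d e, OF WV top_E2_fst[OF e(1)]] by blast
  thus ?thesis using \<open>d : W\<close> by blast
 qed
qed

text \<open>The characteristic maps are equivariant: two collar points with the same image have
  radial projections with the same image, these coincide by injectivity on \<open>W\<close>, and
  they determine the group element.\<close>

lemma inj_ext_1:
 assumes W: "W <= tsp E0" "inj_on snd W" shows "inj_on snd (G1.ext W)"
proof (rule inj_onI)
 fix e e' assume e: "e:G1.ext W" and e': "e':G1.ext W" and eq: "snd e=snd e'"
 have top: "e:tsp E1" "e':tsp E1" using e e' G1.ext_subset[OF W(1)] by blast+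
 have E0: "d:tsp E0" if "d:tsp E1" "snd d=Vertex" for d
  using that by (cases d) (auto simp: E0_def top_E1)
 show "e=e'"
 proof (cases "snd e=Vertex")
  case True
  hence "e:W" "e':W" using e e' G1.ext_A[OF W(1)] E0 top eq by auto
  thus ?thesis using W(2) eq inj_onD by metis
 next
  case False
  then obtain s y where sy: "snd e=Edge s y" "s:three" "\<bar>y\<bar> < 1" using top by (auto simp: top_E1)
  let ?v = "%i::nat. if i=0 then y else 0"
  have v: "?v:tsp (ndisc 1)" using sy by (auto simp: ndisc1)
  have em: "emap x s ?v=(x, Edge s y)" for x using sy by (simp add: emap_def eedge_def)
  have x: "fst e:V" "fst e':V" using top top_E1_fst by auto
  have "e=emap (fst e) s ?v" "e'=emap (fst e') s ?v" unfolding em using sy eq by (simp_all add: prod_eq_iff)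
  hence "emap (fst e) s ?v:G1.ext W" "emap (fst e') s ?v:G1.ext W" using e e' by simp_all
  moreover have "emap x s:{emap x s | x s. x:V & s:three}" if "x:V" for x using that sy(2) by blast
  ultimately have "emap (fst e) s (unitv 1 ?v):W" "emap (fst e') s (unitv 1 ?v):W"
   using G1.phi_ext[OF W(1) _ v] x by blast+
  hence "emap (fst e) s (unitv 1 ?v)=emap (fst e') s (unitv 1 ?v)"
   by (intro inj_onD[OF W(2)]) (simp_all add: snd_emap)
  hence "fst e=fst e'"
   by (intro equivariant_inj[of "%x v. emap x s v" "unitv 1 ?v", OF act_emap]) (use x in \<open>simp_all add: emap_fst\<close>)
  thus ?thesis using eq by (simp add: prod_eq_iff)
 qed
qed

lemma inj_ext_2:
 assumes W: "W <= tsp E1" "inj_on snd W" shows "inj_on snd (G2.ext W)"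
proof (rule inj_onI)
 fix e e' assume e: "e:G2.ext W" and e': "e':G2.ext W" and eq: "snd e=snd e'"
 have top: "e:tsp E2" "e':tsp E2" using e e' G2.ext_subset[OF W(1)] by blast+
 show "e=e'"
 proof (cases "EX v:odisc 2. snd e=Face v")
  case False
  hence "e:tsp E1" "e':tsp E1" using top eq by (auto simp: top_E1 top_E2 cells_def)
  hence "e:W" "e':W" using e e' G2.ext_A[OF W(1)] by auto
  thus ?thesis using W(2) eq inj_onD by metis
 next
  case True
  then obtain v where v: "v:odisc 2" "snd e=Face v" by blast
  hence vD: "v:tsp (ndisc 2)" using open_disc_subset by blast
  have fm: "fmap x v=(x, Face v)" for x using v by (simp add: fmap_def)
  have x: "fst e:V" "fst e':V" using top top_E2_fst by auto
  have "e=fmap (fst e) v" "e'=fmap (fst e') v" unfolding fm using v eq by (simp_all add: prod_eq_iff)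
  hence "fmap (fst e) v:G2.ext W" "fmap (fst e') v:G2.ext W" using e e' by simp_all
  moreover have "fmap x:{fmap x | x. x:V}" if "x:V" for x using that by blast
  ultimately have "fmap (fst e) (unitv 2 v):W" "fmap (fst e') (unitv 2 v):W"
   using G2.phi_ext[OF W(1) _ vD] x by blast+
  hence "fmap (fst e) (unitv 2 v)=fmap (fst e') (unitv 2 v)"
   by (intro inj_onD[OF W(2)]) (simp_all add: snd_fmap)
  hence "fst e=fst e'"
   by (intro equivariant_inj[of fmap "unitv 2 v", OF act_fmap]) (use x in \<open>simp_all add: fmap_fst\<close>)
  thus ?thesis using eq by (simp add: prod_eq_iff)
 qed
qed

lemma ext_self: "W <= G1.ext W" "W <= G2.ext W"
 unfolding G1.ext_def G2.ext_def by blast+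

lemma covers_E2: "covers E2 P2 snd"
 unfolding covers_def
proof (intro conjI ballI continuous_snd_E2)
 fix c assume "c:tsp P2"
 hence c: "c:cells" by (simp add: top_P2)
 have sh: "EX U Sx. c:U & sheets E2 P2 snd U Sx" if "openin E2 W" "inj_on snd W" "(one_V, c):W" for W
  using sheets_of_injective[OF that(1,2)] that(3) image_eqI[of c snd "(one_V, c)" W] by auto
 have up: "EX W. openin E2 W & inj_on snd W & (one_V, c):W" if "openin E1 W" "inj_on snd W" "(one_V, c):W" for W
  using G2.openin_ext[OF that(1)] inj_ext_2[OF openin_subset[OF that(1)] that(2)] ext_self(2)[of W] that(3) by blast
 have vert: "EX W. openin E1 W & inj_on snd W & (one_V, c):W" if "c=Vertex"
 proof (intro exI conjI)
  have o: "openin E0 {(one_V, Vertex)}" by (simp add: E0_def)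
  show "openin E1 (G1.ext {(one_V, Vertex)})" by (rule G1.openin_ext[OF o])
  show "inj_on snd (G1.ext {(one_V, Vertex)})" by (rule inj_ext_1[OF openin_subset[OF o]]) simp
  show "(one_V, c):G1.ext {(one_V, Vertex)}" using ext_self(1) that by blast
 qed
 have edge: "EX W. openin E1 W & inj_on snd W & (one_V, c):W" if "c=Edge s y" "s:three" "\<bar>y\<bar> < 1" for s y
 proof (intro exI conjI)
  have "emap one_V s:{emap x s | x s. x:V & s:three}" using that(2) one_in_V by blast
  thus "openin E1 (emap one_V s ` odisc 1)"
   by (rule G1.openin_cell[OF _ G1.openin_open_disc]) simp
  show "inj_on snd (emap one_V s ` odisc 1)"
   by (rule inj_on_snd[of _ one_V], erule imageE) (simp add: emap_def eedge_def open_disc1)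
  let ?v = "%i::nat. if i=0 then y else 0"
  have "(one_V, c)=emap one_V s ?v" "?v:odisc 1" using that by (auto simp: emap_def eedge_def open_disc1)
  thus "(one_V, c):emap one_V s ` odisc 1" by blast
 qed
 have face: "EX W. openin E2 W & inj_on snd W & (one_V, c):W" if v: "v:odisc 2" "c=Face v" for v
 proof (intro exI conjI)
  have "fmap one_V:{fmap x | x. x:V}" using one_in_V by blast
  thus "openin E2 (fmap one_V ` odisc 2)"
   by (rule G2.openin_cell[OF _ G2.openin_open_disc]) simp
  have fm: "fmap one_V w=(one_V, Face w)" if "w:odisc 2" for w using that by (simp add: fmap_def)
  show "inj_on snd (fmap one_V ` odisc 2)"
   by (rule inj_on_snd[of _ one_V], erule imageE) (simp add: fm)
  show "(one_V, c):fmap one_V ` odisc 2" using v fm[OF v(1)] by (metis image_eqI)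
 qed
 consider "c=Vertex" | s y where "c=Edge s y" "s:three" "\<bar>y\<bar> < 1" | v where "v:odisc 2" "c=Face v"
  using c unfolding cells_def by blast
 then obtain W where "openin E2 W" "inj_on snd W" "(one_V, c):W"
 proof cases
  case 1
  from vert[OF this] show thesis using up that by meson
 next
  case (2 s y)
  from edge[OF this] show thesis using up that by meson
 next
  case (3 v)
  from face[OF this] show thesis using that by meson
 qed
 from sh[OF this] show "EX U Sx. c:U & sheets E2 P2 snd U Sx" .
qed

lemma deck_E2:
 assumes "ccontractible E2" shows "deck E2 P2 snd hgrp act"
proof (rule deck.intro[OF covers_E2])
 show "snd ` tsp E2=tsp P2" unfolding top_E2 top_P2 using one_in_V by (metis empty_iff snd_image_times)
 show "group hgrp" by (rule group_hgrp)
 show "act (g \<otimes>\<^bsub>hgrp\<^esub> h) e=act g (act h e)" if "g:carrier hgrp" "h:carrier hgrp" "e:tsp E2" for g h e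
  using act_act[of g h e] that top_E2_fst by simp
 show "EX g:carrier hgrp. act g e=e'" if "e:tsp E2" "e':tsp E2" "snd e=snd e'" for e e'
  using act_trans[of e e'] that top_E2_fst by simp
 show "g=h" if "g:carrier hgrp" "h:carrier hgrp" "e:tsp E2" "act g e=act h e" for g h e
  using act_free[of g h e] that top_E2_fst by simp
qed (use assms continuous_act in simp_all)

end

section \<open>Attaching a cell along a retract\<close>

lemma compact_space_ndisc: "compact_space (ndisc n)"
proof -
 have f: "cmap (nS n) (ndisc n) (%v i. if i < n then v i else 0)" (is "cmap _ _ ?f")
 proof (rule continuous_map_ndisc)
  show "cmap (nS n) eur (%v. if i < n then v i else 0)" for i
   unfolding nsphere by (cases "i < n") (auto intro: cm_from continuous_map_product_projection)
 next
  fix v assume "v:tsp (nS n)"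
  hence "(SUM i<n. (v i)\<^sup>2) + (v n)\<^sup>2=1" by (simp add: tsp_nS lessThan_Suc_atMost[symmetric])
  hence "(SUM i<n. (v i)\<^sup>2) <= 1" using zero_le_power2[of "v n"] by linarith
  thus "(%i. if i < n then v i else 0):tsp (ndisc n)" by (simp add: tsp_ndisc)
 qed
 have "?f ` tsp (nS n)=tsp (ndisc n)"
 proof
  show "?f ` tsp (nS n) <= tsp (ndisc n)"
   using cm_fun[OF f] by blast
  show "tsp (ndisc n) <= ?f ` tsp (nS n)"
  proof
   fix v assume v: "v:tsp (ndisc n)"
   let ?w = "%i. if i < n then v i else if i=n then sqrt (1 - (SUM i<n. (v i)\<^sup>2)) else 0"
   have w: "?w:tsp (nS n)"
    using v by (simp add: tsp_nS tsp_ndisc lessThan_Suc_atMost[symmetric])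
   have "v=?f ?w" using v by (auto simp: tsp_ndisc fun_eq_iff)
   from this w show "v:?f ` tsp (nS n)" by (rule image_eqI)
  qed
 qed
 moreover have "compactin (ndisc n) (?f ` tsp (nS n))"
  by (rule image_compactin[OF _ f]) (use compact_space_nsphere in \<open>simp add: compact_space_def\<close>)
 ultimately show ?thesis
  unfolding compact_space_def by (simp only:)
qed

lemma nrm_convex:
 assumes t: "0 <= t" "t <= 1" and v: "v:tsp (ndisc n)" "w:tsp (ndisc n)"
 shows "(%i. (1 - t) * v i + t * w i):tsp (ndisc n)"
proof -
 have L: "nrm n x=L2_set x {..<n}" for x by (simp add: nrm_def L2_set_def)
 have "nrm n (%i. (1 - t) * v i + t * w i) <= nrm n (%i. (1 - t) * v i) + nrm n (%i. t * w i)"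
  unfolding L by (rule L2_set_triangle_ineq)
 also have "... = (1 - t) * nrm n v + t * nrm n w"
  unfolding L using t L2_set_right_distrib[of "1 - t" v "{..<n}"] L2_set_right_distrib[of t w "{..<n}"] by simp
 also have "... <= (1 - t) * 1 + t * 1"
  using t v by (intro add_mono mult_left_mono) (auto simp: tsp_ndisc_nrm)
 finally show ?thesis using v by (simp add: tsp_ndisc_nrm)
qed

text \<open>Each point of the disc moves straight to its image under \<open>r\<close>, and points
  already mapped into \<open>K\<close> stay in place; injectivity elsewhere lets the motion descend
  to the space. Serves both to push a cell into \<open>K\<close> and to push a collar into the
  skeleton.\<close>

lemma cell_deformation:
 assumes H: "Hausdorff_space X" and K: "closedin X K" and ph: "cmap (ndisc n) X ph"
  and r: "cmap (ndisc n) (ndisc n) r"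
   "!!v. v:tsp (ndisc n) ==> ph v:K ==> r v=v"
  and inj: "!!v w. [|v:tsp (ndisc n); w:tsp (ndisc n); ph v ~: K; ph v=ph w|] ==> v=w"
 defines "Z == subt X (K Un ph ` tsp (ndisc n))"
 obtains h where "closedin X (K Un ph ` tsp (ndisc n))"
  "cmap (prodt I01 Z) Z h" "ALL x:tsp Z. h (0, x)=x"
  "ALL x:K. ALL t. h (t, x)=x" "ALL v:tsp (ndisc n). h (1, ph v)=ph (r v)"
proof -
 let ?D = "tsp (ndisc n)" and ?I = "I01"
 let ?K = "K Un ph ` ?D"
 let ?X = "subt X ?K"
 have phK: "ph ` ?D <= tsp X" using cm_fun[OF ph] by blast
 have KX: "K <= tsp X" using K closedin_subset by blast
 have "compactin X (ph ` ?D)" by (rule image_compactin[OF _ ph]) (use compact_space_ndisc in \<open>simp add: compact_space_def\<close>)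
 hence cl: "closedin X (ph ` ?D)" using H compactin_imp_closedin by blast
 hence clK: "closedin X ?K" using K by blast
 have topX: "tsp ?X=?K" using phK KX by auto
 define s where "s p=(%i. (1 - fst p) * snd p i + fst p * r (snd p) i)" for p :: "real \<times> (nat => real)"
 have rD: "r v:?D" if "v:?D" for v
  using cm_fun[OF r(1)] that by auto
 have s: "cmap (prodt ?I (ndisc n)) (ndisc n) s"
 proof (rule continuous_map_ndisc)
  have 1: "cmap (prodt ?I (ndisc n)) eur fst"
   using continuous_map_fst cm_full by blast
  have 2: "cmap (prodt ?I (ndisc n)) eur (%p. snd p i)" for i
   using cmo[OF continuous_map_snd continuous_map_ndisc_proj] by (simp add: o_def)
  from cmo[OF cmo[OF continuous_map_snd r(1)] continuous_map_ndisc_proj]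
  have 3: "cmap (prodt ?I (ndisc n)) eur (%p. r (snd p) i)" for i
   by (simp add: o_def)
  show "cmap (prodt ?I (ndisc n)) eur (%p. s p i)" for i
   unfolding s_def by (intro continuous_map_add continuous_map_real_mult continuous_map_diff 1 2 3) simp
  show "s p:?D" if "p:tsp (prodt ?I (ndisc n))" for p
   unfolding s_def using that rD by (intro nrm_convex) auto
 qed
 have s0: "s (0, v)=v" and s1: "s (1, v)=r v" for v by (simp_all add: s_def)
 have sr: "s (t, v)=v" if "v:?D" "ph v:K" for t v
  using r(2)[OF that] by (simp add: s_def fun_eq_iff algebra_simps)
 define h where "h p=(if snd p:K then snd p else ph (s (fst p, inv_into ?D ph (snd p))))" for p
 have hph: "h (t, ph v)=ph (s (t, v))" if "v:?D" for t v
 proof (cases "ph v:K")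
  case True
  thus ?thesis using sr[OF that True] by (simp add: h_def)
 next
  case False
  have "inv_into ?D ph (ph v)=v"
   by (rule inj[symmetric]) (use that False f_inv_into_f[of "ph v" ph ?D] inv_into_into[of "ph v" ph ?D] in auto)
  thus ?thesis using False by (simp add: h_def)
 qed
 have h: "cmap (prodt ?I ?X) ?X h"
 proof (rule continuous_map_union_closed)
  show "closedin (prodt ?I ?X) ({0..1} \<times> K)" "closedin (prodt ?I ?X) ({0..1} \<times> ph ` ?D)"
   using K cl clK by (auto simp: closedin_prod_Times_iff closedin_closed_subtopology)
  show "tsp (prodt ?I ?X) <= {0..1} \<times> K Un {0..1} \<times> ph ` ?D" using topX by auto
  have sub: "subt (prodt ?I ?X) ({0..1} \<times> Y)=prodt ?I (subt X Y)" if "Y <= ?K" for Y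
   using that by (simp add: prod_topology_subtopology[symmetric] subtopology_subtopology Int_absorb1 Times_Int_Times flip: subtopology_Times)
  have "cmap (subt X K) ?X id" by (simp add: cm_into)
  from cmo[OF continuous_map_snd this]
  have "cmap (prodt ?I (subt X K)) ?X snd" by simp
  hence "cmap (prodt ?I (subt X K)) ?X h"
   by (rule continuous_map_eq) (use KX in \<open>auto simp: h_def\<close>)
  thus "cmap (subt (prodt ?I ?X) ({0..1} \<times> K)) ?X h" using sub by simp
  let ?Y = "subt X (ph ` ?D)"
  let ?q = "%p. (fst p, ph (snd p))"
  have q: "cmap (prodt ?I (ndisc n)) (prodt ?I ?Y) ?q"
  proof (intro continuous_map_pairedI continuous_map_fst)
   have "cmap (ndisc n) ?Y ph" using ph by (simp add: cm_into Pi_iff)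
   from cmo[OF continuous_map_snd this]
   show "cmap (prodt ?I (ndisc n)) ?Y (%p. ph (snd p))" by (simp add: o_def)
  qed
  have qm: "quotient_map (prodt ?I (ndisc n)) (prodt ?I ?Y) ?q"
  proof (intro continuous_closed_imp_quotient_map[OF q] continuous_imp_closed_map[OF q])
   show "compact_space (prodt ?I (ndisc n))"
    by (simp add: compact_space_prod_topology cpt_sub compact_space_ndisc)
   show "Hausdorff_space (prodt ?I ?Y)"
    by (simp add: Hausdorff_space_prod_topology Hausdorff_space_subtopology H)
   show "?q ` tsp (prodt ?I (ndisc n))=tsp (prodt ?I ?Y)"
    using phK by (force simp: image_iff)
  qed
  have "cmap (prodt ?I (ndisc n)) ?X (ph o s)"
   using cmo[OF s ph] cm_fun[OF s]
   by (auto simp: cm_into)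
  hence "cmap (prodt ?I (ndisc n)) ?X (h o ?q)"
   by (rule continuous_map_eq) (auto simp: hph)
  from continuous_compose_quotient_map[OF qm this]
  show "cmap (subt (prodt ?I ?X) ({0..1} \<times> ph ` ?D)) ?X h" using sub by simp
 qed
 show thesis
 proof (rule that[OF clK, of h]; (intro ballI allI)?)
  show "cmap (prodt ?I Z) Z h" unfolding Z_def by (rule h)
  show "h (0, x)=x" if x: "x:tsp Z" for x
  proof (cases "x:K")
   case False
   then obtain v where v: "v:?D" "x=ph v" using x topX unfolding Z_def by blast
   thus ?thesis using hph[OF v(1)] s0 by simp
  qed (simp add: h_def)
  show "h (t, x)=x" if "x:K" for t x using that by (simp add: h_def)
  show "h (1, ph v)=ph (r v)" if "v:?D" for v using hph[OF that] s1 by simp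
 qed
qed

text \<open>If the part of the disc that is mapped to \<open>K\<close> is a retract of the disc, the
  whole cell can be pushed into \<open>K\<close>.\<close>

lemma contractible_union_cell:
 assumes H: "Hausdorff_space X" and K: "closedin X K" "contractible_space (subt X K)" "K ~= {}"
  and ph: "cmap (ndisc n) X ph"
  and r: "cmap (ndisc n) (subt (ndisc n) {v. ph v:K}) r"
   "!!v. v:tsp (ndisc n) ==> ph v:K ==> r v=v"
  and inj: "!!v w. [|v:tsp (ndisc n); w:tsp (ndisc n); ph v ~: K; ph v=ph w|] ==> v=w"
 shows "closedin X (K Un ph ` tsp (ndisc n))" "contractible_space (subt X (K Un ph ` tsp (ndisc n)))"
proof -
 let ?D = "tsp (ndisc n)" and ?I = "I01"
 let ?K = "K Un ph ` ?D"
 let ?X = "subt X ?K"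
 have r': "cmap (ndisc n) (ndisc n) r" using r(1) cm_full by blast
 have topX: "tsp ?X=?K"
  using cm_fun[OF ph] closedin_subset[OF K(1)] by auto
 obtain h where clK: "closedin X ?K" and h: "cmap (prodt ?I ?X) ?X h"
  "ALL x:tsp ?X. h (0, x)=x" "ALL x:K. ALL t. h (t, x)=x" "ALL v:?D. h (1, ph v)=ph (r v)"
  by (rule cell_deformation[OF H K(1) ph r' r(2) inj])
 show "closedin X ?K" by (rule clK)
 have h0: "h (0, x)=x" "h (1, x):K" if xK: "x:?K" for x
 proof -
  show "h (0, x)=x" using h(2) xK topX by simp
  show "h (1, x):K"
  proof (cases "x:K")
   case False
   then obtain v where v: "v:?D" "x=ph v" using xK by blast
   thus ?thesis using h(4) cm_fun[OF r(1)] by auto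
  qed (simp add: h(3))
 qed
 have "homotopic_with (%_. True) ?X ?X id (%x. h (1, x))"
  by (subst homotopic_with) (use h(1) h0 topX in auto)
 moreover have "EX a. homotopic_with (%_. True) ?X ?X (%x. h (1, x)) (%_. a)"
 proof -
  have "cmap ?X (subt X K) (%x. h (1, x))"
  proof -
   have "cmap ?X (prodt ?I ?X) (%x. (1, x))"
    by (intro continuous_map_pairedI) auto
   from cmo[OF this h(1)]
   have "cmap ?X X (%x. h (1, x))" by (simp add: o_def cm_into)
   thus ?thesis using h0 topX by (auto simp: cm_into)
  qed
  moreover obtain a where a: "homotopic_with (%_. True) (subt X K) (subt X K) id (%_. a)"
   using K(2) unfolding contractible_space_def by blast
  ultimately have "homotopic_with (%_. True) ?X (subt X K) (id o (%x. h (1, x))) ((%_. a) o (%x. h (1, x)))"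
   by (intro homotopic_with_compose_continuous_map_right[OF a]) auto
  moreover have "cmap (subt X K) ?X id"
   by (simp add: cm_into)
  ultimately have "homotopic_with (%_. True) ?X ?X (id o (id o (%x. h (1, x)))) (id o ((%_. a) o (%x. h (1, x))))"
   by (rule homotopic_with_compose_continuous_map_left) auto
  thus ?thesis by (auto simp: o_def)
 qed
 ultimately show "contractible_space ?X"
  unfolding contractible_space_def using homotopic_with_trans by blast
qed

lemma circ_inj: "circ a=circ b ==> \<bar>a - b\<bar> < 1 ==> a=b"
proof -
 assume eq: "circ a=circ b" and ab: "\<bar>a - b\<bar> < 1"
 have "cos (2 * pi * a)=cos (2 * pi * b)" "sin (2 * pi * a)=sin (2 * pi * b)"
  using fun_cong[OF eq, of 0] fun_cong[OF eq, of 1] by (simp_all add: circ_def)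
 then obtain n :: int where "2 * pi * a=2 * pi * b + 2 * pi * n" using sin_cos_eq_iff[of "2 * pi * a" "2 * pi * b"] by auto
 hence "2 * pi * (a - b - n)=0" by (simp add: algebra_simps)
 hence "a - b=n" by simp
 hence "\<bar>real_of_int n\<bar> < 1" using ab by simp
 hence "n=0" by linarith
 thus "a=b" using \<open>a - b = n\<close> by simp
qed

lemma circ_shift: "circ (a + 1)=circ a"
 by (auto simp: circ_def distrib_left sin_add cos_add)

lemma continuous_map_circ': "cmap eur (nS 1) circ"
proof -
 have "cmap eur eur (%s. circ s i)" for i
  by (cases "i=0"; cases "i=1") (auto simp: circ_def intro!: continuous_intros)
 hence "cmap eur (powertop_real UNIV) circ"
  by (simp add: cm_comp)
 thus ?thesis
  using circ_sphere unfolding nsphere[of 1] cm_into by auto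
qed

text \<open>An arc is a copy of an interval, so by Tietze's theorem its inverse parametrization
  extends to the disc. The set \<open>A\<close> is the closed arc complementary to the open arc from
  a to b; parameters run to a + 1 in order to pass the angle 0.\<close>

lemma disc_retract_arc:
 assumes ab: "a < b" "b < a + 1"
 defines "A == circ ` {b..a + 1}"
 obtains r where "cmap (ndisc 2) (subt (ndisc 2) A) r" "!!v. v:A ==> r v=v"
proof -
 let ?J = "top_of_set {b..a + 1}"
 have c: "cmap ?J (ndisc 2) circ"
 proof -
  have "cmap ?J (nS 1) circ" using continuous_map_circ' cm_from by blast
  moreover have "nS 1=subt (ndisc 2) (tsp (nS 1))"
   using sphere_subtopology[of 2] unfolding diff_2_1 by simp
  ultimately show ?thesis by (metis cm_into)
 qed
 have J: "tsp ?J={b..a + 1}" by simp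
 have comp: "compact_space ?J" by (simp add: cpt_sub)
 have AD: "A <= tsp (ndisc 2)" using cm_fun[OF c] unfolding A_def by auto
 have cJ: "cmap ?J (subt (ndisc 2) A) circ"
  using c by (auto simp: cm_into A_def)
 have inj: "inj_on circ {b..a + 1}" using ab by (intro inj_onI circ_inj) auto
 have "homeomorphic_map ?J (subt (ndisc 2) A) circ"
 proof (rule continuous_imp_homeomorphic_map[OF cJ comp])
  show "Hausdorff_space (subt (ndisc 2) A)" by (simp add: Hausdorff_space_subtopology Hausdorff_space_ndisc)
  show "circ ` tsp ?J=tsp (subt (ndisc 2) A)" using AD by (auto simp: A_def)
  show "inj_on circ (tsp ?J)" using inj by simp
 qed
 then obtain g where g: "homeomorphic_maps ?J (subt (ndisc 2) A) circ g"
  using homeomorphic_map_maps by blast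
 have gA: "circ (g v)=v" "g v:{b..a + 1}" if "v:A" for v
  using g that AD cm_fun[of "subt (ndisc 2) A" ?J g] by (auto simp: homeomorphic_maps_def)
 have gc: "cmap (subt (ndisc 2) A) eur g"
  using g cm_full unfolding homeomorphic_maps_def by blast
 have "compactin (ndisc 2) A"
  unfolding A_def by (rule image_compactin[OF _ c]) (use comp J in \<open>simp add: compact_space_def\<close>)
 hence cl: "closedin (ndisc 2) A" using Hausdorff_space_ndisc compactin_imp_closedin by blast
 have norm: "normal_space (ndisc 2)"
  using compact_Hausdorff_or_regular_imp_normal_space compact_space_ndisc Hausdorff_space_ndisc by blast
 obtain h where h: "cmap (ndisc 2) eur h" "h ` tsp (ndisc 2) <= {b..a + 1}"
  "!!v. v:A ==> h v=g v"
  by (rule Tietze_extension_realinterval[OF norm cl _ _ gc, of "{b..a + 1}"]) (use ab gA in auto)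
 show thesis
 proof (rule that[of "circ o h"])
  have "cmap (ndisc 2) ?J h" using h by (auto simp: cm_into)
  from cmo[OF this cJ] show "cmap (ndisc 2) (subt (ndisc 2) A) (circ o h)" .
  show "(circ o h) v=v" if "v:A" for v using h(3)[OF that] gA(1)[OF that] by simp
 qed
qed

lemma arc_complement:
 assumes "0 <= a" "a < b" "b <= 1"
 shows "circ ` {b..a + 1}={v:tsp (nS 1). ang v ~: {a<..<b}}"
proof (intro equalityI subsetI)
 fix v assume "v:circ ` {b..a + 1}"
 then obtain s where s: "s:{b..a + 1}" "v=circ s" by blast
 have "ang v ~: {a<..<b}"
 proof (cases "s < 1")
  case True
  thus ?thesis using s ang_circ[of s] assms by auto
 next
  case False
  hence "ang v=s - 1" using ang_circ[of "s - 1"] circ_shift[of "s - 1"] s assms by (cases "s=2") auto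
  thus ?thesis using s by auto
 qed
 thus "v:{v:tsp (nS 1). ang v ~: {a<..<b}}" using s by simp
next
 fix v assume v: "v:{v:tsp (nS 1). ang v ~: {a<..<b}}"
 hence cv: "circ (ang v)=v" using circ_ang by blast
 show "v:circ ` {b..a + 1}"
 proof (cases "ang v <= a")
  case True
  thus ?thesis using cv circ_shift[of "ang v"] ang_range[of v] assms by (intro image_eqI[of _ _ "ang v + 1"]) auto
 next
  case False
  thus ?thesis using cv v ang_range[of v] assms by (intro image_eqI[of _ _ "ang v"]) auto
 qed
qed

section \<open>Contractibility of the Cayley complex\<close>

lemma continuous_map_const_sub: "a:S ==> a:tsp X ==> cmap Y (subt X S) (%_. a)"
 by simp

context hnn_words begin

section \<open>A spanning tree of the Cayley graph\<close>

definition tl_letter :: "bool fg state => nat \<times> bool" where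
 "tl_letter x=(if snd x ~= 0 then (let l=last (letters (snd x)) in (if fst l then 1 else 0, snd l))
   else (2, snd (hd (fst x))))"

text \<open>Removes the last letter of the normal form word. For \<open>one_V\<close> the letter is
  arbitrary, so the parent is meaningful only for other states.\<close>

definition par :: "bool fg state => bool fg state" where "par x=lact (inv_letter (tl_letter x)) x"

lemma gen_letter_split:
 assumes "g ~= 0" obtains v where "letters g=letters v @ [last (letters g)]" "g + gen (inv_letter (last (letters g)))=v"
proof -
 obtain w l where w: "letters g=w @ [l]" using letters_nz[OF assms] by (metis rev_exhaust)
 hence "reduced w" by (metis reduced_letters reduced_append)
 hence lw: "letters (word_val w)=w" by (rule letters_word_val_reduced)
 have "word_val (letters g)=word_val w + gen l" unfolding w by simp
 hence "g=word_val w + gen l" by simp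
 hence "g + gen (inv_letter l)=word_val w" by (simp add: gen_inv)
 thus thesis using that[of "word_val w"] lw w by simp
qed

lemma length_nfw: "length (nfw (L, g))=(SUM (c, e)<-L. Suc (length (letters c))) + length (letters g)"
proof (induction L arbitrary: g)
 case (Cons ce L)
 have "length (emb w)=length w" for w by (induction w) auto
 thus ?case using Cons by (cases ce) (simp add: nfw_Cons)
next
 case Nil
 have "length (emb w)=length w" for w by (induction w) auto
 thus ?case by (simp add: nfw_def)
qed

lemma par_cases:
 assumes x: "x:V" "x ~= one_V"
 shows "length (nfw (par x)) < length (nfw x)" "fst (tl_letter x):three"
proof -
 obtain L g where Lg: "x=(L, g)" by fastforce
 have "length (nfw (par x)) < length (nfw x) & fst (tl_letter x):three"
 proof (cases "g=0")
  case False
  obtain v where v: "letters g=letters v @ [last (letters g)]" "g + gen (inv_letter (last (letters g)))=v"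
   using gen_letter_split[OF False] .
  let ?l = "last (letters g)"
  have tl: "tl_letter x=(if fst ?l then 1 else 0, snd ?l)" using False by (simp add: tl_letter_def Lg Let_def)
  have "par x=(L, v)"
   using v(2) unfolding par_def tl by (cases "fst ?l") (simp_all add: Lg lact_def inv_letter_def)
  moreover have "length (letters v) < length (letters g)" by (subst v(1)) simp
  ultimately show ?thesis using tl by (simp add: Lg length_nfw three_def)
 next
  case True
  hence "L ~= []" using x by (simp add: one_V_def Lg)
  then obtain c e L' where L: "L=(c, e) # L'" by (metis list.exhaust surj_pair)
  have tl: "tl_letter x=(2, e)" by (simp add: tl_letter_def Lg L True)
  have "par x=(L', c)" using True unfolding par_def tl
   by (simp add: lact_def inv_letter_def tact_def Lg L)
  thus ?thesis using tl by (simp add: Lg L length_nfw three_def True)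
 qed
 thus "length (nfw (par x)) < length (nfw x)" "fst (tl_letter x):three" by simp_all
qed

lemma par_V: "x:V ==> par x:V"
 by (simp add: par_def)

lemma last_letter_plus:
 fixes g :: "bool fg"
 shows "(g + gen l ~= 0 & last (letters (g + gen l))=l) | (g ~= 0 & last (letters g)=inv_letter l)"
proof (cases "g ~= 0 & last (letters g)=inv_letter l")
 case False
 hence "reduced (letters g @ letters (gen l))" using letters_nz[of g] by (auto simp: reduced_snoc)
 hence "letters (g + gen l)=letters g @ [l]" using letters_plus_reduced by fastforce
 thus ?thesis by (metis last_snoc letters_zero snoc_eq_iff_butlast)
qed simp

text \<open>All edges labelled a or \<tau> join a vertex to its parent. A t-edge does so if no power
  of \<open>u True\<close> has to cross the letter; if one has to, both endpoints have a last letter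
  from the base group.\<close>

definition tree_edge :: "bool fg state => nat => bool" where
 "tree_edge z s \<longleftrightarrow> s:three & (s=2 --> ex True (snd z)=0)"

lemma tree_edge_cases:
 assumes z: "z:V" and t: "tree_edge z s"
 shows "(lact (s, True) z ~= one_V & tl_letter (lact (s, True) z)=(s, True)) | (z ~= one_V & tl_letter z=(s, False))"
proof -
 obtain L g where Lg: "z=(L, g)" by fastforce
 show ?thesis
 proof (cases "s=2")
  case False
  hence s: "s=(if s=1 then 1 else 0)" using t by (auto simp: tree_edge_def three_def)
  have la: "lact (s, True) z=(L, g + gen (s=1, True))" using False by (simp add: lact_def Lg)
  show ?thesis using last_letter_plus[of g "(s=1, True)"]
  proof
   assume "g + gen (s=1, True) ~= 0 & last (letters (g + gen (s=1, True)))=(s=1, True)"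
   thus ?thesis unfolding la using s by (simp add: tl_letter_def one_V_def)
  next
   assume "g ~= 0 & last (letters g)=inv_letter (s=1, True)"
   thus ?thesis unfolding Lg using s by (simp add: tl_letter_def one_V_def inv_letter_def)
  qed
 next
  case True
  hence e0: "ex True g=0" using t by (simp add: tree_edge_def Lg)
  hence rg: "rep True g=g" using rep_ex[of g True] by simp
  show ?thesis
  proof (cases "g=0 & L ~= [] & ~snd (hd L)")
   case True': True
   thus ?thesis using True by (auto simp: Lg one_V_def tl_letter_def)
  next
   case False
   hence "lact (s, True) z=((g, True) # L, 0)"
    using rg e0 True by (auto simp: lact_def Lg tact_def Let_def)
   thus ?thesis using True by (simp add: tl_letter_def one_V_def)
  qed
 qed
qed

definition Ecl :: "bool fg state => nat => pt set" where "Ecl z s=emap z s ` tsp (ndisc 1)"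
definition Fcl :: "bool fg state => pt set" where "Fcl x=fmap x ` tsp (ndisc 2)"

lemma Ecl_iff: "e:Ecl z s \<longleftrightarrow> e=(z, Vertex) | e=(lact (s, True) z, Vertex) | (EX y. \<bar>y\<bar> < 1 & e=(z, Edge s y))"
proof -
 have 1: "(%i::nat. if i=0 then y else 0):tsp (ndisc 1)" if "\<bar>y\<bar> <= 1" for y using that by (simp add: ndisc1)
 have "e:Ecl z s \<longleftrightarrow> (EX y. \<bar>y\<bar> <= 1 & e=eedge z s y)"
 proof
  assume "e:Ecl z s"
  then obtain v where "v:tsp (ndisc 1)" "e=emap z s v" unfolding Ecl_def by blast
  thus "EX y. \<bar>y\<bar> <= 1 & e=eedge z s y" by (intro exI[of _ "v 0"]) (simp add: ndisc1 emap_def)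
 next
  assume "EX y. \<bar>y\<bar> <= 1 & e=eedge z s y"
  then obtain y where "\<bar>y\<bar> <= 1" "e=eedge z s y" by blast
  thus "e:Ecl z s"
   unfolding Ecl_def by (intro image_eqI[OF _ 1[of y]]) (simp_all add: emap_def)
 qed
 also have "... \<longleftrightarrow> e=(z, Vertex) | e=(lact (s, True) z, Vertex) | (EX y. \<bar>y\<bar> < 1 & e=(z, Edge s y))"
 proof
  assume "EX y. \<bar>y\<bar> <= 1 & e=eedge z s y"
  thus "e=(z, Vertex) | e=(lact (s, True) z, Vertex) | (EX y. \<bar>y\<bar> < 1 & e=(z, Edge s y))"
   by (metis eedge_def)
 next
  have "eedge z s (-1)=(z, Vertex)" "eedge z s 1=(lact (s, True) z, Vertex)" by (simp_all add: eedge_def)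
  moreover have "eedge z s y=(z, Edge s y)" if "\<bar>y\<bar> < 1" for y using that by (simp add: eedge_def)
  moreover assume "e=(z, Vertex) | e=(lact (s, True) z, Vertex) | (EX y. \<bar>y\<bar> < 1 & e=(z, Edge s y))"
  ultimately show "EX y. \<bar>y\<bar> <= 1 & e=eedge z s y"
   by (metis abs_minus_cancel abs_one less_imp_le order_refl)
 qed
 finally show ?thesis .
qed

text \<open>The face at x has two t-edges, one at x and one at x times \<open>u True\<close>, whose
  exponents \<open>ex True\<close> differ by 1. The face is matched with the one farther from the
  tree value 0, called \<open>owned x\<close>. Each t-edge outside the tree is matched with exactly
  one face, and along a strip of faces the matching points outward, which makes it acyclic.\<close>

definition owner :: "bool fg state => bool fg state" where
 "owner z=(if ex True (snd z) > 0 then addg (- u True) z else z)"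
definition owned :: "bool fg state => bool fg state" where
 "owned x=(if ex True (snd x) >= 0 then addg (u True) x else x)"
text \<open>Where the matched t-edge occurs in the relator: the letter t follows
  \<open>u True\<close> directly, and its inverse is the final letter.\<close>

definition pos :: "bool fg state => nat" where
 "pos x=(if ex True (snd x) >= 0 then length (letters (u True)) else length relator - 1)"
definition st :: "bool fg state => nat => bool fg state" where "st x i=wact (take i relator) x"
text \<open>Names the edge traversed by letter i of the boundary of the face x by its initial
  vertex; for an inverse letter that is the vertex reached later.\<close>

definition eo :: "bool fg state => nat => bool fg state" where
 "eo x i=(if snd (relator ! i) then st x i else lact (relator ! i) (st x i))"
abbreviation "N == length relator"

lemma ex_add [simp]: "ex True (snd (addg (u True) x))=ex True (snd x) + 1" "ex True (snd (addg (- u True) x))=ex True (snd x) - 1"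
 using ex_shift[of True "snd x" 1] ex_shift[of True "snd x" "-1"] by (simp_all add: addg_def gpow_minus)

lemma owner_owned [simp]: "owner (owned x)=x" and ex_owned: "ex True (snd (owned x)) ~= 0"
 by (auto simp: owner_def owned_def)

lemma owned_owner: "ex True (snd z) ~= 0 ==> owned (owner z)=z"
 by (auto simp: owner_def owned_def)

lemma eletter_eedge: "eletter (st x i) (relator ! i) t=eedge (eo x i) (fst (relator ! i)) (if snd (relator ! i) then 2 * t - 1 else 1 - 2 * t)"
 by (simp add: eletter_def eo_def)

lemma len_emb [simp]: "length (emb w)=length w"
 by (induction w) auto

lemma N_eq: "N=length (letters (u True)) + length (letters (- u False)) + 2"
 by (simp add: relator_def)

lemma len_u: "length (letters (u e)) > 0" "length (letters (- u e)) > 0"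
 using letters_nz[OF u_nz[of e]] letters_nz[of "- u e"] u_nz[of e] by auto

lemma st_V: "x:V ==> st x i:V" and eo_V: "x:V ==> eo x i:V"
 by (simp_all add: st_def eo_def)

lemma st_Suc: "i < N ==> st x (Suc i)=lact (relator ! i) (st x i)"
 by (simp add: st_def take_Suc_conv_app_nth)

lemma st_ends [simp]: "st x 0=x" "x:V ==> st x N=x"
 by (simp_all add: st_def)

lemma Ecl_vertices: "(z, Vertex):Ecl z s" "(lact (s, True) z, Vertex):Ecl z s"
 by (simp_all add: Ecl_iff)

lemma Ecl_ends:
 assumes "x:V" "i < N" shows "(st x i, Vertex):Ecl (eo x i) (fst (relator ! i))" "(st x (Suc i), Vertex):Ecl (eo x i) (fst (relator ! i))"
proof -
 let ?l = "relator ! i"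
 have "lact (fst ?l, True) (lact ?l (st x i))=st x i" if "~snd ?l"
  using lact_inv[OF st_V[OF assms(1)], of ?l i] that by (simp add: inv_letter_def)
 moreover have "(fst ?l, True)=?l" if "snd ?l" using that by (cases ?l) auto
 ultimately have "(st x i=eo x i & st x (Suc i)=lact (fst ?l, True) (eo x i)) | (st x (Suc i)=eo x i & st x i=lact (fst ?l, True) (eo x i))"
  unfolding st_Suc[OF assms(2)] eo_def by (cases "snd ?l") simp_all
 thus "(st x i, Vertex):Ecl (eo x i) (fst ?l)" "(st x (Suc i), Vertex):Ecl (eo x i) (fst ?l)"
  using Ecl_vertices by metis+
qed

lemma relator_rungs:
 assumes x: "x:V" and i: "i < N" and 2: "fst (relator ! i)=2"
 shows "(i=length (letters (u True)) & snd (relator ! i) & eo x i=addg (u True) x) |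
  (i=N - 1 & ~snd (relator ! i) & eo x i=x)"
proof -
 let ?w = "emb (letters (u True))" and ?v = "emb (letters (- u False))"
 have emb2: "fst (emb w ! j) ~= 2" if "j < length w" for w j
 proof -
  have "emb w ! j:{0, 1} \<times> UNIV" using set_emb[of w] that nth_mem[of j "emb w"] by (metis len_emb subsetD)
  thus ?thesis by (auto simp: mem_Times_iff)
 qed
 have R: "relator=?w @ (2, True) # ?v @ [(2, False)]" by (simp add: relator_def)
 consider "i < length ?w" | "i=length ?w" | "length ?w < i" "i < N - 1" | "i=N - 1" using i by linarith
 thus ?thesis
 proof cases
  case 1
  hence "relator ! i=?w ! i" by (simp add: R nth_append)
  thus ?thesis using emb2[of i "letters (u True)"] 1 2 by simp
 next
  case 2
  hence "relator ! i=(2, True)" "take i relator=?w" by (simp_all add: R nth_append)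
  thus ?thesis using 2 by (simp add: eo_def st_def)
 next
  case 3
  define j where "j=i - length ?w - 1"
  have j: "i=length ?w + Suc j" "j < length ?v" using 3 by (auto simp: j_def N_eq)
  have "relator ! i=?v ! j" using j(2) unfolding j(1) R by (simp add: nth_append)
  thus ?thesis using emb2[of j "letters (- u False)"] j(2) 2 by simp
 next
  case 4
  have Ni: "Suc i=N" using 4 i by simp
  have "relator=(?w @ (2, True) # ?v) @ [(2, False)]" "length (?w @ (2, True) # ?v)=i" using 4 by (simp_all add: R N_eq)
  hence r: "relator ! i=(2, False)" by (metis nth_append_length)
  have "lact (relator ! i) (st x i)=x" using st_Suc[OF i, of x] st_ends(2)[OF x] Ni by simp
  thus ?thesis using 4 r by (simp add: eo_def)
 qed
qed

lemma pos:
 assumes x: "x:V" shows "pos x < N" "0 < pos x" "fst (relator ! pos x)=2" "eo x (pos x) = owned x"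
proof -
 let ?w = "emb (letters (u True))" and ?v = "emb (letters (- u False))"
 have R: "relator=?w @ (2, True) # ?v @ [(2, False)]" by (simp add: relator_def)
 have R': "relator=(?w @ (2, True) # ?v) @ [(2, False)]" "length (?w @ (2, True) # ?v)=N - 1" by (simp_all add: R N_eq)
 have "relator ! length (letters (u True))=(2, True)" by (simp add: R nth_append)
 moreover have "relator ! (N - 1)=(2, False)" by (metis R' nth_append_length)
 ultimately show p: "pos x < N" "0 < pos x" "fst (relator ! pos x)=2"
  using len_u(1)[of True] by (simp_all add: pos_def N_eq)
 show "eo x (pos x) = owned x"
  using relator_rungs[OF x p(1,3)] \<open>relator ! length (letters (u True)) = (2, True)\<close> \<open>relator ! (N - 1) = (2, False)\<close>
  by (auto simp: pos_def owned_def)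
qed

lemma other_rung:
 assumes x: "x:V" and i: "i < N" "i ~= pos x" "fst (relator ! i)=2"
 shows "eo x i=(if ex True (snd x) >= 0 then x else addg (u True) x)"
 using relator_rungs[OF x i(1,3)] i(2) by (auto simp: pos_def)

lemma fmap_circ:
 assumes "i < N" "0 <= t" "t < 1"
 shows "fmap x (circ ((real i + t) / N))=eletter (st x i) (relator ! i) t"
proof -
 have n: "N > 0" using assms by linarith
 have s: "0 <= (real i + t) / N" "(real i + t) / N < 1" using assms n by (auto simp: divide_less_eq)
 have "circ ((real i + t) / N) ~: odisc 2"
  using circ_sphere[of "(real i + t) / N"] sphere_nrm(1)[of 2] unfolding diff_2_1 by (auto simp: open_disc_nrm)
 moreover have "real N * ((real i + t) / N)=real i + t" using n by simp
 moreover have "\<lfloor>t\<rfloor>=0" using assms by linarith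
 hence "nat \<lfloor>real i + t\<rfloor>=i" "frac (real i + t)=t" by (simp_all add: frac_def)
 ultimately show ?thesis by (simp add: fmap_def eword_def ang_circ[OF s] st_def)
qed

lemma sphere_point:
 assumes v: "v:tsp (ndisc 2)" "v ~: odisc 2"
 obtains i t where "i < N" "0 <= t" "t < 1" "v=circ ((real i + t) / N)" "ang v=(real i + t) / N"
proof -
 have v: "v:tsp (nS 1)" using disc_boundary[of 2 v] v unfolding diff_2_1 by simp
 have n: "real N > 0" by (simp add: N_eq)
 define a where "a=real N * ang v"
 have a: "0 <= a" "a < N" using ang_range[of v] n by (auto simp: a_def)
 have "a=real (nat \<lfloor>a\<rfloor>) + frac a" using a by (simp add: frac_def)
 hence "ang v=(real (nat \<lfloor>a\<rfloor>) + frac a) / N" using n by (simp add: a_def field_simps)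
 moreover have "nat \<lfloor>a\<rfloor> < N" using a by linarith
 ultimately show thesis using that[of "nat \<lfloor>a\<rfloor>" "frac a"] circ_ang[OF v] frac_ge_0 frac_lt_1 by metis
qed

lemma circ_disc: "circ s:tsp (ndisc 2)"
 using sphere_subset_disc[of 2] circ_sphere[of s] unfolding diff_2_1 by auto

lemma Fcl_cases:
 assumes "e:Fcl x"
 obtains v where "v:odisc 2" "e=(x, Face v)"
 | i t where "i < N" "0 <= t" "t < 1" "e=eletter (st x i) (relator ! i) t"
proof -
 obtain v where v: "v:tsp (ndisc 2)" "e=fmap x v" using assms unfolding Fcl_def by blast
 show thesis
 proof (cases "v:odisc 2")
  case True thus ?thesis using that(1) v by (simp add: fmap_def)
 next
  case False
  obtain i t where "i < N" "0 <= t" "t < 1" "v=circ ((real i + t) / N)" using sphere_point[OF v(1) False] by metis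
  thus ?thesis using that(2) v(2) fmap_circ by simp
 qed
qed

lemma eletter_Ecl: "x:V ==> i < N ==> 0 <= t ==> t <= 1 ==> eletter (st x i) (relator ! i) t:Ecl (eo x i) (fst (relator ! i))"
 unfolding eletter_eedge Ecl_iff by (auto simp: eedge_def)

lemma st_Fcl:
 assumes x: "x:V" and i: "i <= N" shows "(st x i, Vertex):Fcl x"
proof -
 have "(st x i, Vertex):Fcl x" if i: "i < N" for i
 proof -
  have "fmap x (circ ((real i + 0) / N))=(st x i, Vertex)"
   using fmap_circ[OF i, of 0 x] eletter_ends(1)[OF st_V[OF x]] by simp
  thus ?thesis unfolding Fcl_def using circ_disc by (metis image_eqI)
 qed
 from this[of i] this[of 0] show ?thesis using i st_ends[of x] x by (cases "i=N") (auto simp: N_eq)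
qed

lemma Ecl_Fcl:
 assumes x: "x:V" and i: "i < N" shows "Ecl (eo x i) (fst (relator ! i)) <= Fcl x"
proof
 fix e assume "e:Ecl (eo x i) (fst (relator ! i))"
 then consider "e=(eo x i, Vertex)" | "e=(lact (fst (relator ! i), True) (eo x i), Vertex)"
  | y where "\<bar>y\<bar> < 1" "e=(eo x i, Edge (fst (relator ! i)) y)" unfolding Ecl_iff by blast
 moreover have "{eo x i, lact (fst (relator ! i), True) (eo x i)} <= {st x i, st x (Suc i)}"
 proof -
  have "lact (fst (relator ! i), True) (lact (relator ! i) (st x i))=st x i" if "~snd (relator ! i)"
   using lact_inv[OF st_V[OF x], of "relator ! i" i] that by (simp add: inv_letter_def)
  moreover have "(fst (relator ! i), True)=relator ! i" if "snd (relator ! i)" using that by (cases "relator ! i") auto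
  ultimately show ?thesis unfolding st_Suc[OF i] eo_def by (cases "snd (relator ! i)") simp_all
 qed
 ultimately show "e:Fcl x"
 proof cases
  case (3 y)
  define t where "t=(if snd (relator ! i) then 1 / 2 + y / 2 else 1 / 2 - y / 2)"
  have t: "0 <= t" "t < 1" using 3 by (auto simp: t_def)
  have "eletter (st x i) (relator ! i) t=e" unfolding eletter_eedge using 3 by (auto simp: eedge_def t_def)
  thus ?thesis unfolding Fcl_def using fmap_circ[OF i t, of x] circ_disc by (metis image_eqI)
 qed (use st_Fcl[OF x] i in auto)
qed

text \<open>Contractible subcomplexes that contain with each vertex its path to the root, and with
  each t-edge outside the tree the face matched with it. By the last condition the matched edge of a
  missing face is missing too, so the face can be attached along the rest of its boundary.\<close>

definition good :: "pt set => bool" where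
 "good K \<longleftrightarrow> K <= tsp E2 & closedin E2 K & contractible_space (subt E2 K) & (one_V, Vertex):K &
   (ALL z s y. (z, Edge s y):K --> Ecl z s <= K) &
   (ALL x v. (x, Face v):K --> Fcl x <= K) &
   (ALL x. (x, Vertex):K & x ~= one_V --> (par x, Vertex):K &
    Ecl (if snd (tl_letter x) then par x else x) (fst (tl_letter x)) <= K) &
   (ALL z y. (z, Edge 2 y):K & ex True (snd z) ~= 0 --> Fcl (owner z) <= K)"

lemma goodD:
 assumes "good K"
 shows "K <= tsp E2" "closedin E2 K" "contractible_space (subt E2 K)" "(one_V, Vertex):K"
  "(z, Edge s y):K ==> Ecl z s <= K" "(x, Face v):K ==> Fcl x <= K"
  "(x, Vertex):K ==> x ~= one_V ==> (par x, Vertex):K"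
  "(x, Vertex):K ==> x ~= one_V ==> Ecl (if snd (tl_letter x) then par x else x) (fst (tl_letter x)) <= K"
  "(z, Edge 2 y):K ==> ex True (snd z) ~= 0 ==> Fcl (owner z) <= K"
 using assms unfolding good_def by - (elim conjE, (assumption | blast))+

lemma good_base: "good {(one_V, Vertex)}"
 unfolding good_def
proof (intro conjI)
 have "(one_V, Vertex):tsp E2" by (simp add: top_E2 cells_def)
 thus "{(one_V, Vertex)} <= tsp E2" by simp
 show "closedin E2 {(one_V, Vertex)}"
  using Hausdorff_E2 \<open>(one_V, Vertex) : tsp E2\<close> by (simp add: closedin_Hausdorff_sing_eq)
 show "contractible_space (subt E2 {(one_V, Vertex)})"
  by (rule contractible_space_subset_singleton[of _ "(one_V, Vertex)"]) simp
qed simp_all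

lemma edge_ends:
 assumes "x:V"
 defines "z == (if snd (tl_letter x) then par x else x)" and "s == fst (tl_letter x)"
 shows "snd (tl_letter x) ==> z=par x & lact (s, True) z=x" "~snd (tl_letter x) ==> z=x & lact (s, True) z=par x"
proof -
 have l: "lact (tl_letter x) (par x)=x" using lact_inv'[OF assms(1)] by (simp add: par_def)
 show "z=par x & lact (s, True) z=x" if "snd (tl_letter x)"
  using l that by (cases "tl_letter x") (simp add: z_def s_def)
 show "z=x & lact (s, True) z=par x" if "~snd (tl_letter x)"
  using that by (simp add: z_def s_def par_def inv_letter_def)
qed

lemma emap_cont_E2: "z:V ==> s:three ==> cmap (ndisc 1) E2 (emap z s)"
proof -
 assume z: "z:V" "s:three"
 have "cmap (ndisc 1) E1 (emap z s)" by (rule G1.continuous_phi) (use z in blast)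
 from cmo[OF this G2.continuous_A] show ?thesis by simp
qed

text \<open>Exactly one end of the edge lies in \<open>K\<close>, at parameter \<open>a\<close>, and
  a point is a retract of the interval.\<close>

lemma add_edge:
 assumes K: "closedin E2 K" "contractible_space (subt E2 K)"
  and z: "z:V" "s:three" and new: "!!y. (z, Edge s y) ~: K"
  and ends: "(z, Vertex):K \<longleftrightarrow> (lact (s, True) z, Vertex) ~: K"
 shows "closedin E2 (K Un Ecl z s)" "contractible_space (subt E2 (K Un Ecl z s))"
proof -
 define a :: real where "a=(if (z, Vertex):K then -1 else 1)"
 let ?a = "%i::nat. if i=0 then a else 0"
 have em: "emap z s v:K \<longleftrightarrow> v=?a" if v: "v:tsp (ndisc 1)" for v
 proof -
  have "v=(%i. if i=0 then v 0 else 0)" "\<bar>v 0\<bar> <= 1" using v by (auto simp: ndisc1 fun_eq_iff)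
  moreover from this(1) have "v=?a \<longleftrightarrow> v 0=a" by (metis (mono_tags, lifting))
  moreover have "eedge z s y:K \<longleftrightarrow> y=a" if "\<bar>y\<bar> <= 1" for y
  proof (cases "\<bar>y\<bar> < 1")
   case True
   thus ?thesis using new by (auto simp: eedge_def a_def)
  next
   case False
   hence "y=1 | y = -1" using that by auto
   thus ?thesis using ends by (auto simp: eedge_def a_def)
  qed
  ultimately show ?thesis by (simp add: emap_def)
 qed
 have aD: "?a:tsp (ndisc 1)" by (simp add: ndisc1 a_def)
 have ne: "K ~= {}" using ends by blast
 have r: "cmap (ndisc 1) (subt (ndisc 1) {v. emap z s v:K}) (%_. ?a)"
  by (rule continuous_map_const_sub) (use em[OF aD] aD in simp_all)
 have inj: "v=w" if vw: "v:tsp (ndisc 1)" "w:tsp (ndisc 1)" "emap z s v ~: K" "emap z s v=emap z s w" for v w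
 proof (rule ext)
  have o: "v 0=w 0"
  proof (cases "\<bar>v 0\<bar> < 1")
   case True
   thus ?thesis using vw(4) by (auto simp: emap_def eedge_def split: if_splits)
  next
   case False
   have "\<bar>v 0\<bar> <= 1" "\<bar>w 0\<bar> <= 1" using vw by (auto simp: ndisc1)
   moreover have "v 0 ~= a"
   proof
    assume "v 0=a"
    hence "v=?a" using vw(1) by (auto simp: ndisc1 fun_eq_iff)
    thus False using em[OF vw(1)] vw(3) by simp
   qed
   moreover have "w 0 ~= a"
   proof
    assume "w 0=a"
    hence "w=?a" using vw(2) by (auto simp: ndisc1 fun_eq_iff)
    thus False using em[OF vw(2)] vw by simp
   qed
   moreover have "~\<bar>w 0\<bar> < 1" using vw(4) False by (auto simp: emap_def eedge_def split: if_splits)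
   ultimately show ?thesis using False by (auto simp: a_def split: if_splits)
  qed
  fix i show "v i=w i"
  proof (cases "i=0")
   case False
   hence "i >= 1" by simp
   thus ?thesis using vw(1,2) by (simp add: ndisc1)
  qed (use o in simp)
 qed
 show "closedin E2 (K Un Ecl z s)" "contractible_space (subt E2 (K Un Ecl z s))"
  unfolding Ecl_def using contractible_union_cell[OF Hausdorff_E2 K ne emap_cont_E2[OF z] r _ inj] em by blast+
qed

lemma Ecl_E2: "z:V ==> s:three ==> Ecl z s <= tsp E2"
 using cm_fun[OF emap_cont_E2] unfolding Ecl_def by blast

lemma good_edge:
 assumes g: "good K" and x: "x:V" "x ~= one_V" and p: "(par x, Vertex):K" and n: "(x, Vertex) ~: K"
  and z: "z=(if snd (tl_letter x) then par x else x)" and s: "s=fst (tl_letter x)"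
  and t: "s=2 ==> ex True (snd z)=0"
 shows "good (K Un Ecl z s)"
proof -
 have ends: "(z=par x & lact (s, True) z=x) | (z=x & lact (s, True) z=par x)"
  using edge_ends[OF x(1)] unfolding z s by blast
 have zV: "z:V" using x par_V z by simp
 have sV: "s:three" using par_cases(2)[OF x] s by simp
 have new: "(z, Edge s y) ~: K" for y
 proof
  assume "(z, Edge s y):K"
  hence "Ecl z s <= K" by (rule goodD(5)[OF g])
  thus False using Ecl_vertices[where z = z and s = s] ends n by auto
 qed
 have K: "closedin E2 (K Un Ecl z s)" "contractible_space (subt E2 (K Un Ecl z s))"
  by (rule add_edge[OF goodD(2,3)[OF g] zV sV new]; use ends p n in auto)+
 show ?thesis
  unfolding good_def
 proof (intro conjI allI impI)
  show "K Un Ecl z s <= tsp E2" using goodD(1)[OF g] Ecl_E2[OF zV sV] by blast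
  show "closedin E2 (K Un Ecl z s)" "contractible_space (subt E2 (K Un Ecl z s))" by fact+
  show "(one_V, Vertex):K Un Ecl z s" using goodD(4)[OF g] by blast
 next
  fix z' s' y assume "(z', Edge s' y):K Un Ecl z s"
  thus "Ecl z' s' <= K Un Ecl z s"
  proof
   assume "(z', Edge s' y):K" thus ?thesis using goodD(5)[OF g] by blast
  next
   assume "(z', Edge s' y):Ecl z s" thus ?thesis unfolding Ecl_iff by simp
  qed
 next
  fix x' v assume "(x', Face v):K Un Ecl z s"
  hence "(x', Face v):K" by (simp add: Ecl_iff)
  thus "Fcl x' <= K Un Ecl z s" using goodD(6)[OF g] by blast
 next
  fix x' assume a: "(x', Vertex):K Un Ecl z s & x' ~= one_V"
  hence "(x', Vertex):K | x'=x" using ends p by (auto simp: Ecl_iff)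
  thus "(par x', Vertex):K Un Ecl z s" "Ecl (if snd (tl_letter x') then par x' else x') (fst (tl_letter x')) <= K Un Ecl z s"
   using goodD(7,8)[OF g] a p z s by blast+
 next
  fix z' y assume a: "(z', Edge 2 y):K Un Ecl z s & ex True (snd z') ~= 0"
  hence "(z', Edge 2 y):K" using t by (auto simp: Ecl_iff)
  thus "Fcl (owner z') <= K Un Ecl z s" using goodD(9)[OF g] a by blast
 qed
qed

text \<open>Entries of normal forms are chosen representatives, so a t-edge to a parent has exponent
  0. Adding it never creates an obligation to add a face.\<close>

lemma tl_rung:
 assumes "x:V" "x ~= one_V" "fst (tl_letter x)=2"
 shows "ex True (snd (if snd (tl_letter x) then par x else x))=0"
proof -
 obtain L g where Lg: "x=(L, g)" by fastforce
 have g: "g=0" using assms(3) by (auto simp: tl_letter_def Lg Let_def split: if_splits)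
 hence "L ~= []" using assms(2) by (simp add: one_V_def Lg)
 then obtain c e L' where L: "L=(c, e) # L'" by (metis list.exhaust surj_pair)
 have tl: "tl_letter x=(2, e)" by (simp add: tl_letter_def Lg L g)
 have "par x=(L', c)" using g unfolding par_def tl by (simp add: lact_def inv_letter_def tact_def Lg L)
 moreover have "rep e c=c" using assms(1) by (simp add: V_def Lg L)
 ultimately show ?thesis using tl ex_rep[of e c] g by (cases e) (simp_all add: Lg)
qed

text \<open>Induction on the length of the normal form: the path to the root is added edge by
  edge.\<close>

lemma good_vertex:
 assumes "good K" "x:V" shows "EX K'. good K' & K <= K' & (x, Vertex):K'"
 using assms(2)
proof (induction "length (nfw x)" arbitrary: x rule: less_induct)
 case less
 show ?case
 proof (cases "x = one_V")
  case True
  thus ?thesis using assms(1) goodD(4) by blast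
 next
  case False
  obtain K' where K': "good K'" "K <= K'" "(par x, Vertex):K'"
   using less(1)[OF par_cases(1)[OF less(2) False] par_V[OF less(2)]] by blast
  show ?thesis
  proof (cases "(x, Vertex):K'")
   case False': False
   let ?z = "if snd (tl_letter x) then par x else x"
   have "good (K' Un Ecl ?z (fst (tl_letter x)))"
    by (rule good_edge[OF K'(1) less(2) False K'(3) False' refl refl tl_rung[OF less(2) False]])
   moreover have "(x, Vertex):Ecl ?z (fst (tl_letter x))"
    using edge_ends[OF less(2)] Ecl_vertices by metis
   ultimately show ?thesis using K'(2) by blast
  qed (use K' in blast)
 qed
qed

lemma good_tree_edge:
 assumes K: "good K" and z: "z:V" and t: "tree_edge z s"
 shows "EX K'. good K' & K <= K' & Ecl z s <= K'"
 using tree_edge_cases[OF z t]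
proof
 let ?x = "lact (s, True) z"
 assume x: "?x ~= one_V & tl_letter ?x=(s, True)"
 obtain K' where K': "good K'" "K <= K'" "(?x, Vertex):K'" using good_vertex[OF K, of ?x] z by auto
 have "par ?x=z" using x lact_inv[OF z, of "(s, True)"] by (simp add: par_def inv_letter_def)
 thus ?thesis using goodD(8)[OF K'(1,3)] x K' by auto
next
 assume x: "z ~= one_V & tl_letter z=(s, False)"
 obtain K' where K': "good K'" "K <= K'" "(z, Vertex):K'" using good_vertex[OF K z] by auto
 thus ?thesis using goodD(8)[OF K'(1,3)] x by auto
qed

lemma good_finite:
 assumes "finite Q" "good K" and "!!K q. good K ==> q:Q ==> EX K'. good K' & K <= K' & q <= K'"
 shows "EX K'. good K' & K <= K' & \<Union>Q <= K'"
 using assms(1,3)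
proof (induction Q)
 case empty
 thus ?case using assms(2) by auto
next
 case (insert q Q)
 obtain K' where K': "good K'" "K <= K'" "\<Union>Q <= K'" using insert.IH insert.prems by (meson insertI2)
 obtain K'' where "good K''" "K' <= K''" "q <= K''" using insert.prems[OF K'(1), of q] by blast
 thus ?case using K' by blast
qed

lemma Fcl_E2: "x:V ==> Fcl x <= tsp E2"
 using cm_fun[OF G2.continuous_phi] unfolding Fcl_def by blast

text \<open>All boundary edges except the matched t-edge are in \<open>K\<close> and the interior of
  that edge is not. The preimage of \<open>K\<close> in the disc is therefore a closed arc of the
  boundary circle, which is a retract.\<close>

lemma add_face:
 assumes g: "good K" and x: "x:V"
  and bd: "!!i. i < N ==> i ~= pos x ==> Ecl (eo x i) (fst (relator ! i)) <= K"
  and new: "!!y. (owned x, Edge 2 y) ~: K"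
 shows "good (K Un Fcl x)"
proof -
 let ?j = "pos x" and ?A = "{pos x / N<..<(pos x + 1) / N}"
 note pos = pos[OF x]
 have N: "real N > 1" by (simp add: N_eq)
 have ow: "Ecl (owned x) 2 <= Fcl x" using Ecl_Fcl[OF x pos(1)] pos(3,4) by simp
 have "?j - 1 < N" "?j - 1 ~= ?j" "Suc (?j - 1)=?j" using pos by auto
 hence vj: "(st x ?j, Vertex):K" using bd[of "?j - 1"] Ecl_ends(2)[OF x, of "?j - 1"] by auto
 have inK: "eletter (st x i) (relator ! i) t:K" if "i < N" "0 <= t" "t < 1" "~(i=?j & 0 < t)" for i t
 proof (cases "i=?j")
  case True
  thus ?thesis using vj eletter_ends(1)[OF st_V[OF x]] that by auto
 next
  case False
  thus ?thesis using bd[OF that(1) False] eletter_Ecl[OF x that(1)] that by auto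
 qed
 have j: "eletter (st x ?j) (relator ! ?j) t=(owned x, Edge 2 (if snd (relator ! ?j) then 2 * t - 1 else 1 - 2 * t))" if "0 < t" "t < 1" for t
  unfolding eletter_eedge pos using that by (auto simp: eedge_def)
 have arc: "(real i + t) / N:?A \<longleftrightarrow> i=?j & 0 < t" if "0 <= t" "t < 1" for i t
 proof -
  have "(real i + t) / N:?A \<longleftrightarrow> real ?j < real i + t & real i + t < real ?j + 1"
   using N relator_ne by (simp add: divide_less_cancel)
  also have "... \<longleftrightarrow> i=?j & 0 < t"
  proof
   assume a: "real ?j < real i + t & real i + t < real ?j + 1"
   hence "i <= ?j" "?j <= i" using that by linarith+
   thus "i=?j & 0 < t" using a by simp
  qed (use that in simp)
  finally show ?thesis .
 qed
 have face: "(x, Face v) ~: K" for v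
 proof
  assume "(x, Face v):K"
  hence "Ecl (owned x) 2 <= K" by (rule order_trans[OF ow goodD(6)[OF g]])
  moreover have "(owned x, Edge 2 0):Ecl (owned x) 2" by (simp add: Ecl_iff)
  ultimately show False using new by blast
 qed
 have K_iff: "fmap x v:K \<longleftrightarrow> v:tsp (nS 1) & ang v ~: ?A" if v: "v:tsp (ndisc 2)" for v
 proof (cases "v:odisc 2")
  case True
  moreover have "v ~: tsp (nS 1)" using True sphere_nrm(1)[of 2] unfolding diff_2_1 by (auto simp: open_disc_nrm)
  ultimately show ?thesis using face by (simp add: fmap_def)
 next
  case False
  obtain i t where it: "i < N" "0 <= t" "t < 1" "v=circ ((real i + t) / N)" "ang v=(real i + t) / N"
   using sphere_point[OF v False] .
  have s: "v:tsp (nS 1)" unfolding it(4) by simp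
  show ?thesis
  proof (cases "i=?j & 0 < t")
   case True
   hence "fmap x v ~: K" using it fmap_circ[OF it(1-3)] j[of t] new by simp
   thus ?thesis using arc[OF it(2,3), of i] it True by simp
  next
   case False
   hence "fmap x v:K" using it fmap_circ[OF it(1-3)] inK by simp
   thus ?thesis using arc[OF it(2,3), of i] it False s by simp
  qed
 qed
 have ab: "pos x / N < (pos x + 1) / N" "(pos x + 1) / N < pos x / N + 1" "(pos x + 1) / N <= 1"
 proof -
  have "n > 1 ==> p + 1 <= n ==> p / n < (p + 1) / n & (p + 1) / n < p / n + 1 & (p + 1) / n <= 1" for n p :: real
   by (auto simp: divide_simps)
  from this[OF N, of "real (pos x)"]
  show "pos x / N < (pos x + 1) / N" "(pos x + 1) / N < pos x / N + 1" "(pos x + 1) / N <= 1" using pos(1) by auto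
 qed
 let ?C = "circ ` {(pos x + 1) / N..pos x / N + 1}"
 obtain r where r: "cmap (ndisc 2) (subt (ndisc 2) ?C) r" "!!v. v:?C ==> r v=v"
  using disc_retract_arc[OF ab(1,2)] by blast
 have C: "?C=tsp (ndisc 2) Int {v. fmap x v:K}"
  using arc_complement[OF _ ab(1,3)] K_iff sphere_subset_disc[of 2] unfolding diff_2_1 by auto
 have r': "cmap (ndisc 2) (subt (ndisc 2) {v. fmap x v:K}) r"
  using r(1) unfolding C subtopology_restrict .
 have rid: "r v=v" if "v:tsp (ndisc 2)" "fmap x v:K" for v using r(2) C that by blast
 have inj: "v=w" if vw: "v:tsp (ndisc 2)" "w:tsp (ndisc 2)" "fmap x v ~: K" "fmap x v=fmap x w" for v w
 proof -
  have out: "EX t. v=circ ((real ?j + t) / N) & fmap x v=(owned x, Edge 2 (if snd (relator ! ?j) then 2 * t - 1 else 1 - 2 * t))"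
   if v: "v:tsp (ndisc 2)" "fmap x v ~: K" "v ~: odisc 2" for v
  proof -
   obtain i t where it: "i < N" "0 <= t" "t < 1" "v=circ ((real i + t) / N)"
    using sphere_point[OF v(1,3)] by metis
   have e: "fmap x v=eletter (st x i) (relator ! i) t" using it fmap_circ[OF it(1-3)] by simp
   hence "i=?j & 0 < t" using inK it v(2) by metis
   thus ?thesis using e j[of t] it by metis
  qed
  show ?thesis
  proof (cases "v:odisc 2")
   case True
   hence fv: "fmap x v=(x, Face v)" by (simp add: fmap_def)
   show ?thesis
   proof (cases "w:odisc 2")
    case True
    thus ?thesis using fv vw(4) by (simp add: fmap_def)
   next
    case False
    thus ?thesis using out[OF vw(2)] vw(3,4) fv by auto
   qed
  next
   case False
   obtain t where t: "v=circ ((real ?j + t) / N)" "fmap x v=(owned x, Edge 2 (if snd (relator ! ?j) then 2 * t - 1 else 1 - 2 * t))"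
    using out[OF vw(1,3) False] by blast
   have "w ~: odisc 2"
   proof
    assume "w:odisc 2"
    hence "fmap x w=(x, Face w)" by (simp add: fmap_def)
    thus False using t(2) vw(4) by simp
   qed
   then obtain t' where t': "w=circ ((real ?j + t') / N)" "fmap x w=(owned x, Edge 2 (if snd (relator ! ?j) then 2 * t' - 1 else 1 - 2 * t'))"
    using out[OF vw(2)] vw(3,4) by auto
   have "t=t'" using t(2) t'(2) vw(4) by (simp split: if_splits)
   thus ?thesis using t t' by simp
  qed
 qed
 have "fmap x:{fmap x | x. x:V}" using x by blast
 note ct = G2.continuous_phi[OF this]
 have ne: "K ~= {}" using vj by blast
 have K: "closedin E2 (K Un Fcl x)" "contractible_space (subt E2 (K Un Fcl x))"
  unfolding Fcl_def using contractible_union_cell[OF Hausdorff_E2 goodD(2,3)[OF g] ne ct r' rid inj] by blast+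
 have in_cases: "e:K | (EX v. e=(x, Face v)) | (EX y. e=(owned x, Edge 2 y))" if "e:K Un Fcl x" for e
 proof (cases "e:K")
  case False
  hence "e:Fcl x" using that by blast
  thus ?thesis
  proof (cases rule: Fcl_cases)
   case (2 i t)
   hence "i=?j & 0 < t" using inK[of i t] False by metis
   thus ?thesis using 2 j[of t] by simp
  qed blast
 qed blast
 show ?thesis
  unfolding good_def
 proof (intro conjI allI impI)
  show "K Un Fcl x <= tsp E2" using goodD(1)[OF g] Fcl_E2[OF x] by blast
  show "closedin E2 (K Un Fcl x)" "contractible_space (subt E2 (K Un Fcl x))" by fact+
  show "(one_V, Vertex):K Un Fcl x" using goodD(4)[OF g] by blast
 next
  fix z' s' y assume "(z', Edge s' y):K Un Fcl x"
  hence "(z', Edge s' y):K | z' = owned x & s'=2" using in_cases by fastforce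
  thus "Ecl z' s' <= K Un Fcl x" using goodD(5)[OF g] ow by blast
 next
  fix x' v assume "(x', Face v):K Un Fcl x"
  hence "(x', Face v):K | x'=x" using in_cases by fastforce
  thus "Fcl x' <= K Un Fcl x" using goodD(6)[OF g] by blast
 next
  fix x' assume a: "(x', Vertex):K Un Fcl x & x' ~= one_V"
  hence "(x', Vertex):K" using in_cases by fastforce
  thus "(par x', Vertex):K Un Fcl x" "Ecl (if snd (tl_letter x') then par x' else x') (fst (tl_letter x')) <= K Un Fcl x"
   using goodD(7,8)[OF g] a by blast+
 next
  fix z' y assume a: "(z', Edge 2 y):K Un Fcl x & ex True (snd z') ~= 0"
  hence "(z', Edge 2 y):K | z' = owned x" using in_cases by fastforce
  hence "Fcl (owner z') <= K | owner z'=x" using goodD(9)[OF g, of z' y] a owner_owned by blast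
  thus "Fcl (owner z') <= K Un Fcl x" by blast
 qed
qed

text \<open>Induction along the strip towards the tree. The t-edge with which the face is not
  matched either lies in the tree or belongs to a face nearer to the tree, which is added before.
  The remaining boundary edges are labelled a or \<tau> and lie in the tree.\<close>

lemma good_face:
 assumes "good K" "x:V" shows "EX K'. good K' & K <= K' & Fcl x <= K'"
 using assms(2)
proof (induction "if ex True (snd x) >= 0 then nat (ex True (snd x)) else nat (- ex True (snd x) - 1)" arbitrary: x rule: less_induct)
 case less
 note x = less(2)
 define z where "z=(if ex True (snd x) >= 0 then x else addg (u True) x)"
 have zV: "z:V" using x by (simp add: z_def)
 have "EX K'. good K' & K <= K' & Ecl z 2 <= K'"
 proof (cases "ex True (snd z)=0")
  case True
  thus ?thesis using good_tree_edge[OF assms(1) zV, of 2] by (simp add: tree_edge_def three_def)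
 next
  case False
  have "EX K'. good K' & K <= K' & Fcl (owner z) <= K'"
   by (rule less(1)) (use False zV in \<open>auto simp: owner_def z_def split: if_splits\<close>)
  moreover have "Ecl z 2 <= Fcl (owner z)"
  proof -
   have "owner z:V" using zV by (simp add: owner_def)
   from Ecl_Fcl[OF this pos(1)[OF this]] pos(3,4)[OF this] show ?thesis using owned_owner[OF False] by simp
  qed
  ultimately show ?thesis by blast
 qed
 then obtain K1 where K1: "good K1" "K <= K1" "Ecl z 2 <= K1" by blast
 let ?Q = "(%i. Ecl (eo x i) (fst (relator ! i))) ` {i. i < N & i ~= pos x & fst (relator ! i) ~= 2}"
 have "EX K'. good K' & K1 <= K' & \<Union>?Q <= K'"
 proof (rule good_finite[OF _ K1(1)])
  fix K q assume K: "good K" and "q:?Q"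
  then obtain i where i: "i < N" "fst (relator ! i) ~= 2" "q=Ecl (eo x i) (fst (relator ! i))" by blast
  show "EX K'. good K' & K <= K' & q <= K'"
   unfolding i(3) by (rule good_tree_edge[OF K eo_V[OF x]]) (use i relator_letters in \<open>simp add: tree_edge_def\<close>)
 qed simp
 then obtain K2 where K2: "good K2" "K1 <= K2" "\<Union>?Q <= K2" by blast
 have bd: "Ecl (eo x i) (fst (relator ! i)) <= K2" if i: "i < N" "i ~= pos x" for i
 proof (cases "fst (relator ! i)=2")
  case True
  hence "eo x i=z" using other_rung[OF x i] z_def by simp
  thus ?thesis using True K1 K2 by auto
 next
  case False
  thus ?thesis using K2(3) i by blast
 qed
 show ?case
 proof (cases "EX y. (owned x, Edge 2 y):K2")
  case True
  hence "Fcl x <= K2" using goodD(9)[OF K2(1)] ex_owned owner_owned by metis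
  thus ?thesis using K1 K2 by blast
 next
  case False
  hence "good (K2 Un Fcl x)" using add_face[OF K2(1) x bd] by blast
  thus ?thesis using K1 K2 by blast
 qed
qed

lemma good_any_edge:
 assumes "good K" "z:V" "s:three" shows "EX K'. good K' & K <= K' & Ecl z s <= K'"
proof (cases "tree_edge z s")
 case False
 hence s: "s=2" "ex True (snd z) ~= 0" using assms(3) by (auto simp: tree_edge_def)
 have oV: "owner z:V" using assms(2) by (simp add: owner_def)
 have "Ecl z 2 <= Fcl (owner z)"
  using Ecl_Fcl[OF oV pos(1)[OF oV]] pos(3,4)[OF oV] owned_owner[OF s(2)] by simp
 thus ?thesis using good_face[OF assms(1) oV] s by blast
qed (use good_tree_edge assms in blast)

text \<open>A compact set meets only finitely many cells, and finitely many cells fit into one good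
  subcomplex.\<close>

theorem ccontractible_E2: "ccontractible E2"
 unfolding ccontractible_def
proof (intro allI impI)
 fix C assume C: "compactin E2 C"
 have C1: "compactin E1 (C Int tsp E1)"
 proof -
  have "closedin E2 (tsp E1)" by (rule G2.closedin_A_B) simp
  hence "compactin E2 (tsp E1 Int C)" using C closed_Int_compactin by blast
  hence "compactin (subt E2 (tsp E1)) (C Int tsp E1)" by (simp add: compactin_subtopology Int_commute)
  thus ?thesis by (simp add: G2.subtopology_A)
 qed
 have C0: "compactin E0 (C Int tsp E1 Int tsp E0)"
 proof -
  have "closedin E1 (tsp E0)" by (rule G1.closedin_A_B) simp
  hence "compactin E1 (tsp E0 Int (C Int tsp E1))" using C1 closed_Int_compactin by blast
  hence "compactin (subt E1 (tsp E0)) (C Int tsp E1 Int tsp E0)" by (simp add: compactin_subtopology Int_commute)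
  thus ?thesis by (simp add: G1.subtopology_A)
 qed
 hence f0: "finite (C Int tsp E1 Int tsp E0)" by (simp add: E0_def compactin_discrete_topology)
 define Q where "Q=(%e. {e}) ` (C Int tsp E1 Int tsp E0) Un
  (%ph. ph ` tsp (ndisc 1)) ` {ph:{emap x s | x s. x:V & s:three}. ph ` odisc 1 Int (C Int tsp E1) ~= {}} Un
  (%ph. ph ` tsp (ndisc 2)) ` {ph:{fmap x | x. x:V}. ph ` odisc 2 Int C ~= {}}"
 have "finite Q"
  unfolding Q_def using f0 G1.compactin_finitely_many_cells[OF C1] G2.compactin_finitely_many_cells[OF C] by (intro finite_UnI finite_imageI)
 moreover have "EX K'. good K' & K <= K' & q <= K'" if K: "good K" and q: "q:Q" for K q
 proof -
  consider x where "x:V" "q={(x, Vertex)}" | x s where "x:V" "s:three" "q=Ecl x s" | x where "x:V" "q=Fcl x"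
   using q unfolding Q_def Ecl_def Fcl_def E0_def topspace_discrete_topology by blast
  thus ?thesis
  proof cases
   case (1 x)
   thus ?thesis using good_vertex[OF K, of x] by simp
  next
   case (2 x s)
   thus ?thesis using good_any_edge[OF K] by simp
  next
   case (3 x)
   thus ?thesis using good_face[OF K] by simp
  qed
 qed
 ultimately obtain K where K: "good K" "\<Union>Q <= K" using good_finite[OF _ good_base] by metis
 have "C <= \<Union>Q"
 proof
  fix e assume e: "e:C"
  hence "e:tsp E2" using C compactin_subset_topspace by blast
  thus "e:\<Union>Q"
  proof (cases rule: G2.top_B_cases)
   case 1
   thus ?thesis
   proof (cases rule: G1.top_B_cases)
    case 1
    hence "{e}:Q" using e \<open>e : tsp E1\<close> unfolding Q_def by blast
    thus ?thesis by blast
   next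
    case (2 ph v)
    hence "ph ` tsp (ndisc 1):Q" using e \<open>e : tsp E1\<close> unfolding Q_def by blast
    thus ?thesis using 2 open_disc_subset by blast
   qed
  next
   case (2 ph v)
   hence "ph:{ph:{fmap x | x. x:V}. ph ` odisc 2 Int C ~= {}}" using e by blast
   hence "ph ` tsp (ndisc 2):Q" unfolding Q_def by (intro UnI2 imageI)
   thus ?thesis using 2 open_disc_subset by blast
  qed
 qed
 hence "C <= K & contractible_space (subt E2 K)" using K(2) goodD(3)[OF K(1)] by blast
 thus "EX K. C <= K & contractible_space (subt E2 K)" by (rule exI)
qed

sublocale D: deck E2 P2 snd hgrp act
 by (rule deck_E2[OF ccontractible_E2])

end

section \<open>Homology of a space with a cell attached\<close>

lemma contractible_ndisc: "contractible_space (ndisc n)"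
 unfolding contractible_space_def
proof (intro exI)
 show "homotopic_with (%_. True) (ndisc n) (ndisc n) id (%_ _. 0)"
 proof (subst homotopic_with, simp, intro exI conjI ballI)
  let ?h = "%p :: real \<times> (nat => real). %i. (1 - fst p) * snd p i + fst p * 0"
  show "cmap (prodt I01 (ndisc n)) (ndisc n) ?h"
  proof (rule continuous_map_ndisc)
   have 1: "cmap (prodt I01 (ndisc n)) eur fst"
    using continuous_map_fst cm_full by blast
   have 2: "cmap (prodt I01 (ndisc n)) eur (%p. snd p i)" for i
    using cmo[OF continuous_map_snd continuous_map_ndisc_proj] by (simp add: o_def)
   show "cmap (prodt I01 (ndisc n)) eur (%p. ?h p i)" for i
    by (intro continuous_map_add continuous_map_real_mult continuous_map_diff 1 2) simp_all
   show "?h p:tsp (ndisc n)" if "p:tsp (prodt I01 (ndisc n))" for p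
    using that by (intro nrm_convex[of _ _ _ "%_. 0"]) (auto simp: tsp_ndisc)
  qed
 qed simp_all
qed

text \<open>Pushes the shell of radius at least 1/2 radially to the boundary sphere, which stays
  fixed.\<close>

definition expand :: "nat => (nat => real) => nat => real" where
 "expand n v=(%i. v i / max (1/2) (nrm n v))"

lemma nrm_expand: "nrm n (expand n v)=nrm n v / max (1/2) (nrm n v)"
proof -
 let ?m = "max (1/2) (nrm n v)"
 have "(SUM i<n. (v i / ?m)\<^sup>2)=(SUM i<n. (v i)\<^sup>2) / ?m\<^sup>2" by (simp add: power_divide sum_divide_distrib)
 moreover have "?m > 0" by linarith
 ultimately show ?thesis unfolding expand_def nrm_def by (simp add: real_sqrt_divide)
qed

lemma expand:
 "v:tsp (ndisc n) ==> expand n v:tsp (ndisc n)" "nrm n v=1 ==> expand n v=v"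
 "nrm n v >= 1/2 ==> nrm n (expand n v)=1" "cmap (ndisc n) (ndisc n) (expand n)"
proof -
 show *: "expand n v:tsp (ndisc n)" if "v:tsp (ndisc n)" for v
  using that nrm_expand[of n v] by (auto simp: tsp_ndisc_nrm expand_def)
 show "nrm n v=1 ==> expand n v=v" by (simp add: expand_def)
 show "nrm n v >= 1/2 ==> nrm n (expand n v)=1"
 proof -
  assume "nrm n v >= 1/2"
  hence "max (1/2) (nrm n v)=nrm n v" "nrm n v ~= 0" by auto
  thus ?thesis unfolding nrm_expand by simp
 qed
 show "cmap (ndisc n) (ndisc n) (expand n)"
 proof (rule continuous_map_ndisc)
  have "max (1/2) (nrm n x) ~= 0" for x by linarith
  moreover have "cmap (ndisc n) eur (%v. max (1/2) (nrm n v))"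
   by (intro continuous_map_real_max continuous_map_nrm) simp
  ultimately show "cmap (ndisc n) eur (%v. expand n v i)" for i
   unfolding expand_def by (intro continuous_map_real_divide continuous_map_ndisc_proj) auto
 qed (rule *)
qed

text \<open>The motion given by \<open>expand\<close> in the cell takes the collar \<open>A'\<close>
  of radius at least 1/2 into \<open>A\<close>. Excising the thinner collar \<open>U\<close> of
  radius at least 3/4 leaves an open disc, so every relative class comes from the disc.\<close>

lemma cell_homology_surj:
 assumes gl: "glued A n {ph}" and H: "Hausdorff_space A" and B: "B=glue A n {ph}"
  and c: "c:carrier (rhg p B (tsp A))"
 shows "EX d:carrier (rhg p (ndisc n) (tsp (nS (n - 1)))).
  c=hom_induced p (ndisc n) (tsp (nS (n - 1))) B (tsp A) ph d"
proof -
 interpret glued A n "{ph}" by (rule gl)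
 let ?D = "tsp (ndisc n)" and ?S = "tsp (nS (n - 1))"
 have HB: "Hausdorff_space B" unfolding B by (rule Hausdorff_B[OF H])
 have ph: "cmap (ndisc n) B ph" unfolding B by (rule continuous_phi) simp
 have clA: "closedin B (tsp A)" unfolding B by (rule closedin_A_B) simp
 have top: "tsp B=tsp A Un ph ` ?D" unfolding B top_B by simp
 have phA: "ph v:tsp A \<longleftrightarrow> nrm n v=1" if "v:?D" for v
  using phi_in_A[of ph v] that by (auto simp: open_disc_nrm tsp_ndisc_nrm)
 have Snrm: "?S={x:?D. nrm n x=1}" using n by (auto simp: sphere_nrm(1) tsp_ndisc_nrm)
 have inj: "v=w" if vw: "v:?D" "w:?D" "ph v ~: tsp A" "ph v=ph w" for v w
 proof -
  have "v:odisc n" "w:odisc n" using phi_in_A[of ph v] phi_in_A[of ph w] vw by simp_all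
  thus "v=w" using inj[of ph ph v w] vw(4) by simp
 qed
 obtain h where h: "cmap (prodt I01 B) B h"
  "ALL x:tsp B. h (0, x)=x" "ALL x:tsp A. ALL t. h (t, x)=x" "ALL v:?D. h (1, ph v)=ph (expand n v)"
 proof (rule cell_deformation[OF HB clA ph expand(4)])
  show "expand n v=v" if "v:?D" "ph v:tsp A" for v using phA expand(2) that by blast
 next
  fix h :: "real \<times> 'a => 'a" assume "closedin B (tsp A Un ph ` ?D)"
   "cmap (prodt I01 (subt B (tsp A Un ph ` ?D))) (subt B (tsp A Un ph ` ?D)) h"
   "ALL x:tsp (subt B (tsp A Un ph ` ?D)). h (0, x)=x"
   "ALL x:tsp A. ALL t. h (t, x)=x" "ALL v:?D. h (1, ph v)=ph (expand n v)"
  moreover have "subt B (tsp A Un ph ` ?D)=B" using top by (metis subtopology_topspace)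
  ultimately show thesis by (intro that[of h]) (simp_all only:)
 qed (rule inj)
 define rh where "rh x=h (1, x)" for x
 define A' where "A'=tsp A Un ph ` {v:?D. nrm n v >= 1/2}"
 define U where "U=tsp A Un ph ` {v:?D. nrm n v >= 3/4}"
 have rhph: "rh (ph v)=ph (expand n v)" if "v:?D" for v using h(4) that by (simp add: rh_def)
 have hom: "homotopic_with (%f. f:tsp A \<rightarrow> tsp A) B B id rh"
 proof (subst homotopic_with)
  show "(f:tsp A \<rightarrow> tsp A)=(g:tsp A \<rightarrow> tsp A)" if "!!x. x:tsp B ==> f x=g x" for f g :: "'a => 'a"
   using that top by (auto simp: Pi_iff)
  show "EX h. cmap (prodt I01 B) B h & (ALL x:tsp B. h (0, x)=id x) &
    (ALL x:tsp B. h (1, x)=rh x) & (ALL t:{0..1}. (%x. h (t, x)):tsp A \<rightarrow> tsp A)"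
   by (intro exI[of _ h]) (use h in \<open>auto simp: rh_def\<close>)
 qed
 hence rhc: "cmap B B rh" using homotopic_with_imp_continuous_maps by blast
 have A'A: "rh:A' \<rightarrow> tsp A"
 proof
  fix x assume "x:A'"
  then consider "x:tsp A" | v where "v:?D" "nrm n v >= 1/2" "x=ph v" unfolding A'_def by blast
  thus "rh x:tsp A"
  proof cases
   case 1
   thus ?thesis using h(3) by (simp add: rh_def)
  next
   case (2 v)
   thus ?thesis using rhph phA[OF expand(1)] expand(3) by simp
  qed
 qed
 have disj: "ph v:tsp A Un ph ` {v:?D. nrm n v >= r} \<longleftrightarrow> nrm n v >= r" if v: "v:?D" and r: "r <= 1" for v r
 proof
  assume "ph v:tsp A Un ph ` {v:?D. nrm n v >= r}"
  thus "nrm n v >= r"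
  proof
   assume "ph v:tsp A" thus ?thesis using phA[OF v] r by simp
  next
   assume "ph v:ph ` {v:?D. nrm n v >= r}"
   then obtain w where w: "w:?D" "nrm n w >= r" "ph v=ph w" by blast
   show ?thesis
   proof (cases "ph v:tsp A")
    case True
    thus ?thesis using phA[OF v] r by simp
   next
    case False
    thus ?thesis using inj[OF v w(1) False w(3)] w by simp
   qed
  qed
 qed (use v in auto)
 have compl: "tsp B - (tsp A Un ph ` {v:?D. nrm n v >= r})=ph ` {v:?D. nrm n v < r}" if r: "r <= 1" for r
 proof (intro equalityI subsetI)
  fix x assume x: "x:tsp B - (tsp A Un ph ` {v:?D. nrm n v >= r})"
  then obtain v where v: "v:?D" "x=ph v" using top by blast
  hence "~nrm n v >= r" using x by blast
  thus "x:ph ` {v:?D. nrm n v < r}" using v by auto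
 next
  fix x assume "x:ph ` {v:?D. nrm n v < r}"
  then obtain v where v: "v:?D" "x=ph v" "nrm n v < r" by blast
  hence "x ~: tsp A Un ph ` {v:?D. nrm n v >= r}" using disj[OF v(1) r] by simp
  thus "x:tsp B - (tsp A Un ph ` {v:?D. nrm n v >= r})" using v top by blast
 qed
 have opn: "openin B (tsp B - (tsp A Un ph ` {v:?D. nrm n v >= r}))" if r: "r <= 1" for r
 proof -
  show ?thesis unfolding compl[OF r] unfolding B
   by (rule openin_cell) (use openin_nrm(1)[of n r] r in \<open>auto simp: open_disc_nrm tsp_ndisc_nrm\<close>)
 qed
 have sub: "tsp A Un ph ` {v:?D. nrm n v >= r} <= tsp B" for r using top by auto
 have U_iff: "ph v:U \<longleftrightarrow> nrm n v >= 3/4" if "v:?D" for v unfolding U_def by (rule disj[OF that]) simp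
 have A'_iff: "ph v:A' \<longleftrightarrow> nrm n v >= 1/2" if "v:?D" for v unfolding A'_def by (rule disj[OF that]) simp
 have UB: "U <= tsp B" and A'B: "A' <= tsp B" unfolding U_def A'_def by (rule sub)+
 have "openin B (tsp B - U)" unfolding U_def by (rule opn) simp
 hence "B closure_of U=U" using UB by (simp add: closure_of_eq closedin_def)
 moreover have "U <= B interior_of A'"
 proof (rule interior_of_maximal[THEN subset_trans[rotated]])
  show "U <= tsp B - ph ` {v:?D. nrm n v <= 1/2}"
  proof
   fix x assume x: "x:U"
   hence "x:tsp B" using UB by blast
   moreover have "x ~: ph ` {v:?D. nrm n v <= 1/2}"
   proof
    assume "x:ph ` {v:?D. nrm n v <= 1/2}"
    then obtain v where "v:?D" "nrm n v <= 1/2" "x=ph v" by blast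
    thus False using U_iff[of v] x by simp
   qed
   ultimately show "x:tsp B - ph ` {v:?D. nrm n v <= 1/2}" by blast
  qed
  show "tsp B - ph ` {v:?D. nrm n v <= 1/2} <= A'"
  proof
   fix x assume x: "x:tsp B - ph ` {v:?D. nrm n v <= 1/2}"
   show "x:A'"
   proof (cases "x:tsp A")
    case False
    then obtain v where v: "v:?D" "x=ph v" using x top by blast
    hence "~nrm n v <= 1/2" using x by blast
    thus ?thesis using v A'_iff[OF v(1)] by simp
   qed (simp add: A'_def)
  qed
  have "compactin (ndisc n) {v:?D. nrm n v <= 1/2}"
  proof (rule closedin_compact_space[OF compact_space_ndisc])
   have "?D - {v:?D. nrm n v <= 1/2}={v:?D. nrm n v > 1/2}" by auto
   thus "closedin (ndisc n) {v:?D. nrm n v <= 1/2}" using openin_nrm(2)[of n "1/2"] by (simp add: closedin_def)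
  qed
  hence "closedin B (ph ` {v:?D. nrm n v <= 1/2})"
   using compactin_imp_closedin[OF HB image_compactin[OF _ ph]] by blast
  thus "openin B (tsp B - ph ` {v:?D. nrm n v <= 1/2})" by blast
 qed
 ultimately have ex: "hom_induced p (subt B (tsp B - U)) (A' - U) B A' id
   : iso (rhg p (subt B (tsp B - U)) (A' - U)) (rhg p B A')"
  using homology_excision_axiom[of B U A' "tsp B" p] A'B by simp
 let ?O = "subt (ndisc n) {v. nrm n v < 3/4}" and ?N = "subt B (tsp B - U)"
 have BU: "tsp ?N=ph ` {v:?D. nrm n v < 3/4}"
  using compl[of "3/4"] unfolding U_def by auto
 have "homeomorphic_map ?O ?N ph"
 proof (rule bijective_open_imp_homeomorphic_map)
  show "cmap ?O ?N ph"
   using BU cm_from[OF ph] by (auto simp: cm_into)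
  show "open_map ?O ?N ph"
   unfolding open_map_def
  proof (intro allI impI)
   fix W assume "openin ?O W"
   then obtain T where T: "openin (ndisc n) T" "W=T Int {v. nrm n v < 3/4}" unfolding openin_subtopology by blast
   hence WT: "W=T Int {v:?D. nrm n v < 3/4}" using openin_subset[OF T(1)] by blast
   have W: "openin (ndisc n) W" "W <= {v:?D. nrm n v < 3/4}"
    unfolding WT using openin_Int[OF T(1) openin_nrm(1)[of n "3/4"]] by blast+
   have "openin B (ph ` W)"
    unfolding B by (rule openin_cell[OF _ W(1)]) (use W(2) in \<open>auto simp: open_disc_nrm tsp_ndisc_nrm\<close>)
   hence "openin ?N (ph ` W Int (tsp B - U))" by (rule openin_subtopology_Int)
   moreover have "ph ` W <= tsp ?N" unfolding BU by (rule image_mono[OF W(2)])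
   hence "ph ` W Int (tsp B - U)=ph ` W" by auto
   ultimately show "openin ?N (ph ` W)" by simp
  qed
  show "ph ` tsp ?O=tsp ?N" unfolding BU by (simp add: Collect_conj_eq)
  show "inj_on ph (tsp ?O)"
  proof (rule inj_onI)
   fix v w assume "v:tsp ?O" "w:tsp ?O" "ph v=ph w"
   thus "v=w" using inj[of v w] phA[of v] by auto
  qed
 qed
 then obtain py where py: "homeomorphic_maps ?O ?N ph py" using homeomorphic_map_maps by blast
 have c': "hom_induced p B (tsp A) B A' id c:carrier (rhg p B A')"
  by (rule hom_induced_carrier)
 then obtain e where e: "e:carrier (rhg p ?N (A' - U))"
  "hom_induced p B (tsp A) B A' id c=hom_induced p ?N (A' - U) B A' id e"
 proof -
  have "hom_induced p ?N (A' - U) B A' id ` carrier (rhg p ?N (A' - U))=carrier (rhg p B A')"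
   using ex unfolding iso_def bij_betw_def by blast
  hence "hom_induced p B (tsp A) B A' id c:hom_induced p ?N (A' - U) B A' id ` carrier (rhg p ?N (A' - U))"
   using c' by (simp only:)
  thus thesis using that by (elim imageE)
 qed
 define T where "T={v:?D. nrm n v >= 1/2}"
 have pyT: "py:A' - U \<rightarrow> T"
 proof
  fix x assume x: "x:A' - U"
  hence "x:tsp ?N" using A'B by auto
  then obtain v where v: "v:?D" "nrm n v < 3/4" "x=ph v" using BU by auto
  hence "nrm n v >= 1/2" using A'_iff[of v] x by simp
  thus "py x:T" using py v unfolding homeomorphic_maps_def T_def by auto
 qed
 have pyc: "cmap ?N ?O py" "cmap ?O ?N ph" using py unfolding homeomorphic_maps_def by blast+
 have Oc: "cmap ?O (ndisc n) (expand n)" using expand(4) cm_from by blast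
 have TS: "expand n:T \<rightarrow> ?S" unfolding Snrm T_def using expand(1,3) by auto
 \<comment> \<open>The class on the disc: excise, transport to the open disc of radius 3/4, then
   expand it to the full disc.\<close>
 let ?d = "hom_induced p ?O T (ndisc n) ?S (expand n) (hom_induced p ?N (A' - U) ?O T py e)"
 have "c=hom_induced p B (tsp A) B (tsp A) id c" using hom_induced_id[OF c] by simp
 also have "... = hom_induced p B (tsp A) B (tsp A) rh c" using homology_homotopy_axiom[OF hom] by simp
 also have "... = hom_induced p B A' B (tsp A) rh (hom_induced p B (tsp A) B A' id c)"
 proof -
  have "id:tsp A \<rightarrow> A'" by (simp add: A'_def)
  from hom_induced_compose'[OF continuous_map_id this rhc A'A, of p c] show ?thesis by simp
 qed
 also have "... = hom_induced p ?N (A' - U) B (tsp A) rh e"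
 proof -
  have "id:A' - U \<rightarrow> A'" "cmap ?N B id" by (auto simp: cm_from)
  from hom_induced_compose'[OF this(2,1) rhc A'A, of p e] show ?thesis unfolding e(2) by simp
 qed
 also have "... = hom_induced p ?N (A' - U) B (tsp A) (ph o (expand n o py)) e"
 proof -
  have "rh x=(ph o (expand n o py)) x" if x: "x:tsp ?N" for x
  proof -
   have "py x:tsp ?O" using pyc(1) x cm_fun by blast
   moreover have "ph (py x)=x" using py x unfolding homeomorphic_maps_def by blast
   ultimately show ?thesis using rhph[of "py x"] by simp
  qed
  thus ?thesis by (metis hom_induced_eq)
 qed
 also have "... = hom_induced p (ndisc n) ?S B (tsp A) ph ?d"
 proof -
  have "hom_induced p ?N (A' - U) (ndisc n) ?S (expand n o py) e=?d"
   by (rule hom_induced_compose'[OF pyc(1) pyT Oc TS, symmetric])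
  moreover have "ph:?S \<rightarrow> tsp A" using phi_sphere by simp
  moreover have "expand n o py:A' - U \<rightarrow> ?S" using pyT TS by auto
  ultimately show ?thesis
   using hom_induced_compose'[OF cmo[OF pyc(1) Oc] _ ph, of "A' - U" ?S "tsp A" p e] by simp
 qed
 finally show ?thesis using hom_induced_carrier by blast
qed

section \<open>Evaluating functions of lifted vertices on chains\<close>

abbreviation SS :: "nat => (nat => real) topology" where
 "SS q == subt (powertop_real UNIV) (stds q)"

abbreviation vert :: "nat => nat => real" where "vert i == (%j. if j=i then 1 else 0)"

lemma continuous_SS_proj: "cmap (SS q) eur (%x. x i)"
 by (intro cm_from continuous_map_product_projection) simp

lemma continuous_map_SS:
 assumes "!!i. cmap X eur (%x. f x i)" "!!x. x:tsp X ==> f x:stds q"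
 shows "cmap X (SS q) f"
 using assms by (auto simp: cm_into cm_comp)

lemma simplical_face_vert: "simplical_face k (vert i)=vert (if i < k then i else Suc i)"
 by (auto simp: simplical_face_def fun_eq_iff)

lemma singular_face_vert:
 "i <= q ==> sface (Suc q) k ta (vert i)=ta (vert (if i < k then i else Suc i))"
 by (simp add: singular_face_def simplical_face_vert)

text \<open>The set \<open>A\<close> of maps over the base only has to be transitive on fibres.
  Instances are the Cayley complex with the left translations and the line over the circle with the
  integer translations.\<close>

locale lifting =
 fixes E :: "'e topology" and P :: "'p topology" and p :: "'e => 'p" and A :: "('e => 'e) set"
 assumes cov: "covers E P p" and surj: "p ` tsp E=tsp P"
  and A_cont: "a:A ==> cmap E E a" and A_p: "a:A ==> e:tsp E ==> p (a e)=p e"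
  and A_trans: "[|e:tsp E; e':tsp E; p e=p e'|] ==> EX a:A. a e=e'"
begin

lemma simplex_lift:
 assumes si: "ssimp q P si"
 shows "EX ta. ssimp q E ta & smap q p ta=si"
proof -
 let ?c = "%z :: real \<times> (nat => real). %i. (1 - fst z) * vert 0 i + fst z * snd z i"
 have v0: "vert 0:stds q" by simp
 have sic: "cmap (SS q) P si" "si:extensional (stds q)"
  using si by (simp_all add: singular_simplex_def)
 hence "si (vert 0):tsp P" using v0 cm_fun[OF sic(1)] by auto
 then obtain e where e: "e:tsp E" "p e=si (vert 0)" using surj by (metis imageE)
 have "cmap (prodt I01 (SS q)) (SS q) ?c"
 proof (rule continuous_map_SS)
  have 1: "cmap (prodt I01 (SS q)) eur fst"
   using continuous_map_fst cm_full by blast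
  have 2: "cmap (prodt I01 (SS q)) eur (%z. snd z i)" for i
   using cmo[OF continuous_map_snd continuous_SS_proj] by (simp add: o_def)
  show "cmap (prodt I01 (SS q)) eur (%z. ?c z i)" for i
   by (intro continuous_map_add continuous_map_real_mult continuous_map_diff 1 2) simp_all
  show "?c z:stds q" if "z:tsp (prodt I01 (SS q))" for z
   by (rule convex_standard_simplex) (use that in auto)
 qed
 then obtain g where g: "cmap (SS q) E g" "!!x. x:tsp (SS q) ==> p (g x)=si x"
  by (rule star_lift[OF cov sic(1), where c = ?c and ?x0.0 = "vert 0" and e = e]) (use e in auto)
 let ?ta = "restrict g (stds q)"
 have "cmap (SS q) E ?ta" by (rule continuous_map_eq[OF g(1)]) simp
 hence "ssimp q E ?ta" by (simp add: singular_simplex_def)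
 moreover have "smap q p ?ta=si"
 proof
  fix x show "smap q p ?ta x=si x"
   using g(2)[of x] sic(2) by (cases "x:stds q") (auto simp: simplex_map_def extensional_def)
 qed
 ultimately show ?thesis by blast
qed

lemma lifts_related:
 assumes ta: "ssimp q E ta" "ssimp q E ta'" and eq: "smap q p ta=smap q p ta'"
 shows "EX a:A. ALL x:stds q. ta' x=a (ta x)"
proof -
 have c: "cmap (SS q) E ta" "cmap (SS q) E ta'" using ta by (simp_all add: singular_simplex_def)
 have v0: "vert 0:stds q" by simp
 have pe: "p (ta x)=p (ta' x)" if "x:stds q" for x
  using fun_cong[OF eq, of x] that by (simp add: simplex_map_def)
 have inE: "ta x:tsp E" "ta' x:tsp E" if "x:stds q" for x
  using c that cm_fun by fastforce+
 obtain a where a: "a:A" "a (ta (vert 0))=ta' (vert 0)" using A_trans[OF inE[OF v0] pe[OF v0]] by blast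
 have con: "connected_space (SS q)" using connectedin_standard_simplex[of q] by (simp add: connectedin_def)
 have "ta' x=(a o ta) x" if "x:stds q" for x
 proof (rule lift_unique[OF cov con c(2) cmo[OF c(1) A_cont[OF a(1)]]])
  show "p (ta' x)=p ((a o ta) x)" if "x:tsp (SS q)" for x using that pe A_p[OF a(1)] inE by auto
  show "vert 0:tsp (SS q)" "ta' (vert 0)=(a o ta) (vert 0)" "x:tsp (SS q)" using a that by simp_all
 qed
 thus ?thesis using a(1) by auto
qed

definition lift :: "nat => ((nat => real) => 'p) => (nat => real) => 'e" where
 "lift q si=(SOME ta. ssimp q E ta & smap q p ta=si)"

lemma lift: "ssimp q P si ==> ssimp q E (lift q si)" "ssimp q P si ==> smap q p (lift q si)=si"
 using someI_ex[OF simplex_lift] unfolding lift_def by blast+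

end

text \<open>A cochain that depends only on the vertices of a lifted simplex: \<open>local\<close>
  restricts attention to the vertices 0 to q, \<open>inv\<close> makes the value independent of the
  lift, and \<open>cocycle\<close> makes it vanish on boundaries.\<close>

locale lift_functional = lifting E P p A for E :: "'e topology" and P :: "'p topology" and p A +
 fixes q :: nat and F :: "(nat => 'e) => real"
 assumes local: "(!!i. i <= q ==> xi i=et i) ==> F xi=F et"
  and inv: "a:A ==> (!!i. xi i:tsp E) ==> F (%i. a (xi i))=F xi"
  and cocycle: "(!!i. xi i:tsp E) ==> (SUM k<=Suc q. (-1) ^ k * F (%i. xi (if i < k then i else Suc i)))=0"
begin

definition val :: "((nat => real) => 'p) => real" where "val si=F (%i. lift q si (vert i))"

definition Lam :: "'p real_chain => real" where "Lam=lsum (%si a. a * val si)"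

lemma Lam_add: "Lam (c + d)=Lam c + Lam d" and Lam_diff: "Lam (c - d)=Lam c - Lam d"
 and Lam_single: "Lam (single si a)=a * val si" and Lam_0 [simp]: "Lam 0=0"
 and Lam_sum: "Lam (SUM i:I. x i)=(SUM i:I. Lam (x i))"
 by (simp_all add: Lam_def lsum_add lsum_diff lsum_single lsum_sum)

lemma val_eq:
 assumes ta: "ssimp q E ta" shows "val (smap q p ta)=F (%i. ta (vert i))"
proof -
 have pc: "cmap E P p" using cov by (simp add: covers_def)
 let ?l = "lift q (smap q p ta)"
 have l: "ssimp q E ?l" "smap q p ?l=smap q p ta"
  using lift[OF singular_simplex_simplex_map[OF ta pc]] by simp_all
 obtain a where a: "a:A" "!!x. x:stds q ==> ?l x=a (ta x)"
  using lifts_related[OF ta l(1) l(2)[symmetric]] by blast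
 have inE: "ta (vert i):tsp E" if "i <= q" for i
  using ta that cm_fun[of "SS q" E ta] by (auto simp: singular_simplex_def)
 let ?xi = "%i. ta (vert (if i <= q then i else 0))"
 have "val (smap q p ta)=F (%i. a (?xi i))" unfolding val_def by (rule local) (simp add: a(2))
 also have "... = F ?xi" by (rule inv[OF a(1)]) (use inE in auto)
 also have "... = F (%i. ta (vert i))" by (rule local) simp
 finally show ?thesis .
qed

lemma Lam_boundary:
 assumes "rchain (Suc q) P b" shows "Lam (rbd (Suc q) b)=0"
proof (rule additive_induct[where c = b and P = "%b. Lam (rbd (Suc q) b)=0"])
 fix si a assume "si:keys b"
 hence si: "ssimp (Suc q) P si" using assms by (auto simp: singular_real_chain_def)
 show "Lam (rbd (Suc q) (single si a))=0"
 proof -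
  define ta where "ta=lift (Suc q) si"
  have ta: "ssimp (Suc q) E ta" "smap (Suc q) p ta=si" using lift[OF si] by (simp_all add: ta_def)
  let ?xi = "%i. ta (vert (if i <= Suc q then i else 0))"
  have inE: "?xi i:tsp E" for i
   using ta(1) cm_fun[of "SS (Suc q)" E ta] by (auto simp: singular_simplex_def)
  have v: "val (sface (Suc q) k si)=F (%i. ?xi (if i < k then i else Suc i))" if k: "k <= Suc q" for k
  proof -
   have "ssimp q E (sface (Suc q) k ta)"
    using singular_simplex_singular_face[OF ta(1) _ k] by simp
   hence "val (smap q p (sface (Suc q) k ta))=F (%i. sface (Suc q) k ta (vert i))"
    by (rule val_eq)
   also have "... = F (%i. ?xi (if i < k then i else Suc i))"
    by (rule local) (use k in \<open>auto simp: singular_face_vert\<close>)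
   finally show ?thesis using singular_face_simplex_map'[OF k, of p ta] ta(2) by simp
  qed
  have "rbd (Suc q) (single si a)=(SUM k<=Suc q. single (sface (Suc q) k si) ((-1) ^ k * a))"
   by (simp only: real_boundary_lsum[OF zero_less_Suc] lsum_single[OF additive_family_bdf] bdf_def)
  hence "Lam (rbd (Suc q) (single si a))=(SUM k<=Suc q. (-1) ^ k * a * val (sface (Suc q) k si))"
   by (simp only: Lam_sum Lam_single)
  also have "... = a * (SUM k<=Suc q. (-1) ^ k * F (%i. ?xi (if i < k then i else Suc i)))"
   unfolding sum_distrib_left by (rule sum.cong) (simp_all add: v)
  also have "... = 0" using cocycle[of ?xi] inE by simp
  finally show ?thesis .
 qed
qed (simp_all add: real_boundary_add Lam_add)

lemma Lam_norm:
 assumes "rchain q P c" "!!xi. (!!i. xi i:tsp E) ==> \<bar>F xi\<bar> <= M"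
 shows "\<bar>Lam c\<bar> <= M * l1_norm c"
proof -
 have v: "\<bar>val si\<bar> <= M" if "si:keys c" for si
 proof -
  have "ssimp q P si" using assms(1) that by (auto simp: singular_real_chain_def)
  hence "ssimp q E (lift q si)" by (rule lift)
  hence inE: "lift q si (vert i):tsp E" if "i <= q" for i
   using that cm_fun[of "SS q" E "lift q si"] by (auto simp: singular_simplex_def)
  have "val si=F (%i. lift q si (vert (if i <= q then i else 0)))" unfolding val_def by (rule local) simp
  also have "\<bar>...\<bar> <= M" by (rule assms(2)) (use inE in auto)
  finally show ?thesis .
 qed
 have "\<bar>Lam c\<bar> <= (SUM si:keys c. \<bar>lookup c si * val si\<bar>)" unfolding Lam_def lsum_def by (rule sum_abs)
 also have "... <= (SUM si:keys c. \<bar>lookup c si\<bar> * M)"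
  by (intro sum_mono) (simp add: abs_mult mult_left_mono v)
 also have "... = M * l1_norm c" by (simp add: l1_norm_def sum_distrib_left mult.commute)
 finally show ?thesis .
qed

end

section \<open>The first homology of the circle\<close>

lemma circ_int: "circ (a + of_int n)=circ a"
proof -
 have "cos (2 * pi * (a + of_int n))=cos (2 * pi * a)" "sin (2 * pi * (a + of_int n))=sin (2 * pi * a)"
  using sin_cos_eq_iff[of "2 * pi * (a + of_int n)" "2 * pi * a"] by (auto simp: algebra_simps)
 thus ?thesis unfolding circ_def by (simp only:)
qed

lemma circ_eq: "circ a=circ b ==> EX n::int. b=a + of_int n"
proof -
 assume eq: "circ a=circ b"
 have "cos (2 * pi * b)=cos (2 * pi * a)" "sin (2 * pi * b)=sin (2 * pi * a)"
  using fun_cong[OF eq, of 0] fun_cong[OF eq, of 1] by (simp_all add: circ_def)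
 then obtain n :: int where "2 * pi * b=2 * pi * a + 2 * pi * n" using sin_cos_eq_iff[of "2 * pi * b" "2 * pi * a"] by auto
 hence "2 * pi * (b - a - n)=0" by (simp add: algebra_simps)
 thus ?thesis by (intro exI[of _ n]) simp
qed

lemma circ_surj: "circ ` UNIV=tsp (nS 1)"
 using circ_ang circ_sphere by (metis (no_types, opaque_lifting) UNIV_I image_eqI image_subsetI subsetI subset_antisym)

text \<open>A short open arc is the complement of a closed arc, which is compact and hence
  closed.\<close>

lemma open_circ:
 assumes W: "open W" shows "openin (nS 1) (circ ` W)"
proof (subst openin_subopen, intro ballI)
 fix v assume "v:circ ` W"
 then obtain s where s: "s:W" "v=circ s" by blast
 obtain d where d: "d > 0" "!!y. dist y s < d ==> y:W" using W s open_dist by metis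
 define e where "e=min d (1/4)"
 have e: "0 < e" "e <= 1/4" "e <= d" using d by (auto simp: e_def)
 let ?J = "{s - e<..<s + e}" and ?C = "circ ` {s + e..s - e + 1}"
 have "circ ` ?J=tsp (nS 1) - ?C"
 proof (intro equalityI subsetI)
  fix x assume "x:circ ` ?J"
  then obtain t where t: "t:?J" "x=circ t" by blast
  have "x ~: ?C"
  proof
   assume "x:?C"
   then obtain t' where t': "t':{s + e..s - e + 1}" "circ t=circ t'" using t by auto
   hence "t=t'" using circ_inj[of t t'] t by auto
   thus False using t t' by auto
  qed
  thus "x:tsp (nS 1) - ?C" using t by simp
 next
  fix x assume x: "x:tsp (nS 1) - ?C"
  define t where "t=s - e + frac (ang x - (s - e))"
  have "t=ang x + of_int (- \<lfloor>ang x - (s - e)\<rfloor>)" by (simp add: t_def frac_def)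
  hence tx: "circ t=x" using circ_int[of "ang x" "- \<lfloor>ang x - (s - e)\<rfloor>"] circ_ang[of x] x by simp
  have fr: "0 <= frac (ang x - (s - e))" "frac (ang x - (s - e)) < 1" by (simp_all add: frac_ge_0 frac_lt_1)
  hence "t ~: {s + e..s - e + 1}" using tx x by blast
  hence "t < s + e" using fr by (simp add: t_def)
  moreover have "t ~= s - e"
  proof
   assume "t=s - e"
   hence "x=circ (s - e + 1)" using tx circ_shift[of "s - e"] by simp
   thus False using x e by auto
  qed
  ultimately show "x:circ ` ?J" using tx fr by (intro image_eqI[of _ _ t]) (auto simp: t_def)
 qed
 moreover have "closedin (nS 1) ?C"
 proof (rule compactin_imp_closedin[OF Hausdorff_space_nsphere])
  have "compactin eur {s + e..s - e + 1}" by simp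
  thus "compactin (nS 1) ?C" by (rule image_compactin[OF _ continuous_map_circ'])
 qed
 ultimately have "openin (nS 1) (circ ` ?J)" by (simp add: openin_diff)
 moreover have "v:circ ` ?J" using s e by auto
 moreover have "circ ` ?J <= circ ` W" by (rule image_mono) (use d(2) e in \<open>auto simp: dist_real_def abs_less_iff\<close>)
 ultimately show "EX T. openin (nS 1) T & v:T & T <= circ ` W" by blast
qed

lemma covers_circ: "covers eur (nS 1) circ"
 unfolding covers_def
proof (intro conjI ballI continuous_map_circ')
 fix y assume "y:tsp (nS 1)"
 then obtain s where s: "y=circ s" using circ_ang by metis
 let ?J = "%n::int. {s + of_int n - 1/2<..<s + of_int n + 1/2}"
 let ?U = "circ ` ?J 0"
 have U: "circ ` ?J n=?U" for n
 proof (intro equalityI subsetI)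
  fix x assume "x:circ ` ?J n"
  then obtain t where "t:?J n" "x=circ t" by blast
  thus "x:?U" using circ_int[of t "-n"] by (intro image_eqI[of _ _ "t + of_int (- n)"]) auto
 next
  fix x assume "x:?U"
  then obtain t where "t:?J 0" "x=circ t" by blast
  thus "x:circ ` ?J n" using circ_int[of t n] by (intro image_eqI[of _ _ "t + of_int n"]) auto
 qed
 have "sheets eur (nS 1) circ ?U ((%N. inv_into N circ) ` range ?J)"
 proof (rule sheetsI[OF continuous_map_circ'])
  show "openin (nS 1) (circ ` W)" if "openin eur W" for W using that open_circ by simp
  show "openin (nS 1) ?U" by (rule open_circ) simp
  show "openin eur N & inj_on circ N & circ ` N=?U" if N: "N:range ?J" for N
  proof -
   obtain n where n: "N=?J n" using N by blast
   have "inj_on circ (?J n)" by (rule inj_onI, rule circ_inj) auto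
   thus ?thesis using U[of n] n by simp
  qed
  show "N=N'" if N: "N:range ?J" "N':range ?J" "e:N" "e:N'" for N N' e
  proof -
   obtain n n' where n: "N=?J n" "N'=?J n'" using N by blast
   have "real_of_int n < of_int n' + 1" "real_of_int n' < of_int n + 1" using N(3,4) unfolding n by auto
   hence "n=n'" by linarith
   thus ?thesis using n by simp
  qed
  show "EX N:range ?J. e:N" if "e:tsp eur" and e: "circ e:?U" for e
  proof -
   obtain t where t: "t:?J 0" "circ t=circ e" using e by auto
   then obtain n :: int where "e=t + of_int n" using circ_eq by blast
   hence "e:?J n" using t by auto
   thus ?thesis by blast
  qed
 qed
 moreover have "y:?U" using s by (intro image_eqI[of _ _ s]) auto
 ultimately show "EX U Sx. y:U & sheets eur (nS 1) circ U Sx" by blast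
qed

text \<open>The winding number: the increment of a lift to the line.\<close>

interpretation W: lift_functional euclideanreal "nS 1" circ "{%x. x + of_int n | n. True}" "1" "%xi. xi 1 - xi 0"
proof
 show "covers eur (nS 1) circ" by (rule covers_circ)
 show "circ ` tsp eur=tsp (nS 1)" using circ_surj by simp
 show "EX a:{%x. x + of_int n | n. True}. a e=e'" if "circ e=circ e'" for e e'
  using circ_eq[OF that] by auto
 show "(SUM k<=Suc 1. (-1) ^ k * (xi (if 1 < k then 1 else Suc 1) - xi (if 0 < k then 0 else Suc 0)))=(0::real)" for xi :: "nat => real"
  by (simp add: One_nat_def numeral_2_eq_2)
qed (auto simp: circ_int intro!: continuous_intros)

text \<open>The increment of a lift differs by an integer from the difference of the angles
  \<open>ang\<close> at the ends, and these differences cancel on a cycle.\<close>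

lemma W_integer:
 assumes c: "singular_relcycle 1 (nS 1) {} c" shows "W.Lam (realc c):\<int>"
proof -
 define th where "th=lsum (%si a. a * ang (si (vert 0)))"
 have th: "th (x + y)=th x + th y" "th 0=0" "th (single si a)=a * ang (si (vert 0))" for x y si a
  by (simp_all add: th_def lsum_add lsum_single)
 have c1: "singular_chain 1 (nS 1) c" "chain_boundary 1 c=0" using c by (simp_all add: singular_cycle)
 have "W.Lam (realc c) - th (rbd 1 (realc c)):\<int>"
 proof (rule additive_induct[where c = c and P = "%c. W.Lam (realc c) - th (rbd 1 (realc c)):\<int>"])
  fix si n assume "si:keys c"
  hence si: "ssimp 1 (nS 1) si" using c1 by (auto simp: singular_chain_def)
  define l where "l=W.lift 1 si"
  have l: "smap 1 circ l=si" unfolding l_def by (rule W.lift(2)[OF si])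
  have "EX i::int. ang (si (vert j))=l (vert j) + of_int i" if "j <= 1" for j
  proof -
   have "si (vert j)=circ (l (vert j))" using fun_cong[OF l, of "vert j"] that by (simp add: simplex_map_def)
   hence "circ (l (vert j))=circ (ang (si (vert j)))" using circ_ang by simp
   thus ?thesis using circ_eq by blast
  qed
  then obtain i j :: int where ij: "ang (si (vert 0))=l (vert 0) + of_int i" "ang (si (vert 1))=l (vert 1) + of_int j"
   by (metis le_refl zero_le)
  have f: "sface 1 0 si (vert 0)=si (vert 1)" "sface 1 1 si (vert 0)=si (vert 0)"
   using singular_face_vert[of 0 0 0 si] singular_face_vert[of 0 0 1 si] by (simp_all add: One_nat_def)
  have "rbd 1 (realc (single si n))=single (sface 1 0 si) (real_of_int n) + single (sface 1 1 si) (- real_of_int n)"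
   by (simp only: realc_single real_boundary_lsum[OF zero_less_one] lsum_single[OF additive_family_bdf] bdf_def) (simp add: One_nat_def)
  hence "th (rbd 1 (realc (single si n)))=real_of_int n * (l (vert 1) - l (vert 0)) + of_int (n * (j - i))"
   by (simp add: th f ij algebra_simps)
  moreover have "W.Lam (realc (single si n))=real_of_int n * (l (vert 1) - l (vert 0))"
   by (simp add: realc_single W.Lam_single W.val_def l_def)
  ultimately have "W.Lam (realc (single si n)) - th (rbd 1 (realc (single si n))) = of_int (- (n * (j - i)))" by simp
  thus "W.Lam (realc (single si n)) - th (rbd 1 (realc (single si n))):\<int>" by (metis Ints_of_int)
 next
  fix x y :: "(nat => real) chain"
  assume "W.Lam (realc x) - th (rbd 1 (realc x)):\<int>" "W.Lam (realc y) - th (rbd 1 (realc y)):\<int>"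
  from Ints_add[OF this] show "W.Lam (realc (x + y)) - th (rbd 1 (realc (x + y))):\<int>"
   by (simp add: realc_add W.Lam_add real_boundary_add th algebra_simps)
 qed (simp add: th)
 moreover have "rbd 1 (realc c)=0" using c1(2) by (metis realc_chain_boundary realc_0)
 ultimately show ?thesis by (simp add: th)
qed

lemma frag_cmul_diff: "fcm n (x - y)=fcm n x - fcm n (y :: 'x \<Rightarrow>\<^sub>0 int)"
 by (rule poly_mapping_eqI) (simp add: lookup_minus right_diff_distrib)

lemma homology_class_add:
 "hrel q X S z \<otimes>\<^bsub>rhg (int q) X S\<^esub> hrel q X S y=hrel q X S (z + y)"
 unfolding mult_relative_homology_group
proof (intro equalityI subsetI)
 fix x assume "x:hrel q X S (z + y)"
 hence "homologous_rel q X S (z + y) x" by simp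
 from homologous_rel_diff[OF this homologous_rel_refl[of q X S z]] have "homologous_rel q X S y (x - z)" by simp
 thus "x:(UN r:hrel q X S z. UN s:hrel q X S y. {r + s})"
  by (intro UN_I[of z] UN_I[of "x - z"]) simp_all
qed (auto intro: homologous_rel_add)

lemma homology_class_pow:
 assumes z: "singular_relcycle q X S z"
 shows "hrel q X S z [^]\<^bsub>rhg (int q) X S\<^esub> (n::int)=hrel q X S (fcm n z)"
proof -
 interpret G: group "rhg (int q) X S" by simp
 let ?G = "rhg (int q) X S"
 have c: "hrel q X S (fcm n z):carrier ?G" for n
  using singular_relcycle_cmul[OF z] by (auto simp: carrier_relative_homology_group)
 have one: "hrel q X S 0=\<one>\<^bsub>?G\<^esub>"
  using homologous_rel_set_eq_relboundary[of q X S 0] by simp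
 have *: "hrel q X S z [^]\<^bsub>?G\<^esub> n=hrel q X S (fcm (int n) z)" for n :: nat
 proof (induction n)
  case (Suc n)
  have "fcm (int n) z + z=fcm (int (Suc n)) z" by (simp add: frag_cmul_distrib)
  thus ?case using Suc homology_class_add[of q X S "fcm (int n) z" z] by simp
 qed (simp add: one)
 show ?thesis
 proof (cases "n >= 0")
  case True
  then obtain k where k: "n=int k" by (metis nonneg_int_cases)
  show ?thesis unfolding k int_pow_int by (rule *)
 next
  case False
  then obtain k where k: "n = - int k" by (metis add.inverse_inverse int_nat_eq nle_le neg_0_le_iff_le nonneg_int_cases)
  have z1: "hrel q X S z:carrier ?G" using c[of 1] by simp
  have "hrel q X S (fcm n z) \<otimes>\<^bsub>?G\<^esub> hrel q X S (fcm (int k) z)=\<one>\<^bsub>?G\<^esub>"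
   unfolding homology_class_add using frag_cmul_distrib[of n "int k" z] one k by simp
  hence "inv\<^bsub>?G\<^esub> (hrel q X S (fcm (int k) z))=hrel q X S (fcm n z)"
   by (rule G.inv_equality[OF _ c c])
  moreover have "hrel q X S z [^]\<^bsub>?G\<^esub> n=inv\<^bsub>?G\<^esub> (hrel q X S z [^]\<^bsub>?G\<^esub> k)"
   unfolding k by (simp only: G.int_pow_neg[OF z1] int_pow_int)
  ultimately show ?thesis unfolding * by simp
 qed
qed

definition omega :: "(nat => real) => nat => real" where
 "omega=restrict (%x. circ (x 1)) (stds 1)"

lemma omega_simplex: "ssimp 1 (nS 1) omega"
proof -
 have "cmap (SS 1) (nS 1) (circ o (%x. x 1))"
  by (rule cmo[OF continuous_SS_proj continuous_map_circ'])
 thus ?thesis unfolding singular_simplex_def omega_def by (auto elim: continuous_map_eq)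
qed

lemma omega_cycle: "singular_relcycle 1 (nS 1) {} (frag_of omega)"
proof -
 have "sface 1 0 omega=sface 1 1 omega"
 proof
  fix x show "sface 1 0 omega x=sface 1 1 omega x"
  proof (cases "x:stds 0")
   case True
   hence x: "x=vert 0" by (simp add: standard_simplex_0)
   have v: "vert 0:stds 1" "vert 1:stds 1" by simp_all
   show ?thesis using singular_face_vert[of 0 0 0 omega] singular_face_vert[of 0 0 1 omega] v circ_1
    by (simp add: x omega_def flip: One_nat_def)
  qed (simp add: singular_face_def One_nat_def)
 qed
 hence "chain_boundary 1 (frag_of omega)=0" by (simp add: chain_boundary_of One_nat_def)
 thus ?thesis using omega_simplex by (simp add: singular_cycle singular_chain_of)
qed

lemma W_omega: "W.Lam (realc (frag_of omega))=1"
proof -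
 let ?t = "restrict (%x :: nat => real. x 1) (stds 1)"
 have "cmap (SS 1) eur ?t" by (rule continuous_map_eq[OF continuous_SS_proj[of 1 1]]) simp
 hence "ssimp 1 eur ?t" by (simp add: singular_simplex_def)
 from W.val_eq[OF this] have "W.val (smap 1 circ ?t)=1" by simp
 moreover have "smap 1 circ ?t = omega" by (auto simp: simplex_map_def omega_def fun_eq_iff)
 moreover have "realc (frag_of omega)=single omega 1"
  using realc_single[of omega 1] frag_cmul_single[of 1 omega] by simp
 ultimately show ?thesis by (simp add: W.Lam_single)
qed

text \<open>The first homology is cyclic and its generator has an integral winding number. As
  \<open>omega\<close> has winding number 1, it equals the generator up to sign.\<close>

lemma circle_cycles:
 assumes c: "singular_relcycle 1 (nS 1) {} c"
 shows "EX n. homologous_rel 1 (nS 1) {} c (fcm n (frag_of omega))"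
proof -
 let ?G = "rhg (int 1) (nS 1) {}"
 interpret G: group ?G by simp
 have "reduced_homology_group (int 1) (nS 1)=?G" by (rule un_reduced_homology_group) simp
 hence "cyclic_group ?G" using cyclic_reduced_homology_group_nsphere[of "int 1" 1] by simp
 then obtain g where g: "g:carrier ?G" "carrier ?G=range (%n::int. g [^]\<^bsub>?G\<^esub> n)" using G.cyclic_group by blast
 obtain z where z: "singular_relcycle 1 (nS 1) {} z" "g=hrel 1 (nS 1) {} z"
  using g(1) unfolding carrier_relative_homology_group by auto
 have mult: "EX n. homologous_rel 1 (nS 1) {} y (fcm n z)" if y: "singular_relcycle 1 (nS 1) {} y" for y
 proof -
  have "hrel 1 (nS 1) {} y:carrier ?G" using y unfolding carrier_relative_homology_group by blast
  then obtain n :: int where "hrel 1 (nS 1) {} y=g [^]\<^bsub>?G\<^esub> n" using g(2) by blast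
  hence "hrel 1 (nS 1) {} y=hrel 1 (nS 1) {} (fcm n z)"
   unfolding z(2) homology_class_pow[OF z(1)] .
  thus ?thesis unfolding homologous_rel_set_eq by blast
 qed
 obtain d where d: "homologous_rel 1 (nS 1) {} (frag_of omega) (fcm d z)" using mult[OF omega_cycle] by blast
 obtain b where b: "singular_chain (Suc 1) (nS 1) b" "chain_boundary (Suc 1) b=frag_of omega - fcm d z"
  using homologous_rel_empty[OF d] by blast
 have "W.Lam (realc (frag_of omega - fcm d z))=0"
  unfolding b(2)[symmetric] realc_chain_boundary by (rule W.Lam_boundary) (simp only: singular_real_chain_realc b(1))
 moreover have cm: "W.Lam (realc (fcm d y)) = of_int d * W.Lam (realc y)" for d y
 proof -
  have "keys (fcm d y) <= keys y" by (rule keys_cmul)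
  hence "W.Lam (realc (fcm d y))=(SUM si:keys y. of_int (d * lookup y si) * W.val si)"
   unfolding W.Lam_def by (subst lsum_superset[of "keys y"]) simp_all
  thus ?thesis by (simp add: W.Lam_def lsum_def sum_distrib_left mult.assoc)
 qed
 ultimately have "of_int d * W.Lam (realc z)=1" using W_omega by (simp add: realc_diff W.Lam_diff)
 moreover obtain i :: int where "W.Lam (realc z) = of_int i" using W_integer[OF z(1)] by (auto elim: Ints_cases)
 ultimately have "d * i=1" by (metis of_int_mult of_int_eq_1_iff)
 obtain n where n: "homologous_rel 1 (nS 1) {} c (fcm n z)" using mult[OF c] by blast
 have "homologous_rel 1 (nS 1) {} (fcm (n * i) (frag_of omega)) (fcm (n * i) (fcm d z))"
  using singular_relboundary_cmul[of 1 "nS 1" "{}" "frag_of omega - fcm d z" "n * i"] d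
  unfolding homologous_rel_def by (simp only: frag_cmul_diff)
 moreover have "n * i * d=n" using \<open>d * i = 1\<close> by (metis mult.assoc mult.commute mult.right_neutral)
 hence "fcm (n * i) (fcm d z)=fcm n z" by (simp only: frag_cmul_cmul)
 ultimately show ?thesis using n homologous_rel_sym homologous_rel_trans by metis
qed

section \<open>The second homology of the presentation complex\<close>

text \<open>The singular \<open>1\<close>-simplex that runs linearly through the path \<open>W\<close> from \<open>a\<close> to \<open>b\<close>.\<close>

definition seg :: "(real => 'p) => real => real => (nat => real) => 'p" where
 "seg W a b=restrict (%x. W (a * x 0 + b * x 1)) (stds 1)"

lemma standard_simplex_1: "x:stds 1 ==> 0 <= x 0 & 0 <= x 1 & x 0 + x 1=1"
 by (auto simp: standard_simplex_def One_nat_def)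

lemma standard_simplex_2: "x:stds 2 ==> 0 <= x 0 & 0 <= x 1 & 0 <= x 2 & x 0 + x 1 + x 2=1"
 by (auto simp: standard_simplex_def One_nat_def numeral_2_eq_2)

lemma sum_le_2: "(SUM k<=Suc 1. f k)=f 0 + f 1 + (f 2 :: 'a::comm_monoid_add)"
 by (simp add: One_nat_def numeral_2_eq_2)

text \<open>Bounded by a triangle that factors through the interval, linearly in barycentric
  coordinates.\<close>

lemma seg_triangle:
 assumes W: "pathin X W" and abc: "a:{0..1}" "b:{0..1}" "c:{0..1}"
 shows "homologous_rel 1 X {} (frag_of (seg W a c)) (frag_of (seg W a b) + frag_of (seg W b c))"
proof -
 define T where "T=restrict (%x. W (a * x 0 + b * x 1 + c * x 2)) (stds 2)"
 have "cmap (SS 2) I01 (%x. a * x 0 + b * x 1 + c * x 2)"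
 proof (subst cm_into, intro conjI funcsetI)
  show "cmap (SS 2) eur (%x. a * x 0 + b * x 1 + c * x 2)"
   by (intro continuous_map_add continuous_map_real_mult continuous_SS_proj) simp_all
  fix x assume "x:tsp (SS 2)"
  hence x: "0 <= x 0" "0 <= x 1" "0 <= x 2" "x 0 + x 1 + x 2=1" using standard_simplex_2[of x] by auto
  have "a * x 0 + b * x 1 + c * x 2 <= 1 * x 0 + 1 * x 1 + 1 * x 2"
   using x abc by (intro add_mono mult_right_mono) auto
  thus "a * x 0 + b * x 1 + c * x 2:{0..1}" using x abc by auto
 qed
 from cmo[OF this W[unfolded pathin_def]]
 have "cmap (SS 2) X T" by (rule continuous_map_eq) (simp add: T_def)
 hence T: "ssimp (Suc 1) X T" by (simp add: singular_simplex_def T_def One_nat_def numeral_2_eq_2)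
 have sf: "x:stds 1 ==> k <= 2 ==> simplical_face k x:stds 2" for x :: "nat => real" and k
  using simplical_face_in_standard_simplex[of 2 k x] by (simp add: One_nat_def)
 have "sface (Suc 1) k T=seg W (if k=0 then b else a) (if k=2 then b else c)" if k: "k <= 2" for k
 proof
  fix x show "sface (Suc 1) k T x=seg W (if k=0 then b else a) (if k=2 then b else c) x"
  proof (cases "x:stds 1")
   case True
   have "x 2=0" using True by (simp add: standard_simplex_def)
   moreover have "k=0 | k=1 | k=2" using k by linarith
   ultimately show ?thesis using sf[OF True k] True
    by (auto simp: singular_face_def T_def seg_def simplical_face_def One_nat_def)
  qed (simp add: singular_face_def seg_def One_nat_def)
 qed
 moreover have "chain_boundary (Suc 1) (frag_of T)=frag_of (sface (Suc 1) 0 T) - frag_of (sface (Suc 1) 1 T) + frag_of (sface (Suc 1) 2 T)"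
  by (simp only: chain_boundary_of sum_le_2) simp
 ultimately have "chain_boundary (Suc 1) (frag_of T)=frag_of (seg W b c) - frag_of (seg W a c) + frag_of (seg W a b)"
  by simp
 hence "singular_relboundary 1 X {} (- (frag_of (seg W b c) - frag_of (seg W a c) + frag_of (seg W a b)))"
  using T unfolding singular_relboundary_minus singular_boundary by (metis singular_chain_of)
 moreover have "- (frag_of (seg W b c) - frag_of (seg W a c) + frag_of (seg W a b))=frag_of (seg W a c) - (frag_of (seg W a b) + frag_of (seg W b c))"
  by (simp add: algebra_simps)
 ultimately show ?thesis unfolding homologous_rel_def by (simp only:)
qed

lemma seg_const: "pathin X W ==> a:{0..1} ==> homologous_rel 1 X {} 0 (frag_of (seg W a a))"
 using homologous_rel_diff[OF seg_triangle[of X W a a a] homologous_rel_refl[of 1 X "{}" "frag_of (seg W a a)"]] by simp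

lemma seg_reverse:
 assumes "pathin X W" "a:{0..1}" "b:{0..1}"
 shows "homologous_rel 1 X {} (frag_of (seg W b a)) (- frag_of (seg W a b))"
proof -
 have "homologous_rel 1 X {} 0 (frag_of (seg W a b) + frag_of (seg W b a))"
  using homologous_rel_trans[OF seg_triangle[OF assms(1,2,3,2)] seg_const[OF assms(1,2)]] .
 from homologous_rel_diff[OF this homologous_rel_refl[of 1 X "{}" "frag_of (seg W a b)"]]
 show ?thesis by (simp add: homologous_rel_sym)
qed

lemma seg_subdivide:
 assumes W: "pathin X W" and n: "n > 0" and k: "k <= n"
 shows "homologous_rel 1 X {} (frag_of (seg W 0 (k / n))) (SUM i<k. frag_of (seg W (i / n) (Suc i / n)))"
 using k
proof (induction k)
 case 0
 thus ?case using seg_const[OF W, of 0] by (simp add: homologous_rel_sym)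
next
 case (Suc k)
 have "homologous_rel 1 X {} (frag_of (seg W 0 (Suc k / n))) (frag_of (seg W 0 (k / n)) + frag_of (seg W (k / n) (Suc k / n)))"
  by (rule seg_triangle[OF W]) (use Suc.prems n in \<open>auto simp: divide_le_eq\<close>)
 moreover have "homologous_rel 1 X {} (frag_of (seg W 0 (k / n)) + frag_of (seg W (k / n) (Suc k / n)))
   ((SUM i<k. frag_of (seg W (i / n) (Suc i / n))) + frag_of (seg W (k / n) (Suc k / n)))"
  by (rule homologous_rel_add[OF Suc.IH homologous_rel_refl]) (use Suc.prems in simp)
 ultimately show ?case unfolding sum.lessThan_Suc by (rule homologous_rel_trans[rotated])
qed

definition esum :: "'s => 's word => int" where
 "esum s w=(SUM l<-w. if fst l=s then (if snd l then 1 else -1) else 0)"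

text \<open>The second homology of an interval modulo its ends vanishes, so by
  \<open>cell_homology_surj\<close> that of the pair vanishes too; exactness then reduces the claim
  to \<open>A\<close>.\<close>

lemma trivial_group_H2_step:
 assumes gl: "glued A 1 {ph}" and H: "Hausdorff_space A" and A: "trivial_group (homology_group 2 A)"
 shows "trivial_group (homology_group 2 (glue A 1 {ph}))"
proof -
 interpret glued A 1 "{ph}" by (rule gl)
 let ?S = "tsp (nS (1 - 1))"
 have S: "nS (1 - 1)=subt (ndisc 1) ?S" by (rule sphere_subtopology) simp
 have "(%i::nat. if i=0 then 1 else 0::real):tsp (ndisc 1) Int ?S"
  unfolding ndisc1 by (simp add: nsphere0)
 hence "hom_boundary 2 (ndisc 1) ?S:iso (rhg 2 (ndisc 1) ?S) (reduced_homology_group (2 - 1) (subt (ndisc 1) ?S))"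
  by (intro iso_relative_homology_of_contractible contractible_ndisc) blast
 moreover have "trivial_group (reduced_homology_group (2 - 1) (nS (1 - 1)))"
  by (rule reduced_homology_group_nsphere(2)) simp
 ultimately have "trivial_group (rhg 2 (ndisc 1) ?S)"
  using isomorphic_group_triviality is_isoI S group_relative_homology_group group_reduced_homology_group by metis
 hence D: "carrier (rhg 2 (ndisc 1) ?S)={\<one>\<^bsub>rhg 2 (ndisc 1) ?S\<^esub>}"
  by (simp add: trivial_group_def)
 let ?j = "hom_induced 2 B {} B (tsp A) id" and ?i = "hom_induced 2 A {} B {} id"
 have "c=\<one>\<^bsub>homology_group 2 B\<^esub>" if c: "c:carrier (homology_group 2 B)" for c
 proof -
  have "?j c:carrier (rhg 2 B (tsp A))" by (rule hom_induced_carrier)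
  then obtain d where d: "d:carrier (rhg 2 (ndisc 1) ?S)" "?j c=hom_induced 2 (ndisc 1) ?S B (tsp A) ph d"
   using cell_homology_surj[OF gl H refl] by blast
  hence "d=\<one>\<^bsub>rhg 2 (ndisc 1) ?S\<^esub>" using D by blast
  hence "?j c=\<one>\<^bsub>rhg 2 B (tsp A)\<^esub>"
   unfolding d(2) by (simp add: hom_one[OF hom_induced_hom])
  hence "c:kernel (homology_group 2 B) (rhg 2 B (tsp A)) ?j" using c by (simp add: kernel_def)
  hence "c:?i ` carrier (homology_group 2 A)"
   using homology_exactness_axiom_3[of 2 B "tsp A"] by (simp add: subtopology_A)
  then obtain a where "a:carrier (homology_group 2 A)" "c=?i a" by blast
  thus ?thesis using A hom_one[OF hom_induced_hom] by (simp add: trivial_group_def)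
 qed
 moreover have "\<one>\<^bsub>homology_group 2 B\<^esub> : carrier (homology_group 2 B)"
  by (rule monoid.one_closed[OF group.is_monoid[OF group_relative_homology_group]])
 ultimately have "carrier (homology_group 2 B)={\<one>\<^bsub>homology_group 2 B\<^esub>}" by blast
 thus ?thesis unfolding trivial_group_def using group_relative_homology_group by blast
qed

lemma glue_insert:
 assumes top: "tsp (glue A n F)=tsp A Un (UN py:F. py ` tsp (ndisc n))"
 shows "glue (glue A n F) n {ph}=glue A n (insert ph F)"
proof (rule topology_eq[THEN iffD2], intro allI)
 fix U
 have "U Int (tsp A Un (UN py:F. py ` tsp (ndisc n))) Int tsp A=U Int tsp A" by blast
 moreover have "{x:tsp (ndisc n). py x:U Int (tsp A Un (UN py:F. py ` tsp (ndisc n)))}={x:tsp (ndisc n). py x:U}"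
  if "py:F" for py using that by blast
 ultimately show "openin (glue (glue A n F) n {ph}) U = openin (glue A n (insert ph F)) U"
  unfolding openin_glue[of "glue A n F"] top unfolding openin_glue by auto
qed

context hnn_words begin

definition lp :: "nat => real => nat cw_point" where "lp s=letter_loop (s, True)"

lemma snd_eword_point:
 assumes "i < N" "0 <= t" "t <= 1"
 shows "face_map relator (circ ((real i + t) / N))=letter_loop (relator ! i) t"
proof -
 have *: "face_map relator (circ ((real i + t) / N))=letter_loop (relator ! i) t" if "i < N" "0 <= t" "t < 1" for i t
  using fmap_circ[OF that, of one_V] snd_fmap[of one_V "circ ((real i + t) / N)"] snd_eletter by simp
 have V: "letter_loop l 0=Vertex" "letter_loop l 1=Vertex" for l :: "nat \<times> bool"
  by (simp_all add: letter_loop_def edge_point_def)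
 show ?thesis
 proof (cases "t < 1")
  case False
  hence t: "t=1" using assms by simp
  have "face_map relator (circ ((real i + 1) / N))=Vertex"
  proof (cases "Suc i < N")
   case True
   thus ?thesis using *[of "Suc i" 0] V by (simp add: add.commute)
  next
   case False
   hence "real i + 1=N" using assms(1) by linarith
   hence "circ ((real i + 1) / N)=circ ((real 0 + 0) / N)" using circ_1 relator_ne by simp
   thus ?thesis using *[of 0 0] V relator_ne by simp
  qed
  thus ?thesis using t V by simp
 qed (use * assms in blast)
qed

lemma pathin_lp: "s:three ==> pathin P1 (lp s)"
proof -
 assume s: "s:three"
 have "cmap I01 E1 (eletter one_V (s, True))" by (rule continuous_eletter) (simp_all add: s)
 from cmo[OF this continuous_snd_E1] show ?thesis
  by (simp add: pathin_def o_def snd_eletter lp_def)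
qed

lemma esum_Cons: "esum s (l # w)=(if fst l=s then (if snd l then 1 else -1) else 0) + esum s w"
 by (simp add: esum_def)

lemma letters_sum:
 fixes e :: "nat => 'x \<Rightarrow>\<^sub>0 int"
 shows "set w <= three \<times> UNIV ==>
  (SUM l<-w. fcm (if snd l then 1 else -1) (e (fst l)))=(SUM s:three. fcm (esum s w) (e s))"
proof (induction w)
 case (Cons l w)
 have "(SUM s:three. fcm (esum s (l # w)) (e s)) =
   (SUM s:three. (if s=fst l then fcm (if snd l then 1 else -1) (e s) else 0)) + (SUM s:three. fcm (esum s w) (e s))"
  unfolding sum.distrib[symmetric] by (rule sum.cong) (auto simp: esum_Cons frag_cmul_distrib)
 also have "(SUM s:three. (if s=fst l then fcm (if snd l then 1 else -1) (e s) else 0))=fcm (if snd l then 1 else -1) (e (fst l))"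
  using Cons.prems by (subst sum.delta) (auto simp: three_def)
 finally show ?case using Cons by simp
qed (simp add: esum_def)

text \<open>The boundary loop is homologous to the sum of its letters, an inverse letter counts
  negatively, and the exponent sums are zero.\<close>

lemma face_loop_null:
 assumes e: "!!s. esum s relator=0"
 shows "homologous_rel 1 P1 {} (chain_map 1 (face_map relator) (frag_of omega)) 0"
proof -
 define W where "W s=face_map relator (circ s)" for s
 have "cmap I01 P1 W"
  using cmo[OF continuous_map_circ H2.cont[unfolded diff_2_1, of "face_map relator"]]
  unfolding W_def[abs_def] by (simp add: o_def)
 hence W: "pathin P1 W" by (simp add: pathin_def)
 have N0: "N > 0" using relator_ne by simp
 have "smap 1 (face_map relator) omega=seg W 0 1"
  by (auto simp: simplex_map_def omega_def seg_def W_def fun_eq_iff)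
 hence 0: "chain_map 1 (face_map relator) (frag_of omega)=frag_of (seg W 0 (real N / N))"
  using N0 by (simp add: chain_map_of)
 have 1: "homologous_rel 1 P1 {} (frag_of (seg W 0 (real N / N))) (SUM i<N. frag_of (seg W (i / N) (Suc i / N)))"
  by (rule seg_subdivide[OF W]) (use N0 in simp_all)
 have 2: "homologous_rel 1 P1 {} (SUM i<N. frag_of (seg W (i / N) (Suc i / N)))
   (SUM i<N. fcm (if snd (relator ! i) then 1 else -1) (frag_of (seg (lp (fst (relator ! i))) 0 1)))"
 proof (rule homologous_rel_sum)
  fix i assume "i:{..<N}"
  hence i: "i < N" by simp
  let ?s = "fst (relator ! i)"
  have "seg W (i / N) (Suc i / N)=(if snd (relator ! i) then seg (lp ?s) 0 1 else seg (lp ?s) 1 0)"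
  proof
   fix x show "seg W (i / N) (Suc i / N) x=(if snd (relator ! i) then seg (lp ?s) 0 1 else seg (lp ?s) 1 0) x"
   proof (cases "x:stds 1")
    case True
    have x: "0 <= x 1" "x 1 <= 1" "x 0=1 - x 1" using standard_simplex_1[OF True] by auto
    have "i / N * x 0 + Suc i / N * x 1=(real i + x 1) / N" unfolding x(3) using N0 by (simp add: field_simps)
    hence h: "seg W (i / N) (Suc i / N) x=letter_loop (relator ! i) (x 1)"
     using snd_eword_point[OF i x(1,2)] True by (simp add: seg_def W_def)
    show ?thesis unfolding h using True by (cases "relator ! i") (simp add: seg_def lp_def letter_loop_def x(3))
   qed (simp add: seg_def)
  qed
  thus "homologous_rel 1 P1 {} (frag_of (seg W (i / N) (Suc i / N)))
    (fcm (if snd (relator ! i) then 1 else -1) (frag_of (seg (lp ?s) 0 1)))"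
   using seg_reverse[OF pathin_lp[OF relator_letters[OF i]], of 0 1] by simp
 qed simp_all
 have "(SUM i<N. fcm (if snd (relator ! i) then 1 else -1) (frag_of (seg (lp (fst (relator ! i))) 0 1))) =
   (SUM l<-relator. fcm (if snd l then 1 else -1) (frag_of (seg (lp (fst l)) 0 1)))"
  unfolding sum_list_sum_nth by (simp add: atLeast0LessThan)
 also have "... = 0"
  using letters_sum[of relator "%s. frag_of (seg (lp s) 0 1)"] relator_carrier e by (simp add: free_group_def)
 finally have 3: "(SUM i<N. fcm (if snd (relator ! i) then 1 else -1) (frag_of (seg (lp (fst (relator ! i))) 0 1)))=0" .
 show ?thesis unfolding 0 using homologous_rel_trans[OF 2 1] unfolding 3 .
qed

lemma trivial_H2_P1: "trivial_group (homology_group 2 P1)"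
proof -
 have em: "glued (dtop {Vertex}) 1 (edge_map ` S)" if "S <= three" for S
  using H1.n H1.cont H1.inj H1.new that unfolding glued_def by (meson image_mono subsetD)
 have sub: "S <= three ==> trivial_group (homology_group 2 (glue (dtop {Vertex}) 1 (edge_map ` S)))" if "finite S" for S
  using that
 proof (induction S)
  case empty
  have "glue (dtop {Vertex}) 1 ({} :: ((nat => real) => nat cw_point) set)=dtop {Vertex}"
   by (rule topology_eq[THEN iffD2]) (auto simp: openin_glue)
  thus ?case using homology_dimension_axiom[of "dtop {Vertex}" Vertex 2] by simp
 next
  case (insert s S)
  have S: "S <= three" "s:three" "s ~: S" using insert by auto
  interpret S: glued "dtop {Vertex}" 1 "edge_map ` S" by (rule em[OF S(1)])
  let ?A = "glue (dtop {Vertex}) 1 (edge_map ` S)"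
  have H: "Hausdorff_space ?A" by (rule S.Hausdorff_B) simp
  have gl: "glued ?A 1 {edge_map s}"
  proof
   fix ph :: "(nat => real) => nat cw_point" assume ph: "ph:{edge_map s}"
   have "cmap (nS (1 - 1)) (dtop {Vertex}) ph" using H1.cont[of ph] ph S(2) by blast
   from cmo[OF this S.continuous_A] show "cmap (nS (1 - 1)) ?A ph" by simp
   fix v assume v: "v:odisc 1"
   show "ph v ~: tsp ?A"
   proof
    assume "ph v:tsp ?A"
    moreover have "ph v=Edge s (v 0)" using v ph by (simp add: edge_map_def edge_point_def open_disc1)
    ultimately obtain s' w where "s':S" "edge_map s' w=Edge s (v 0)" unfolding S.top_B by auto
    thus False using S(3) by (auto simp: edge_map_def edge_point_def split: if_splits)
   qed
  next
   fix ph py :: "(nat => real) => nat cw_point" and v w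
   assume "ph:{edge_map s}" "py:{edge_map s}" "v:odisc 1" "w:odisc 1" "ph v=py w"
   thus "ph=py & v=w" using H1.inj[of ph py v w] S(2) by blast
  qed simp
  have "glue ?A 1 {edge_map s}=glue (dtop {Vertex}) 1 (edge_map ` insert s S)"
   unfolding image_insert by (rule glue_insert[OF S.top_B])
  thus ?case using trivial_group_H2_step[OF gl H insert.IH[OF S(1)]] by simp
 qed
 have "finite three" by (simp add: three_def)
 from sub[OF this order_refl] show ?thesis by (simp only: one_skeleton_def)
qed

lemma P2_glue: "glue P1 2 {face_map relator}=P2"
 unfolding presentation_complex_def ..

lemma group_generated_pow: "group G ==> a:carrier G ==> generate G {a}=range (%n::int. a [^]\<^bsub>G\<^esub> n)"
 using group.generate_pow[of G a] by auto

lemma disc_class: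
 "disc_class:carrier (rhg 2 (ndisc 2) (tsp (nS 1)))"
 "d:carrier (rhg 2 (ndisc 2) (tsp (nS 1))) ==>
  EX n::int. d=disc_class [^]\<^bsub>rhg 2 (ndisc 2) (tsp (nS 1))\<^esub> n"
proof -
 let ?G = "rhg 2 (ndisc 2) (tsp (nS 1))"
 interpret G: group ?G by simp
 have S: "subt (ndisc 2) (tsp (nS 1))=nS 1"
  using sphere_subtopology[of 2] unfolding diff_2_1 by simp
 have "tsp (ndisc 2) Int tsp (nS 1) ~= {}"
  using circ_disc[of 0] circ_sphere[of 0] by blast
 hence "hom_boundary 2 (ndisc 2) (tsp (nS 1)):iso ?G (reduced_homology_group (2 - 1) (nS 1))"
  using iso_relative_homology_of_contractible[OF contractible_ndisc, of 2 "tsp (nS 1)" 2] S by simp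
 hence "cyclic_group ?G"
  using isomorphic_group_cyclicity[OF is_isoI group_relative_homology_group group_reduced_homology_group]
   cyclic_reduced_homology_group_nsphere by metis
 then obtain g where g: "g:carrier ?G" "carrier ?G=range (%n::int. g [^]\<^bsub>?G\<^esub> n)" using G.cyclic_group by blast
 hence "g:carrier ?G & generate ?G {g}=carrier ?G" using group_generated_pow[of ?G g] by simp
 hence *: "disc_class:carrier ?G & generate ?G {disc_class}=carrier ?G"
  unfolding disc_class_def by (rule someI)
 thus "disc_class:carrier ?G" by blast
 show "EX n::int. d=disc_class [^]\<^bsub>?G\<^esub> n" if "d:carrier ?G"
  using group_generated_pow[of ?G disc_class] * that by auto
qed

text \<open>Exact sequence of the complex and its 1-skeleton. Absolute classes embed into relative
  ones since the 1-skeleton has no second homology; the cell lifts since its boundary loop is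
  null-homologous; and relative classes are multiples of the cell.\<close>

theorem cell_class:
 assumes e: "!!s. esum s relator=0"
 obtains z where "singular_relcycle 2 P2 {} z" "cell_class three relator=hrel 2 P2 {} z"
  "!!w. singular_relcycle 2 P2 {} w ==> EX n. homologous_rel 2 P2 {} w (fcm n z)"
proof -
 let ?S = "tsp (nS 1)" and ?D = "rhg 2 (ndisc 2) (tsp (nS 1))"
 let ?H = "homology_group 2 P2" and ?R = "rhg 2 P2 (tsp P1)"
 let ?j = "hom_induced 2 P2 {} P2 (tsp P1) id" and ?ph = "hom_induced 2 (ndisc 2) ?S P2 (tsp P1) (face_map relator)"
 interpret J: group_hom ?H ?R ?j by (simp add: group_hom_def group_hom_axioms_def hom_induced_empty_hom hom_induced_hom)
 interpret F: group_hom ?D ?R ?ph by (simp add: group_hom_def group_hom_axioms_def hom_induced_hom)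
 have S: "subt (ndisc 2) ?S=nS 1" using sphere_subtopology[of 2] unfolding diff_2_1 by simp
 have Psub: "subt P2 (tsp P1)=P1" by (rule H2.subtopology_A)
 have phc: "cmap (ndisc 2) P2 (face_map relator)" by (rule H2.continuous_phi) simp
 have phS: "face_map relator:?S \<rightarrow> tsp P1" using H2.phi_sphere[of "face_map relator"] unfolding diff_2_1 by blast
 have inj: "inj_on ?j (carrier ?H)"
 proof (subst J.inj_iff_trivial_ker)
  have "kernel ?H ?R ?j=hom_induced 2 P1 {} P2 {} id ` carrier (homology_group 2 P1)"
   using homology_exactness_axiom_3[of 2 P2 "tsp P1"] by (simp add: Psub)
  also have "carrier (homology_group 2 P1)={\<one>\<^bsub>homology_group 2 P1\<^esub>}"
   using trivial_H2_P1 by (simp add: trivial_group_def)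
  also have "hom_induced 2 P1 {} P2 {} id ` ... = {\<one>\<^bsub>?H\<^esub>}"
   by (simp add: hom_one[OF hom_induced_hom])
  finally show "kernel ?H ?R ?j={\<one>\<^bsub>?H\<^esub>}" .
 qed
 have "EX a:carrier ?H. ?j a=?ph disc_class"
 proof -
  have "hom_boundary 2 (ndisc 2) ?S disc_class:carrier (homology_group (2 - 1) (subt (ndisc 2) ?S))"
   using hom_boundary_hom disc_class(1) by (meson hom_in_carrier)
  hence "hom_boundary 2 (ndisc 2) ?S disc_class:carrier (rhg (int 1) (nS 1) {})"
   unfolding S by simp
  then obtain c where c: "singular_relcycle 1 (nS 1) {} c" "hom_boundary 2 (ndisc 2) ?S disc_class=hrel 1 (nS 1) {} c"
   unfolding carrier_relative_homology_group by blast
  obtain n where n: "homologous_rel 1 (nS 1) {} c (fcm n (frag_of omega))" using circle_cycles[OF c(1)] by blast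
  have ct: "cmap (nS 1) P1 (face_map relator)" using H2.cont[of "face_map relator"] unfolding diff_2_1 by simp
  have cyc: "singular_relcycle 1 (nS 1) {} (fcm n (frag_of omega))"
   by (rule singular_relcycle_cmul[OF omega_cycle])
  have "hom_boundary 2 (ndisc 2) ?S disc_class=hrel 1 (nS 1) {} (fcm n (frag_of omega))"
   unfolding c(2) using n by (simp only: homologous_rel_set_eq)
  hence "hom_induced (int 1) (nS 1) {} P1 {} (face_map relator) (hom_boundary 2 (ndisc 2) ?S disc_class) =
    hrel 1 P1 {} (chain_map 1 (face_map relator) (fcm n (frag_of omega)))"
   using hom_induced_chain_map[OF ct _ cyc, of "{}"] by simp
  also have "... = hrel 1 P1 {} 0"
  proof -
   have "singular_relboundary 1 P1 {} (fcm n (chain_map 1 (face_map relator) (frag_of omega) - 0))"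
    using face_loop_null[OF e] unfolding homologous_rel_def by (rule singular_relboundary_cmul)
   hence "homologous_rel 1 P1 {} (chain_map 1 (face_map relator) (fcm n (frag_of omega))) 0"
    unfolding homologous_rel_def by (simp add: chain_map_cmul)
   thus ?thesis by (simp only: homologous_rel_set_eq)
  qed
  also have "... = \<one>\<^bsub>rhg (int 1) P1 {}\<^esub>"
   unfolding one_relative_homology_group using homologous_rel_set_eq_relboundary[of 1 P1 "{}" 0] by simp
  finally have "hom_boundary 2 P2 (tsp P1) (?ph disc_class)=\<one>\<^bsub>homology_group (2 - 1) (subt P2 (tsp P1))\<^esub>"
   using fun_cong[OF naturality_hom_induced[OF phc phS, of 2], of disc_class] by (simp add: S Psub)
  moreover have "?ph disc_class:carrier ?R" by (rule hom_induced_carrier)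
  ultimately have "?ph disc_class:kernel ?R (homology_group (2 - 1) (subt P2 (tsp P1))) (hom_boundary 2 P2 (tsp P1))"
   by (simp add: kernel_def)
  hence "?ph disc_class:?j ` carrier ?H"
   using homology_exactness_axiom_1[of 2 P2 "tsp P1"] by simp
  then obtain a where "?ph disc_class=?j a" "a:carrier ?H" by (rule imageE)
  thus ?thesis by (intro bexI[of _ a]) simp_all
 qed
 then obtain a where a: "a:carrier ?H" "?j a=?ph disc_class" by blast
 have "cell_class three relator=a"
  unfolding cell_class_def
 proof (rule the_equality)
  show "a:carrier ?H & ?j a=?ph disc_class" using a by blast
  show "b=a" if "b:carrier ?H & ?j b=?ph disc_class" for b
   by (rule inj_onD[OF inj]) (use a that in simp_all)
 qed
 moreover obtain z where z: "singular_relcycle 2 P2 {} z" "a=hrel 2 P2 {} z"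
  using a(1) carrier_relative_homology_group[of 2 P2 "{}"] by auto
 moreover have "EX n. homologous_rel 2 P2 {} w (fcm n z)" if w: "singular_relcycle 2 P2 {} w" for w
 proof -
  let ?w = "hrel 2 P2 {} w"
  have wc: "?w:carrier ?H" using w carrier_relative_homology_group[of 2 P2 "{}"] by auto
  have HP1: "Hausdorff_space P1" by (rule H1.Hausdorff_B) simp
  obtain d where d: "d:carrier ?D" "?j ?w=?ph d"
   using cell_homology_surj[OF glued_P2 HP1 P2_glue[symmetric] hom_induced_carrier[of 2 P2 "{}" P2 "tsp P1" id ?w]] unfolding diff_2_1 by blast
  obtain n :: int where "d=disc_class [^]\<^bsub>?D\<^esub> n" using disc_class(2)[OF d(1)] by blast
  hence "?j ?w=?j (a [^]\<^bsub>?H\<^esub> n)"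
   using d(2) F.hom_int_pow[OF disc_class(1)] J.hom_int_pow[OF a(1)] a(2) by simp
  hence "?w=a [^]\<^bsub>?H\<^esub> n" by (rule inj_onD[OF inj _ wc J.G.int_pow_closed[OF a(1)]])
  hence "?w=hrel 2 P2 {} (fcm n z)"
   using homology_class_pow[OF z(1), of n] z(2) by simp
  thus ?thesis unfolding homologous_rel_set_eq by blast
 qed
 ultimately show thesis using that by blast
qed

end

section \<open>Straightening and the simplicial volume\<close>

lemma triangle_boundary:
 "x:stds 2 \<longleftrightarrow> 0 <= x 0 & 0 <= x 1 & 0 <= x 2 & x 0 + x 1 + x 2=1 & (ALL i>2. x i=0)"
proof -
 have *: "(SUM i<=2. x i)=x 0 + x 1 + x 2" using sum_le_2[of x] by (simp add: numeral_2_eq_2 One_nat_def)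
 have i: "i=0 | i=1 | i=2 | i > 2" for i :: nat by linarith
 show ?thesis
 proof
  assume a: "0 <= x 0 & 0 <= x 1 & 0 <= x 2 & x 0 + x 1 + x 2=1 & (ALL i>2. x i=0)"
  have "0 <= x i & x i <= 1" for i using a i[of i] by (elim disjE) auto
  thus "x:stds 2" using a by (simp add: standard_simplex_def *)
 qed (auto simp: standard_simplex_def *)
qed

text \<open>The three edges define a null-homotopic map on the boundary, and the triangle is the
  cone over its boundary with the barycentre as apex.\<close>

lemma fill_triangle:
 assumes E: "ccontractible E" and f: "!!k. k <= 2 ==> ssimp 1 E (f k)"
  and e: "!!k i. k <= 2 ==> i <= 1 ==> f k (vert i)=e (if i < k then i else Suc i)"
 shows "EX ta. ssimp 2 E ta & (ALL k<=2. sface 2 k ta=f k)"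
proof -
 let ?S = "stds 2"
 define S where "S={x:?S. x 0 * x 1 * x 2=0}"
 define B where "B=subt (SS 2) S"
 define deg where "deg k x=(%i. x (if i < k then i else Suc i))" for k :: nat and x :: "nat => real"
 define b :: "nat => real" where "b=(%i. if i <= 2 then 1/3 else 0)"
 define q where "q z=(%i. (1 - fst z) * snd z i + fst z * b i)" for z :: "real \<times> (nat => real)"
 have bS: "b:?S" by (simp add: triangle_boundary b_def)
 have SS: "S <= ?S" by (auto simp: S_def)
 have topB: "tsp B=S" by (auto simp: B_def S_def)
 have degS: "deg k x:stds 1" if "x:S" "k <= 2" "x k=0" for k x
 proof -
  have x: "0 <= x 0" "0 <= x 1" "0 <= x 2" "x 0 + x 1 + x 2=1" "!!i. i > 2 ==> x i=0"
   using that unfolding S_def triangle_boundary by auto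
  have k: "k=0 | k=1 | k=2" using that by linarith
  have s: "deg k x 0 + deg k x 1=1" "0 <= deg k x 0" "0 <= deg k x 1" "!!i. i > 1 ==> deg k x i=0"
   using x k that(3) by (auto simp: deg_def One_nat_def numeral_2_eq_2)
  have "0 <= deg k x i & deg k x i <= 1" for i
  proof -
   consider "i=0" | "i=1" | "i > 1" by linarith
   thus ?thesis using s by cases auto
  qed
  thus ?thesis using s unfolding standard_simplex_def by (simp add: One_nat_def)
 qed
 obtain g where g: "cmap B E g" "!!k x. k:{..2} ==> x:tsp B Int {x:S. x k=0} ==> g x=f k (deg k x)"
 proof (rule pasting_lemma_exists_closed[where X = B and I = "{..2::nat}" and T = "%k. {x:S. x k=0}" and f = "%k x. f k (deg k x)" and Y = E])
  show "tsp B <= \<Union> ((%k. {x:S. x k=0}) ` {..2})"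
  proof
   fix x assume "x:tsp B"
   hence "x:S" "x 0=0 | x 1=0 | x 2=0" unfolding topB S_def by auto
   moreover have "0:{..2::nat}" "1:{..2::nat}" "2:{..2::nat}" by simp_all
   ultimately show "x:\<Union> ((%k. {x:S. x k=0}) ` {..2})" by blast
  qed
  fix k :: nat assume k: "k:{..2}"
  have "closedin B {x:tsp B. x k:{0}}"
   unfolding B_def by (rule closed_pre[of _ euclideanreal]) (simp_all add: cm_from continuous_SS_proj)
  thus "closedin B {x:S. x k=0}" unfolding topB by simp
  have "cmap (subt B {x:S. x k=0}) (SS 1) (deg k)"
  proof (rule continuous_map_SS)
   show "cmap (subt B {x:S. x k=0}) eur (%x. deg k x i)" for i
    unfolding B_def deg_def by (intro cm_from continuous_SS_proj)
  qed (use degS k topB in auto)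
  from cmo[OF this, of E "f k"]
  show "cmap (subt B {x:S. x k=0}) E (%x. f k (deg k x))"
   using f[of k] k by (simp add: singular_simplex_def o_def)
 next
  have d: "f j (deg j (vert m))=e m" if j: "j <= 2" "m <= 2" "j ~= m" for j m
  proof -
   have "deg j (vert m)=vert (if m < j then m else m - 1)" unfolding deg_def using j by (intro ext) auto
   thus ?thesis using e[of j "if m < j then m else m - 1"] j by auto
  qed
  have *: "f k (deg k x)=f l (deg l x)" if kl: "k < l" "l <= 2" "x:S" "x k=0" "x l=0" for k l x
  proof -
   have x: "x 0 + x 1 + x 2=1" "!!i. i > 2 ==> x i=0" using kl(3) unfolding S_def triangle_boundary by auto
   have i: "i=0 | i=1 | i=2 | i > 2" for i :: nat by linarith
   consider "k=0" "l=1" | "k=0" "l=2" | "k=1" "l=2" using kl by linarith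
   hence "EX m<=2. m ~= k & m ~= l & x=vert m"
   proof cases
    case 1
    have "x j=vert 2 j" for j using x kl 1 i[of j] by (elim disjE) auto
    thus ?thesis using 1 by (intro exI[of _ 2]) auto
   next
    case 2
    have "x j=vert 1 j" for j using x kl 2 i[of j] by (elim disjE) auto
    thus ?thesis using 2 by (intro exI[of _ 1]) auto
   next
    case 3
    have "x j=vert 0 j" for j using x kl 3 i[of j] by (elim disjE) auto
    thus ?thesis using 3 by (intro exI[of _ 0]) auto
   qed
   then obtain m where "m <= 2" "m ~= k" "m ~= l" "x=vert m" by blast
   thus ?thesis using d[of k m] d[of l m] kl by simp
  qed
  fix k l x assume "k:{..2}" "l:{..2}" "x:tsp B Int {x:S. x k=0} Int {x:S. x l=0}"
  hence "k <= 2" "l <= 2" "x:S" "x k=0" "x l=0" by auto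
  thus "f k (deg k x)=f l (deg l x)"
   by (cases k l rule: linorder_cases) (metis *, simp, metis *)
 qed (simp, blast)
 have compB: "compact_space B"
 proof -
  have "closedin (SS 2) {x:tsp (SS 2). x 0 * x 1 * x 2:{0::real}}"
   by (rule closed_pre[of _ euclideanreal])
    (simp_all add: continuous_map_real_mult continuous_SS_proj)
  hence "closedin (SS 2) S" by (simp add: S_def)
  moreover have "compact_space (SS 2)" using compactin_standard_simplex by (simp add: cpt_sub)
  ultimately show ?thesis unfolding B_def using closedin_compact_space cpt_sub by blast
 qed
 obtain c where "homotopic_with (%_. True) B E g (%_. c)" using ccontractible_null[OF E compB g(1)] by blast
 note cext = cone_extension[where B = B and D = "SS 2" and q = q, OF _ _ compB _ _ this]
 \<comment> \<open>The smallest barycentric coordinate is t/3, so the cone parameter can be read off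
   from the point.\<close>
 have mn: "min (q (t, x) 0) (min (q (t, x) 1) (q (t, x) 2))=t / 3" if "t:{0..1}" "x:S" for t x
 proof -
  have x: "0 <= x 0" "0 <= x 1" "0 <= x 2" "x 0=0 | x 1=0 | x 2=0"
   using that(2) unfolding S_def triangle_boundary by auto
  hence "0 <= (1 - t) * x 0" "0 <= (1 - t) * x 1" "0 <= (1 - t) * x 2" using that(1) by auto
  moreover have "min (u + d) (min (v + d) (w + d))=d" if "0 <= u" "0 <= v" "0 <= w" "u=0 | v=0 | w=0" for u v w d :: real
   using that by (auto simp: min_def)
  moreover have "(1 - t) * x 0=0 | (1 - t) * x 1=0 | (1 - t) * x 2=0" using x(4) by auto
  ultimately show ?thesis by (simp add: q_def b_def)
 qed
 obtain ta where ta: "cmap (SS 2) E ta" "!!x. x:tsp B ==> ta (q (0, x))=g x"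
 proof (rule cext)
  show "cmap (prodt I01 B) (SS 2) q"
  proof (rule continuous_map_SS)
   have 1: "cmap (prodt I01 B) eur fst"
    using continuous_map_fst cm_full by blast
   have 0: "cmap B eur (%x. x i)" for i
    unfolding B_def by (rule cm_from[OF continuous_SS_proj])
   have 2: "cmap (prodt I01 B) eur (%z. snd z i)" for i
    using cmo[OF continuous_map_snd 0] by (simp add: o_def)
   show "cmap (prodt I01 B) eur (%z. q z i)" for i
    unfolding q_def by (intro continuous_map_add continuous_map_real_mult continuous_map_diff 1 2) simp_all
   show "q z:?S" if "z:tsp (prodt I01 B)" for z
    unfolding q_def by (rule convex_standard_simplex[OF _ bS]) (use that topB SS in auto)
  qed
  from cm_fun[OF this] have sub: "q ` ({0..1} \<times> tsp B) <= tsp (SS 2)" by auto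
  show "q ` ({0..1} \<times> tsp B)=tsp (SS 2)"
  proof (intro equalityI sub subsetI)
   fix x assume "x:tsp (SS 2)"
   hence x: "0 <= x 0" "0 <= x 1" "0 <= x 2" "x 0 + x 1 + x 2=1" "!!i. i > 2 ==> x i=0"
    unfolding topspace_standard_simplex triangle_boundary by auto
   define m where "m=min (x 0) (min (x 1) (x 2))"
   have m: "m <= x 0" "m <= x 1" "m <= x 2" "0 <= m" "m=x 0 | m=x 1 | m=x 2" using x by (auto simp: m_def min_def)
   have i: "i=0 | i=1 | i=2 | i > 2" for i :: nat by linarith
   show "x:q ` ({0..1} \<times> tsp B)"
   proof (cases "m=1/3")
    case True
    hence "x 0=1/3" "x 1=1/3" "x 2=1/3" using x m by linarith+
    hence "x j=q (1, vert 0) j" for j using i[of j] x(5) by (elim disjE) (auto simp: q_def b_def)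
    hence "x=q (1, vert 0)" by (rule ext)
    moreover have "vert 0:S" by (simp add: S_def triangle_boundary)
    ultimately show ?thesis unfolding topB by (intro image_eqI[of _ _ "(1, vert 0)"]) auto
   next
    case False
    hence m3: "1 - 3 * m > 0" using m x by linarith
    let ?y = "%i. if i <= 2 then (x i - m) / (1 - 3 * m) else 0"
    have "(x 0 - m) / (1 - 3 * m) + (x 1 - m) / (1 - 3 * m) + (x 2 - m) / (1 - 3 * m)=1"
     using m3 x(4) by (simp add: add_divide_distrib[symmetric] divide_eq_eq)
    hence "?y:S" using m m3 unfolding S_def triangle_boundary by auto
    moreover have "x j=q (3 * m, ?y) j" for j using m3 x(5)[of j] by (simp add: q_def b_def)
    hence "x=q (3 * m, ?y)" by (rule ext)
    ultimately show ?thesis unfolding topB using m3 m by (intro image_eqI[of _ _ "(3 * m, ?y)"]) auto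
   qed
  qed
  show "t=s & (x=y | t=1)" if as: "t:{0..1}" "s:{0..1}" "x:tsp B" "y:tsp B" "q (t, x)=q (s, y)" for t x s y
  proof -
   have ts: "t=s" using mn[of t x] mn[of s y] as by (simp add: topB)
   moreover have "x=y" if "t ~= 1"
   proof
    fix i show "x i=y i" using fun_cong[OF as(5), of i] that ts by (simp add: q_def)
   qed
   ultimately show ?thesis by blast
  qed
  show "Hausdorff_space (SS 2)" by (simp add: Hausdorff_space_subtopology Hausdorff_space_product_topology)
 next
  fix h assume h: "cmap (SS 2) E h" "!!x. x:tsp B ==> h (q (0, x))=g x"
  show thesis by (rule that[OF h])
 qed
 have q0: "q (0, x)=x" for x by (simp add: q_def)
 let ?ta = "restrict ta ?S"
 have "cmap (SS 2) E ?ta" by (rule continuous_map_eq[OF ta(1)]) simp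
 hence "ssimp 2 E ?ta" by (simp add: singular_simplex_def)
 moreover have "sface 2 k ?ta=f k" if k: "k <= 2" for k
 proof
  fix x show "sface 2 k ?ta x=f k x"
  proof (cases "x:stds 1")
   case True
   have fS: "simplical_face k x:?S" using simplical_face_in_standard_simplex[of 2 k x] True k by (simp add: One_nat_def)
   have k0: "simplical_face k x k=0" by (simp add: simplical_face_def)
   moreover have "k=0 | k=1 | k=2" using k by linarith
   ultimately have "simplical_face k x:S" unfolding S_def using fS by auto
   moreover have "deg k (simplical_face k x)=x" by (auto simp: deg_def simplical_face_def fun_eq_iff)
   ultimately show ?thesis using ta(2)[of "simplical_face k x"] g(2)[of k "simplical_face k x"] k k0 fS True
    by (simp add: q0 topB singular_face_def One_nat_def)
  next
   case False
   thus ?thesis using f[OF k] by (simp add: singular_face_def singular_simplex_def extensional_def One_nat_def)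
  qed
 qed
 ultimately show ?thesis by blast
qed

section \<open>The bar complex of the group and its realization by singular chains\<close>

type_synonym vtx = "bool fg state"
type_synonym bchain = "(vtx \<times> vtx) \<Rightarrow>\<^sub>0 int"

context hnn_words begin

text \<open>A chosen simplex from the base vertex to the vertex g. Together with \<open>tri\<close>
  it realizes the symbols of the bar complex so that faces match.\<close>

definition sgm :: "vtx => (nat => real) => pt" where
 "sgm g=(SOME si. ssimp 1 E2 si & si (vert 0)=(one_V, Vertex) & si (vert 1)=(g, Vertex))"

lemma sgm:
 assumes g: "g:V"
 shows "ssimp 1 E2 (sgm g) & sgm g (vert 0)=(one_V, Vertex) & sgm g (vert 1)=(g, Vertex)"
proof -
 obtain W where W: "pathin E2 W" "W 0=(one_V, Vertex)" "W 1=(g, Vertex)"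
  using ccontractible_path[OF ccontractible_E2, of "(one_V, Vertex)" "(g, Vertex)"] g by (auto simp: top_E2 cells_def)
 have "cmap (SS 1) I01 (%x. x 1)"
  using continuous_SS_proj standard_simplex_1 by (fastforce simp: cm_into)
 from cmo[OF this W(1)[unfolded pathin_def]]
 have "cmap (SS 1) E2 (restrict (%x. W (x 1)) (stds 1))"
  by (rule continuous_map_eq) simp
 moreover have "vert 0:stds 1" "vert 1:stds 1" by simp_all
 ultimately have "EX si. ssimp 1 E2 si & si (vert 0)=(one_V, Vertex) & si (vert 1)=(g, Vertex)"
  using W by (intro exI[of _ "restrict (%x. W (x 1)) (stds 1)"]) (simp add: singular_simplex_def)
 thus ?thesis unfolding sgm_def by (rule someI_ex)
qed

abbreviation "tri_face g h k == if k=0 then smap 1 (act g) (sgm h) else if k=1 then sgm (mul g h) else sgm g"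

definition tri :: "vtx => vtx => (nat => real) => pt" where
 "tri g h=(SOME ta. ssimp 2 E2 ta & (ALL k<=2::nat. sface 2 k ta=tri_face g h k))"

lemma tri:
 assumes "g:V" "h:V"
 shows "ssimp 2 E2 (tri g h) & (ALL k<=2. sface 2 k (tri g h)=tri_face g h k)"
proof -
 let ?e = "%i::nat. if i=0 then (one_V, Vertex) else if i=1 then (g, Vertex) else (mul g h, Vertex) :: pt"
 note s = sgm[OF assms(1)] sgm[OF assms(2)] sgm[OF mul_V[OF assms(1)], of h]
 have v: "vert 0:stds 1" "vert 1:stds 1" by simp_all
 have "EX ta. ssimp 2 E2 ta & (ALL k<=2. sface 2 k ta=tri_face g h k)"
 proof (rule fill_triangle[OF ccontractible_E2, of "tri_face g h" ?e])
  show "ssimp 1 E2 (tri_face g h k)" for k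
   using s singular_simplex_simplex_map[OF _ continuous_act[OF assms(1)]] by simp
  fix k i :: nat assume "k <= 2" "i <= 1"
  hence "(k=0 | k=1 | k=2) & (i=0 | i=1)" by linarith
  thus "tri_face g h k (vert i)=?e (if i < k then i else Suc i)"
   using s v by (auto simp: simplex_map_def act_def)
 qed
 thus ?thesis unfolding tri_def by (rule someI_ex)
qed

definition bd :: "bchain => (vtx \<Rightarrow>\<^sub>0 int)" where
 "bd=lsum (%(g, h) n. single h n - single (mul g h) n + single g n)"
definition bev :: "(vtx => vtx => real) => bchain => real" where
 "bev ph=lsum (%(g, h) n. of_int n * ph g h)"
definition bnorm :: "bchain => real" where
 "bnorm c=(SUM x:keys c. \<bar>real_of_int (lookup c x)\<bar>)"
definition bsimp :: "vtx \<times> vtx => (nat => real) => nat cw_point" where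
 "bsimp x=smap 2 snd (tri (fst x) (snd x))"
definition sch :: "bchain => nat cw_point chain" where
 "sch=lsum (%x. single (bsimp x))"
definition bcycle :: "bchain => bool" where
 "bcycle c \<longleftrightarrow> keys c <= V \<times> V & bd c=0"

lemma additive_bd [simp]: "additive_family (%(g, h) n. single h n - single (mul g h) n + single g (n::int))"
 by (auto simp: additive_family_def single_add algebra_simps)

lemma additive_bev [simp]: "additive_family (%(g, h) n. of_int n * (ph g h :: real))"
 by (auto simp: additive_family_def algebra_simps)

lemma bd_add: "bd (x + y)=bd x + bd y" and bd_diff: "bd (x - y)=bd x - bd y"
 and bd_single: "bd (single (g, h) n)=single h n - single (mul g h) n + single g n"
 and bev_add: "bev ph (x + y)=bev ph x + bev ph y" and bev_diff: "bev ph (x - y)=bev ph x - bev ph y"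
 and bev_single: "bev ph (single (g, h) n) = of_int n * ph g h" and bd_0 [simp]: "bd 0=0" and bev_0 [simp]: "bev ph 0=0"
 by (simp_all add: bd_def bev_def lsum_add lsum_diff lsum_single)

lemma bsimp_simplex: "x:V \<times> V ==> ssimp 2 P2 (bsimp x)"
 unfolding bsimp_def using tri[of "fst x" "snd x"] by (intro singular_simplex_simplex_map[OF _ continuous_snd_E2]) auto

text \<open>In \<open>P2\<close> a translated simplex has the same image as the original one, so the
  face of \<open>tri g h\<close> opposite to the base vertex becomes the symbol of h alone.\<close>

lemma sch_boundary:
 assumes "keys c <= V \<times> V"
 shows "chain_boundary 2 (sch c)=lsum (%g. single (smap 1 snd (sgm g))) (bd c)"
proof (rule additive_induct[where c = c and P = "%c. chain_boundary 2 (sch c)=lsum (%g. single (smap 1 snd (sgm g))) (bd c)"])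
 fix x n assume xk: "x:keys c"
 obtain g h where gh: "x=(g, h)" by (rule prod.exhaust)
 hence x: "x=(g, h)" "g:V" "h:V" using xk assms by blast+
 have f: "sface 2 k (bsimp x)=smap 1 snd (tri_face g h k)" if "k <= 2" for k
 proof -
  have "Suc 1=2" by simp
  note fm = singular_face_simplex_map'[of k 1 snd "tri g h", unfolded this, OF that]
  have t: "sface 2 k (tri g h)=tri_face g h k" using tri[OF x(2,3)] that by blast
  show ?thesis unfolding bsimp_def x fst_conv snd_conv fm t ..
 qed
 have a: "smap 1 snd (smap 1 (act g) (sgm h))=smap 1 snd (sgm h)"
  unfolding simplex_map_def by (rule ext) simp
 have "single (bsimp x) n=fcm n (frag_of (bsimp x))" by (simp add: frag_cmul_single)
 hence "chain_boundary 2 (sch (single x n))=fcm n (SUM k<=Suc 1. fcm ((-1) ^ k) (frag_of (sface 2 k (bsimp x))))"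
  using chain_boundary_of[of 2 "bsimp x"] by (simp add: sch_def lsum_single chain_boundary_cmul)
 also have "... = fcm n (frag_of (smap 1 snd (sgm h)) - frag_of (smap 1 snd (sgm (mul g h))) + frag_of (smap 1 snd (sgm g)))"
  unfolding sum_le_2 using f a by simp
 also have "... = lsum (%g. single (smap 1 snd (sgm g))) (bd (single x n))"
  by (simp add: x bd_single lsum_add lsum_diff lsum_single frag_cmul_distrib2 frag_cmul_diff frag_cmul_single)
 finally show "chain_boundary 2 (sch (single x n))=lsum (%g. single (smap 1 snd (sgm g))) (bd (single x n))" .
qed (simp_all add: sch_def bd_add lsum_add chain_boundary_add)

lemma sch_cycle: assumes "bcycle c" shows "singular_relcycle 2 P2 {} (sch c)"
proof -
 have c: "keys c <= V \<times> V" "bd c=0" using assms by (auto simp: bcycle_def)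
 have "keys (sch c) <= bsimp ` keys c"
  unfolding sch_def lsum_def using keys_sum[of "%x. single (bsimp x) (lookup c x)" "keys c"] by (fastforce split: if_splits)
 hence "singular_chain 2 P2 (sch c)" unfolding singular_chain_def using bsimp_simplex c(1) by blast
 moreover have "chain_boundary 2 (sch c)=0" unfolding sch_boundary[OF c(1)] c(2) by simp
 ultimately show ?thesis by (simp add: singular_cycle)
qed

lemma sch_norm: "l1_norm (realc (sch c)) <= bnorm c"
proof -
 have "l1_norm (realc (sch c))=l1_norm (SUM x:keys c. single (bsimp x) (real_of_int (lookup c x)))"
  by (simp add: sch_def lsum_def realc_sum realc_single)
 also have "... <= (SUM x:keys c. l1_norm (single (bsimp x) (real_of_int (lookup c x))))" by (rule l1_norm_sum)
 finally show ?thesis by (simp add: bnorm_def)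
qed

definition inhom :: "(vtx => vtx => real) => bool" where
 "inhom ph \<longleftrightarrow> (ALL g:V. ALL h:V. ALL k:V. ph h k - ph (mul g h) k + ph g (mul h k) - ph g h=0)"

lemma lifting_E2: "lifting E2 P2 snd (act ` V)"
 by unfold_locales (use D.cov D.surj continuous_act act_trans top_E2_fst in auto)

text \<open>The homogeneous form of the inhomogeneous cochain \<open>ph\<close>, evaluated at the
  group components of the lifted vertices.\<close>

definition evF :: "(vtx => vtx => real) => (nat => pt) => real" where
 "evF ph xi=ph (mul (invV (fst (xi 0))) (fst (xi 1))) (mul (invV (fst (xi 1))) (fst (xi 2)))"

lemma mul_invV: "x:V ==> y:V ==> mul x (mul (invV x) y)=y" "x:V ==> y:V ==> mul (invV x) (mul x y)=y"
 by (simp_all add: mul_assoc[symmetric] mul_one_left)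

lemma inv_mul:
 assumes V: "g:V" "x:V" "y:V" shows "mul (invV (mul g x)) (mul g y)=mul (invV x) y"
proof -
 have "mul (mul g x) (mul (invV (mul g x)) (mul g y))=mul (mul g x) (mul (invV x) y)"
  using V mul_invV mul_assoc[of g x "mul (invV x) y"] by (simp add: mul_V)
 thus ?thesis using V mul_left_cancel[of "mul g x"] by (simp add: mul_V)
qed

lemma functional_E2:
 assumes "inhom ph" shows "lift_functional E2 P2 snd (act ` V) 2 (evF ph)"
proof (intro lift_functional.intro lifting_E2 lift_functional_axioms.intro)
 show "evF ph xi=evF ph et" if "!!i. i <= 2 ==> xi i=et i" for xi et using that by (simp add: evF_def)
 show "evF ph (%i. a (xi i))=evF ph xi" if a: "a:act ` V" and x: "!!i. xi i:tsp E2" for a xi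
  using a x[THEN top_E2_fst] by (auto simp: evF_def fst_act inv_mul)
 show "(SUM k<=Suc 2. (- 1) ^ k * evF ph (%i. xi (if i < k then i else Suc i)))=0" if x: "!!i. xi i:tsp E2" for xi
 proof -
  have m: "mul (mul (invV (fst (xi i))) (fst (xi j))) (mul (invV (fst (xi j))) (fst (xi l)))=mul (invV (fst (xi i))) (fst (xi l))" for i j l
   using x[THEN top_E2_fst] by (simp add: mul_assoc mul_V mul_invV)
  have "mul (invV (fst (xi i))) (fst (xi j)):V" for i j using x[THEN top_E2_fst] mul_V by simp
  hence "ph (mul (invV (fst (xi 1))) (fst (xi 2))) (mul (invV (fst (xi 2))) (fst (xi 3))) - ph (mul (invV (fst (xi 0))) (fst (xi 2))) (mul (invV (fst (xi 2))) (fst (xi 3)))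
    + ph (mul (invV (fst (xi 0))) (fst (xi 1))) (mul (invV (fst (xi 1))) (fst (xi 3))) - ph (mul (invV (fst (xi 0))) (fst (xi 1))) (mul (invV (fst (xi 1))) (fst (xi 2)))=0"
   using assms m unfolding inhom_def by metis
  moreover have "(SUM k<=Suc 2. f k)=f 0 + f 1 + f 2 + (f 3 :: real)" for f
   by (simp add: numeral_2_eq_2 numeral_3_eq_3 One_nat_def)
  ultimately show ?thesis by (simp add: evF_def numeral_3_eq_3 numeral_2_eq_2 One_nat_def)
 qed
qed

lemma Lam_sch:
 assumes "inhom ph" "keys c <= V \<times> V"
 shows "lift_functional.Lam E2 snd 2 (evF ph) (realc (sch c))=bev ph c"
proof -
 interpret lift_functional E2 P2 snd "act ` V" 2 "evF ph" by (rule functional_E2[OF assms(1)])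
 have v: "val (bsimp x)=ph (fst x) (snd x)" if "x:keys c" for x
 proof -
  have V: "fst x:V" "snd x:V" using assms(2) that by auto
  let ?t = "tri (fst x) (snd x)"
  note t = tri[OF V]
  have f: "sface 2 2 ?t=sgm (fst x)" "sface 2 1 ?t=sgm (mul (fst x) (snd x))" using t by auto
  have "?t (vert 0)=(one_V, Vertex)" "?t (vert 1)=(fst x, Vertex)" "?t (vert 2)=(mul (fst x) (snd x), Vertex)"
   using singular_face_vert[of 0 1 2 ?t] singular_face_vert[of 1 1 2 ?t] singular_face_vert[of 1 1 1 ?t] f sgm V mul_V
   by (simp_all add: numeral_2_eq_2 One_nat_def)
  moreover have "val (bsimp x)=evF ph (%i. ?t (vert i))" unfolding bsimp_def by (rule val_eq) (use t in simp)
  moreover have "mul (invV one_V) y=y" if "y:V" for y using mul_invV(2)[of one_V y] that by (simp add: mul_one_left)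
  moreover have "mul (invV (fst x)) (mul (fst x) (snd x))=snd x" using V mul_invV by simp
  ultimately show ?thesis using V by (simp add: evF_def)
 qed
 have "Lam (realc (sch c))=(SUM x:keys c. of_int (lookup c x) * val (bsimp x))"
  by (simp add: sch_def lsum_def realc_sum realc_single Lam_sum Lam_single)
 also have "... = bev ph c" unfolding bev_def lsum_def by (rule sum.cong) (auto simp: v split: prod.split)
 finally show ?thesis .
qed

end

definition rsc :: "real => 'p real_chain => 'p real_chain" where
 "rsc a=lsum (%si r. single si (a * r))"

lemma additive_rsc [simp]: "additive_family (%si r. single si (a * r :: real))"
 by (simp add: additive_family_def distrib_left single_add)

lemma lookup_rsc: "lookup (rsc a c) si=a * lookup c si"
 by (induction c rule: additive_induct)
  (simp_all add: rsc_def lsum_add lsum_single lookup_add distrib_left lookup_single when_def)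

lemma rsc_boundary: "rbd (Suc p) (rsc a c)=rsc a (rbd (Suc p) c)"
proof (induction c rule: additive_induct)
 case (single si r)
 show ?case
  by (simp only: rsc_def lsum_single[OF additive_rsc] real_boundary_lsum[OF zero_less_Suc] lsum_single[OF additive_family_bdf] bdf_def lsum_sum[OF additive_rsc])
   (simp add: algebra_simps)
qed (simp_all add: rsc_def lsum_add real_boundary_add)

lemma keys_rsc: "keys (rsc a c) <= keys c"
 by (auto simp: in_keys_iff lookup_rsc)

lemma rsc_norm: "l1_norm (rsc a c)=\<bar>a\<bar> * l1_norm c"
proof -
 have "l1_norm (rsc a c)=(SUM si:keys c. \<bar>lookup (rsc a c) si\<bar>)"
  unfolding l1_norm_def by (rule sum.mono_neutral_left) (use keys_rsc[of a c] in \<open>auto simp: in_keys_iff\<close>)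
 thus ?thesis by (simp add: l1_norm_def lookup_rsc abs_mult sum_distrib_left)
qed

context hnn_words begin

text \<open>As \<open>P2\<close> is a classifying extension, the chosen complex is one too, and its
  retraction onto \<open>P2\<close> identifies the seminorms.\<close>

lemma volume_seminorm:
 assumes z: "singular_relcycle 2 P2 {} z" "cell_class three relator=hrel 2 P2 {} z"
 shows "simplicial_volume three relator=l1_seminorm (rhc 2 P2 (realc z))"
proof -
 have "hgrp \<cong> one_relator_group three relator"
  using one_relator_group_iso group.iso_sym[OF _ one_relator_group_iso]
   normal.factorgroup_is_group[OF group_hom.normal_kernel[OF group_hom_ev]] unfolding kernel_ev one_relator_group_def by blast
 moreover have "tsp P2 ~= {}" by (auto simp: top_P2 cells_def)
 ultimately have "classifying_extension three relator P2"
  unfolding classifying_extension_def using D.classifying_space_P attaches_no_higher_cells by blast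
 hence "classifying_extension three relator (classifying_complex three relator)"
  unfolding classifying_complex_def by (rule someI)
 hence "attaches_higher_cells P2 (classifying_complex three relator)" by (simp add: classifying_extension_def)
 from higher_cells_retraction[OF this sphere_null[OF D.cov D.surj ccontractible_E2]]
 obtain rh where rh: "cmap (classifying_complex three relator) P2 rh" "!!x. x:tsp P2 ==> rh x=x"
  "cmap P2 (classifying_complex three relator) id" by metis
 show ?thesis
  using l1_seminorm_fundamental[OF rh z(1)] unfolding simplicial_volume_def fundamental_class_def z(2) by simp
qed

text \<open>The cocycle \<open>py\<close> counts and \<open>ph\<close> bounds. Values of
  \<open>py\<close> on integral cycles are integers, and a cycle of value 1 exists, so
  \<open>py\<close> is 1 or -1 on the generator, and a cycle of value N represents plus or minus N
  times it. The cycles in \<open>C\<close> therefore force the value of \<open>ph\<close> on the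
  generator to be at least \<open>v\<close> in absolute value, which bounds the norm from below
  because \<open>ph\<close> is bounded by 1; the cycles in \<open>U\<close>, divided by the multiple
  they represent, bound it from above.\<close>

theorem simplicial_volume_eq:
 fixes py :: "vtx => vtx => int" and v K L :: real
 assumes e: "!!s. esum s relator=0"
  and ph: "inhom ph" "!!g h. g:V ==> h:V ==> \<bar>ph g h\<bar> <= 1" and py: "inhom (%g h. real_of_int (py g h))"
  and C: "!!N::nat. EX C. bcycle C & bev (%g h. real_of_int (py g h)) C=N & N * v - K <= \<bar>bev ph C\<bar>"
  and U: "!!N::nat. EX C. bcycle C & bev (%g h. real_of_int (py g h)) C=L * N & bnorm C <= L * N * v + K" and L: "L > 0"
 shows "simplicial_volume three relator=v"
proof -
 let ?py = "%g h. real_of_int (py g h)"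
 obtain z where z: "singular_relcycle 2 P2 {} z" "cell_class three relator=hrel 2 P2 {} z"
  and gen: "!!w. singular_relcycle 2 P2 {} w ==> EX n. homologous_rel 2 P2 {} w (fcm n z)"
 proof (rule cell_class[OF e])
  fix z assume "singular_relcycle 2 P2 {} z" "cell_class three relator=hrel 2 P2 {} z"
   "!!w. singular_relcycle 2 P2 {} w ==> EX n. homologous_rel 2 P2 {} w (fcm n z)"
  thus thesis by (rule that)
 qed
 interpret A: lift_functional E2 P2 snd "act ` V" 2 "evF ph" by (rule functional_E2[OF ph(1)])
 interpret B: lift_functional E2 P2 snd "act ` V" 2 "evF ?py" by (rule functional_E2[OF py])
 have zc: "singular_chain 2 P2 z" using z(1) by (simp add: singular_cycle)
 have S2: "Suc 2=3" by simp
 have Bint: "B.Lam (realc z):\<int>"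
  unfolding B.Lam_def lsum_def by (rule Ints_sum) (simp add: B.val_def evF_def)
 have rel: "EX n b. rchain 3 P2 b & realc (sch C) - realc (fcm n z)=rbd 3 b &
   bev ph C = of_int n * A.Lam (realc z) & bev ?py C = of_int n * B.Lam (realc z)" if C: "bcycle C" for C
 proof -
  obtain n where "homologous_rel 2 P2 {} (sch C) (fcm n z)" using gen[OF sch_cycle[OF C]] by blast
  from homologous_rel_empty[OF this] obtain b where b: "singular_chain 3 P2 b" "chain_boundary 3 b=sch C - fcm n z"
   unfolding S2 by blast
  have rb: "realc (sch C) - realc (fcm n z)=rbd 3 (realc b)"
   using realc_chain_boundary[of 3 b] b(2) by (simp add: realc_diff)
  have rb3: "rchain 3 P2 (realc b)" using b(1) by simp
  have rz: "realc (fcm n z)=rsc (of_int n) (realc z)"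
   by (rule poly_mapping_eqI) (simp add: lookup_rsc)
  have lin: "lsum (%si a. a * vt si) (rsc r c)=r * lsum (%si a. a * vt si) c" for r c and vt :: "_ => real"
   by (subst lsum_superset[OF finite_keys keys_rsc[of r c]]) (simp_all add: lookup_rsc lsum_def sum_distrib_left mult.assoc)
  have kc: "keys C <= V \<times> V" using C by (simp add: bcycle_def)
  have "A.Lam (realc (sch C)) - A.Lam (realc (fcm n z))=0"
   using A.Lam_boundary[of "realc b", unfolded S2, OF rb3] rb by (metis A.Lam_diff)
  hence 1: "bev ph C = of_int n * A.Lam (realc z)"
   using Lam_sch[OF ph(1) kc] lin[of A.val "of_int n" "realc z"] by (simp add: rz A.Lam_def)
  have "B.Lam (realc (sch C)) - B.Lam (realc (fcm n z))=0"
   using B.Lam_boundary[of "realc b", unfolded S2, OF rb3] rb by (metis B.Lam_diff)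
  hence 2: "bev ?py C = of_int n * B.Lam (realc z)"
   using Lam_sch[OF py kc] lin[of B.val "of_int n" "realc z"] by (simp add: rz B.Lam_def)
  show ?thesis using rb rb3 1 2 by blast
 qed
 have B1: "\<bar>B.Lam (realc z)\<bar>=1"
 proof -
  obtain C1 where C1: "bcycle C1" "bev ?py C1=1" using C[of 1] by auto
  obtain n :: int where "of_int n * B.Lam (realc z)=1" using rel[OF C1(1)] C1(2) by auto
  moreover obtain i :: int where "B.Lam (realc z) = of_int i" using Bint by (auto elim: Ints_cases)
  ultimately have "n * i=1" "B.Lam (realc z) = of_int i" by (metis of_int_mult of_int_eq_1_iff, simp)
  thus ?thesis using zmult_eq_1_iff[of n i] by auto
 qed
 have n_abs: "\<bar>of_int n\<bar>=bev ?py C" if "bev ?py C = of_int n * B.Lam (realc z)" "bev ?py C >= 0" for n C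
 proof -
  have "\<bar>bev ?py C\<bar>=\<bar>of_int n\<bar> * \<bar>B.Lam (realc z)\<bar>" by (simp only: that(1) abs_mult)
  thus ?thesis using B1 that(2) by simp
 qed
 have lower: "v <= \<bar>A.Lam (realc z)\<bar>"
 proof (rule ccontr)
  assume "~v <= \<bar>A.Lam (realc z)\<bar>"
  hence d: "v - \<bar>A.Lam (realc z)\<bar> > 0" by simp
  obtain N :: nat where N: "N * (v - \<bar>A.Lam (realc z)\<bar>) > K" using reals_Archimedean3[OF d] by blast
  obtain C where C: "bcycle C" "bev ?py C=N" "N * v - K <= \<bar>bev ph C\<bar>" using C by blast
  obtain n :: int where n: "bev ph C = of_int n * A.Lam (realc z)" "bev ?py C = of_int n * B.Lam (realc z)"
   using rel[OF C(1)] by blast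
  have "\<bar>bev ph C\<bar>=N * \<bar>A.Lam (realc z)\<bar>" using n_abs[OF n(2)] C(2) n(1) by (simp add: abs_mult)
  thus False using C(3) N by (simp add: right_diff_distrib)
 qed
 let ?H = "rhc 2 P2 (realc z)"
 have zH: "realc z:?H" unfolding real_homology_class_def using zc
  by (intro CollectI conjI exI[of _ 0]) simp_all
 have lb: "v <= l1_norm c" if "c:?H" for c
 proof -
  obtain b where b: "rchain 2 P2 c" "rchain 3 P2 b" "c - realc z=rbd 3 b"
   using \<open>c : ?H\<close> unfolding real_homology_class_def S2 by blast
  have "A.Lam c - A.Lam (realc z)=0"
   using A.Lam_boundary[of b, unfolded S2, OF b(2)] b(3) by (metis A.Lam_diff)
  moreover have "\<bar>A.Lam c\<bar> <= 1 * l1_norm c"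
  proof (rule A.Lam_norm[OF b(1)])
   fix xi :: "nat => pt" assume "!!i. xi i:tsp E2"
   hence "fst (xi i):V" for i using top_E2_fst by blast
   thus "\<bar>evF ph xi\<bar> <= 1" unfolding evF_def by (intro ph(2)) (simp_all add: mul_V)
  qed
  ultimately show ?thesis using lower by linarith
 qed
 have ub: "l1_seminorm ?H <= v + ep" if ep: "ep > 0" for ep
 proof -
  have "L * ep > 0" using L ep by simp
  then obtain N :: nat where N: "N * (L * ep) > max K 0" using reals_Archimedean3 by blast
  hence N0: "real N > 0" by (cases "N=0") auto
  obtain C where C: "bcycle C" "bev ?py C=L * N" "bnorm C <= L * N * v + K" using U by blast
  obtain n b where nb: "rchain 3 P2 b" "realc (sch C) - realc (fcm n z)=rbd 3 b"
   "bev ?py C = of_int n * B.Lam (realc z)" using rel[OF C(1)] by blast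
  have n: "\<bar>real_of_int n\<bar>=L * N" using n_abs[OF nb(3)] C(2) L by simp
  hence n0: "real_of_int n ~= 0" using L N0 by auto
  let ?c = "rsc (1 / n) (realc (sch C))"
  have "?c:?H"
   unfolding real_homology_class_def S2
  proof (intro CollectI conjI exI)
   have "rchain 2 P2 (realc (sch C))" using sch_cycle[OF C(1)] by (simp add: singular_cycle)
   thus "rchain 2 P2 ?c" unfolding singular_real_chain_def using keys_rsc by blast
   show "rchain 3 P2 (rsc (1 / n) b)" using nb(1) unfolding singular_real_chain_def using keys_rsc by blast
   have "rbd 3 (rsc (1 / n) b)=rsc (1 / n) (rbd 3 b)" using rsc_boundary[of 2 "1 / n" b] by simp
   also have "... = ?c - realc z"
    unfolding nb(2)[symmetric] using n0 by (intro poly_mapping_eqI) (simp add: lookup_rsc lookup_minus right_diff_distrib)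
   finally show "?c - realc z=rbd 3 (rsc (1 / n) b)" by simp
  qed
  hence "l1_seminorm ?H <= l1_norm ?c"
   unfolding l1_seminorm_def by (intro cInf_lower imageI bdd_belowI[of _ 0]) auto
  also have "... <= bnorm C / (L * N)"
   using sch_norm[of C] L N0 n by (simp add: rsc_norm divide_right_mono)
  also have "... <= (L * N * v + K) / (L * N)" using C(3) L N0 by (intro divide_right_mono) auto
  also have "... = v + K / (L * N)" using L N0 by (simp add: add_divide_distrib)
  also have "... <= v + ep" using N L N0 by (simp add: divide_le_eq mult.commute mult.left_commute)
  finally show ?thesis .
 qed
 have "l1_seminorm ?H <= v" using field_le_epsilon ub by blast
 moreover have "v <= l1_seminorm ?H" unfolding l1_seminorm_def using zH lb by (intro cInf_greatest) auto
 ultimately show ?thesis using volume_seminorm[OF z] by simp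
qed

section \<open>Efficient fillings\<close>

abbreviation J :: "bool fg => vtx" where "J g == ([], g)"
abbreviation Tt :: vtx where "Tt == tact True one_V"
abbreviation qc :: "bool fg => vtx \<Rightarrow>\<^sub>0 int" where "qc g == single (J g) 1"

lemma J_V [simp]: "J g:V" and mul_J [simp]: "mul (J g) (J h)=J (g + h)" and one_J: "one_V=J 0"
 by (simp_all add: V_def mul_def one_V_def)

lemma bnorm_superset: "finite A ==> keys c <= A ==> bnorm c=(SUM x:A. \<bar>real_of_int (lookup c x)\<bar>)"
 unfolding bnorm_def by (rule sum.mono_neutral_left) (auto simp: in_keys_iff)

lemma bnorm_add: "bnorm (c + d) <= bnorm c + bnorm d"
proof -
 let ?A = "keys c Un keys d"
 have "bnorm (c + d)=(SUM x:?A. \<bar>real_of_int (lookup (c + d) x)\<bar>)"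
  by (rule bnorm_superset) (use keys_add[of c d] in auto)
 also have "... <= (SUM x:?A. \<bar>real_of_int (lookup c x)\<bar> + \<bar>real_of_int (lookup d x)\<bar>)"
  by (rule sum_mono) (simp add: lookup_add abs_triangle_ineq)
 finally show ?thesis by (simp add: sum.distrib bnorm_superset[of ?A])
qed

text \<open>Only symbols of the base group are allowed. On these \<open>lam\<close> vanishes
  (\<open>bev_lam_J\<close>), so a filling does not affect which multiple of the class a cycle
  represents.\<close>

definition fills :: "(vtx \<Rightarrow>\<^sub>0 int) => real => bool" where
 "fills x r \<longleftrightarrow> (EX M. keys M <= range J \<times> range J & bd M=x & bnorm M <= r)"

lemma fills_eq: "fills x r ==> x=y ==> r <= s ==> fills y s"
 unfolding fills_def by (blast intro: order_trans)

lemma fills_add: "fills x r ==> fills y s ==> fills (x + y) (r + s)"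
proof -
 assume "fills x r" "fills y s"
 then obtain M M' where M: "keys M <= range J \<times> range J" "bd M=x" "bnorm M <= r"
   "keys M' <= range J \<times> range J" "bd M'=y" "bnorm M' <= s" unfolding fills_def by blast
 have "keys (M + M') <= range J \<times> range J" using keys_add[of M M'] M by blast
 moreover have "bnorm (M + M') <= r + s" using bnorm_add[of M M'] M by linarith
 ultimately show ?thesis unfolding fills_def using M bd_add[of M M'] by blast
qed

lemma fills_0 [simp]: "fills 0 0"
 unfolding fills_def by (intro exI[of _ 0]) (simp add: bnorm_def)

lemma fills_uminus: assumes "fills x r" shows "fills (- x) r"
proof -
 obtain M where "keys M <= range J \<times> range J" "bd M=x" "bnorm M <= r" using assms unfolding fills_def by blast
 thus ?thesis unfolding fills_def using bd_diff[of 0 M] by (intro exI[of _ "- M"]) (simp add: bnorm_def)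
qed

lemma fills_diff: "fills x r ==> fills y s ==> fills (x - y) (r + s)"
 using fills_add[of x r "- y" s] fills_uminus[of y s] by simp

lemma fills_cmul: "fills x r ==> fills (fcm (int n) x) (n * r)"
proof (induction n)
 case (Suc n)
 thus ?case using fills_add[OF Suc.IH Suc.prems] by (auto elim!: fills_eq simp: frag_cmul_distrib algebra_simps)
qed simp

lemma fills_tri: "fills (qc h - qc (g + h) + qc g) 1"
 unfolding fills_def by (intro exI[of _ "single (J g, J h) 1"]) (simp add: bd_single bnorm_def)

lemma fills_q0: "fills (qc 0) 1"
 using fills_tri[of 0 0] by simp

lemma fills_inv: "fills (qc g + qc (- g)) 2"
 by (rule fills_eq[OF fills_add[OF fills_tri[of "- g" g] fills_q0]]) simp_all

text \<open>Two triangles multiply by \<open>a\<close> and by its inverse, and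
  \<open>fills_inv\<close> uses two more.\<close>

lemma fills_conj: "fills (qc (a + g - a) - qc g) 4"
 by (rule fills_eq[OF fills_add[OF fills_inv[of a] fills_uminus[OF fills_add[OF fills_tri[of "- a" "a + g"] fills_tri[of g a]]]]])
  (simp_all add: algebra_simps)

text \<open>The cost does not depend on n. Replacing an n-th power of a j-th power by j copies of
  the n-th power hence only contributes to the error term.\<close>

lemma fills_power: "fills (qc (gpow x (n * int j)) - fcm (int j) (qc (gpow x n))) (j + 1)"
proof (induction j)
 case 0
 thus ?case using fills_q0 by simp
next
 case (Suc j)
 have "gpow x (n * int (Suc j))=gpow x (n * int j) + gpow x n" by (simp add: distrib_left add.commute flip: gpow_add)
 thus ?case
  by (intro fills_eq[OF fills_diff[OF Suc fills_tri[of "gpow x n" "gpow x (n * int j)"]]])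
   (simp_all add: frag_cmul_distrib algebra_simps)
qed

text \<open>A pair of pants: the triangles \<open>p\<^sup>i q\<^sup>-\<^sup>i \<cdot> q\<^sup>j (pq)\<^sup>-\<^sup>s\<close> with \<open>j = i, i + 1\<close> telescope.\<close>

lemma fills_pants: "fills (qc (gpow p (int n)) + qc (gpow q (int n)) - qc (gpow (p + q) (int n))) (2 * n + 9)"
proof -
 let ?s = "%i::nat. int (i div 2)"
 define PQ where "PQ i=gpow p (int i) - gpow q (int i)" for i
 define QR where "QR i=gpow q (int i) - gpow (p + q) (?s i)" for i
 define PR where "PR i=gpow p (int i) - gpow (p + q) (?s i)" for i
 have D1: "PQ i + QR i=PR i" for i by (simp add: PQ_def QR_def PR_def algebra_simps)
 have D2: "PQ (Suc i) + QR (Suc (Suc i))=PR i" for i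
 proof -
  have "gpow q (int (Suc (Suc i)))=gpow q (int (Suc i)) + q" "gpow p (int (Suc i))=gpow p (int i) + p"
   "gpow (p + q) (?s (Suc (Suc i)))=gpow (p + q) (?s i) + (p + q)"
   using gpow_add[of q "int (Suc i)" 1] gpow_add[of p "int i" 1] gpow_add[of "p + q" "?s i" 1] by (simp_all add: algebra_simps)
  thus ?thesis by (simp add: PQ_def QR_def PR_def dcu minus_add add.assoc del: auc)
 qed
 have f0: "fills (qc q - qc (QR (Suc n)) + qc 0 - qc (PR n)) (2 * n)"
 proof (induction n)
  case 0
  have "QR (Suc 0)=q" "PR 0=0" by (simp_all add: QR_def PR_def)
  thus ?case by simp
 next
  case (Suc n)
  show ?case
   by (rule fills_eq[OF fills_add[OF Suc fills_diff[OF fills_tri[of "QR (Suc n)" "PQ (Suc n)"] fills_tri[of "QR (Suc (Suc n))" "PQ (Suc n)"]]]])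
    (simp_all add: D1 D2)
 qed
 have sub: "fills (qc (x - y) - qc x + qc y) 3" for x y
  by (rule fills_eq[OF fills_diff[OF fills_inv[of y] fills_tri[of "- y" x]]]) (simp_all add: algebra_simps)
 have f1: "fills (qc (QR (Suc n)) - qc (gpow q (int (Suc n))) + qc (gpow (p + q) (?s (Suc n)))) 3" unfolding QR_def by (rule sub)
 have f2: "fills (qc (PR n) - qc (gpow p (int n)) + qc (gpow (p + q) (?s n))) 3" unfolding PR_def by (rule sub)
 have f3: "fills (qc q - qc (gpow q (int (Suc n))) + qc (gpow q (int n))) 1"
  using fills_tri[of q "gpow q (int n)"] gpow_add[of q "int n" 1] by (simp add: algebra_simps)
 have f4: "fills (qc (gpow (p + q) (?s n)) - qc (gpow (p + q) (int n)) + qc (gpow (p + q) (?s (Suc n)))) 1"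
 proof -
  have "?s (Suc n) + ?s n=int n" by presburger
  thus ?thesis using fills_tri[of "gpow (p + q) (?s n)" "gpow (p + q) (?s (Suc n))"] by (simp flip: gpow_add)
 qed
 note 1 = fills_diff[OF fills_diff[OF fills_add[OF fills_add[OF f0 f1] f2] f3] f4]
 show ?thesis by (rule fills_eq[OF fills_uminus[OF fills_diff[OF 1 fills_q0]]]) simp_all
qed

lemma u_Tt: "mul (J (gpow (u True) n)) Tt=mul Tt (J (gpow (u False) n))"
proof -
 have "mul (J (gpow (u True) n)) Tt=tact True (J (gpow (u True) n))" by (simp add: mul_tact)
 also have "... = tact True (addg (gpow (u True) n) one_V)" by (simp add: one_V_def)
 also have "... = addg (gpow (u False) n) Tt" using tact_shift[of True n one_V] by simp
 finally show ?thesis by (simp add: mul_def)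
qed

lemma Tt_V [simp]: "Tt:V"
 by (simp add: tact_V)

lemma inhom_lam: "inhom (%g h. real_of_int (lam g h))"
 unfolding inhom_def
proof (intro ballI)
 fix g h k assume "g:V" "h:V" "k:V"
 from lam_cocycle[OF this] show "real_of_int (lam h k) - real_of_int (lam (mul g h) k) + real_of_int (lam g (mul h k)) - real_of_int (lam g h)=0"
  by linarith
qed

lemma lam_J: "lam y (J g)=0" and lam_Tt: "lam (J (gpow (u True) n)) Tt=n"
proof -
 show "lam y (J g)=0" by (simp add: lam_def)
 have "lam (J g) Tt=inc True (J g)" for g using lam_tact[of "J g" one_V True] lam_one[of "J g"] by (simp add: inc_def) (simp add: one_V_def)
 thus "lam (J (gpow (u True) n)) Tt=n" by (simp add: inc_def)
qed

lemma bev_lam_J: "keys M <= range J \<times> range J ==> bev (%g h. real_of_int (lam g h)) M=0"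
 unfolding bev_def lsum_def by (rule sum.neutral) (auto simp: lam_J)

text \<open>The annulus swept out by t between the n-th powers of \<open>u True\<close> and
  \<open>u False\<close>. In the cycles below it is the only part on which \<open>lam\<close> does
  not vanish.\<close>

definition hchain :: "int => bchain" where
 "hchain n=single (J (gpow (u True) n), Tt) 1 - single (Tt, J (gpow (u False) n)) 1"

lemma hchain:
 "bd (hchain n)=qc (gpow (u True) n) - qc (gpow (u False) n)" "bnorm (hchain n) <= 2"
 "bev ph (hchain n)=ph (J (gpow (u True) n)) Tt - ph Tt (J (gpow (u False) n))" "keys (hchain n) <= V \<times> V"
proof -
 let ?x = "(J (gpow (u True) n), Tt)" and ?y = "(Tt, J (gpow (u False) n))"
 show "bd (hchain n)=qc (gpow (u True) n) - qc (gpow (u False) n)"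
  unfolding hchain_def bd_diff bd_single u_Tt by simp
 show "bev ph (hchain n)=ph (J (gpow (u True) n)) Tt - ph Tt (J (gpow (u False) n))"
  unfolding hchain_def bev_diff bev_single by simp
 have b1: "bnorm (single x i)=\<bar>real_of_int i\<bar>" for x i by (cases "i=0") (simp_all add: bnorm_def)
 have "hchain n=single ?x 1 + single ?y (- 1)" by (simp add: hchain_def single_uminus)
 thus "bnorm (hchain n) <= 2" using bnorm_add[of "single ?x 1" "single ?y (- 1)"] by (simp add: b1)
 show "keys (hchain n) <= V \<times> V"
  unfolding hchain_def using keys_diff[of "single ?x (1::int)" "single ?y 1"] by fastforce
qed

lemma cmul_bar: "bd (fcm n c)=fcm n (bd c)" "bev ph (fcm n c) = of_int n * bev ph c" "bnorm (fcm n c)=\<bar>of_int n\<bar> * bnorm c"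
proof -
 have k: "keys (fcm n c) <= keys c" by (rule keys_cmul)
 show "bev ph (fcm n c) = of_int n * bev ph c"
  unfolding bev_def by (subst lsum_superset[OF finite_keys k]) (auto simp: lsum_def sum_distrib_left split_beta mult.assoc)
 show "bnorm (fcm n c)=\<bar>of_int n\<bar> * bnorm c"
  by (subst bnorm_superset[OF finite_keys k]) (simp add: bnorm_def sum_distrib_left abs_mult)
 show "bd (fcm n c)=fcm n (bd c)"
 proof (rule additive_induct[where c = c and P = "%c. bd (fcm n c)=fcm n (bd c)"])
  fix x i show "bd (fcm n (single x i))=fcm n (bd (single x i))"
   by (cases x) (simp add: frag_cmul_single' bd_single frag_cmul_distrib2 frag_cmul_diff)
 qed (simp_all add: bd_add frag_cmul_distrib2)
qed

lemma cycle_of_filling: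
 assumes f: "fills (fcm (int m) (qc (gpow (u False) n) - qc (gpow (u True) n))) r"
 shows "EX C. bcycle C & bev (%g h. real_of_int (lam g h)) C=m * n & bnorm C <= r + 2 * m"
proof -
 obtain M where M: "keys M <= range J \<times> range J" "bd M=fcm (int m) (qc (gpow (u False) n) - qc (gpow (u True) n))" "bnorm M <= r"
  using f unfolding fills_def by blast
 let ?C = "fcm (int m) (hchain n) + M"
 have "keys ?C <= V \<times> V"
  using keys_add[of "fcm (int m) (hchain n)" M] keys_cmul[of "int m" "hchain n"] hchain(4)[of n] M(1) J_V by blast
 moreover have "bd ?C=0" by (simp add: bd_add cmul_bar hchain M(2) frag_cmul_diff)
 moreover have "bev (%g h. real_of_int (lam g h)) ?C=m * n" by (simp add: bev_add cmul_bar hchain bev_lam_J[OF M(1)] lam_Tt lam_J)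
 moreover have "bnorm ?C <= r + 2 * m"
 proof -
  have "real m * bnorm (hchain n) <= real m * 2" by (intro mult_left_mono hchain) simp
  thus ?thesis using bnorm_add[of "fcm (int m) (hchain n)" M] M(3) by (simp add: cmul_bar)
 qed
 ultimately show ?thesis unfolding bcycle_def by (intro exI[of _ ?C] conjI) simp_all
qed

end

section \<open>The relators \<open>[a, \<tau>]\<^sup>k t [a\<^sup>m, \<tau>]\<^sup>-\<^sup>1 t\<^sup>-\<^sup>1\<close>\<close>

abbreviation aa :: "bool fg" where "aa == gen (False, True)"
abbreviation tt :: "bool fg" where "tt == gen (True, True)"

definition vv :: "nat => bool fg" where "vv m=gpow aa (int m) + (tt + - gpow aa (int m) - tt)"

abbreviation vword :: "nat => bool word" where
 "vword m == replicate m (False, True) @ (True, True) # replicate m (False, False) @ [(True, False)]"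

text \<open>Splits off one commutator at a time, so that iteration writes \<open>vv m\<close> as a
  product of m conjugates of \<open>vv 1\<close>.\<close>

lemma vv_Suc: "vv (Suc m)=(aa + vv m - aa) + vv 1"
proof -
 have "gpow aa (int (Suc m))=aa + gpow aa (int m)" using gpow_add[of aa 1 "int m"] by simp
 thus ?thesis
  by (simp add: vv_def One_nat_def minus_add add.assoc dcu del: auc)
qed

lemma gpow_aa: "gpow aa (int m)=word_val (replicate m (False, True))"
 "- gpow aa (int m)=word_val (replicate m (False, False))"
proof -
 show 1: "gpow aa (int m)=word_val (replicate m (False, True))"
 proof (induction m)
  case (Suc m) thus ?case using gpow_add[of aa 1 "int m"] by simp
 qed simp
 have "inv_word (replicate m (False, True))=replicate m (False, False)"
  by (simp add: inv_word_def inv_letter_def)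
 thus "- gpow aa (int m)=word_val (replicate m (False, False))"
  unfolding 1 by (metis word_val_inv)
qed

lemma reduced_replicate: "reduced (replicate n l)"
 by (induction n) (auto simp: reduced_Cons)

lemma vword_reduced: "m > 0 ==> reduced (vword m @ vword m)"
 by (simp add: reduced_append reduced_Cons reduced_replicate inv_letter_def)

lemma letters_vv: "m > 0 ==> letters (vv m)=vword m"
proof -
 assume "m > 0"
 hence r: "reduced (vword m)" using vword_reduced[of m] reduced_append by blast
 have "vv m=word_val (vword m)"
  using gen_inv[of "(True, True)"] unfolding vv_def gpow_aa(2) unfolding gpow_aa(1)
  by (simp add: inv_letter_def add.assoc dcu del: auc)
 thus ?thesis using letters_word_val_reduced[OF r] by simp
qed

definition uu :: "nat => nat => bool => bool fg" where
 "uu k m e=(if e then gpow (vv 1) (int k) else vv m)"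

lemma gpow_vv_inj: "m > 0 ==> gpow (vv m) n=0 ==> n=0"
proof (rule gpow_inj_of_reduced)
 assume m: "m > 0"
 thus "reduced (letters (vv m) @ letters (vv m))" using letters_vv vword_reduced by metis
 show "vv m ~= 0" using letters_vv[OF m] by force
qed

lemma letters_uu:
 "m > 0 ==> letters (gpow (vv m) (int n))=concat (replicate n (vword m))"
 using letters_gpow[of "vv m" n] by (metis letters_vv vword_reduced)

section \<open>Fillings for the relators and the upper bound\<close>

locale relators =
 fixes k m :: nat assumes k: "0 < k" and km: "k <= m"
begin

lemma uu_simps [simp]: "uu k m True=gpow (vv 1) (int k)" "uu k m False=vv m"
 by (simp_all add: uu_def)

lemma m: "0 < m" using k km by simp

sublocale hnn_words "uu k m"
proof
 show z: "n=0" if "gpow (uu k m e) n=0" for e n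
 proof (cases e)
  case True
  hence "gpow (vv 1) (int k * n)=0" using that by (simp add: gpow_mult)
  thus ?thesis using gpow_vv_inj[of 1 "int k * n"] k by simp
 next
  case False
  thus ?thesis using that gpow_vv_inj[OF m] by simp
 qed
 show "uu k m e ~= 0" for e using z[of e 1] by fastforce
qed

text \<open>Each factor split off costs one pair of pants, 2 n + 9, and one conjugation, 4.\<close>

lemma fills_vv_Suc: "fills (qc (gpow (vv (Suc j)) (int n)) - fcm (int (Suc j)) (qc (gpow (vv 1) (int n)))) (real j * (2 * real n + 13))"
proof (induction j)
 case 0
 thus ?case by (simp add: One_nat_def)
next
 case (Suc j)
 let ?p = "aa + vv (Suc j) - aa"
 note f = fills_diff[OF fills_add[OF Suc fills_conj[of aa "gpow (vv (Suc j)) (int n)"]] fills_pants[of ?p n "vv 1"]]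
 have "fcm 2 x=x + x" for x :: "vtx \<Rightarrow>\<^sub>0 int" using frag_cmul_distrib[of 1 1 x] by simp
 thus ?case
  by (intro fills_eq[OF f]) (simp_all add: gpow_conj vv_Suc[of "Suc j"] frag_cmul_distrib algebra_simps)
qed

text \<open>A single pair of pants, since the n-th powers of a^j and of the conjugate of its inverse
  cancel at the cost of 2 + 4 triangles.\<close>

lemma fills_vv: "fills (qc (gpow (vv j) (int n))) (2 * real n + 15)"
proof -
 let ?p = "gpow aa (int j)"
 have g: "gpow (- ?p) (int n) = - gpow ?p (int n)"
  by (simp add: gpow_mult flip: gpow_minus)
 note f = fills_diff[OF fills_add[OF fills_inv[of "gpow ?p (int n)"] fills_conj[of tt "- gpow ?p (int n)"]] fills_pants[of ?p n "tt + - ?p - tt"]]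
 show ?thesis
  by (rule fills_eq[OF f]) (simp_all only: gpow_conj g vv_def, simp_all)
qed

abbreviation (input) "vol == 2 * real k + 2 - 4 * real k / real m"

text \<open>There are m copies of the n-th power of \<open>vv m\<close>. Of these, k are cut into m
  copies each of the n-th power of \<open>vv 1\<close>, which cancel against the m copies of the
  other boundary, each worth k of them; the other m - k are filled directly, which is possible as k
  is at most m. The leading count k (m - 1) 2 n + (m - k) 2 n equals m n \<open>vol\<close>.\<close>

lemma upper_bound:
 "EX C. bcycle C & bev (%g h. real_of_int (lam g h)) C=m * int n & bnorm C <= m * n * vol + 20 * m * (real k + 1)"
proof -
 obtain m' where m': "m=Suc m'" using m by (cases m) auto
 let ?v = "qc (gpow (vv m) (int n))" and ?c = "qc (gpow (vv 1) (int n))" and ?w = "qc (gpow (gpow (vv 1) (int k)) (int n))"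
 have "fills (fcm (int k) (?v - fcm (int m) ?c) + fcm (int (m - k)) ?v - fcm (int m) (?w - fcm (int k) ?c))
   (k * (real m' * (2 * real n + 13)) + (m - k) * (2 * real n + 15) + m * (real k + 1))"
  using fills_diff[OF fills_add[OF fills_cmul[OF fills_vv_Suc[of m' n], of k] fills_cmul[OF fills_vv[of m n], of "m - k"]]
    fills_cmul[OF fills_power[of "vv 1" "int n" k], of m]]
  by (simp add: m' gpow_mult mult.commute)
 moreover have "fcm (int k) (?v - fcm (int m) ?c) + fcm (int (m - k)) ?v - fcm (int m) (?w - fcm (int k) ?c)
   = fcm (int m) (?v - ?w)"
 proof -
  have "fcm (int k) ?v + fcm (int (m - k)) ?v=fcm (int m) ?v" using km by (simp flip: frag_cmul_distrib)
  thus ?thesis by (simp add: frag_cmul_diff mult.commute algebra_simps)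
 qed
 ultimately obtain C where C: "bcycle C" "bev (%g h. real_of_int (lam g h)) C=m * int n"
   "bnorm C <= (k * (real m' * (2 * real n + 13)) + (m - k) * (2 * real n + 15) + m * (real k + 1)) + 2 * m"
  using cycle_of_filling[of m "int n"] by force
 have e1: "m * n * vol=n * (2 * real k * m + 2 * m - 4 * k)" using m by (simp add: field_simps)
 have e2: "real m'=real m - 1" "real (m - k)=real m - real k" using m' km by simp_all
 have "(k * (real m' * (2 * real n + 13)) + (m - k) * (2 * real n + 15) + m * (real k + 1)) + 2 * m
   = m * n * vol + (14 * real m * k + 18 * m - 28 * k)"
  unfolding e1 e2 by (simp add: algebra_simps)
 moreover have "14 * real m * k + 18 * m - 28 * k <= 20 * m * (real k + 1)" by (simp add: algebra_simps)
 ultimately show ?thesis using C by (intro exI[of _ C]) simp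
qed

end

section \<open>Directions at the subgroup generated by \<open>a\<close>\<close>

text \<open>The direction of a word is \<open>Some (i, s)\<close> if its reduced form starts with \<open>a\<^sup>i \<tau>\<^sup>s\<close>, and
  \<open>None\<close> if it is a power of \<open>a\<close>.\<close>

type_synonym dir = "(int \<times> bool) option"

abbreviation shift :: "int => dir => dir" where "shift j == map_option (%(i, e). (i + j, e))"

fun dw :: "bool word => dir" where
 "dw []=None"
| "dw ((t, s) # w)=(if t then Some (0, s) else shift (sg s) (dw w))"

definition D0 :: "bool fg => dir" where "D0 g=dw (letters g)"

lemma shift_shift [simp]: "shift i (shift j d)=shift (j + i) d" and shift_0 [simp]: "shift 0 d=d"
 by (cases d; force)+

lemma dw_push: "dw (push (False, s) w)=shift (sg s) (dw w)"
 by (cases w) (auto simp: push_def inv_letter_def option.map_id)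

lemma D0_a: "D0 (gpow aa j + g)=shift j (D0 g)"
proof (induction j arbitrary: g rule: int_induct[where k = 0])
 case (step1 j)
 show ?case using step1(2)[of "aa + g"] by (simp add: add.commute[of 1 j] gpow_Suc add.assoc D0_def letters_gen_plus dw_push)
next
 case (step2 j)
 have "- aa=gen (False, False)" using gen_inv[of "(False, True)"] by (simp add: inv_letter_def)
 hence "D0 (- aa + g)=shift (- 1) (D0 g)" by (simp add: D0_def letters_gen_plus dw_push)
 moreover have "gpow aa (j - 1) + g=gpow aa j + (- aa + g)" unfolding gpow_pred by (simp add: dcu add.assoc del: auc)
 moreover have "shift j (shift (- 1) (D0 g))=shift (j - 1) (D0 g)" by (cases "D0 g") auto
 ultimately show ?case by (simp only: step2(2))
next
 case base
 show ?case by (simp add: option.map_ident)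
qed

lemma D0_tau: "D0 g ~= Some (0, ~s) ==> D0 (gen (True, s) + g)=Some (0, s)"
 by (cases "letters g") (auto simp: D0_def letters_gen_plus push_def inv_letter_def)

lemma dw_append: "dw v ~= None ==> dw (v @ w)=dw v"
 by (induction v) auto

lemma dw_tau: "(True, s):set w ==> dw w ~= None"
 by (induction w) auto

lemma D0_0 [simp]: "D0 0=None"
 by (simp add: D0_def)

lemma D0_None: "D0 g=None \<longleftrightarrow> (EX j. g=gpow aa j)"
proof
 have "dw w=None ==> EX j. word_val w=gpow aa j" for w
 proof (induction w)
  case (Cons l w)
  then obtain s where l: "l=(False, s)" and "dw w=None" by (cases l) (auto split: if_splits)
  then obtain j where j: "word_val w=gpow aa j" using Cons by blast
  have "gen l=gpow aa (sg s)" using gen_inv[of "(False, True)"] gpow_minus[of aa 1] l by (auto simp: inv_letter_def)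
  thus ?case unfolding word_val_simps j by (metis gpow_add)
 qed (auto intro: exI[of _ 0])
 from this[of "letters g"] show "D0 g=None ==> EX j. g=gpow aa j" by (simp add: D0_def)
 show "EX j. g=gpow aa j ==> D0 g=None"
 proof -
  assume "EX j. g=gpow aa j"
  then obtain j where "g=gpow aa j + 0" by auto
  thus ?thesis using D0_a[of j 0] by simp
 qed
qed

text \<open>Appending a letter changes the end of a reduced word while the direction depends on its
  beginning; exceptions arise only if there is no \<tau> before or after.\<close>

lemma D0_right: "D0 (z + gen l)=D0 z | D0 z=None | D0 (z + gen l)=None"
proof -
 have *: "D0 (z + gen l)=D0 z | D0 z=None" if "letters z=[] | last (letters z) ~= inv_letter l" for z l
 proof -
  have "letters (z + gen l)=letters z @ [l]"
   using letters_plus_reduced[of z "gen l"] that by (simp add: reduced_snoc)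
  thus ?thesis unfolding D0_def using dw_append[of "letters z" "[l]"] by metis
 qed
 show ?thesis
 proof (cases "letters z=[] | last (letters z) ~= inv_letter l")
  case False
  hence z: "letters z=butlast (letters z) @ [inv_letter l]" by (metis append_butlast_last_id)
  hence r: "reduced (butlast (letters z) @ [inv_letter l])" using reduced_letters[of z] by metis
  hence b: "reduced (butlast (letters z))" unfolding reduced_snoc by blast
  have "z=word_val (butlast (letters z)) + gen (inv_letter l)"
   using arg_cong[OF z, of word_val] by simp
  hence "z + gen l=word_val (butlast (letters z))" by (metis add.right_neutral add_diff_cancel diff_add_cancel diff_minus_eq_add gen_inv)
  hence zl: "letters (z + gen l)=butlast (letters z)" using letters_word_val_reduced[OF b] by simp
  show ?thesis unfolding D0_def zl using dw_append[of "butlast (letters z)" "[inv_letter l]"] z by metis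
 qed (use * in blast)
qed

text \<open>Write g as a^j \<tau>^s R. The product of g and y starts like g unless y starts with the
  inverse of \<tau>^s R, and in that case y has the direction \<open>d\<close> of that
  inverse.\<close>

lemma D0_separated:
 assumes "D0 g ~= None"
 obtains d where "!!y. D0 (g + y)=D0 g | D0 y=d"
proof -
 have "EX p s r. w=p @ (True, s) # r & (ALL l:set p. ~fst l)" if "dw w ~= None" for w
  using that
 proof (induction w)
  case (Cons l w)
  obtain t s where l: "l=(t, s)" by (cases l)
  show ?case
  proof (cases t)
   case True
   thus ?thesis using l by (intro exI[of _ "[]"]) simp
  next
   case False
   then obtain p s' r where "w=p @ (True, s') # r & (ALL l:set p. ~fst l)" using Cons l by auto
   thus ?thesis using l False by (intro exI[of _ "l # p"]) simp
  qed
 qed simp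
 then obtain p s r where w: "letters g=p @ (True, s) # r" and p: "ALL l:set p. ~fst l"
  using assms unfolding D0_def by blast
 have "EX j. word_val p=gpow aa j"
 proof -
  have "dw p=None" using p by (induction p) auto
  moreover have "reduced p" using reduced_letters[of g] unfolding w reduced_append by blast
  ultimately show ?thesis using D0_None[of "word_val p"] by (simp add: D0_def letters_word_val_reduced)
 qed
 then obtain j where j: "word_val p=gpow aa j" by blast
 define R where "R=word_val r"
 have g: "g=gpow aa j + (gen (True, s) + R)"
  using arg_cong[OF w, of word_val] by (simp add: R_def j)
 have red: "reduced ((True, s) # r)" using reduced_letters[of g] unfolding w reduced_append by blast
 have lR: "letters R=r" unfolding R_def using red by (intro letters_word_val_reduced) (simp add: reduced_Cons)
 have Dg: "D0 g=Some (j, s)" unfolding g D0_a using red by (auto simp: D0_def letters_gen_plus push_def lR reduced_Cons split: list.splits)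
 define d where "d=dw (inv_word r @ [(True, ~s)])"
 show ?thesis
 proof (rule that[of d])
  fix y
  show "D0 (g + y)=D0 g | D0 y=d"
  proof (cases "letters (R + y) ~= [] & hd (letters (R + y))=(True, ~s)")
   case False
   hence "D0 (gen (True, s) + (R + y))=Some (0, s)"
    by (cases "letters (R + y)") (auto simp: D0_def letters_gen_plus push_def inv_letter_def)
   thus ?thesis unfolding Dg using D0_a[of j "gen (True, s) + (R + y)"] by (simp add: g add.assoc)
  next
   case True
   have li: "letters (- R)=inv_word r" by (simp add: letters_uminus lR)
   have "inv_word r=[] | last (inv_word r) ~= (True, s)"
   proof (cases r)
    case (Cons l r')
    thus ?thesis using red by (auto simp: inv_word_def reduced_Cons inv_letter_eq_iff)
   qed (simp add: inv_word_def)
   hence "reduced (letters (- R) @ letters (R + y))"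
    using True reduced_letters[of "- R"] unfolding reduced_append li by (auto simp: inv_letter_def prod_eq_iff)
   hence "letters (- R + (R + y))=inv_word r @ letters (R + y)" using letters_plus_reduced[of "- R" "R + y"] li by simp
   hence "letters y=inv_word r @ letters (R + y)" by (simp add: add.assoc[symmetric])
   moreover have "letters (R + y)=[(True, ~s)] @ tl (letters (R + y))" using True by (cases "letters (R + y)") auto
   ultimately have y: "letters y=(inv_word r @ [(True, ~s)]) @ tl (letters (R + y))" by simp
   have "dw (inv_word r @ [(True, ~s)]) ~= None" by (rule dw_tau[of "~s"]) simp
   thus ?thesis unfolding d_def D0_def[of y] y using dw_append by blast
  qed
 qed
qed

text \<open>Each letter of \<open>w\<close> cancels at most one letter, so a prefix at least as long
  as \<open>w\<close> shields \<open>z\<close>.\<close>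

lemma foldr_push_append: "length w <= length v ==> foldr push w (v @ z)=foldr push w v @ z"
proof -
 have "length w <= length v ==> foldr push w (v @ z)=foldr push w v @ z & length v <= length (foldr push w v) + length w"
 proof (induction w)
  case (Cons l w)
  let ?X = "foldr push w v"
  have ne: "?X ~= []" using Cons by fastforce
  hence "push l (?X @ z)=push l ?X @ z" by (cases ?X) (simp_all add: push_def)
  moreover have "length ?X <= length (push l ?X) + 1" by (cases ?X) (simp_all add: push_def)
  ultimately show ?case using Cons by simp
 qed simp
 thus "length w <= length v ==> ?thesis" by blast
qed

context relators begin

section \<open>Directions of elements of the extension\<close>

lemma uu_word: "reduced (letters (uu k m e) @ letters (uu k m e))" "EX s. (True, s):set (letters (uu k m e))"
proof -
 have 1: "letters (uu k m True)=concat (replicate k (vword 1))" using letters_uu[of 1 k] by simp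
 have "concat (replicate k (vword 1)) @ concat (replicate k (vword 1))=concat (replicate (k + k) (vword 1))"
  by (simp add: replicate_add)
 also have "... = letters (gpow (vv 1) (int (k + k)))" using letters_uu[of 1 "k + k"] by simp
 finally have "reduced (letters (uu k m True) @ letters (uu k m True))" unfolding 1 by simp
 thus "reduced (letters (uu k m e) @ letters (uu k m e))"
  using vword_reduced[OF m] letters_vv[OF m] by (cases e) (simp_all only: uu_simps)
 have "(True, True):set (letters (uu k m e))"
  using k by (cases e) (simp_all only: 1, simp_all add: letters_vv[OF m])
 thus "EX s. (True, s):set (letters (uu k m e))" by blast
qed

definition tends :: "bool => bool fg => dir => bool" where
 "tends e c d \<longleftrightarrow> (EX N::int. ALL n>=N. D0 (c + gpow (uu k m e) n)=d)"

text \<open>The direction of the positive end of the coset of c modulo the subgroup generated by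
  \<open>u e\<close>. It depends only on the coset (\<open>Dinf_shift\<close>), which is what allows
  it to serve as the direction of every normal form starting with c t^e.\<close>

definition Dinf :: "bool => bool fg => dir" where "Dinf e c=(SOME d. tends e c d)"

lemma Dinf: "tends e c (Dinf e c)"
 unfolding Dinf_def
proof (rule someI_ex)
 let ?W = "letters (uu k m e)" and ?n = "length (letters c)"
 \<comment> \<open>As many copies of the word of \<open>uu k m e\<close> as c has letters absorb all
   cancellation; one further copy is sure to contain a letter \<tau>, and from then on the direction
   is constant.\<close>
 let ?Z = "foldr push (letters c) (concat (replicate ?n ?W))"
 have ne: "?W ~= []" using uu_word(2)[of e] by force
 have len: "length (letters c) <= length (concat (replicate ?n ?W))"
  using ne by (simp add: length_concat sum_list_replicate Suc_le_eq)
 have "D0 (c + gpow (uu k m e) n)=dw (?Z @ ?W)" if "n >= int ?n + 1" for n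
 proof -
  define i where "i=nat (n - int ?n - 1)"
  have n: "n=int (?n + Suc i)" using that by (simp add: i_def)
  have "letters (c + gpow (uu k m e) n)=foldr push (letters c) (concat (replicate ?n ?W) @ (?W @ concat (replicate i ?W)))"
   unfolding n letters_plus letters_gpow[OF uu_word(1)] replicate_add replicate_Suc by simp
  also have "... = (?Z @ ?W) @ concat (replicate i ?W)" unfolding foldr_push_append[OF len] by simp
  finally have "D0 (c + gpow (uu k m e) n)=dw ((?Z @ ?W) @ concat (replicate i ?W))" unfolding D0_def by (rule arg_cong)
  moreover obtain s where "(True, s):set (?Z @ ?W)" using uu_word(2)[of e] by auto
  ultimately show ?thesis using dw_append[OF dw_tau] by metis
 qed
 thus "EX d. tends e c d" unfolding tends_def by blast
qed

lemma Dinf_eqI: "tends e c d ==> Dinf e c=d"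
proof -
 assume "tends e c d"
 then obtain N where N: "!!n. n >= N ==> D0 (c + gpow (uu k m e) n)=d" unfolding tends_def by blast
 obtain M where M: "!!n. n >= M ==> D0 (c + gpow (uu k m e) n)=Dinf e c" using Dinf[of e c] unfolding tends_def by blast
 show ?thesis using N[of "max M N"] M[of "max M N"] by simp
qed

lemma Dinf_shift: "Dinf e (c + gpow (uu k m e) j)=Dinf e c"
proof (rule Dinf_eqI)
 obtain M where M: "!!n. n >= M ==> D0 (c + gpow (uu k m e) n)=Dinf e c" using Dinf[of e c] unfolding tends_def by blast
 have "D0 (c + gpow (uu k m e) j + gpow (uu k m e) n)=Dinf e c" if "n >= M - j" for n
  using M[of "j + n"] that by (simp add: gpow_add add.assoc)
 thus "tends e (c + gpow (uu k m e) j) (Dinf e c)" unfolding tends_def by blast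
qed

lemma Dinf_rep: "Dinf e (rep e c)=Dinf e c"
 using Dinf_shift[of e "rep e c" "ex e c"] rep_ex[of c e] by simp

lemma Dinf_a: "Dinf e (gpow aa j + c)=shift j (Dinf e c)"
proof (rule Dinf_eqI)
 obtain M where M: "!!n. n >= M ==> D0 (c + gpow (uu k m e) n)=Dinf e c" using Dinf[of e c] unfolding tends_def by blast
 hence "D0 (gpow aa j + c + gpow (uu k m e) n)=shift j (Dinf e c)" if "n >= M" for n
  using that by (simp add: add.assoc D0_a)
 thus "tends e (gpow aa j + c) (shift j (Dinf e c))" unfolding tends_def by blast
qed

text \<open>The list is stored in reverse, so \<open>last\<close> is the first syllable; whatever
  follows it does not influence the direction.\<close>

definition DD :: "vtx => dir" where
 "DD x=(if fst x=[] then D0 (snd x) else Dinf (snd (last (fst x))) (fst (last (fst x))))"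

lemma DD_J [simp]: "DD (J g)=D0 g"
 by (simp add: DD_def)

text \<open>If multiplying \<open>y\<close> by the first syllable \<open>c t\<^sup>e\<close> of \<open>(L, h)\<close> does not cancel, then neither do
  the later syllables.\<close>

lemma mul_last:
 assumes "vl L" "L ~= []" "last L=(c, e)"
  and nc: "~(rep e (snd y + c)=0 & fst y ~= [] & snd (hd (fst y))=(~e))"
 shows "fst (mul y (L, h)) ~= [] & last (fst (mul y (L, h)))=last ((rep e (snd y + c), e) # fst y)"
proof -
 let ?l = "last ((rep e (snd y + c), e) # fst y)"
 have "EX c' Q n. mulL y L=((c', snd (hd L)) # Q, gpow (uu k m (~snd (hd L))) n) & last ((c', snd (hd L)) # Q)=?l"
  using assms(1-3)
 proof (induction L)
  case (Cons l L)
  obtain c2 e2 where l: "l=(c2, e2)" by (cases l)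
  obtain Ly gy where y: "y=(Ly, gy)" by (cases y)
  show ?case
  proof (cases "L=[]")
   case True
   hence "c2=c" "e2=e" using Cons.prems l by auto
   hence "mulL y (l # L)=((rep e (snd y + c), e) # fst y, gpow (uu k m (~e)) (ex e (snd y + c)))"
    using nc by (auto simp: l True y tact_def Let_def)
   thus ?thesis using l True \<open>e2 = e\<close> by auto
  next
   case False
   have "vl L" "last L=(c, e)" and c2: "rep e2 c2=c2" "c2=0 ==> snd (hd L)=e2"
    using Cons.prems False l by auto
   then obtain c' Q n where Q: "mulL y L=((c', snd (hd L)) # Q, gpow (uu k m (~snd (hd L))) n)" "last ((c', snd (hd L)) # Q)=?l"
    using Cons.IH False by blast
   let ?h = "gpow (uu k m (~snd (hd L))) n + c2"
   have "~(rep e2 ?h=0 & snd (hd L)=(~e2))"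
   proof
    assume a: "rep e2 ?h=0 & snd (hd L)=(~e2)"
    hence r: "rep e2 ?h=0" and e2: "(~snd (hd L))=e2" by blast+
    from rep_ex[of ?h e2] have "?h=gpow (uu k m e2) (ex e2 ?h)" unfolding r add_0 .
    hence "gpow (uu k m e2) n + c2=gpow (uu k m e2) (ex e2 ?h)" unfolding e2 .
    hence "- gpow (uu k m e2) n + (gpow (uu k m e2) n + c2)=gpow (uu k m e2) (- n + ex e2 ?h)"
     by (simp only: gpow_add gpow_minus)
    hence "c2=gpow (uu k m e2) (- n + ex e2 ?h)" by simp
    hence "c2=0" using c2(1) rep_gpow by metis
    thus False using c2(2) a by simp
   qed
   hence "mulL y (l # L)=((rep e2 ?h, e2) # fst (mulL y L), gpow (uu k m (~e2)) (ex e2 ?h))"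
    by (simp add: l Q(1) tact_def Let_def)
   thus ?thesis using Q by (auto simp: l)
  qed
 qed simp
 thus ?thesis by (auto simp: mul_def)
qed

lemma DD_a:
 assumes "x:V" shows "DD (mul (J (gpow aa j)) x)=shift j (DD x)"
proof (cases "fst x=[]")
 case True
 thus ?thesis by (cases x) (simp add: D0_a)
next
 case False
 obtain c e where ce: "last (fst x)=(c, e)" by (cases "last (fst x)")
 have "vl (fst x)" using assms by (simp add: V_def)
 from mul_last[OF this False ce, of "J (gpow aa j)" "snd x"] show ?thesis
  using False ce by (simp add: DD_def Dinf_rep Dinf_a)
qed

lemma DD_right: "DD (mul x (J (gen l)))=DD x | (EX j. x=J (gpow aa j)) | (EX j. mul x (J (gen l))=J (gpow aa j))"
proof -
 obtain L g where x: "x=(L, g)" by (cases x)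
 show ?thesis using D0_right[of g l] unfolding D0_None by (cases "L=[]") (auto simp: x DD_def mul_def)
qed

text \<open>For g in the base group, \<open>D0_separated\<close> is applied far out along the coset
  of the first syllable of y. Otherwise the first syllable of g survives in the product unless the
  first syllable of y cancels the last one of g, and then the coset of that syllable, hence the
  direction of y, is determined by g.\<close>

lemma DD_separated:
 assumes g: "g:V" "\<nexists>j. g=J (gpow aa j)"
 shows "EX d. ALL y:V. DD (mul g y)=DD g | DD y=d"
proof (cases "fst g=[]")
 case True
 then obtain h where h: "g=J h" by (cases g) simp
 hence "D0 h ~= None" using g(2) unfolding D0_None by blast
 then obtain d where d: "!!y. D0 (h + y)=D0 h | D0 y=d" using D0_separated by blast
 have "DD (mul g y)=DD g | DD y=d" if y: "y:V" for y
 proof (cases "fst y=[]")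
  case True
  thus ?thesis using d[of "snd y"] by (cases y) (simp add: h)
 next
  case False
  obtain c e where ce: "last (fst y)=(c, e)" by (cases "last (fst y)")
  have "vl (fst y)" using y by (simp add: V_def)
  from mul_last[OF this False ce, of g "snd y"] have 1: "DD (mul g y)=Dinf e (h + c)"
   by (simp add: h DD_def Dinf_rep)
  have 2: "DD y=Dinf e c" using False ce by (simp add: DD_def)
  obtain N where N: "!!n. n >= N ==> D0 (c + gpow (uu k m e) n)=Dinf e c" using Dinf[of e c] unfolding tends_def by blast
  obtain M where M: "!!n. n >= M ==> D0 (h + c + gpow (uu k m e) n)=Dinf e (h + c)" using Dinf[of e "h + c"] unfolding tends_def by blast
  show ?thesis using d[of "c + gpow (uu k m e) (max M N)"] N[of "max M N"] M[of "max M N"] unfolding 1 2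
   by (simp add: h add.assoc)
 qed
 thus ?thesis by blast
next
 case False
 define e where "e=(~snd (hd (fst g)))"
 have "DD (mul g y)=DD g | DD y=Dinf e (- snd g)" if y: "y:V" for y
 proof (cases "fst y=[]")
  case True
  thus ?thesis using False by (simp add: DD_def mul_def addg_def)
 next
  case ny: False
  obtain c e2 where ce: "last (fst y)=(c, e2)" by (cases "last (fst y)")
  have vy: "vl (fst y)" using y by (simp add: V_def)
  show ?thesis
  proof (cases "rep e2 (snd g + c)=0 & fst g ~= [] & snd (hd (fst g))=(~e2)")
   case True
   hence e: "e2=e" and "snd g + c=gpow (uu k m e) (ex e (snd g + c))" using rep_ex[of "snd g + c" e2] by (auto simp: e_def)
   hence "c = - snd g + gpow (uu k m e) (ex e (snd g + c))" by (metis minus_add_cancel)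
   hence "Dinf e c=Dinf e (- snd g)" by (metis Dinf_shift)
   thus ?thesis using ny ce e by (simp add: DD_def)
  next
   case nc: False
   from mul_last[OF vy ny ce nc, of "snd y"] show ?thesis using False by (simp add: DD_def)
  qed
 qed
 thus ?thesis by blast
qed

section \<open>A bounded cocycle\<close>

text \<open>The ceiling of x / m.\<close>

definition cc :: "int => int" where "cc x = - ((- x) div int m)"

definition hh :: "int => real" where
 "hh x=(if x=0 then 0 else of_int (if 0 < x then 2 * cc x - 1 else 1 - 2 * cc (- x)) - 2 * x / m)"

lemma hh_minus: "hh (- x) = - hh x"
 by (simp add: hh_def)

text \<open>The linear parts cancel, and rounding up i + j loses r, which is 0 or 1, compared with
  rounding up i and j. The value is exactly 1 or -1.\<close>

lemma hh_add: assumes "0 < i" "0 < j" shows "\<bar>hh i + hh j - hh (i + j)\<bar> <= 1"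
proof -
 define r where "r=((- i) mod int m + (- j) mod int m) div int m"
 have "(- i) mod int m < int m" "(- j) mod int m < int m" "0 <= (- i) mod int m" "0 <= (- j) mod int m" using m by simp_all
 hence s: "0 <= (- i) mod int m + (- j) mod int m" "(- i) mod int m + (- j) mod int m < 2 * int m" by linarith+
 have "0 <= r" unfolding r_def using s m by (intro pos_imp_zdiv_nonneg_iff[THEN iffD2]) simp_all
 moreover have "r < 2"
 proof (rule ccontr)
  assume "~r < 2"
  hence "int m * 2 <= int m * r" using m by (intro mult_left_mono) simp_all
  moreover have "int m * r + ((- i) mod int m + (- j) mod int m) mod int m=(- i) mod int m + (- j) mod int m"
   unfolding r_def by (rule mult_div_mod_eq)
  moreover have "0 <= ((- i) mod int m + (- j) mod int m) mod int m" using m by simp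
  ultimately show False using s(2) by linarith
 qed
 ultimately have "r=0 | r=1" by linarith
 moreover have "cc (i + j)=cc i + cc j - r" using div_add1_eq[of "- i" "- j" "int m"] by (simp add: cc_def r_def)
 hence "hh i + hh j - hh (i + j)=2 * real_of_int r - 1" using assms by (simp add: hh_def add_divide_distrib algebra_simps)
 ultimately show ?thesis by auto
qed

text \<open>For positive x the value is 2/m times the residue of -x modulo m, minus 1.\<close>

lemma hh_le: "\<bar>hh x\<bar> <= 1"
proof -
 have "\<bar>hh x\<bar> <= 1" if "0 < x" for x
 proof -
  have "int m * ((- x) div int m) + (- x) mod int m = - x" by (rule mult_div_mod_eq)
  hence "int m * cc x=x + (- x) mod int m" unfolding cc_def mult_minus_right by linarith
  hence "real m * real_of_int (cc x) = of_int x + of_int ((- x) mod int m)" by (metis of_int_add of_int_mult of_int_of_nat_eq)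
  hence "hh x=2 * of_int ((- x) mod int m) / m - 1" using that m by (simp add: hh_def field_simps)
  moreover have "real_of_int ((- x) mod int m) <= real_of_int (int m)" using m pos_mod_bound[of "int m" "- x"] by linarith
  hence "0 <= real_of_int ((- x) mod int m) / m" "real_of_int ((- x) mod int m) / m <= 1"
   using m by (simp_all add: divide_le_eq_1)
  ultimately show ?thesis by linarith
 qed
 from this[of x] this[of "- x"] show ?thesis unfolding hh_minus by (cases "x=0") (simp_all add: hh_def, linarith)
qed

lemma hh_1: "hh 1=1 - 2 / m" and hh_m: "hh (int m) = - 1"
proof -
 have "(- 1) div int m = - 1" using m by (simp add: div_eq_minus1)
 thus "hh 1=1 - 2 / m" by (simp add: hh_def cc_def)
 have "(- int m) div int m = - 1" using m by (simp add: zdiv_zminus1_eq_if)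
 thus "hh (int m) = - 1" using m by (simp add: hh_def cc_def)
qed

text \<open>Unless all three vanish, two of the numbers have no opposite signs and one of these is
  nonzero; oddness turns the third into their sum.\<close>

lemma hh_triangle: assumes "i + j + l=0" shows "\<bar>hh i + hh j + hh l\<bar> <= 1"
proof -
 have *: "\<bar>hh i + hh j + hh l\<bar> <= 1" if "i + j + l=0" "0 < i" "0 <= j" for i j l
 proof (cases "j=0")
  case True
  hence "l = - i" using that by simp
  thus ?thesis using True hh_minus[of i] by (simp add: hh_def[of 0])
 next
  case False
  hence "l = - (i + j)" "0 < j" using that by simp_all
  thus ?thesis using hh_add[of i j] hh_minus[of "i + j"] that(2) by simp
 qed
 have n: "\<bar>hh i + hh j + hh l\<bar>=\<bar>hh (- i) + hh (- j) + hh (- l)\<bar>" by (simp add: hh_minus)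
 consider "i=0 & j=0" | "0 < i" "0 <= j" | "0 < j" "0 <= l" | "0 < l" "0 <= i" | "i < 0" "j <= 0" | "j < 0" "l <= 0" | "l < 0" "i <= 0"
  using assms by linarith
 thus ?thesis
 proof cases
  case 1
  thus ?thesis using assms by (simp add: hh_def)
 next
  case 2
  thus ?thesis using *[of i j l] assms by simp
 next
  case 3
  thus ?thesis using *[of j l i] assms by (simp add: algebra_simps)
 next
  case 4
  thus ?thesis using *[of l i j] assms by (simp add: algebra_simps)
 next
  case 5
  thus ?thesis using *[of "- i" "- j" "- l"] assms unfolding n by auto
 next
  case 6
  thus ?thesis using *[of "- j" "- l" "- i"] assms unfolding n by (auto simp: algebra_simps)
 next
  case 7
  thus ?thesis using *[of "- l" "- i" "- j"] assms unfolding n by (auto simp: algebra_simps)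
 qed
qed

text \<open>Directions with different signs of \<tau> do not interact, and the negative ones are
  counted with reversed orientation.\<close>

fun eta :: "dir => dir => real" where
 "eta (Some (i, s)) (Some (j, t))=(if s=t then of_int (sg s) * hh (j - i) else 0)"
| "eta None d=0"
| "eta (Some d) None=0"

lemma eta_None [simp]: "eta d None=0"
 by (cases d) simp_all

lemma eta_anti: "eta d e = - eta e d"
proof (cases "d=None | e=None")
 case False
 then obtain i s j t where "d=Some (i, s)" "e=Some (j, t)" by auto
 thus ?thesis using hh_minus[of "j - i"] by simp
qed auto

text \<open>The coboundary of the antisymmetric function \<open>eta\<close>, hence a cocycle on
  triples of directions that vanishes as soon as two of them coincide.\<close>

definition gam :: "dir => dir => dir => real" where "gam d e f=eta d e + eta e f + eta f d"

lemma gam_coincide: "d=e | e=f | d=f ==> gam d e f=0"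
 using eta_anti[of d e] eta_anti[of e f] eta_anti[of d f] eta_anti[of e e] eta_anti[of d d] unfolding gam_def by auto

lemma eta_shift: "eta (shift j d) (shift j e)=eta d e"
proof (cases "d=None | e=None")
 case False
 then obtain i s j t where "d=Some (i, s)" "e=Some (j, t)" by auto
 thus ?thesis by simp
qed auto

lemma gam_shift: "gam (shift j d) (shift j e) (shift j f)=gam d e f"
 by (simp only: gam_def eta_shift)

lemma gam_cocycle: "gam e f g - gam d f g + gam d e g - gam d e f=0"
 using eta_anti[of g e] eta_anti[of g d] eta_anti[of f d] unfolding gam_def by linarith

text \<open>For three directions of one sign this is \<open>hh_triangle\<close>; in all other cases
  at most one of the three terms is nonzero and \<open>hh_le\<close> applies.\<close>

lemma gam_le: "\<bar>gam d e f\<bar> <= 1"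
proof -
 have e: "\<bar>eta d e\<bar> <= 1" for d e
 proof (cases "d=None | e=None")
  case False
  then obtain i s j t where "d=Some (i, s)" "e=Some (j, t)" by auto
  thus ?thesis using hh_le[of "j - i"] by (auto simp: abs_mult)
 qed auto
 show ?thesis
 proof (cases "d=None | e=None | f=None")
  case True
  thus ?thesis using e[of d e] e[of e f] e[of f d] unfolding gam_def by auto
 next
  case False
  then obtain i s j t l v where d: "d=Some (i, s)" "e=Some (j, t)" "f=Some (l, v)" by auto
  show ?thesis
  proof (cases "s=t & t=v")
   case True
   have "gam d e f = of_int (sg s) * (hh (j - i) + hh (l - j) + hh (i - l))" using True by (simp add: gam_def d)
   thus ?thesis using hh_triangle[of "j - i" "l - j" "i - l"] by (simp add: abs_mult)
  next
   case False
   hence "eta d e=0 & (eta e f=0 | eta f d=0) | eta e f=0 & eta f d=0" by (auto simp: d)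
   thus ?thesis using e[of d e] e[of e f] e[of f d] unfolding gam_def by auto
  qed
 qed
qed

text \<open>The contribution of the coset of g: directions are taken after g is moved to the
  identity. Another element of the coset shifts all directions alike, which \<open>gam\<close>
  ignores.\<close>

definition Ga :: "vtx => vtx => vtx => vtx => real" where
 "Ga g x y z=gam (DD (mul (invV g) x)) (DD (mul (invV g) y)) (DD (mul (invV g) z))"

abbreviation Ja :: "int => vtx" where "Ja j == J (gpow aa j)"

lemma Ga_coset: assumes "g:V" "x:V" "y:V" "z:V" shows "Ga (mul g (Ja j)) x y z=Ga g x y z"
proof -
 let ?g = "mul g (Ja j)"
 have g: "?g:V" using assms by (simp add: mul_V)
 have "DD (mul (invV g) x)=shift j (DD (mul (invV ?g) x))" if x: "x:V" for x
 proof -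
  have w: "mul (invV ?g) x:V" using g x by (simp add: mul_V)
  have "x=mul g (mul (Ja j) (mul (invV ?g) x))"
   using mul_invV(1)[OF g x] mul_assoc[OF assms(1) J_V w, of "gpow aa j"] by simp
  hence "mul (invV g) x=mul (Ja j) (mul (invV ?g) x)" using mul_invV(2)[OF assms(1)] w by (metis J_V mul_V)
  thus ?thesis using DD_a[OF w] by simp
 qed
 thus ?thesis unfolding Ga_def using assms by (simp only: gam_shift)
qed

text \<open>By \<open>DD_separated\<close>, each of the three points either is seen from g' in the
  direction of g or is seen from g in the direction \<open>d\<close>. By the pigeonhole principle
  one of these alternatives holds for two points, and then the contribution of that coset
  vanishes.\<close>

lemma Ga_unique:
 assumes V: "g:V" "g':V" "x:V" "y:V" "z:V" and nz: "Ga g x y z ~= 0" "Ga g' x y z ~= 0"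
 shows "EX j. g=mul g' (Ja j)"
proof (rule ccontr)
 assume no: "\<nexists>j. g=mul g' (Ja j)"
 let ?h = "mul (invV g') g"
 have h: "?h:V" using V by (simp add: mul_V)
 have "\<nexists>j. ?h=Ja j" using no mul_invV(1)[OF V(2,1)] by metis
 then obtain d where d: "!!w. w:V ==> DD (mul ?h w)=DD ?h | DD w=d" using DD_separated[OF h] by blast
 have *: "DD (mul (invV g') w)=DD ?h | DD (mul (invV g) w)=d" if w: "w:V" for w
 proof -
  have gw: "mul (invV g) w:V" using w V by (simp add: mul_V)
  have "mul ?h (mul (invV g) w)=mul (invV g') w"
   using mul_assoc[OF _ V(1) gw, of "invV g'"] mul_invV(1)[OF V(1) w] V(2) by simp
  thus ?thesis using d[OF gw] by simp
 qed
 show False using *[OF V(3)] *[OF V(4)] *[OF V(5)] nz gam_coincide unfolding Ga_def by metis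
qed

definition rcos :: "vtx => vtx" where "rcos g=(SOME h. EX j. h=mul g (Ja j))"

lemma rcos: "EX j. rcos g=mul g (Ja j)"
 unfolding rcos_def by (rule someI[of "%h. EX j. h=mul g (Ja j)" "mul g (Ja 0)"]) blast

lemma rcos_V: "g:V ==> rcos g:V"
 using rcos[of g] J_V mul_V by metis

lemma rcos_eq: assumes "g:V" shows "rcos (mul g (Ja j))=rcos g"
proof -
 have s: "mul (mul g (Ja j)) (Ja i)=mul g (Ja (j + i))" for i
  using assms by (simp add: mul_assoc gpow_add)
 have "(EX i. h=mul (mul g (Ja j)) (Ja i)) \<longleftrightarrow> (EX i. h=mul g (Ja i))" for h
  unfolding s by (metis add_diff_cancel_left' diff_add_cancel add.commute)
 thus ?thesis unfolding rcos_def by presburger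
qed

text \<open>The sum over all cosets. It has at most one nonzero term, so the bound for a single
  coset carries over.\<close>

definition ff :: "vtx => vtx => vtx => real" where
 "ff x y z=(SUM g:{g:rcos ` V. Ga g x y z ~= 0}. Ga g x y z)"

lemma Ga_rcos: "g:V ==> x:V ==> y:V ==> z:V ==> Ga (rcos g) x y z=Ga g x y z"
 using rcos[of g] Ga_coset by metis

lemma ff_support:
 assumes V: "g:V" "x:V" "y:V" "z:V" and nz: "Ga g x y z ~= 0"
 shows "{g:rcos ` V. Ga g x y z ~= 0}={rcos g}"
proof -
 have "h=rcos g" if h: "h:rcos ` V" "Ga h x y z ~= 0" for h
 proof -
  obtain h' where h': "h=rcos h'" "h':V" using h(1) by blast
  have "Ga h' x y z ~= 0" using h(2) Ga_rcos V h' by simp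
  then obtain j where "h'=mul g (Ja j)" using Ga_unique[OF h'(2) V _ nz] by blast
  thus ?thesis using rcos_eq[OF V(1)] h' by simp
 qed
 moreover have "Ga (rcos g) x y z ~= 0" using nz Ga_rcos V by simp
 ultimately show ?thesis using V(1) by blast
qed

lemma ff_eq:
 assumes "g:V" "x:V" "y:V" "z:V" "Ga g x y z ~= 0"
 shows "ff x y z=Ga g x y z"
 unfolding ff_def ff_support[OF assms] using Ga_rcos assms by simp

lemma ff_0: assumes "!!g. g:V ==> Ga g x y z=0" shows "ff x y z=0"
proof -
 have "{g:rcos ` V. Ga g x y z ~= 0}={}" using assms rcos_V by blast
 thus ?thesis unfolding ff_def by (simp only: sum.empty)
qed

lemma ff_finite: assumes "x:V" "y:V" "z:V" shows "finite {g:rcos ` V. Ga g x y z ~= 0}"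
proof (cases "EX g:V. Ga g x y z ~= 0")
 case True
 then obtain g where "g:V" "Ga g x y z ~= 0" by blast
 hence "{g:rcos ` V. Ga g x y z ~= 0}={rcos g}" using ff_support assms by blast
 thus ?thesis by (simp only: finite.intros)
next
 case False
 hence "{g:rcos ` V. Ga g x y z ~= 0}={}" using rcos_V by blast
 thus ?thesis by (simp only: finite.emptyI)
qed

lemma ff_le: assumes "x:V" "y:V" "z:V" shows "\<bar>ff x y z\<bar> <= 1"
proof (cases "EX g:V. Ga g x y z ~= 0")
 case True
 then obtain g where "g:V" "Ga g x y z ~= 0" by blast
 hence "ff x y z=Ga g x y z" using ff_eq assms by blast
 thus ?thesis unfolding Ga_def by (simp only: gam_le)
next
 case False
 hence "ff x y z=0" by (intro ff_0) blast
 thus ?thesis by simp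
qed

lemma ff_coincide: "x=y | y=z | x=z ==> ff x y z=0"
 by (rule ff_0) (auto simp: Ga_def intro: gam_coincide)

lemma ff_mul:
 assumes h: "h:V" and V: "x:V" "y:V" "z:V"
 shows "ff (mul h x) (mul h y) (mul h z)=ff x y z"
proof -
 have G: "Ga (mul h g) (mul h x) (mul h y) (mul h z)=Ga g x y z" if g: "g:V" for g
 proof -
  have "mul (invV (mul h g)) (mul h w)=mul (invV g) w" if "w:V" for w
   using inv_mul(1)[of h g w] h g that by simp
  thus ?thesis unfolding Ga_def using V by simp
 qed
 have hV: "mul h x:V" "mul h y:V" "mul h z:V" using h V mul_V by simp_all
 show ?thesis
 proof (cases "EX g:V. Ga g x y z ~= 0")
  case True
  then obtain g where g: "g:V" "Ga g x y z ~= 0" by blast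
  have "mul h g:V" "Ga (mul h g) (mul h x) (mul h y) (mul h z) ~= 0" using g h G mul_V by simp_all
  thus ?thesis using ff_eq[OF g(1) V g(2)] ff_eq[OF _ hV, of "mul h g"] G[OF g(1)] by simp
 next
  case False
  have "Ga g (mul h x) (mul h y) (mul h z)=0" if g: "g:V" for g
  proof -
   have "mul (invV h) g:V" using g h by (simp add: mul_V)
   thus ?thesis using G[of "mul (invV h) g"] False mul_invV(1)[OF h g] by metis
  qed
  hence "ff (mul h x) (mul h y) (mul h z)=0" by (rule ff_0)
  moreover have "ff x y z=0" using False by (intro ff_0) blast
  ultimately show ?thesis by simp
 qed
qed

lemma ff_cocycle:
 assumes V: "x:V" "y:V" "z:V" "w:V"
 shows "ff y z w - ff x z w + ff x y w - ff x y z=0"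
proof -
 let ?s = "%x y z. {g:rcos ` V. Ga g x y z ~= 0}"
 let ?A = "?s y z w Un ?s x z w Un ?s x y w Un ?s x y z"
 have fin: "finite ?A" using ff_finite V by simp
 have "ff a b c=(SUM g:?A. Ga g a b c)" if "?s a b c <= ?A" for a b c
  unfolding ff_def by (rule sum.mono_neutral_left[OF fin that]) blast
 hence e: "ff y z w=(SUM g:?A. Ga g y z w)" "ff x z w=(SUM g:?A. Ga g x z w)"
   "ff x y w=(SUM g:?A. Ga g x y w)" "ff x y z=(SUM g:?A. Ga g x y z)" by blast+
 have "(SUM g:?A. Ga g y z w - Ga g x z w + Ga g x y w - Ga g x y z)=0"
  by (rule sum.neutral) (simp only: Ga_def gam_cocycle, simp)
 thus ?thesis unfolding e by (simp add: sum.distrib sum_subtractf)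
qed

section \<open>The inhomogeneous cocycle and its values on letters\<close>

definition phi :: "vtx => vtx => real" where "phi g h=ff one_V g (mul g h)"

lemma phi_le: "g:V ==> h:V ==> \<bar>phi g h\<bar> <= 1"
 unfolding phi_def by (intro ff_le) (simp_all add: mul_V)

lemma inhom_phi: "inhom phi"
 unfolding inhom_def
proof (intro ballI)
 fix g h k assume V: "g:V" "h:V" "k:V"
 have "ff one_V h (mul h k)=ff g (mul g h) (mul g (mul h k))"
  using ff_mul[OF V(1) one_in_V V(2), of "mul h k"] V by (simp add: mul_V)
 moreover have "mul (mul g h) k=mul g (mul h k)" using V mul_assoc by simp
 ultimately show "phi h k - phi (mul g h) k + phi g (mul h k) - phi g h=0"
  using ff_cocycle[of one_V g "mul g h" "mul g (mul h k)"] V unfolding phi_def by (simp add: mul_V)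
qed

lemma gen_a: "gen (False, s)=gpow aa (sg s)"
 using gen_inv[of "(False, True)"] gpow_minus[of aa 1] by (auto simp: inv_letter_def)

lemma gen_not: "gen (t, ~s) = - gen (t, s)"
 using gen_inv[of "(t, s)"] by (simp add: inv_letter_def)

lemma invV_J: "invV (J g)=J (- g)"
proof -
 have "mul (J g) (J (- g)) = one_V" by (simp add: one_V_def)
 thus ?thesis using mul_invV(2)[of "J g" "J (- g)"] invV(1)[of "J g"] J_V mul_one_right by metis
qed

lemma DD_Ja: "DD (mul z (Ja i))=DD z"
proof -
 have "D0 (x + gen (False, s))=D0 x" for x s
 proof -
  consider "D0 (x + gen (False, s))=D0 x" | j where "x=gpow aa j" | j where "x + gen (False, s)=gpow aa j"
   using D0_right[of x "(False, s)"] unfolding D0_None by blast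
  thus ?thesis
  proof cases
   case (2 j)
   hence "x + gen (False, s)=gpow aa (j + sg s)" unfolding gen_a[of s] gpow_add by simp
   thus ?thesis using 2 D0_None by metis
  next
   case (3 j)
   hence "x=gpow aa (j - sg s)" unfolding gen_a[of s] gpow_diff by (simp add: eq_diff_eq)
   thus ?thesis using 3 D0_None by metis
  qed simp
 qed
 hence g: "D0 (x + gpow aa 1)=D0 x" "D0 (x + gpow aa (- 1))=D0 x" for x
  using gen_a[of True] gen_a[of False] by (metis (full_types))+
 have "D0 (x + gpow aa i)=D0 x" for x
 proof (induction i rule: int_induct[where k = 0])
  case (step1 i)
  thus ?case using g(1)[of "x + gpow aa i"] by (simp add: gpow_add add.assoc)
 next
  case (step2 i)
  have "x + gpow aa (i - 1)=(x + gpow aa i) + gpow aa (- 1)" using gpow_add[of aa i "- 1"] by (simp add: add.assoc)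
  thus ?case using step2 g(2) by simp
 qed simp
 thus ?thesis by (cases z) (auto simp: DD_def mul_def)
qed

lemma phi_a: "phi (J x) (J (gen (False, s)))=0"
 unfolding phi_def
proof (rule ff_0)
 fix g assume "g:V"
 hence "mul (invV g) (mul (J x) (J (gen (False, s))))=mul (mul (invV g) (J x)) (J (gen (False, s)))"
  by (intro mul_assoc[symmetric]) simp_all
 thus "Ga g one_V (J x) (mul (J x) (J (gen (False, s))))=0"
  unfolding Ga_def gen_a[of s] using DD_Ja by (intro gam_coincide) simp
qed

text \<open>Only the cosets of x and of x \<tau>^s can tell these two elements apart. From the
  latter coset the base point and x lie in the same direction, by the hypothesis on x, so it
  contributes nothing; from the former, x itself has no direction, which leaves a single value of
  \<open>eta\<close>.\<close>

lemma phi_tau: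
 assumes x: "D0 (- x) ~= Some (0, s)"
 shows "phi (J x) (J (gen (True, s)))=eta (Some (0, s)) (D0 (- x))"
proof -
 let ?t = "gen (True, s)"
 have t: "D0 (gen (True, s))=Some (0, s)" for s using D0_tau[of 0 s] by simp
 have e: "mul (J x) (J ?t)=J (x + ?t)" by simp
 have 1: "Ga (J x) one_V (J x) (J (x + ?t))=eta (Some (0, s)) (D0 (- x))"
  unfolding Ga_def invV_J by (simp add: gam_def t flip: add.assoc)
 show ?thesis
 proof (cases "eta (Some (0, s)) (D0 (- x))=0")
  case False
  thus ?thesis unfolding phi_def e using ff_eq[of "J x" one_V "J x" "J (x + ?t)"] 1 by simp
 next
  case True
  have "Ga g one_V (J x) (J (x + ?t))=0" if g: "g:V" for g
  proof -
   let ?z = "mul (invV g) (J x)"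
   have z: "mul (invV g) (J (x + ?t))=mul ?z (J ?t)" unfolding e[symmetric] using g by (intro mul_assoc[symmetric]) simp_all
   consider "DD (mul ?z (J ?t))=DD ?z" | j where "?z=Ja j" | j where "mul ?z (J ?t)=Ja j" using DD_right by blast
   thus ?thesis
   proof cases
    case 1
    thus ?thesis unfolding Ga_def z by (intro gam_coincide) simp
   next
    case (2 j)
    hence eq: "mul g (Ja j)=J x" using mul_invV(1)[OF g J_V, of x] by simp
    have "Ga (mul g (Ja j)) one_V (J x) (J (x + ?t))=Ga g one_V (J x) (J (x + ?t))" by (rule Ga_coset[OF g one_in_V J_V J_V])
    thus ?thesis unfolding eq 1 True by simp
   next
    case (3 j)
    hence eq: "mul g (Ja j)=J (x + ?t)" using mul_invV(1)[OF g J_V, of "x + ?t"] z by simp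
    have "Ga (mul g (Ja j)) one_V (J x) (J (x + ?t))=Ga g one_V (J x) (J (x + ?t))" by (rule Ga_coset[OF g one_in_V J_V J_V])
    hence "Ga g one_V (J x) (J (x + ?t))=Ga (J (x + ?t)) one_V (J x) (J (x + ?t))" unfolding eq by simp
    moreover have "D0 (- (x + ?t))=Some (0, ~s)" using D0_tau[of "- x" "~s"] x by (simp add: minus_add gen_not)
    moreover have "D0 (- (x + ?t) + x)=Some (0, ~s)" using t[of "~s"] by (simp add: minus_add gen_not add.assoc)
    ultimately show ?thesis unfolding Ga_def invV_J by (simp add: gam_coincide)
   qed
  qed
  thus ?thesis unfolding phi_def e True by (rule ff_0)
 qed
qed

section \<open>The simplicial volume of the relators\<close>

text \<open>The cone from the base vertex over the path that starts at x and reads the word.\<close>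

fun fan :: "bool fg => bool word => bchain" where
 "fan x []=0"
| "fan x (l # w)=single (J x, J (gen l)) 1 + fan (x + gen l) w"

lemma bd_0 [simp]: "bd 0=0" and bev_0 [simp]: "bev ph 0=0"
 using bd_diff[of 0 0] bev_diff[of ph 0 0] by simp_all

lemma fan_append: "fan x (v @ w)=fan x v + fan (x + word_val v) w"
 by (induction v arbitrary: x) (simp_all add: add.assoc)

lemma keys_fan: "keys (fan x w) <= range J \<times> range J"
proof (induction w arbitrary: x)
 case (Cons l w)
 show ?case using keys_add[of "single (J x, J (gen l)) (1::int)" "fan (x + gen l) w"] Cons[of "x + gen l"] by simp blast
qed simp

lemma bd_fan: "bd (fan x w)=(SUM l<-w. qc (gen l)) + qc x - qc (x + word_val w)"
 by (induction w arbitrary: x) (simp_all add: bd_add bd_single add.assoc)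

abbreviation "vcat j n == concat (replicate n (vword j))"

lemma word_val_vcat: "word_val (vcat j n)=gpow (vv j) (int n)"
proof (induction n)
 case (Suc n)
 have v: "word_val (vword j)=vv j"
  using gen_not[of True True] unfolding vv_def gpow_aa(2) unfolding gpow_aa(1)
  by (simp add: add.assoc dcu del: auc)
 have "gpow (vv j) (int (Suc n))=vv j + gpow (vv j) (int n)" using gpow_add[of "vv j" 1 "int n"] by simp
 thus ?case using Suc v by (simp only: replicate_Suc concat.simps word_val_append)
qed simp

definition pairs :: "bool => vtx \<Rightarrow>\<^sub>0 int" where "pairs t=qc (gen (t, True)) + qc (gen (t, False))"

lemma sum_vcat: "(SUM l<-vcat j n. qc (gen l))=fcm (int (n * j)) (pairs False) + fcm (int n) (pairs True)"
proof -
 have r: "sum_list (replicate j c)=fcm (int j) c" for c :: "vtx \<Rightarrow>\<^sub>0 int"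
  by (induction j) (simp_all add: frag_cmul_distrib)
 show ?thesis by (induction n) (simp_all add: r pairs_def frag_cmul_distrib frag_cmul_distrib2 algebra_simps)
qed

text \<open>Absorbs the symbols of a letter and its inverse, which remain in the boundary of
  \<open>fan\<close>. In each of its triangles two vertices coincide, so \<open>phi\<close> vanishes
  on it.\<close>

definition pair_fill :: "bool => bchain" where
 "pair_fill t=single (J (gen (t, True)), J (gen (t, False))) 1 + single (J 0, J 0) 1"

lemma pair_fill: "bd (pair_fill t)=pairs t" "bev phi (pair_fill t)=0" "keys (pair_fill t) <= range J \<times> range J"
proof -
 have 0: "gen (t, True) + gen (t, False)=0" using gen_not[of t True] by simp
 show "bd (pair_fill t)=pairs t" by (simp add: pair_fill_def bd_add bd_single pairs_def 0)
 show "bev phi (pair_fill t)=0" by (simp add: pair_fill_def bev_add bev_single phi_def 0 one_V_def ff_coincide)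
 show "keys (pair_fill t) <= range J \<times> range J"
  unfolding pair_fill_def using keys_add[of "single (J (gen (t, True)), J (gen (t, False))) (1::int)" "single (J 0, J 0) 1"] by simp blast
qed

lemma bev_fan_a: "bev phi (fan x (replicate j (False, s)))=0"
 by (induction j arbitrary: x) (simp_all add: bev_add bev_single phi_a)

text \<open>Only \<tau> and its inverse contribute. The letter \<tau> does so only if x was reached
  through an inverse of \<tau>, which fails at the beginning of the path and holds after each copy
  of \<open>vv j\<close>.\<close>

lemma bev_fan_vword:
 assumes j: "0 < j" and d: "D0 (- x):{None, Some (0, True)}"
 shows "bev phi (fan x (vword j))=(if D0 (- x)=None then - hh (int j) else - 2 * hh (int j))"
  "D0 (- (x + vv j))=Some (0, True)"
proof -
 define y where "y=x + gpow aa (int j)"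
 define z where "z=y + tt - gpow aa (int j)"
 have y: "D0 (- y)=shift (- int j) (D0 (- x))" using D0_a[of "- int j" "- x"] by (simp add: y_def minus_add gpow_minus)
 have y': "D0 (- y) ~= Some (0, True)" using d j unfolding y by auto
 have t: "D0 (gen (True, False) + - y)=Some (0, False)" using y' by (intro D0_tau) simp
 have "- z=gpow aa (int j) + (gen (True, False) + - y)" using gen_not[of True True]
  by (simp add: z_def minus_add add.assoc dcu del: auc)
 hence z: "D0 (- z)=Some (int j, False)" using D0_a[of "int j"] t by simp
 have z': "D0 (- z) ~= Some (0, False)" using z j by simp
 have yy: "x + word_val (replicate j (False, True))=y" unfolding y_def gpow_aa(1) ..
 have zz: "y + tt + word_val (replicate j (False, False))=z" unfolding z_def gpow_aa(2)[symmetric] by simp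
 have "bev phi (fan x (vword j))=phi (J y) (J tt) + phi (J z) (J (gen (True, False)))"
  by (simp only: fan_append fan.simps yy zz bev_add bev_single bev_fan_a bev_0 add_0 add_0_right)
 also have "phi (J y) (J tt)=(if D0 (- x)=None then 0 else - hh (int j))"
  using phi_tau[OF y'] d hh_minus[of "int j"] unfolding y by auto
 also have "phi (J z) (J (gen (True, False))) = - hh (int j)" using phi_tau[OF z'] unfolding z by simp
 finally show "bev phi (fan x (vword j))=(if D0 (- x)=None then - hh (int j) else - 2 * hh (int j))" by simp
 have "- (x + vv j)=tt + - z"
  by (simp add: z_def y_def vv_def minus_add add.assoc dcu del: auc)
 thus "D0 (- (x + vv j))=Some (0, True)" using D0_tau[of "- z" True] z j by simp
qed

text \<open>Two contributions per copy, except that the first copy makes only one.\<close>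

lemma bev_fan_vcat:
 assumes j: "0 < j"
 shows "bev phi (fan 0 (vcat j (Suc n))) = - (2 * n + 1) * hh (int j) & D0 (- gpow (vv j) (int (Suc n)))=Some (0, True)"
proof (induction n)
 case 0
 show ?case using bev_fan_vword[OF j, of 0] by (simp add: One_nat_def)
next
 case (Suc n)
 have "replicate (Suc (Suc n)) (vword j)=replicate (Suc n) (vword j) @ [vword j]" by (metis replicate_Suc replicate_append_same)
 hence v: "vcat j (Suc (Suc n))=vcat j (Suc n) @ vword j" by (simp only: concat_append concat.simps append_Nil2)
 have g: "gpow (vv j) (int (Suc (Suc n)))=gpow (vv j) (int (Suc n)) + vv j" using gpow_add[of "vv j" "int (Suc n)" 1] by (simp add: add.commute)
 have d: "D0 (- gpow (vv j) (int (Suc n)))=Some (0, True)" using Suc by blast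
 have "bev phi (fan 0 (vcat j (Suc (Suc n))))=bev phi (fan 0 (vcat j (Suc n))) + bev phi (fan (gpow (vv j) (int (Suc n))) (vword j))"
  unfolding v fan_append bev_add word_val_vcat by simp
 also have "... = - (2 * n + 1) * hh (int j) - 2 * hh (int j)" using Suc bev_fan_vword(1)[OF j, of "gpow (vv j) (int (Suc n))"] unfolding d by simp
 also have "... = - (2 * Suc n + 1) * hh (int j)" by (simp add: algebra_simps)
 finally show ?case using bev_fan_vword(2)[OF j, of "gpow (vv j) (int (Suc n))"] unfolding d g by simp
qed

text \<open>The annulus \<open>hchain\<close> is closed up by the cones over its two boundary words,
  whose letters cancel in pairs. The 4 collects the contributions missing at the beginnings of the
  two words and the two symbols of \<open>hchain\<close>.\<close>

lemma lower_bound: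
 fixes n :: nat
 shows "EX C. bcycle C & bev (%g h. real_of_int (lam g h)) C=n & n * vol - 4 <= \<bar>bev phi C\<bar>"
proof (cases n)
 case 0
 have "bcycle 0" by (simp add: bcycle_def bd_def)
 thus ?thesis using 0 by (intro exI[of _ 0]) (simp add: bev_def)
next
 case (Suc n')
 define kn where "kn=k * n - 1"
 have kn: "k * n=Suc kn" using k Suc by (simp add: kn_def)
 let ?w = "vcat 1 (k * n)" and ?v = "vcat m n"
 \<comment> \<open>Both signs of a occur k n times in the first word and n m times in the second;
   for \<tau> the numbers are k n and n.\<close>
 define M where "M=fan 0 ?w - fan 0 ?v - fcm (int (k * n) - int (n * m)) (pair_fill False) - fcm (int (k * n) - int n) (pair_fill True)"
 let ?C = "hchain (int n) + M"
 have gw: "gpow (uu k m True) (int n)=gpow (vv 1) (int (k * n))" by (simp add: gpow_mult)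
 have kM: "keys M <= range J \<times> range J"
 proof -
  have d: "keys (a - b) <= range J \<times> range J" if "keys a <= range J \<times> range J" "keys b <= range J \<times> range J" for a b :: bchain
   using keys_diff[of a b] that by blast
  have c: "keys (fcm i (pair_fill t)) <= range J \<times> range J" for i t using keys_cmul[of i "pair_fill t"] pair_fill(3)[of t] by blast
  show ?thesis unfolding M_def by (intro d keys_fan c)
 qed
 have "bd M=qc (gpow (vv m) (int n)) - qc (gpow (vv 1) (int (k * n)))"
  unfolding M_def bd_diff cmul_bar pair_fill bd_fan sum_vcat word_val_vcat by (simp add: frag_cmul_diff_distrib algebra_simps)
 hence "bd ?C=0" unfolding bd_add hchain(1) gw by simp
 moreover have "keys ?C <= V \<times> V"
  using keys_add[of "hchain (int n)" M] hchain(4)[of "int n"] kM J_V by blast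
 ultimately have "bcycle ?C" by (simp add: bcycle_def)
 moreover have "bev (%g h. real_of_int (lam g h)) ?C=n"
  unfolding bev_add hchain(3) bev_lam_J[OF kM] lam_Tt lam_J by simp
 moreover have "n * vol - 4 <= \<bar>bev phi ?C\<bar>"
 proof -
  have w: "bev phi (fan 0 ?w) = - (2 * real (k * n) - 1) * hh 1"
   unfolding kn using bev_fan_vcat[of 1 kn] by (simp add: One_nat_def)
  have v: "bev phi (fan 0 ?v) = - (2 * real n - 1) * hh (int m)"
   unfolding Suc using bev_fan_vcat[OF m, of n'] by simp
  have "bev phi M = - (2 * real (k * n) - 1) * hh 1 + (2 * real n - 1) * hh (int m)"
   unfolding M_def bev_diff cmul_bar pair_fill w v by (simp add: algebra_simps)
  also have "... = - n * vol + hh 1 + 1" unfolding hh_m using m by (simp add: hh_1 field_simps)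
  finally have "bev phi M = - n * vol + hh 1 + 1" .
  moreover have "\<bar>bev phi (hchain (int n))\<bar> <= 2"
   using phi_le[OF J_V Tt_V, of "gpow (uu k m True) (int n)"] phi_le[OF Tt_V J_V, of "gpow (uu k m False) (int n)"]
   unfolding hchain(3) by linarith
  moreover have "\<bar>hh 1\<bar> <= 1" by (rule hh_le)
  ultimately show ?thesis unfolding bev_add by linarith
 qed
 ultimately show ?thesis by (intro exI[of _ ?C] conjI)
qed

lemma esum_append: "esum s (v @ w)=esum s v + esum s w"
 by (simp add: esum_def)

lemma esum_emb: "esum s (emb (replicate i l))=int i * esum s (emb [l])"
  "esum s (emb (concat (replicate i w)))=int i * esum s (emb w)"
 by (induction i) (simp_all add: esum_append esum_Cons algebra_simps, simp_all add: esum_def)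

lemma esum_relator: "esum s relator=0"
proof -
 have "letters (uu k m True)=vcat 1 k" using letters_uu[of 1 k] by simp
 moreover have "inv_word (vword m)=[(True, True)] @ replicate m (False, True) @ [(True, False)] @ replicate m (False, False)"
  by (simp add: inv_word_def inv_letter_def)
 ultimately show ?thesis
  unfolding relator_def letters_uminus by (simp add: letters_vv[OF m] esum_append esum_emb esum_Cons) (simp add: esum_def)
qed

theorem volume: "simplicial_volume three relator=vol"
proof (rule simplicial_volume_eq[where ph = phi and py = lam and L = m and K = "20 * m * (real k + 1)"])
 \<comment> \<open>One constant must serve for both bounds; the error of the upper bound also covers
   the 4 of the lower one.\<close>
 have "4 <= 20 * m * (real k + 1)"
 proof -
  have "1 * 1 <= real m * (real k + 1)" using m by (intro mult_mono) simp_all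
  thus ?thesis by simp
 qed
 hence K: "x - 4 <= y ==> x - 20 * m * (real k + 1) <= y" for x y :: real by linarith
 show "EX C. bcycle C & bev (%g h. real_of_int (lam g h)) C=n & n * vol - 20 * m * (real k + 1) <= \<bar>bev phi C\<bar>" for n :: nat
  using lower_bound[of n] K by blast
 show "EX C. bcycle C & bev (%g h. real_of_int (lam g h)) C=real m * real n & bnorm C <= real m * real n * vol + 20 * m * (real k + 1)" for n :: nat
  using upper_bound[of n] by simp
qed (use esum_relator inhom_phi phi_le inhom_lam m in simp_all)

text \<open>Both \<open>uu k m True\<close> and \<open>vv m\<close> are products of commutators, and
  the t-conjugate of y, the inverse of \<open>vv m\<close>, is the commutator of t and y times
  y.\<close>

lemma relator_derived: "relator:derived (free_group three) (carrier (free_group three))"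
proof -
 let ?F = "free_group three"
 let ?D = "derived ?F (carrier ?F)"
 interpret F: group ?F by (rule group_free_group)
 interpret D: subgroup ?D ?F by (rule F.derived_is_subgroup) simp
 define E where "E g=emb (letters g)" for g
 have EF: "E g:carrier ?F" for g using set_emb_three[of "letters g"] by (simp add: E_def free_group_def reduced_emb)
 have tF: "[(2, s)]:carrier ?F" for s by (simp add: free_group_def three_def reduced_def)
 have mult: "v \<otimes>\<^bsub>?F\<^esub> w=foldr push v w" for v w by (simp add: free_group_def)
 have Eadd: "E (g + h)=E g \<otimes>\<^bsub>?F\<^esub> E h" for g h by (simp add: mult E_def letters_plus emb_foldr_push)
 have E0: "E 0=\<one>\<^bsub>?F\<^esub>" by (simp add: E_def free_group_def)
 have inv: "inv\<^bsub>?F\<^esub> E g=E (- g)" for g by (rule F.inv_equality) (simp_all add: EF E0 flip: Eadd)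
 have tinv: "inv\<^bsub>?F\<^esub> [(2, True)]=[(2, False)]"
  by (rule F.inv_equality) (simp_all add: tF mult, simp_all add: push_def inv_letter_def free_group_def)
 have comm: "x \<otimes>\<^bsub>?F\<^esub> y \<otimes>\<^bsub>?F\<^esub> inv\<^bsub>?F\<^esub> x \<otimes>\<^bsub>?F\<^esub> inv\<^bsub>?F\<^esub> y:?D" if "x:carrier ?F" "y:carrier ?F" for x y
  unfolding derived_def using that by (intro generate.incl) blast
 have v: "E (vv j):?D" for j
  using comm[OF EF EF, of "gpow aa (int j)" tt] unfolding inv Eadd[symmetric] by (simp add: vv_def add.assoc dcu del: auc)
 have w: "E (gpow (vv 1) (int i)):?D" for i
 proof (induction i)
  case (Suc i)
  thus ?case using v[of 1] gpow_add[of "vv 1" 1 "int i"] by (simp add: Eadd)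
 qed (simp add: E0)
 let ?y = "E (- vv m)"
 have y: "?y:?D" using D.m_inv_closed[OF v[of m]] inv by simp
 have "relator=foldr push relator []" using relator_reduced by (simp add: foldr_push_Nil)
 also have "... = E (uu k m True) \<otimes>\<^bsub>?F\<^esub> ([(2, True)] \<otimes>\<^bsub>?F\<^esub> (?y \<otimes>\<^bsub>?F\<^esub> [(2, False)]))"
  by (simp add: relator_def E_def mult push_def)
 also have "... = E (uu k m True) \<otimes>\<^bsub>?F\<^esub> (([(2, True)] \<otimes>\<^bsub>?F\<^esub> ?y \<otimes>\<^bsub>?F\<^esub> inv\<^bsub>?F\<^esub> [(2, True)] \<otimes>\<^bsub>?F\<^esub> inv\<^bsub>?F\<^esub> ?y) \<otimes>\<^bsub>?F\<^esub> ?y)"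
  unfolding tinv[symmetric] using tF EF by (simp add: F.m_assoc)
 also have "... : ?D"
  using w[of k] comm[OF tF EF, of True "- vv m"] y by simp
 finally show ?thesis .
qed

lemma relator_nontrivial: "relator ~= \<one>\<^bsub>free_group three\<^esub>"
 by (simp add: free_group_def relator_def)

end

theorem corollary2:
  fixes q :: rat
  assumes "0 \<le> q" and "q < 1"
  shows "\<exists>(S :: nat set) r.
    r \<in> derived (free_group S) (carrier (free_group S)) - {\<one>\<^bsub>free_group S\<^esub>} \<and>
    simplicial_volume S r - of_rat q \<in> \<int>"
proof -
 obtain a b where q: "q = of_int a / of_int b" "b > 0" by (metis Fract_of_int_quotient Rat_cases)
 define n where "n=nat b"
 have n: "0 < n" "int n=b" using q by (simp_all add: n_def)
 \<comment> \<open>The representative of -a modulo b between 1 and b. With m = 4 n the volume is 2 k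
   + 2 - k / n, so only k / n matters modulo the integers.\<close>
 define k where "k=nat (b - a mod b)"
 have kk: "int k=int n - a mod b" "0 < k" "k <= 4 * n"
  using n q(2) pos_mod_bound[of b a] pos_mod_sign[of b a] unfolding k_def by linarith+
 interpret relators k "4 * n" by unfold_locales (use kk in auto)
 have "int k=int n - (a - int n * (a div b))" unfolding kk(1) n(2) by (simp add: minus_mult_div_eq_mod)
 hence "real k=real n - (real_of_int a - real n * real_of_int (a div b))"
  by (metis of_int_diff of_int_mult of_int_of_nat_eq)
 hence "real k / real n=1 - real_of_int a / real n + real_of_int (a div b)"
  using n(1) by (simp add: field_simps)
 moreover have "real_of_rat q=real_of_int a / real n" unfolding q(1) n(2)[symmetric] by (simp add: of_rat_divide)
 moreover have "4 * real k / real (4 * n)=real k / real n" by simp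
 ultimately have "2 * real k + 2 - 4 * real k / real (4 * n) - of_rat q = of_int (2 * int k + 1 - a div b)"
  by simp
 hence "simplicial_volume three relator - of_rat q:\<int>" unfolding volume by (metis Ints_of_int)
 thus ?thesis using relator_derived relator_nontrivial by blast
qed

end
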